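(* Let $\beta>1$, $\boldsymbol\theta_0\in\Theta_1$, and $\mathbf X^n\sim P^{\rm CW}_{\boldsymbol\theta_0,\beta}$. Let $U_n\in\arg\min_{|u|\le1}\big[\frac{\beta u^2}2-\frac1n\sum_i\log\cosh(\beta u+\boldsymbol\theta_0^\top\mathbf X_i)\big]$. Then (i) $\sum_{i=1}^n\mathbf X_i\,\mathbb E^{\mathbb Q^{\rm CW}_{\boldsymbol\theta_0,\beta}}W_i=\sum_{i=1}^n\mathbf X_i\tanh(\beta U_n+\boldsymbol\theta_0^\top\mathbf X_i)+O_p(1)$; (ii) for $\mathbf h\in\mathbb R^d$ and $\boldsymbol\theta_n=\boldsymbol\theta_0+\mathbf h/\sqrt n$, $$\log\frac{dP^{\rm CW}_{\boldsymbol\theta_n,\beta}}{dP^{\rm CW}_{\boldsymbol\theta_0,\beta}}(\mathbf X^n)=\mathbf h^\top\tilde\Delta_{n,\boldsymbol\theta_0,\beta}-\tfrac12\mathbf h^\top I_\beta(\boldsymbol\theta_0)\mathbf h+o_p(1),$$ where $\tilde\Delta_{n,\boldsymbol\theta_0,\beta}=\sqrt n\big(\frac1n\sum_i\mathbf X_i\tanh(\beta U_n+\boldsymbol\theta_0^\top\mathbf X_i)-\boldsymbol\theta_0\big)\xrightarrow{d}N_d(0,I_\beta(\boldsymbol\theta_0))$ under $P^{\rm CW}_{\boldsymbol\theta_0,\beta}$. Hence $\{P^{\rm CW}_{\boldsymbol\theta,\beta}\}_{\boldsymbol\theta\in\Theta_1}$ is LAN at every $\boldsymbol\theta_0\in\Theta_1$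 with precision matrix $I_\beta(\boldsymbol\theta_0)$.
   Context: Curie–Weiss labels: $\mathbb Q^{\rm CW}_{0,\beta}(\mathbf z)\propto e^{n\beta\bar z^2/2}$ on $\{-1,1\}^n$, $\bar z=\frac1n\sum_iz_i$. Given $\mathbf Z^n$, the $\mathbf X_i$ are independent $N_d(\boldsymbol\theta Z_i,\mathbf I_d)$; $P^{\rm CW}_{\boldsymbol\theta,\beta}$ is the law of $\mathbf X^n$. Given $\mathbf X^n$, $\mathbb Q^{\rm CW}_{\boldsymbol\theta,\beta}(\mathbf w)\propto\exp(n\beta\bar w^2/2+\boldsymbol\theta^\top\sum_i\mathbf X_iw_i)$ on $\{-1,1\}^n$ and $\mathbb E^{\mathbb Q^{\rm CW}_{\boldsymbol\theta,\beta}}$ is expectation in $\mathbf W^n$ with $\mathbf X^n$ fixed. $\Theta_1$ is the lexicographically positive half-space of $\mathbb R^d\setminus\{0\}$. $m=m(\beta)>0$ solves $m=\tanh(\beta m)$; $\mathbb E_{\boldsymbol\theta_0}$ denotes expectation under $\frac{1+m}2N_d(\boldsymbol\theta_0,\mathbf I_d)+\frac{1-m}2N_d(-\boldsymbol\theta_0,\mathbf I_d)$. $\gamma_{1,1}=\beta-\beta^2\mathbb E_{\boldsymbol\theta_0}\operatorname{sech}^2(\beta m+\boldsymbol\theta_0^\top\mathbf X)$, $\boldsymbol\gamma_{1,2}=-\beta\mathbb E_{\boldsymbol\theta_0}\mathbf X\operatorname{sech}^2(\beta m+\boldsymbol\theta_0^\top\mathbf X)$, $\boldsymbol\gamma_{2,2}=\mathbf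 I_d-\mathbb E_{\boldsymbol\theta_0}\mathbf X\mathbf X^\top\operatorname{sech}^2(\beta m+\boldsymbol\theta_0^\top\mathbf X)$, $I_\beta(\boldsymbol\theta_0)=\boldsymbol\gamma_{2,2}-\boldsymbol\gamma_{1,2}\boldsymbol\gamma_{1,2}^\top/\gamma_{1,1}$. *)

theory Defs
  imports "HOL-Probability.Probability"
begin

definition gauss_dens :: "real^'d \<Rightarrow> real" where
  "gauss_dens x = (2 * pi) powr (- real CARD('d) / 2) * exp (- (norm x)\<^sup>2 / 2)"

definition std_gauss :: "(real^'d) measure" where
  "std_gauss = density lborel (\<lambda>x. ennreal (gauss_dens x))"

text \<open>Centered normal N_d(0, S) for a positive semidefinite S: law of A z with z ~ N_d(0,I), A A^T = S.\<close>
definition normal_meas :: "real^'d^'d \<Rightarrow> (real^'d) measure" where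
  "normal_meas S = distr std_gauss lborel
     (\<lambda>z. (SOME A :: real^'d^'d. A ** transpose A = S) *v z)"

definition labels :: "nat \<Rightarrow> (nat \<Rightarrow> real) set" where
  "labels n = PiE {..<n} (\<lambda>_. {-1, 1})"

definition zbar :: "nat \<Rightarrow> (nat \<Rightarrow> real) \<Rightarrow> real" where
  "zbar n z = (\<Sum>i<n. z i) / real n"

definition cw_weight :: "nat \<Rightarrow> real \<Rightarrow> (nat \<Rightarrow> real) \<Rightarrow> real" where
  "cw_weight n \<beta> z = exp (real n * \<beta> * (zbar n z)\<^sup>2 / 2)"

definition cw_prior :: "nat \<Rightarrow> real \<Rightarrow> (nat \<Rightarrow> real) \<Rightarrow> real" where
  "cw_prior n \<beta> z = cw_weight n \<beta> z / (\<Sum>w\<in>labels n. cw_weight n \<beta> w)"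

definition sample_space :: "nat \<Rightarrow> (nat \<Rightarrow> real^'d) measure" where
  "sample_space n = PiM {..<n} (\<lambda>_. lborel)"

definition cw_dens :: "nat \<Rightarrow> real^'d \<Rightarrow> real \<Rightarrow> (nat \<Rightarrow> real^'d) \<Rightarrow> real" where
  "cw_dens n \<theta> \<beta> x =
     (\<Sum>z\<in>labels n. cw_prior n \<beta> z * (\<Prod>i<n. gauss_dens (x i - z i *\<^sub>R \<theta>)))"

definition cw_law :: "nat \<Rightarrow> real^'d \<Rightarrow> real \<Rightarrow> (nat \<Rightarrow> real^'d) measure" where
  "cw_law n \<theta> \<beta> = density (sample_space n) (\<lambda>x. ennreal (cw_dens n \<theta> \<beta> x))"

definition post_weight :: "nat \<Rightarrow> real^'d \<Rightarrow> real \<Rightarrow> (nat \<Rightarrow> real^'d) \<Rightarrow> (nat \<Rightarrow> real) \<Rightarrow> real" where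
  "post_weight n \<theta> \<beta> x w =
     exp (real n * \<beta> * (zbar n w)\<^sup>2 / 2 + \<theta> \<bullet> (\<Sum>i<n. w i *\<^sub>R x i))"

definition post_mean :: "nat \<Rightarrow> real^'d \<Rightarrow> real \<Rightarrow> (nat \<Rightarrow> real^'d) \<Rightarrow> nat \<Rightarrow> real" where
  "post_mean n \<theta> \<beta> x i =
     (\<Sum>w\<in>labels n. w i * post_weight n \<theta> \<beta> x w) / (\<Sum>w\<in>labels n. post_weight n \<theta> \<beta> x w)"

definition Theta1 :: "(real^'d::{finite,linorder}) set" where
  "Theta1 = {\<theta>. \<exists>k. \<theta> $ k > 0 \<and> (\<forall>j<k. \<theta> $ j = 0)}"

text \<open>m(beta) > 0 solving m = tanh(beta m) (unique for beta > 1).\<close>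
definition cw_m :: "real \<Rightarrow> real" where
  "cw_m \<beta> = (THE m. m > 0 \<and> m = tanh (\<beta> * m))"

definition mix_meas :: "real^'d \<Rightarrow> real \<Rightarrow> (real^'d) measure" where
  "mix_meas \<theta>0 \<beta> = density lborel (\<lambda>x. ennreal
      ((1 + cw_m \<beta>) / 2 * gauss_dens (x - \<theta>0) + (1 - cw_m \<beta>) / 2 * gauss_dens (x + \<theta>0)))"

definition sech2 :: "real \<Rightarrow> real" where
  "sech2 t = 1 / (cosh t)\<^sup>2"

definition gamma11 :: "real^'d \<Rightarrow> real \<Rightarrow> real" where
  "gamma11 \<theta>0 \<beta> = \<beta> - \<beta>\<^sup>2 * (\<integral>x. sech2 (\<beta> * cw_m \<beta> + \<theta>0 \<bullet> x) \<partial>mix_meas \<theta>0 \<beta>)"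

definition gamma12 :: "real^'d \<Rightarrow> real \<Rightarrow> real^'d" where
  "gamma12 \<theta>0 \<beta> = - \<beta> *\<^sub>R (\<integral>x. sech2 (\<beta> * cw_m \<beta> + \<theta>0 \<bullet> x) *\<^sub>R x \<partial>mix_meas \<theta>0 \<beta>)"

definition outer :: "real^'d \<Rightarrow> real^'d \<Rightarrow> real^'d^'d" where
  "outer a b = (\<chi> i j. a $ i * b $ j)"

definition gamma22 :: "real^'d \<Rightarrow> real \<Rightarrow> real^'d^'d" where
  "gamma22 \<theta>0 \<beta> = mat 1 -
     (\<integral>x. sech2 (\<beta> * cw_m \<beta> + \<theta>0 \<bullet> x) *\<^sub>R outer x x \<partial>mix_meas \<theta>0 \<beta>)"

definition info_mat :: "real^'d \<Rightarrow> real \<Rightarrow> real^'d^'d" where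
  "info_mat \<theta>0 \<beta> = gamma22 \<theta>0 \<beta> -
     (1 / gamma11 \<theta>0 \<beta>) *\<^sub>R outer (gamma12 \<theta>0 \<beta>) (gamma12 \<theta>0 \<beta>)"

text \<open>Outer probability (so no measurability is needed for O_p / o_p).\<close>
definition outer_prob :: "'a measure \<Rightarrow> 'a set \<Rightarrow> real" where
  "outer_prob M A = Inf {measure M B | B. B \<in> sets M \<and> A \<inter> space M \<subseteq> B}"

definition bounded_in_prob :: "(nat \<Rightarrow> 'a measure) \<Rightarrow> (nat \<Rightarrow> 'a \<Rightarrow> 'b::real_normed_vector) \<Rightarrow> bool" where
  "bounded_in_prob M Y \<longleftrightarrow> (\<forall>\<epsilon>>0. \<exists>C N. \<forall>n\<ge>N.
      outer_prob (M n) {x \<in> space (M n). norm (Y n x) > C} \<le> \<epsilon>)"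

definition vanish_in_prob :: "(nat \<Rightarrow> 'a measure) \<Rightarrow> (nat \<Rightarrow> 'a \<Rightarrow> 'b::real_normed_vector) \<Rightarrow> bool" where
  "vanish_in_prob M Y \<longleftrightarrow> (\<forall>\<epsilon>>0.
      (\<lambda>n. outer_prob (M n) {x \<in> space (M n). norm (Y n x) > \<epsilon>}) \<longlonglongrightarrow> 0)"

definition conv_distr :: "(nat \<Rightarrow> 'a measure) \<Rightarrow> (nat \<Rightarrow> 'a \<Rightarrow> real^'d) \<Rightarrow> (real^'d) measure \<Rightarrow> bool" where
  "conv_distr M Y \<mu> \<longleftrightarrow> (\<forall>n. Y n \<in> borel_measurable (M n)) \<and>
     (\<forall>g :: real^'d \<Rightarrow> real. continuous_on UNIV g \<and> bounded (range g) \<longrightarrow>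
        (\<lambda>n. \<integral>x. g (Y n x) \<partial>M n) \<longlonglongrightarrow> (\<integral>y. g y \<partial>\<mu>))"

definition cw_objective :: "nat \<Rightarrow> real^'d \<Rightarrow> real \<Rightarrow> (nat \<Rightarrow> real^'d) \<Rightarrow> real \<Rightarrow> real" where
  "cw_objective n \<theta>0 \<beta> x u =
     \<beta> * u\<^sup>2 / 2 - (1 / real n) * (\<Sum>i<n. ln (cosh (\<beta> * u + \<theta>0 \<bullet> x i)))"

definition Delta_tilde :: "nat \<Rightarrow> real^'d \<Rightarrow> real \<Rightarrow> (nat \<Rightarrow> (nat \<Rightarrow> real^'d) \<Rightarrow> real)
    \<Rightarrow> (nat \<Rightarrow> real^'d) \<Rightarrow> real^'d" where
  "Delta_tilde n \<theta>0 \<beta> U x = sqrt (real n) *\<^sub>R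
     ((1 / real n) *\<^sub>R (\<Sum>i<n. tanh (\<beta> * U n x + \<theta>0 \<bullet> x i) *\<^sub>R x i) - \<theta>0)"

text \<open>Log-likelihood ratio log dP_{theta_n}/dP_{theta_0}(x) (both laws have everywhere positive densities).\<close>
definition log_lr :: "nat \<Rightarrow> real^'d \<Rightarrow> real^'d \<Rightarrow> real \<Rightarrow> (nat \<Rightarrow> real^'d) \<Rightarrow> real" where
  "log_lr n \<theta>1 \<theta>0 \<beta> x = ln (cw_dens n \<theta>1 \<beta> x / cw_dens n \<theta>0 \<beta> x)"

definition cw_LAN :: "real \<Rightarrow> real^'d \<Rightarrow> real^'d^'d \<Rightarrow> bool" where
  "cw_LAN \<beta> \<theta>0 I \<longleftrightarrow> (\<exists>\<Delta> :: nat \<Rightarrow> (nat \<Rightarrow> real^'d) \<Rightarrow> real^'d.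
     conv_distr (\<lambda>n. cw_law n \<theta>0 \<beta>) \<Delta> (normal_meas I) \<and>
     (\<forall>h. vanish_in_prob (\<lambda>n. cw_law n \<theta>0 \<beta>)
        (\<lambda>n x. log_lr n (\<theta>0 + (1 / sqrt (real n)) *\<^sub>R h) \<theta>0 \<beta> x
               - (h \<bullet> \<Delta> n x - h \<bullet> (I *v h) / 2))))"

end

(* The labels are integrated out by a Hubbard--Stratonovich transform, which turns posterior sums into
   one-dimensional integrals with integrand exp (- n * objective); these are expanded by Laplace's
   method around the minimiser U.  All expansions are deterministic, along sequences of data for which
   countably many empirical means converge to their limits under the mixture; a second-moment bound
   given the labels shows that X or -X is such data with probability tending to one, and everything
   in question is invariant under the sign change.

   The limit law needs no central limit theorem.  In the imaginary direction i*t the posterior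
   characteristic function of (sum_i W_i X_i) / sqrt n has an exactly computable Gaussian expectation,
   while the Laplace expansion makes it asymptotically a constant multiple of
   exp (i * t . Delta); hence the characteristic function of Delta converges.  Positive
   semidefiniteness of the information matrix follows from the same limit. *)
theory Submission
  imports Defs
begin

section \<open>Gaussian measures on Euclidean space\<close>

text \<open>Labels drawn from the posterior, together with the data, have the joint law of true
  labels and data. As labels square to 1, the sum of Z_i X_i is exactly normal with mean n theta and
  covariance n times the identity, however dependent the labels are; this is why the posterior
  characteristic function has an explicit mean. Its Laplace limit contributes exp (- curv / 2), so
  the exponent left for Delta is (|h|^2 - curv) / 2, half the form of \<open>info_mat\<close>. The
  real shift of theta in the likelihood ratio meets the same \<open>curv\<close>.

  The obstacle is symmetry breaking: the label mean is near m or near -m, so the empirical measure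
  has two possible limits and U follows the sign. The Laplace step also needs the population
  objective to have a unique minimiser m on [-1,1]; its excess is a free-energy gap plus a
  Kullback-Leibler divergence, and the divergence is what rules out -m. Finally, bounds along good
  data must not depend on the sequence, which fixes the form of \<open>mom_bound\<close>,
  \<open>var_bound\<close> and \<open>mean_bound\<close>.\<close>

lemma norm_power2_eq_sum_Basis: "(norm x)\<^sup>2 = (\<Sum>b\<in>Basis. (x \<bullet> b)\<^sup>2)"
  for x :: "'a::euclidean_space"
  using euclidean_inner[of x x] by (simp add: dot_square_norm power2_eq_square)

text \<open>Coordinates of a standard normal vector are independent, so integrals against the
  density split into one-dimensional ones; the power - d / 2 collects one factor 1 / sqrt (2 pi) per
  basis vector.\<close>

lemma gauss_dens_prod:
  "gauss_dens x = (\<Prod>b\<in>Basis. std_normal_density (x \<bullet> b))" for x :: "real^'d"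
proof -
  have "(\<Prod>b\<in>Basis. std_normal_density (x \<bullet> b))
      = (\<Prod>b\<in>(Basis::(real^'d) set). 1 / sqrt (2 * pi)) * exp (\<Sum>b\<in>Basis. - (x \<bullet> b)\<^sup>2 / 2)"
    unfolding std_normal_density_def by (simp add: prod_dividef exp_sum power_divide)
  also have "(\<Sum>b\<in>Basis. - (x \<bullet> b)\<^sup>2 / 2) = - (norm x)\<^sup>2 / 2"
    unfolding norm_power2_eq_sum_Basis
    by (simp only: sum_divide_distrib[symmetric] sum_negf minus_divide_left)
  also have "(\<Prod>b\<in>(Basis::(real^'d) set). 1 / sqrt (2 * pi)) = (2 * pi) powr (- real CARD('d) / 2)"
  proof -
    have "(2 * pi) powr (- real CARD('d) / 2) = ((2 * pi) powr (- (1 / 2))) powr real CARD('d)"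
      by (simp add: powr_powr)
    also have "\<dots> = (1 / sqrt (2 * pi)) ^ CARD('d)"
      by (simp add: powr_realpow powr_minus_divide powr_half_sqrt)
    finally show ?thesis by simp
  qed
  finally show ?thesis by (simp add: gauss_dens_def)
qed

lemma gauss_dens_pos: "gauss_dens x > 0"
  by (simp add: gauss_dens_def)

lemma gauss_dens_nonneg [simp]: "gauss_dens x \<ge> 0"
  using gauss_dens_pos[of x] by simp

lemma gauss_dens_uminus [simp]: "gauss_dens (- x) = gauss_dens x"
  by (simp add: gauss_dens_def)

lemma borel_measurable_gauss_dens [measurable]: "gauss_dens \<in> borel_measurable borel"
  unfolding gauss_dens_def[abs_def] by measurable

text \<open>The quadratic term in x cancels in the ratio of two shifted densities, which leaves an
  exponential linear in x: the origin of every exponential tilt below.\<close>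

lemma gauss_dens_shift:
  "gauss_dens (x - \<theta>) = gauss_dens x * exp (\<theta> \<bullet> x - (norm \<theta>)\<^sup>2 / 2)"
proof -
  have "- (norm (x - \<theta>))\<^sup>2 / 2 = - (norm x)\<^sup>2 / 2 + (\<theta> \<bullet> x - (norm \<theta>)\<^sup>2 / 2)"
    unfolding power2_norm_eq_inner by (simp add: inner_diff inner_commute field_simps)
  then show ?thesis
    unfolding gauss_dens_def by (simp only: exp_add mult.assoc)
qed

lemma nn_integral_gauss_dens: "(\<integral>\<^sup>+x. ennreal (gauss_dens x) \<partial>(lborel :: (real^'d) measure)) = 1"
proof -
  have "(\<integral>\<^sup>+x. ennreal (gauss_dens x) \<partial>(lborel :: (real^'d) measure))
    = (\<integral>\<^sup>+x. (\<Prod>b\<in>Basis. ennreal (std_normal_density (x \<bullet> b))) \<partial>(lborel :: (real^'d) measure))"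
    unfolding gauss_dens_prod by (simp add: prod_ennreal)
  also have "\<dots> = (\<Prod>b\<in>(Basis :: (real^'d) set). (\<integral>\<^sup>+x. ennreal (std_normal_density x) \<partial>lborel))"
    by (rule nn_integral_lborel_prod) auto
  also have "\<dots> = 1"
    by (subst nn_integral_eq_integral) (auto)
  finally show ?thesis .
qed

definition gauss_at :: "real^'d \<Rightarrow> (real^'d) measure" where
  "gauss_at \<theta> = density lborel (\<lambda>x. ennreal (gauss_dens (x - \<theta>)))"

lemma sets_gauss_at [simp, measurable_cong]: "sets (gauss_at \<theta>) = sets borel"
  by (simp add: gauss_at_def)

lemma space_gauss_at [simp]: "space (gauss_at \<theta>) = UNIV"
  by (simp add: gauss_at_def)

lemma std_gauss_eq: "std_gauss = gauss_at 0"
  by (simp add: std_gauss_def gauss_at_def)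

lemma gauss_at_eq_distr: "gauss_at \<theta> = distr (gauss_at 0) borel (\<lambda>x. \<theta> + x)" for \<theta> :: "real^'d"
proof -
  have "gauss_at \<theta> = density (distr lborel borel ((+) \<theta>)) (\<lambda>x. ennreal (gauss_dens (x - \<theta>)))"
    unfolding lborel_distr_plus gauss_at_def ..
  also have "\<dots> = distr (density lborel (\<lambda>x. ennreal (gauss_dens (\<theta> + x - \<theta>)))) borel ((+) \<theta>)"
    by (subst density_distr) auto
  finally show ?thesis by (simp add: gauss_at_def)
qed

text \<open>Reflection symmetry of Lebesgue measure and of the density; it lets sign-flipped data be
  treated as data with flipped labels.\<close>

lemma gauss_at_uminus_eq_distr: "gauss_at (- \<theta>) = distr (gauss_at \<theta>) borel uminus" for \<theta> :: "real^'d"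
proof -
  have L: "distr lborel borel uminus = (lborel :: (real^'d) measure)"
    using lborel_affine[of "-1" "0 :: real^'d"] by (simp add: density_1)
  have "gauss_at (- \<theta>) = density (distr lborel borel uminus) (\<lambda>x. ennreal (gauss_dens (x + \<theta>)))"
    unfolding L gauss_at_def by simp
  also have "\<dots> = distr (density lborel (\<lambda>x. ennreal (gauss_dens (- x + \<theta>)))) borel uminus"
    by (subst density_distr) auto
  also have "(\<lambda>x. ennreal (gauss_dens (- x + \<theta>))) = (\<lambda>x. ennreal (gauss_dens (x - \<theta>)))"
    using gauss_dens_uminus[of "x - \<theta>" for x] by auto
  finally show ?thesis by (simp add: gauss_at_def)
qed

lemma prob_space_gauss_at: "prob_space (gauss_at \<theta>)" for \<theta> :: "real^'d"
proof -
  interpret prob_space "gauss_at (0 :: real^'d)"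
    by (rule prob_spaceI) (simp add: gauss_at_def emeasure_density nn_integral_gauss_dens)
  show ?thesis unfolding gauss_at_eq_distr[of \<theta>] by (rule prob_space_distr) simp
qed

lemma integral_gauss_at:
  fixes F :: "real^'d \<Rightarrow> 'b::{banach, second_countable_topology}"
  assumes "F \<in> borel_measurable borel"
  shows "(\<integral>x. F x \<partial>gauss_at \<theta>) = (\<integral>x. gauss_dens (x - \<theta>) *\<^sub>R F x \<partial>lborel)"
  unfolding gauss_at_def using assms by (intro integral_density) auto

lemma integrable_gauss_at:
  fixes F :: "real^'d \<Rightarrow> 'b::{banach, second_countable_topology}"
  assumes "F \<in> borel_measurable borel"
  shows "integrable (gauss_at \<theta>) F \<longleftrightarrow> integrable lborel (\<lambda>x. gauss_dens (x - \<theta>) *\<^sub>R F x)"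
  unfolding gauss_at_def using assms by (intro integrable_density) auto

text \<open>Completing the square turns the tilt by \<open>h\<close> into a shift of the mean, so
  integrability and value both follow from the total mass of
  \<open>gauss_at (\<theta> + h)\<close>.\<close>

lemma has_bochner_integral_gauss_at_exp:
  "has_bochner_integral (gauss_at \<theta>) (\<lambda>x. exp (h \<bullet> x)) (exp (h \<bullet> \<theta> + (norm h)\<^sup>2 / 2))"
  for \<theta> h :: "real^'d"
proof -
  interpret prob_space "gauss_at (\<theta> + h)" by (rule prob_space_gauss_at)
  have e: "gauss_dens (x - \<theta>) * exp (h \<bullet> x) = exp (h \<bullet> \<theta> + (norm h)\<^sup>2 / 2) * gauss_dens (x - (\<theta> + h))" for x
  proof -
    have "\<theta> \<bullet> x - (norm \<theta>)\<^sup>2 / 2 + h \<bullet> x = h \<bullet> \<theta> + (norm h)\<^sup>2 / 2 + ((\<theta> + h) \<bullet> x - (norm (\<theta> + h))\<^sup>2 / 2)"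
      unfolding power2_norm_eq_inner by (simp add: inner_add inner_commute field_simps)
    then show ?thesis
      unfolding gauss_dens_shift mult.assoc mult_exp_exp
      by (simp only: mult.left_commute[of _ "gauss_dens x"] mult_exp_exp)
  qed
  have "has_bochner_integral (gauss_at (\<theta> + h)) (\<lambda>x. 1::real) 1"
    using prob_space by (simp add: has_bochner_integral_iff)
  then have "has_bochner_integral lborel (\<lambda>x. gauss_dens (x - (\<theta> + h))) 1"
    by (simp only: has_bochner_integral_iff integral_gauss_at integrable_gauss_at borel_measurable_const real_scaleR_def mult_1_right)
  then have "has_bochner_integral lborel (\<lambda>x. gauss_dens (x - \<theta>) * exp (h \<bullet> x)) (exp (h \<bullet> \<theta> + (norm h)\<^sup>2 / 2))"
    unfolding e using has_bochner_integral_mult_right[of "exp (h \<bullet> \<theta> + (norm h)\<^sup>2 / 2)" lborel _ 1] by simp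
  then show ?thesis
    by (simp add: has_bochner_integral_iff integral_gauss_at integrable_gauss_at)
qed

lemmas integrable_gauss_at_exp = has_bochner_integral_gauss_at_exp[THEN integrable.intros]

text \<open>The Euclidean norm is at most the l1 norm, which is the maximum of v . x over sign
  vectors v; bounding the maximum of exponentials by their sum leaves finitely many terms with known
  Gaussian integrals.\<close>

lemma exp_norm_le_sum_exp:
  fixes x :: "real^'d"
  assumes "a \<ge> 0"
  shows "exp (a * norm x) \<le> (\<Sum>v\<in>{v :: real^'d. \<forall>i. v $ i \<in> {-1, 1}}. exp ((a *\<^sub>R v) \<bullet> x))"
    and "finite {v :: real^'d. \<forall>i. v $ i \<in> {-1, 1::real}}"
proof -
  show fin: "finite {v :: real^'d. \<forall>i. v $ i \<in> {-1, 1::real}}"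
    proof (rule finite_subset)
    show "{v :: real^'d. \<forall>i. v $ i \<in> {-1, 1}} \<subseteq> vec_lambda ` (UNIV \<rightarrow>\<^sub>E {-1, 1})"
    proof safe
      fix v :: "real^'d" assume "\<forall>i. v $ i \<in> {-1, 1}"
      then show "v \<in> vec_lambda ` (UNIV \<rightarrow>\<^sub>E {-1, 1})"
        by (intro image_eqI[of _ _ "vec_nth v"]) (auto simp: PiE_iff)
    qed
  qed (intro finite_imageI finite_PiE; simp)
  define v :: "real^'d" where "v = (\<chi> i. if x $ i < 0 then -1 else 1)"
  have "norm x \<le> v \<bullet> x"
  proof -
    have "norm x \<le> (\<Sum>i\<in>UNIV. \<bar>x $ i\<bar>)" by (rule norm_le_l1_cart)
    also have "\<dots> = v \<bullet> x" unfolding inner_vec_def v_def by (intro sum.cong) auto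
    finally show ?thesis .
  qed
  then have "exp (a * norm x) \<le> exp ((a *\<^sub>R v) \<bullet> x)" using assms by (simp add: mult_left_mono)
  also have "\<dots> \<le> (\<Sum>v\<in>{v :: real^'d. \<forall>i. v $ i \<in> {-1, 1}}. exp ((a *\<^sub>R v) \<bullet> x))"
    by (rule member_le_sum) (use fin in \<open>auto simp: v_def\<close>)
  finally show "exp (a * norm x) \<le> (\<Sum>v\<in>{v :: real^'d. \<forall>i. v $ i \<in> {-1, 1}}. exp ((a *\<^sub>R v) \<bullet> x))" .
qed

lemma integrable_gauss_at_exp_norm: "integrable (gauss_at \<theta>) (\<lambda>x. exp (a * norm x))" for \<theta> :: "real^'d"
proof -
  have "integrable (gauss_at \<theta>) (\<lambda>x. exp (\<bar>a\<bar> * norm x))"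
  proof (rule Bochner_Integration.integrable_bound)
    show "integrable (gauss_at \<theta>) (\<lambda>x. \<Sum>v\<in>{v :: real^'d. \<forall>i. v $ i \<in> {-1, 1}}. exp ((\<bar>a\<bar> *\<^sub>R v) \<bullet> x))"
      by (intro Bochner_Integration.integrable_sum integrable_gauss_at_exp)
    show "AE x in gauss_at \<theta>. norm (exp (\<bar>a\<bar> * norm x))
        \<le> norm (\<Sum>v\<in>{v :: real^'d. \<forall>i. v $ i \<in> {-1, 1}}. exp ((\<bar>a\<bar> *\<^sub>R v) \<bullet> x))"
      using exp_norm_le_sum_exp(1)[of "\<bar>a\<bar>"] by (intro AE_I2) (simp add: sum_nonneg)
  qed simp
  then show ?thesis
    by (rule Bochner_Integration.integrable_bound) (auto intro!: mult_right_mono)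
qed

lemma integral_lborel_prod:
  fixes f :: "'a::euclidean_space \<Rightarrow> real \<Rightarrow> complex"
  assumes "\<And>b. b \<in> Basis \<Longrightarrow> integrable lborel (f b)"
  shows "(\<integral>x. (\<Prod>b\<in>Basis. f b (x \<bullet> b)) \<partial>(lborel :: 'a measure)) = (\<Prod>b\<in>Basis. \<integral>x. f b x \<partial>lborel)"
proof -
  interpret product_sigma_finite "\<lambda>_::'a. lborel :: real measure" ..
  have [measurable]: "f b \<in> borel_measurable borel" if "b \<in> Basis" for b
    using assms[OF that] by (auto dest: borel_measurable_integrable)
  have "(\<integral>x. (\<Prod>b\<in>Basis. f b (x \<bullet> b)) \<partial>(lborel :: 'a measure))
      = (\<integral>y. (\<Prod>b\<in>Basis. f b ((\<Sum>c\<in>Basis. y c *\<^sub>R c) \<bullet> b)) \<partial>(\<Pi>\<^sub>M b\<in>(Basis::'a set). lborel))"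
    unfolding lborel_eq[where 'a='a] by (rule integral_distr) measurable
  also have "\<dots> = (\<integral>y. (\<Prod>b\<in>Basis. f b (y b)) \<partial>(\<Pi>\<^sub>M b\<in>(Basis::'a set). lborel))"
    by (intro Bochner_Integration.integral_cong prod.cong refl)
       (simp add: inner_sum_left inner_Basis if_distrib[where f="\<lambda>x. _ * x"] cong: if_cong)
  also have "\<dots> = (\<Prod>b\<in>Basis. \<integral>x. f b x \<partial>lborel)"
    by (rule product_integral_prod) (use assms in auto)
  finally show ?thesis .
qed

text \<open>The centred case splits over coordinates into the one-dimensional characteristic
  function; a translation then contributes the phase.\<close>

lemma integral_gauss_at_iexp:
  "(\<integral>x. iexp (t \<bullet> x) \<partial>gauss_at \<theta>) = iexp (t \<bullet> \<theta>) * exp (- (norm t)\<^sup>2 / 2)" for t \<theta> :: "real^'d"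
proof -
  have c: "(\<integral>x. std_normal_density x *\<^sub>R iexp (s * x) \<partial>lborel) = exp (- s\<^sup>2 / 2)" for s
  proof -
    have "char std_normal_distribution s = exp (- s\<^sup>2 / 2)"
      by (simp add: char_std_normal_distribution)
    then show ?thesis unfolding char_def by (subst (asm) integral_density) auto
  qed
  have i: "integrable lborel (\<lambda>x. std_normal_density x *\<^sub>R iexp (s * x))" for s
    by (rule Bochner_Integration.integrable_bound[OF integrable_std_normal_moment[of 0]]) simp_all
  have p: "gauss_dens x *\<^sub>R iexp (t \<bullet> x) = (\<Prod>b\<in>Basis. std_normal_density (x \<bullet> b) *\<^sub>R iexp ((t \<bullet> b) * (x \<bullet> b)))" for x
  proof -
    have "iexp (t \<bullet> x) = (\<Prod>b\<in>Basis. iexp ((t \<bullet> b) * (x \<bullet> b)))"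
      unfolding euclidean_inner[of t x] by (subst exp_sum[symmetric]) (simp_all add: sum_distrib_left)
    then show ?thesis
      unfolding gauss_dens_prod scaleR_conv_of_real prod.distrib by (simp only: of_real_prod)
  qed
  have "(\<integral>x. gauss_dens x *\<^sub>R iexp (t \<bullet> x) \<partial>lborel)
      = (\<Prod>b\<in>Basis. \<integral>y. std_normal_density y *\<^sub>R iexp ((t \<bullet> b) * y) \<partial>lborel)"
    unfolding p by (rule integral_lborel_prod) (rule i)
  also have "\<dots> = complex_of_real (\<Prod>b\<in>Basis. exp (- (t \<bullet> b)\<^sup>2 / 2))"
    unfolding c of_real_prod ..
  also have "(\<Prod>b\<in>Basis. exp (- (t \<bullet> b)\<^sup>2 / 2)) = exp (- (norm t)\<^sup>2 / 2)"
    unfolding norm_power2_eq_sum_Basis by (subst exp_sum[symmetric]) (simp_all only: finite_Basis sum_divide_distrib[symmetric] sum_negf minus_divide_left)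
  finally have 0: "(\<integral>x. iexp (t \<bullet> x) \<partial>gauss_at 0) = exp (- (norm t)\<^sup>2 / 2)"
    by (subst integral_gauss_at) simp_all
  have "(\<integral>x. iexp (t \<bullet> x) \<partial>gauss_at \<theta>) = (\<integral>x. iexp (t \<bullet> \<theta>) * iexp (t \<bullet> x) \<partial>gauss_at 0)"
    unfolding gauss_at_eq_distr[of \<theta>]
    by (subst integral_distr) (auto simp: inner_add_right exp_add ring_distribs)
  also have "\<dots> = iexp (t \<bullet> \<theta>) * exp (- (norm t)\<^sup>2 / 2)"
    by (simp add: 0)
  finally show ?thesis .
qed

text \<open>For limits where the comparison sequence itself, for instance a smoothed or truncated
  integral, depends on \<epsilon>.\<close>

lemma LIMSEQ_approxI:
  fixes X :: "nat \<Rightarrow> 'a::real_normed_vector"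
  assumes "\<And>\<epsilon>. \<epsilon> > 0 \<Longrightarrow> \<exists>a b. a \<longlonglongrightarrow> b \<and> (\<forall>\<^sub>F n in sequentially. norm (X n - a n) \<le> \<epsilon>) \<and> norm (L - b) \<le> \<epsilon>"
  shows "X \<longlonglongrightarrow> L"
proof (rule tendstoI)
  fix e :: real assume "e > 0"
  then have "e / 4 > 0" by simp
  from assms[OF this] obtain a b where a: "a \<longlonglongrightarrow> b"
    and X: "\<forall>\<^sub>F n in sequentially. norm (X n - a n) \<le> e / 4" and L: "norm (L - b) \<le> e / 4" by blast
  from tendstoD[OF a \<open>e / 4 > 0\<close>] X show "\<forall>\<^sub>F n in sequentially. dist (X n) L < e"
  proof eventually_elim
    case (elim n)
    have "X n - L = (X n - a n) + (a n - b) - (L - b)" by simp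
    then have "norm (X n - L) \<le> norm (X n - a n) + norm (a n - b) + norm (L - b)"
      by (metis norm_triangle_ineq4 norm_triangle_ineq add_right_mono order_trans)
    then show ?case using elim L \<open>e > 0\<close> by (simp add: dist_norm)
  qed
qed

lemma lborel_integral_affine:
  fixes f :: "'a::euclidean_space \<Rightarrow> real"
  assumes [measurable]: "f \<in> borel_measurable borel" and "c \<noteq> 0"
  shows "(\<integral>x. f x \<partial>lborel) = \<bar>c\<bar> ^ DIM('a) * (\<integral>x. f (t + c *\<^sub>R x) \<partial>lborel)"
proof -
  have "(\<integral>x. f x \<partial>lborel) = (\<integral>x. f x \<partial>density (distr lborel borel (\<lambda>x. t + c *\<^sub>R x)) (\<lambda>_. ennreal (\<bar>c\<bar> ^ DIM('a))))"
    using lborel_affine[OF assms(2), of t] by simp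
  also have "\<dots> = (\<integral>x. \<bar>c\<bar> ^ DIM('a) *\<^sub>R f x \<partial>distr lborel borel (\<lambda>x. t + c *\<^sub>R x))"
    by (rule integral_density) auto
  also have "\<dots> = (\<integral>x. \<bar>c\<bar> ^ DIM('a) *\<^sub>R f (t + c *\<^sub>R x) \<partial>lborel)"
    by (rule integral_distr) auto
  finally show ?thesis by simp
qed

section \<open>Characteristic functions determine weak limits\<close>

text \<open>The bump is, as a function of t - s y, the characteristic function of the standard
  normal law. Fubini thus writes its mean as a Gaussian average of characteristic functions at the
  points - s z, where the assumed pointwise limits pass under a bounded integral.\<close>

lemma integral_gauss_bump_tendsto:
  fixes \<nu> :: "nat \<Rightarrow> (real^'d) measure"
  assumes "\<And>n. prob_space (\<nu> n)" "prob_space \<mu>"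
    and sets [measurable_cong]: "\<And>n. sets (\<nu> n) = sets borel" "sets \<mu> = sets borel"
    and cf: "\<And>t. (\<lambda>n. \<integral>y. iexp (t \<bullet> y) \<partial>\<nu> n) \<longlonglongrightarrow> (\<integral>y. iexp (t \<bullet> y) \<partial>\<mu>)"
  shows "(\<lambda>n. \<integral>y. exp (- (norm (t - s *\<^sub>R y))\<^sup>2 / 2) \<partial>\<nu> n) \<longlonglongrightarrow> (\<integral>y. exp (- (norm (t - s *\<^sub>R y))\<^sup>2 / 2) \<partial>\<mu>)"
proof -
  interpret G: prob_space "gauss_at (0 :: real^'d)" by (rule prob_space_gauss_at)
  have swap: "complex_of_real (\<integral>y. exp (- (norm (t - s *\<^sub>R y))\<^sup>2 / 2) \<partial>\<rho>)
     = (\<integral>z. iexp (t \<bullet> z) * (\<integral>y. iexp ((- s *\<^sub>R z) \<bullet> y) \<partial>\<rho>) \<partial>gauss_at 0)"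
    if "prob_space \<rho>" and [measurable_cong]: "sets \<rho> = sets borel" for \<rho> :: "(real^'d) measure"
  proof -
    interpret \<rho>: prob_space \<rho> by fact
    interpret P: pair_prob_space "gauss_at (0 :: real^'d)" \<rho> ..
    have "complex_of_real (\<integral>y. exp (- (norm (t - s *\<^sub>R y))\<^sup>2 / 2) \<partial>\<rho>)
        = (\<integral>y. complex_of_real (exp (- (norm (t - s *\<^sub>R y))\<^sup>2 / 2)) \<partial>\<rho>)" by simp
    also have "\<dots> = (\<integral>y. (\<integral>z. iexp ((t - s *\<^sub>R y) \<bullet> z) \<partial>gauss_at 0) \<partial>\<rho>)"
      unfolding integral_gauss_at_iexp by simp
    also have "\<dots> = (\<integral>z. (\<integral>y. iexp ((t - s *\<^sub>R y) \<bullet> z) \<partial>\<rho>) \<partial>gauss_at 0)"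
      by (rule P.Fubini_integral) (auto intro!: P.P.integrable_const_bound[where B=1])
    also have "\<dots> = (\<integral>z. iexp (t \<bullet> z) * (\<integral>y. iexp ((- s *\<^sub>R z) \<bullet> y) \<partial>\<rho>) \<partial>gauss_at 0)"
    proof -
      have "iexp ((t - s *\<^sub>R y) \<bullet> z) = iexp (t \<bullet> z) * iexp ((- s *\<^sub>R z) \<bullet> y)" for y z
        by (simp add: mult_exp_exp inner_diff_left inner_commute[of y z] right_diff_distrib)
      then show ?thesis by simp
    qed
    finally show ?thesis .
  qed
  have "(\<lambda>n. \<integral>z. iexp (t \<bullet> z) * (\<integral>y. iexp ((- s *\<^sub>R z) \<bullet> y) \<partial>\<nu> n) \<partial>gauss_at 0)
      \<longlonglongrightarrow> (\<integral>z. iexp (t \<bullet> z) * (\<integral>y. iexp ((- s *\<^sub>R z) \<bullet> y) \<partial>\<mu>) \<partial>gauss_at 0)"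
  proof (rule integral_dominated_convergence[where w="\<lambda>_. 1"])
    have m: "(\<lambda>z. iexp (t \<bullet> z) * (\<integral>y. iexp ((- s *\<^sub>R z) \<bullet> y) \<partial>\<rho>)) \<in> borel_measurable (gauss_at 0)"
      if "prob_space \<rho>" and [measurable_cong]: "sets \<rho> = sets borel" for \<rho> :: "(real^'d) measure"
    proof -
      interpret \<rho>: prob_space \<rho> by fact
      show ?thesis by measurable
    qed
    show "(\<lambda>z. iexp (t \<bullet> z) * (\<integral>y. iexp ((- s *\<^sub>R z) \<bullet> y) \<partial>\<mu>)) \<in> borel_measurable (gauss_at 0)"
      "(\<lambda>z. iexp (t \<bullet> z) * (\<integral>y. iexp ((- s *\<^sub>R z) \<bullet> y) \<partial>\<nu> n)) \<in> borel_measurable (gauss_at 0)" for n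
      using m assms by auto
    show "AE z in gauss_at 0. norm (iexp (t \<bullet> z) * (\<integral>y. iexp ((- s *\<^sub>R z) \<bullet> y) \<partial>\<nu> n)) \<le> 1" for n
    proof (rule AE_I2)
      fix z :: "real^'d"
      interpret \<nu>: prob_space "\<nu> n" by (rule assms)
      have "norm (\<integral>y. iexp ((- s *\<^sub>R z) \<bullet> y) \<partial>\<nu> n) \<le> (\<integral>y. norm (iexp ((- s *\<^sub>R z) \<bullet> y)) \<partial>\<nu> n)"
        by (rule integral_norm_bound)
      then show "norm (iexp (t \<bullet> z) * (\<integral>y. iexp ((- s *\<^sub>R z) \<bullet> y) \<partial>\<nu> n)) \<le> 1"
        using \<nu>.prob_space by (simp add: norm_mult)
    qed
    next
    show "AE z in gauss_at 0. (\<lambda>n. iexp (t \<bullet> z) * (\<integral>y. iexp ((- s *\<^sub>R z) \<bullet> y) \<partial>\<nu> n))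
        \<longlonglongrightarrow> iexp (t \<bullet> z) * (\<integral>y. iexp ((- s *\<^sub>R z) \<bullet> y) \<partial>\<mu>)"
      by (intro AE_I2 tendsto_mult tendsto_const cf)
  qed simp
  then have "(\<lambda>n. complex_of_real (\<integral>y. exp (- (norm (t - s *\<^sub>R y))\<^sup>2 / 2) \<partial>\<nu> n))
      \<longlonglongrightarrow> complex_of_real (\<integral>y. exp (- (norm (t - s *\<^sub>R y))\<^sup>2 / 2) \<partial>\<mu>)"
    by (simp only: swap[OF assms(1) sets(1)] swap[OF assms(2) sets(2)])
  then show ?thesis by (simp add: tendsto_of_real_iff)
qed

lemma finite_measure_lborel_cball:
  "finite_measure (density lborel (indicator (cball 0 R)) :: 'a::euclidean_space measure)"
  using emeasure_lborel_cball_finite[of 0 R] by (intro finite_measureI) (simp add: emeasure_restricted less_top)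

text \<open>The substitution z = s (x - y) moves y out of \<open>g\<close> and into a Gaussian bump,
  whose means are governed by characteristic functions. Restricting x to a ball containing the
  support of \<open>g\<close> keeps the base measure finite, so that bounded integrands are
  integrable.\<close>

lemma integral_gauss_smoothing:
  fixes g :: "real^'d \<Rightarrow> real"
  assumes [measurable]: "g \<in> borel_measurable borel" and "\<And>x. \<bar>g x\<bar> \<le> B" and "\<And>x. norm x > R \<Longrightarrow> g x = 0"
    and s: "s > 0" and "prob_space \<rho>" and [measurable_cong]: "sets \<rho> = sets borel"
  shows "(\<integral>y. (\<integral>z. g (y + z /\<^sub>R s) \<partial>gauss_at 0) \<partial>\<rho>)
    = (\<integral>x. g x * (s ^ DIM(real^'d) * (2 * pi) powr (- real CARD('d) / 2) * (\<integral>y. exp (- (norm (s *\<^sub>R x - s *\<^sub>R y))\<^sup>2 / 2) \<partial>\<rho>))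
        \<partial>density lborel (indicator (cball 0 R)))"
proof -
  let ?L = "density lborel (indicator (cball 0 R)) :: (real^'d) measure"
  let ?c = "s ^ DIM(real^'d) * (2 * pi) powr (- real CARD('d) / 2)"
  interpret \<rho>: prob_space \<rho> by fact
  interpret L: finite_measure ?L by (rule finite_measure_lborel_cball)
  interpret P: pair_sigma_finite ?L \<rho> ..
  interpret PP: finite_measure "?L \<Otimes>\<^sub>M \<rho>"
    by (intro finite_measure_pair_measure) unfold_locales
  have [measurable_cong]: "sets ?L = sets borel" by simp
  have inner: "(\<integral>z. g (y + z /\<^sub>R s) \<partial>gauss_at 0) = (\<integral>x. g x * (?c * exp (- (norm (s *\<^sub>R x - s *\<^sub>R y))\<^sup>2 / 2)) \<partial>?L)" for y
  proof -
    have "(\<integral>z. g (y + z /\<^sub>R s) \<partial>gauss_at 0) = (\<integral>z. gauss_dens z * g (y + z /\<^sub>R s) \<partial>lborel)"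
      by (subst integral_gauss_at) auto
    also have "\<dots> = s ^ DIM(real^'d) * (\<integral>x. gauss_dens (- s *\<^sub>R y + s *\<^sub>R x) * g (y + (- s *\<^sub>R y + s *\<^sub>R x) /\<^sub>R s) \<partial>lborel)"
      using s by (subst lborel_integral_affine[where c=s and t="- s *\<^sub>R y"]) auto
    also have "\<dots> = s ^ DIM(real^'d) * (\<integral>x. gauss_dens (s *\<^sub>R x - s *\<^sub>R y) * g x \<partial>lborel)"
      using s by (simp add: scaleR_right_distrib scaleR_diff_right)
    also have "\<dots> = (\<integral>x. indicator (cball 0 R) x *\<^sub>R (g x * (?c * exp (- (norm (s *\<^sub>R x - s *\<^sub>R y))\<^sup>2 / 2))) \<partial>lborel)"
      unfolding integral_mult_right_zero[symmetric]
      by (intro Bochner_Integration.integral_cong)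
         (use assms(3) in \<open>auto simp: gauss_dens_def indicator_def\<close>)
    also have "\<dots> = (\<integral>x. g x * (?c * exp (- (norm (s *\<^sub>R x - s *\<^sub>R y))\<^sup>2 / 2)) \<partial>?L)"
      by (subst integral_density[symmetric]) (auto simp: ennreal_indicator intro!: borel_measurable_indicator)
    finally show ?thesis .
  qed
  have "B \<ge> 0" using assms(2)[of 0] by auto
  have "(\<integral>y. (\<integral>z. g (y + z /\<^sub>R s) \<partial>gauss_at 0) \<partial>\<rho>) = (\<integral>y. (\<integral>x. g x * (?c * exp (- (norm (s *\<^sub>R x - s *\<^sub>R y))\<^sup>2 / 2)) \<partial>?L) \<partial>\<rho>)"
    unfolding inner ..
  also have "\<dots> = (\<integral>x. (\<integral>y. g x * (?c * exp (- (norm (s *\<^sub>R x - s *\<^sub>R y))\<^sup>2 / 2)) \<partial>\<rho>) \<partial>?L)"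
  proof (rule P.Fubini_integral, rule PP.integrable_const_bound[where B="B * (?c * 1)"])
    show "AE z in ?L \<Otimes>\<^sub>M \<rho>. norm (case z of (x, y) \<Rightarrow> g x * (?c * exp (- (norm (s *\<^sub>R x - s *\<^sub>R y))\<^sup>2 / 2))) \<le> B * (?c * 1)"
    proof (rule AE_I2)
      fix p :: "(real^'d) \<times> (real^'d)"
      obtain x y where p: "p = (x, y)" by (cases p)
      have "\<bar>g x\<bar> * (?c * exp (- (norm (s *\<^sub>R x - s *\<^sub>R y))\<^sup>2 / 2)) \<le> B * (?c * 1)"
        using assms(2)[of x] \<open>B \<ge> 0\<close> s by (intro mult_mono) simp_all
      moreover have "norm (g x * (?c * e)) = \<bar>g x\<bar> * (?c * e)" if "e \<ge> 0" for e
        using that s unfolding real_norm_def abs_mult by (simp only: abs_of_nonneg zero_le_power less_imp_le powr_ge_zero)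
      ultimately show "norm (case p of (x, y) \<Rightarrow> g x * (?c * exp (- (norm (s *\<^sub>R x - s *\<^sub>R y))\<^sup>2 / 2))) \<le> B * (?c * 1)"
        unfolding p prod.case by simp
    qed
  qed measurable
  finally show ?thesis by simp
qed

text \<open>Convolving \<open>g\<close> with a Gaussian of width 1 / s changes it by at most
  \<epsilon> uniformly, and integrals of the convolution converge by the bump lemma.\<close>

lemma tendsto_integral_compact_support:
  fixes \<nu> :: "nat \<Rightarrow> (real^'d) measure" and g :: "real^'d \<Rightarrow> real"
  assumes \<nu>: "\<And>n. prob_space (\<nu> n)" and \<mu>: "prob_space \<mu>"
    and sets [measurable_cong]: "\<And>n. sets (\<nu> n) = sets borel" "sets \<mu> = sets borel"
    and cf: "\<And>t. (\<lambda>n. \<integral>y. iexp (t \<bullet> y) \<partial>\<nu> n) \<longlonglongrightarrow> (\<integral>y. iexp (t \<bullet> y) \<partial>\<mu>)"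
    and g: "continuous_on UNIV g" "\<And>x. norm x > R \<Longrightarrow> g x = 0"
  shows "(\<lambda>n. \<integral>y. g y \<partial>\<nu> n) \<longlonglongrightarrow> (\<integral>y. g y \<partial>\<mu>)"
proof (rule LIMSEQ_approxI)
  fix \<epsilon> :: real assume \<epsilon>: "\<epsilon> > 0"
  interpret G: prob_space "gauss_at (0 :: real^'d)" by (rule prob_space_gauss_at)
  have gm [measurable]: "g \<in> borel_measurable borel"
    using g(1) by (rule borel_measurable_continuous_onI)
  have unif: "uniformly_continuous_on (cball 0 (R + 1)) g"
    by (intro compact_uniformly_continuous continuous_on_subset[OF g(1)]) auto
  have "bounded (g ` cball 0 R)"
    by (intro compact_imp_bounded compact_continuous_image continuous_on_subset[OF g(1)]) auto
  then obtain B where B: "B > 0" "\<And>x. norm x \<le> R \<Longrightarrow> \<bar>g x\<bar> \<le> B"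
    unfolding bounded_pos by auto
  have gB: "\<bar>g x\<bar> \<le> B" for x
    using B(1) B(2)[of x] g(2)[of x] by (cases "norm x \<le> R") auto
  \<comment> \<open>Uniform continuity holds on the ball of radius R + 1. With \<delta> at most 1 it
    contains every close pair with one point of norm at most R, and \<open>g\<close> vanishes at
    both points of any other pair.\<close>
  obtain \<delta> where \<delta>: "\<delta> > 0" "\<delta> \<le> 1" and uc: "\<And>x y. dist x y \<le> \<delta> \<Longrightarrow> \<bar>g x - g y\<bar> \<le> \<epsilon> / 2"
  proof -
    from unif \<epsilon> obtain d where d: "d > 0"
      and D: "\<And>x y. \<lbrakk>x \<in> cball 0 (R+1); y \<in> cball 0 (R+1); dist y x < d\<rbrakk> \<Longrightarrow> dist (g y) (g x) < \<epsilon> / 2"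
      unfolding uniformly_continuous_on_def by (metis half_gt_zero)
    have "\<bar>g x - g y\<bar> \<le> \<epsilon> / 2" if "dist x y \<le> min (d / 2) 1" for x y
    proof (cases "norm x \<le> R \<or> norm y \<le> R")
      case True
      moreover have "\<bar>norm x - norm y\<bar> \<le> 1"
        using that norm_triangle_ineq3[of x y] by (simp add: dist_norm)
      ultimately have "x \<in> cball 0 (R+1)" "y \<in> cball 0 (R+1)" by auto
      then show ?thesis using D[of y x] that d by (auto simp: dist_real_def)
    qed (use g(2) \<epsilon> in auto)
    then show ?thesis using that[of "min (d / 2) 1"] d by auto
  qed
  \<comment> \<open>\<open>C\<close> serves a Chernoff bound: where norm z exceeds s \<delta>, the
    indicator is at most exp (norm z - s \<delta>), so the tail costs at most 2 B C exp (- s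
    \<delta>).\<close>
  define C where "C = (\<integral>z. exp (norm z) \<partial>gauss_at (0 :: real^'d))"
  have intC: "integrable (gauss_at (0 :: real^'d)) (\<lambda>z. exp (norm z))"
    using integrable_gauss_at_exp_norm[of 0 1] by simp
  have "C \<ge> 0" unfolding C_def by (rule integral_nonneg_AE) simp
  have "((\<lambda>s. 2 * B * C * exp (- (s * \<delta>))) \<longlongrightarrow> 0) at_top"
    using \<delta>(1) by (intro tendsto_mult_right_zero filterlim_compose[OF exp_at_bot])
      (auto simp: filterlim_uminus_at_bot intro!: filterlim_at_top_mult_tendsto_pos filterlim_ident)
  then have "\<forall>\<^sub>F s in at_top. 2 * B * C * exp (- (s * \<delta>)) < \<epsilon> / 2"
    by (rule order_tendstoD(2)) (use \<epsilon> in simp)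
  with eventually_gt_at_top[of 0]
  have "\<forall>\<^sub>F s in at_top. s > 0 \<and> 2 * B * C * exp (- (s * \<delta>)) < \<epsilon> / 2"
    by eventually_elim simp
  from eventually_happens'[OF trivial_limit_at_top_linorder this]
  obtain s where s: "s > 0" "2 * B * C * exp (- (s * \<delta>)) < \<epsilon> / 2" by blast
  have close: "\<bar>g y - (\<integral>z. g (y + z /\<^sub>R s) \<partial>gauss_at 0)\<bar> \<le> \<epsilon>" for y
  proof -
    have i: "integrable (gauss_at 0) (\<lambda>z. g (y + z /\<^sub>R s))"
      by (rule G.integrable_const_bound[where B=B]) (use gB in auto)
    have "\<bar>g y - (\<integral>z. g (y + z /\<^sub>R s) \<partial>gauss_at 0)\<bar> = \<bar>\<integral>z. g y - g (y + z /\<^sub>R s) \<partial>gauss_at 0\<bar>"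
      using i G.prob_space by simp
    also have "\<dots> \<le> (\<integral>z. \<epsilon> / 2 + 2 * B * (exp (- (s * \<delta>)) * exp (norm z)) \<partial>gauss_at (0 :: real^'d))"
    proof (rule integral_abs_bound_integral)
      fix z :: "real^'d"
      show "\<bar>g y - g (y + z /\<^sub>R s)\<bar> \<le> \<epsilon> / 2 + 2 * B * (exp (- (s * \<delta>)) * exp (norm z))"
      proof (cases "norm z \<le> s * \<delta>")
        case True
        then have "dist y (y + z /\<^sub>R s) \<le> \<delta>" using s(1) by (simp add: dist_norm field_simps)
        then show ?thesis using uc[of y "y + z /\<^sub>R s"] B(1) by (simp add: add_increasing2)
      next
        case False
        then have "1 \<le> exp (- (s * \<delta>)) * exp (norm z)" by (simp add: mult_exp_exp)
        then have "2 * B * 1 \<le> 2 * B * (exp (- (s * \<delta>)) * exp (norm z))" using B(1) by (intro mult_left_mono) auto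
        then show ?thesis using gB[of y] gB[of "y + z /\<^sub>R s"] \<epsilon> by linarith
      qed
    qed (use i intC in auto)
    also have "\<dots> = \<epsilon> / 2 + 2 * B * C * exp (- (s * \<delta>))"
      using intC G.prob_space by (simp add: C_def)
    finally show ?thesis using s(2) by linarith
  qed
  define H where "H y = (\<integral>z. g (y + z /\<^sub>R s) \<partial>gauss_at 0)" for y
  have Hm [measurable]: "H \<in> borel_measurable borel" unfolding H_def by measurable
  have HB: "\<bar>H y\<bar> \<le> B + \<epsilon>" for y using close[of y] gB[of y] unfolding H_def by linarith
  have near: "norm ((\<integral>y. g y \<partial>\<rho>) - (\<integral>y. H y \<partial>\<rho>)) \<le> \<epsilon>"
    if "prob_space \<rho>" and [measurable_cong]: "sets \<rho> = sets borel" for \<rho> :: "(real^'d) measure"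
  proof -
    interpret \<rho>: prob_space \<rho> by fact
    have i: "integrable \<rho> g" "integrable \<rho> H"
      by (rule \<rho>.integrable_const_bound[where B=B], use gB in simp_all)
         (rule \<rho>.integrable_const_bound[where B="B + \<epsilon>"], use HB in simp_all)
    have "norm (\<integral>y. g y - H y \<partial>\<rho>) \<le> (\<integral>y. \<epsilon> \<partial>\<rho>)"
      by (rule Bochner_Integration.integral_norm_bound_integral)
         (use i close[folded H_def] in auto)
    then show ?thesis using i \<rho>.prob_space by simp
  qed
  interpret L: finite_measure "density lborel (indicator (cball 0 R)) :: (real^'d) measure" by (rule finite_measure_lborel_cball)
  let ?D = "density lborel (indicator (cball 0 R)) :: (real^'d) measure"
  define c where "c = s ^ DIM(real^'d) * (2 * pi) powr (- real CARD('d) / 2)"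
  have c: "c \<ge> 0" using s(1) by (simp add: c_def)
  define K where "K \<rho> x = c * (\<integral>y. exp (- (norm (s *\<^sub>R x - s *\<^sub>R y))\<^sup>2 / 2) \<partial>\<rho>)" for \<rho> and x :: "real^'d"
  have H_eq: "(\<integral>y. H y \<partial>\<rho>) = (\<integral>x. g x * K \<rho> x \<partial>?D)"
    if "prob_space \<rho>" "sets \<rho> = sets borel" for \<rho> :: "(real^'d) measure"
    unfolding H_def K_def c_def by (rule integral_gauss_smoothing[OF gm gB g(2) s(1) that])
  have Km: "K \<rho> \<in> borel_measurable borel" and K01: "0 \<le> K \<rho> x" "K \<rho> x \<le> c"
    if "prob_space \<rho>" and [measurable_cong]: "sets \<rho> = sets borel" for \<rho> :: "(real^'d) measure" and x
  proof -
    interpret \<rho>: prob_space \<rho> by fact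
    show "K \<rho> \<in> borel_measurable borel" unfolding K_def by measurable
    have "(\<integral>y. exp (- (norm (s *\<^sub>R x - s *\<^sub>R y))\<^sup>2 / 2) \<partial>\<rho>) \<le> (\<integral>y. 1 \<partial>\<rho>)"
      by (intro integral_mono \<rho>.integrable_const_bound[where B=1]) auto
    then show "K \<rho> x \<le> c"
      unfolding K_def using c \<rho>.prob_space by (intro mult_left_le) auto
    show "0 \<le> K \<rho> x" unfolding K_def using c by (intro mult_nonneg_nonneg integral_nonneg_AE) auto
  qed
  note [measurable] = Km[OF \<nu> sets(1)] Km[OF \<mu> sets(2)]
  have "(\<lambda>n. \<integral>x. g x * K (\<nu> n) x \<partial>?D) \<longlonglongrightarrow> (\<integral>x. g x * K \<mu> x \<partial>?D)"
  proof (rule integral_dominated_convergence[where w="\<lambda>_. B * c"])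
    show "AE x in ?D. norm (g x * K (\<nu> n) x) \<le> B * c" for n
    proof (rule AE_I2)
      fix x
      have "\<bar>g x\<bar> * K (\<nu> n) x \<le> B * c"
        using gB[of x] K01[OF \<nu> sets(1)] B(1) by (intro mult_mono) auto
      then show "norm (g x * K (\<nu> n) x) \<le> B * c"
        using K01(1)[OF \<nu> sets(1), of n x] by (simp add: abs_mult)
    qed
    show "AE x in ?D. (\<lambda>n. g x * K (\<nu> n) x) \<longlonglongrightarrow> g x * K \<mu> x"
      unfolding K_def by (intro AE_I2 tendsto_intros integral_gauss_bump_tendsto assms)
  qed simp_all
  then have lim: "(\<lambda>n. \<integral>y. H y \<partial>\<nu> n) \<longlonglongrightarrow> (\<integral>y. H y \<partial>\<mu>)"
    unfolding H_eq[OF \<nu> sets(1)] H_eq[OF \<mu> sets(2)] .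
  show "\<exists>a b. a \<longlonglongrightarrow> b \<and> (\<forall>\<^sub>F n in sequentially. norm ((\<integral>y. g y \<partial>\<nu> n) - a n) \<le> \<epsilon>) \<and> norm ((\<integral>y. g y \<partial>\<mu>) - b) \<le> \<epsilon>"
    using lim near[OF \<nu> sets(1)] near[OF \<mu> sets(2)] by (intro exI conjI) auto
qed

text \<open>Truncation by a continuous cutoff reduces bounded \<open>g\<close> to compact support.
  The mass of \<open>\<nu> n\<close> lost outside the cutoff is controlled by the convergence of the
  cutoff's own integral, so tightness is a by-product.\<close>

theorem weak_conv_of_char:
  fixes \<nu> :: "nat \<Rightarrow> (real^'d) measure" and g :: "real^'d \<Rightarrow> real"
  assumes \<nu>: "\<And>n. prob_space (\<nu> n)" and \<mu>: "prob_space \<mu>"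
    and sets [measurable_cong]: "\<And>n. sets (\<nu> n) = sets borel" "sets \<mu> = sets borel"
    and cf: "\<And>t. (\<lambda>n. \<integral>y. iexp (t \<bullet> y) \<partial>\<nu> n) \<longlonglongrightarrow> (\<integral>y. iexp (t \<bullet> y) \<partial>\<mu>)"
    and g: "continuous_on UNIV g" "bounded (range g)"
  shows "(\<lambda>n. \<integral>y. g y \<partial>\<nu> n) \<longlonglongrightarrow> (\<integral>y. g y \<partial>\<mu>)"
proof (rule LIMSEQ_approxI)
  fix \<epsilon> :: real assume \<epsilon>: "\<epsilon> > 0"
  from g(2) obtain B where B: "B > 0" "\<And>x. \<bar>g x\<bar> \<le> B" unfolding bounded_pos by auto
  have gm [measurable]: "g \<in> borel_measurable borel"
    using g(1) by (rule borel_measurable_continuous_onI)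
  define \<phi> where "\<phi> R y = max 0 (min 1 (R - norm y))" for R :: real and y :: "real^'d"
  have \<phi>_cont: "continuous_on UNIV (\<phi> R)" for R unfolding \<phi>_def by (intro continuous_intros)
  have [measurable]: "\<phi> R \<in> borel_measurable borel" for R
    using \<phi>_cont by (rule borel_measurable_continuous_onI)
  have \<phi>01: "0 \<le> \<phi> R y" "\<phi> R y \<le> 1" for R y by (auto simp: \<phi>_def)
  interpret \<mu>: prob_space \<mu> by fact
  have "(\<lambda>n. \<integral>y. \<phi> (real n) y \<partial>\<mu>) \<longlonglongrightarrow> (\<integral>y. 1 \<partial>\<mu>)"
  proof (rule integral_dominated_convergence[where w="\<lambda>_. 1"])
    show "AE y in \<mu>. (\<lambda>n. \<phi> (real n) y) \<longlonglongrightarrow> 1"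
    proof (rule AE_I2)
      fix y :: "real^'d"
      have "\<forall>\<^sub>F n in sequentially. real n \<ge> norm y + 1"
        by (rule eventually_sequentiallyI[of "nat \<lceil>norm y + 1\<rceil>"]) linarith
      then have "\<forall>\<^sub>F n in sequentially. \<phi> (real n) y = 1" by eventually_elim (auto simp: \<phi>_def)
      then show "(\<lambda>n. \<phi> (real n) y) \<longlonglongrightarrow> 1" by (rule tendsto_eventually)
    qed
  qed (use \<phi>01 in auto)
  then have "(\<lambda>n. \<integral>y. \<phi> (real n) y \<partial>\<mu>) \<longlonglongrightarrow> 1" using \<mu>.prob_space by simp
  \<comment> \<open>The lost mass is below \<epsilon> / (2 B), so truncating \<open>g\<close> costs
    at most \<epsilon> / 2 under the limit and, eventually, under \<open>\<nu> n\<close>.\<close>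
  from order_tendstoD(1)[OF this, of "1 - \<epsilon> / (2 * B)"] \<epsilon> B(1)
  obtain R where R: "(\<integral>y. \<phi> R y \<partial>\<mu>) > 1 - \<epsilon> / (2 * B)"
    by (auto simp: eventually_sequentially)
  have \<phi>0: "\<phi> R y = 0" if "norm y > R" for y using that by (auto simp: \<phi>_def)
  note lim = tendsto_integral_compact_support[OF \<nu> \<mu> sets cf]
  have l1: "(\<lambda>n. \<integral>y. \<phi> R y \<partial>\<nu> n) \<longlonglongrightarrow> (\<integral>y. \<phi> R y \<partial>\<mu>)"
    by (rule lim[OF \<phi>_cont, of R]) (auto simp: \<phi>0)
  have l2: "(\<lambda>n. \<integral>y. g y * \<phi> R y \<partial>\<nu> n) \<longlonglongrightarrow> (\<integral>y. g y * \<phi> R y \<partial>\<mu>)"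
    by (rule lim[of "\<lambda>y. g y * \<phi> R y" R]) (auto simp: \<phi>0 intro!: continuous_intros g \<phi>_cont)
  have near: "norm ((\<integral>y. g y \<partial>\<rho>) - (\<integral>y. g y * \<phi> R y \<partial>\<rho>)) \<le> \<epsilon>"
    if "prob_space \<rho>" and [measurable_cong]: "sets \<rho> = sets borel" and "(\<integral>y. \<phi> R y \<partial>\<rho>) > 1 - \<epsilon> / (2 * B)"
    for \<rho> :: "(real^'d) measure"
  proof -
    interpret \<rho>: prob_space \<rho> by fact
    have i: "integrable \<rho> g" "integrable \<rho> (\<phi> R)" "integrable \<rho> (\<lambda>y. g y * \<phi> R y)"
    proof -
      show "integrable \<rho> g" by (rule \<rho>.integrable_const_bound[where B=B]) (simp_all add: B)
      show "integrable \<rho> (\<phi> R)" by (rule \<rho>.integrable_const_bound[where B=1]) (simp_all add: \<phi>01)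
      have "\<bar>g y\<bar> * \<phi> R y \<le> B * 1" for y using B \<phi>01 by (intro mult_mono) auto
      then show "integrable \<rho> (\<lambda>y. g y * \<phi> R y)"
        by (intro \<rho>.integrable_const_bound[where B=B]) (simp_all add: abs_mult \<phi>01)
    qed
    have "norm (\<integral>y. g y - g y * \<phi> R y \<partial>\<rho>) \<le> (\<integral>y. B * (1 - \<phi> R y) \<partial>\<rho>)"
    proof (rule Bochner_Integration.integral_norm_bound_integral)
      fix y
      have "\<bar>g y - g y * \<phi> R y\<bar> = \<bar>g y\<bar> * (1 - \<phi> R y)"
      proof -
        have "g y - g y * \<phi> R y = g y * (1 - \<phi> R y)" by (simp add: algebra_simps)
        then show ?thesis using \<phi>01[of R y] by (simp add: abs_mult)
      qed
      then show "norm (g y - g y * \<phi> R y) \<le> B * (1 - \<phi> R y)"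
        using B(2)[of y] \<phi>01[of R y] by (simp add: mult_right_mono)
    qed (use i in auto)
    also have "\<dots> = B * (1 - (\<integral>y. \<phi> R y \<partial>\<rho>))" using i \<rho>.prob_space by simp
    also have "\<dots> \<le> B * (\<epsilon> / (2 * B))" using that(3) B(1) by (intro mult_left_mono) auto
    also have "\<dots> \<le> \<epsilon>" using B(1) \<epsilon> by simp
    finally show ?thesis using i by simp
  qed
  from order_tendstoD(1)[OF l1 R]
  have "\<forall>\<^sub>F n in sequentially. norm ((\<integral>y. g y \<partial>\<nu> n) - (\<integral>y. g y * \<phi> R y \<partial>\<nu> n)) \<le> \<epsilon>"
    by eventually_elim (rule near[OF \<nu> sets(1)])
  then show "\<exists>a b. a \<longlonglongrightarrow> b \<and> (\<forall>\<^sub>F n in sequentially. norm ((\<integral>y. g y \<partial>\<nu> n) - a n) \<le> \<epsilon>) \<and> norm ((\<integral>y. g y \<partial>\<mu>) - b) \<le> \<epsilon>"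
    using l2 near[OF \<mu> sets(2) R] by (intro exI conjI)
qed

section \<open>Centred normal laws\<close>

text \<open>At e_j + t e_k the quadratic form is affine in t once the diagonal entry at k vanishes;
  a nonzero slope would make it negative.\<close>

lemma psd_diag_zero_imp_row_zero:
  fixes S :: "real^'d^'d"
  assumes "transpose S = S" and "\<And>x. 0 \<le> x \<bullet> (S *v x)" and "S $ k $ k = 0"
  shows "S $ k $ j = 0"
proof (rule ccontr)
  assume nz: "S $ k $ j \<noteq> 0"
  have sym: "S $ a $ b = S $ b $ a" for a b using assms(1) by (metis transpose_def vec_lambda_beta)
  have "0 \<le> S $ j $ j + 2 * t * S $ k $ j" for t
  proof -
    have "(axis j 1 + t *\<^sub>R axis k 1) \<bullet> (S *v (axis j 1 + t *\<^sub>R axis k 1)) = S $ j $ j + 2 * t * S $ k $ j"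
      using assms(3) sym[of k j]
      by (simp add: matrix_vector_right_distrib matrix_vector_mult_scaleR inner_add_left inner_add_right
          matrix_vector_mult_basis inner_axis' column_def algebra_simps)
    then show ?thesis using assms(2) by metis
  qed
  \<comment> \<open>At this t the affine function equals -1.\<close>
  from this[of "- (S $ j $ j + 1) / (2 * S $ k $ j)"] nz show False by (simp add: field_simps)
qed

text \<open>Cholesky elimination: subtracting the square of a normalised column with nonzero pivot
  keeps the matrix positive semidefinite and clears the row and column of the pivot.\<close>
lemma psd_eq_sum_outer:
  fixes S :: "real^'d^'d"
  assumes "finite K" and "transpose S = S" and "\<And>x. 0 \<le> x \<bullet> (S *v x)" and "\<And>i j. i \<notin> K \<Longrightarrow> S $ i $ j = 0"
  shows "\<exists>v. S = (\<Sum>k\<in>K. outer (v k) (v k))"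
  using assms
proof (induction K arbitrary: S rule: finite_induct)
  case empty
  then show ?case by (auto simp: vec_eq_iff)
next
  case (insert k K)
  have sym: "S $ a $ b = S $ b $ a" for a b using insert.prems(1) by (metis transpose_def vec_lambda_beta)
  show ?case
  proof (cases "S $ k $ k = 0")
    case True
    have "\<exists>v. S = (\<Sum>k\<in>K. outer (v k) (v k))"
      by (rule insert.IH) (use insert.prems psd_diag_zero_imp_row_zero[OF insert.prems(1,2) True] in \<open>metis insertE\<close>)+
    then obtain v where v: "S = (\<Sum>k\<in>K. outer (v k) (v k))" by blast
    have "(\<Sum>i\<in>K. outer ((v(k := 0)) i) ((v(k := 0)) i)) = (\<Sum>i\<in>K. outer (v i) (v i))"
      by (rule sum.cong) (use insert.hyps in auto)
    then show ?thesis using v insert.hyps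
      by (intro exI[of _ "v(k := 0)"]) (simp add: outer_def vec_eq_iff)
  next
    case False
    define s where "s = column k S"
    define S' where "S' = S - (1 / S $ k $ k) *\<^sub>R outer s s"
    have s_nth: "s $ i = S $ i $ k" for i by (simp add: s_def column_def)
    have pos: "S $ k $ k > 0"
      using insert.prems(2)[of "axis k 1"] False
      by (simp add: matrix_vector_mult_basis inner_axis' column_def)
    have outv: "outer a b *v x = (b \<bullet> x) *\<^sub>R a" for a b x :: "real^'d"
      by (simp add: outer_def matrix_vector_mult_def vec_eq_iff inner_vec_def sum_distrib_left mult_ac)
    have qf: "x \<bullet> (S' *v x) = x \<bullet> (S *v x) - (s \<bullet> x)\<^sup>2 / S $ k $ k" for x
      by (simp add: S'_def matrix_vector_mult_diff_rdistrib scaleR_matrix_vector_assoc[symmetric] outv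
          inner_diff_right inner_commute power2_eq_square)
    have "\<exists>v. S' = (\<Sum>k\<in>K. outer (v k) (v k))"
    proof (rule insert.IH)
      show "transpose S' = S'" using sym by (simp add: transpose_def S'_def outer_def vec_eq_iff mult_ac)
      fix x :: "real^'d"
      \<comment> \<open>Subtracting \<open>?c\<close> times e_k minimises the form of
        \<open>S\<close> along that axis, and the minimum is the form of the Schur complement
        \<open>S'\<close> at x.\<close>
      let ?c = "(s \<bullet> x) / S $ k $ k"
      have "(S *v x) $ k = s \<bullet> x"
        by (simp add: matrix_vector_mult_def inner_vec_def s_nth sym[of k])
      then have sx: "axis k 1 \<bullet> (S *v x) = s \<bullet> x" by (simp add: inner_axis')
      have "0 \<le> (x - ?c *\<^sub>R axis k 1) \<bullet> (S *v (x - ?c *\<^sub>R axis k 1))" by (rule insert.prems)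
      also have "\<dots> = x \<bullet> (S *v x) - 2 * ?c * (s \<bullet> x) + ?c\<^sup>2 * S $ k $ k"
        using sx by (simp add: matrix_vector_mult_diff_distrib matrix_vector_mult_scaleR inner_diff_left inner_diff_right
            matrix_vector_mult_basis inner_axis inner_axis' s_def[symmetric] s_nth power2_eq_square inner_commute algebra_simps)
      also have "\<dots> = x \<bullet> (S' *v x)" unfolding qf using False by (simp add: field_simps power2_eq_square)
      finally show "0 \<le> x \<bullet> (S' *v x)" .
    next
      fix i j assume "i \<notin> K"
      then consider "i = k" | "i \<notin> insert k K" by blast
      then show "S' $ i $ j = 0"
      proof cases
        case 1 then show ?thesis using False sym[of j k] by (simp add: S'_def outer_def s_nth)
      next
        case 2 then show ?thesis using insert.prems(3) by (simp add: S'_def outer_def s_nth)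
      qed
    qed
    then obtain v where v: "S' = (\<Sum>k\<in>K. outer (v k) (v k))" by blast
    let ?v = "v(k := (1 / sqrt (S $ k $ k)) *\<^sub>R s)"
    have "(\<Sum>i\<in>K. outer (?v i) (?v i)) = (\<Sum>i\<in>K. outer (v i) (v i))"
      by (rule sum.cong) (use insert.hyps in auto)
    moreover have "outer (?v k) (?v k) = (1 / S $ k $ k) *\<^sub>R outer s s"
      using pos by (simp add: outer_def vec_eq_iff)
    ultimately have "S = (\<Sum>i\<in>insert k K. outer (?v i) (?v i))"
      using v insert.hyps by (simp add: S'_def algebra_simps)
    then show ?thesis by blast
  qed
qed

lemma psd_eq_mult_transpose:
  fixes S :: "real^'d^'d"
  assumes "transpose S = S" and "\<And>x. 0 \<le> x \<bullet> (S *v x)"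
  shows "\<exists>A :: real^'d^'d. A ** transpose A = S"
proof -
  have "\<exists>v. S = (\<Sum>k\<in>(UNIV :: 'd set). outer (v k) (v k))"
    by (rule psd_eq_sum_outer) (use assms in auto)
  then obtain v where v: "S = (\<Sum>k\<in>(UNIV :: 'd set). outer (v k) (v k))" by blast
  show ?thesis
    by (rule exI[of _ "\<chi> i k. v k $ i"])
       (simp add: v matrix_matrix_mult_def transpose_def vec_eq_iff outer_def sum_component)
qed

text \<open>The law depends on the factor chosen by \<open>SOME\<close> only through A A^T = S,
  because the characteristic function sees nothing but the norm of t A. Existence of a factor is
  where symmetry and semidefiniteness enter.\<close>

lemma normal_meas_char:
  fixes S :: "real^'d^'d"
  assumes "transpose S = S" and "\<And>x. 0 \<le> x \<bullet> (S *v x)"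
  shows "(\<integral>y. iexp (t \<bullet> y) \<partial>normal_meas S) = exp (- (t \<bullet> (S *v t)) / 2)"
    and "prob_space (normal_meas S)" and "sets (normal_meas S) = sets borel"
proof -
  define A where "A = (SOME A :: real^'d^'d. A ** transpose A = S)"
  have A: "A ** transpose A = S"
    unfolding A_def using psd_eq_mult_transpose[OF assms] by (rule someI_ex)
  interpret prob_space "gauss_at (0 :: real^'d)" by (rule prob_space_gauss_at)
  have [measurable]: "(\<lambda>z. A *v z) \<in> borel_measurable borel"
    by (intro borel_measurable_continuous_onI linear_continuous_on matrix_vector_mul_bounded_linear)
  have eq: "normal_meas S = distr (gauss_at 0) borel (\<lambda>z. A *v z)"
    unfolding normal_meas_def std_gauss_eq A_def[symmetric] by (rule distr_cong) auto
  show "prob_space (normal_meas S)" unfolding eq by (rule prob_space_distr) simp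
  show "sets (normal_meas S) = sets borel" unfolding eq by simp
  have n: "(norm (t v* A))\<^sup>2 = t \<bullet> (S *v t)"
    unfolding A[symmetric] power2_norm_eq_inner dot_lmul_matrix
    by (simp add: matrix_vector_mul_assoc[symmetric])
  have "(\<integral>y. iexp (t \<bullet> y) \<partial>normal_meas S) = (\<integral>z. iexp ((t v* A) \<bullet> z) \<partial>gauss_at 0)"
    unfolding eq by (subst integral_distr) (simp_all add: dot_lmul_matrix)
  then show "(\<integral>y. iexp (t \<bullet> y) \<partial>normal_meas S) = exp (- (t \<bullet> (S *v t)) / 2)"
    unfolding integral_gauss_at_iexp n by simp
qed

section \<open>The function ln cosh\<close>

text \<open>The cumulant generating function of a fair sign; its derivatives \<open>tanh\<close> and
  \<open>sech2\<close> are mean and variance of the tilted sign, which is how they enter the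
  posterior.\<close>

definition lncosh :: "real \<Rightarrow> real" where
  "lncosh v = ln (cosh v)"

lemma lncosh_minus [simp]: "lncosh (- v) = lncosh v"
  by (simp add: lncosh_def)

lemma lncosh_abs [simp]: "lncosh \<bar>v\<bar> = lncosh v"
  by (simp add: lncosh_def)

lemma exp_lncosh [simp]: "exp (lncosh v) = cosh v"
  by (simp add: lncosh_def)

lemma lncosh_0 [simp]: "lncosh 0 = 0"
  by (simp add: lncosh_def)

lemma sech2_eq: "sech2 v = 1 - (tanh v)\<^sup>2"
  unfolding sech2_def tanh_def by (simp add: power_divide sinh_square_eq diff_divide_distrib)

lemma abs_tanh_le_1: "\<bar>tanh v\<bar> \<le> (1::real)"
  using tanh_real_bounds[of v] by auto

lemma sech2_bounds: "0 \<le> sech2 v" "sech2 v \<le> 1"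
  by (simp add: sech2_def) (simp add: sech2_eq)

lemma DERIV_lncosh: "(lncosh has_real_derivative tanh v) (at v)"
  unfolding lncosh_def[abs_def] by (auto intro!: derivative_eq_intros simp: tanh_def field_simps)

lemmas DERIV_lncosh' [derivative_intros] = DERIV_chain2[OF DERIV_lncosh]

lemma DERIV_tanh: "(tanh has_real_derivative sech2 v) (at v)" for v :: real
  by (auto intro!: derivative_eq_intros simp: sech2_eq)

lemma DERIV_sech2: "(sech2 has_real_derivative (- 2 * tanh v * sech2 v)) (at v)"
  unfolding sech2_eq[abs_def] by (auto intro!: derivative_eq_intros)

lemma borel_measurable_lncosh [measurable]: "lncosh \<in> borel_measurable borel"
  by (intro borel_measurable_continuous_onI DERIV_continuous_on[OF DERIV_lncosh[THEN has_field_derivative_at_within]])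

lemma borel_measurable_tanh [measurable]: "(tanh :: real \<Rightarrow> real) \<in> borel_measurable borel"
  by (intro borel_measurable_continuous_onI DERIV_continuous_on[OF DERIV_tanh[THEN has_field_derivative_at_within]])

lemma borel_measurable_sech2 [measurable]: "sech2 \<in> borel_measurable borel"
  by (intro borel_measurable_continuous_onI DERIV_continuous_on[OF DERIV_sech2[THEN has_field_derivative_at_within]])

lemma abs_diff_le_of_deriv_bound:
  fixes f f' :: "real \<Rightarrow> real"
  assumes "\<And>x. (f has_real_derivative f' x) (at x)" and "\<And>x. \<bar>f' x\<bar> \<le> B"
  shows "\<bar>f a - f b\<bar> \<le> B * \<bar>a - b\<bar>"
  using field_differentiable_bound[of UNIV f f' B a b] assms by simp

lemma abs_lncosh_diff: "\<bar>lncosh a - lncosh b\<bar> \<le> \<bar>a - b\<bar>"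
  using abs_diff_le_of_deriv_bound[OF DERIV_lncosh abs_tanh_le_1] by simp

lemma abs_tanh_diff: "\<bar>tanh a - tanh b\<bar> \<le> \<bar>a - b\<bar>" for a b :: real
  using abs_diff_le_of_deriv_bound[OF DERIV_tanh, of 1] sech2_bounds by simp

lemma abs_sech2_diff: "\<bar>sech2 a - sech2 b\<bar> \<le> 2 * \<bar>a - b\<bar>"
proof (rule abs_diff_le_of_deriv_bound[OF DERIV_sech2])
  fix x :: real
  have "\<bar>tanh x\<bar> * sech2 x \<le> 1 * 1"
    by (intro mult_mono abs_tanh_le_1 sech2_bounds) auto
  then show "\<bar>- 2 * tanh x * sech2 x\<bar> \<le> 2" using sech2_bounds(1)[of x] by (simp add: abs_mult)
qed

lemma lncosh_bounds: "0 \<le> lncosh v" "lncosh v \<le> \<bar>v\<bar>"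
proof -
  show "0 \<le> lncosh v" by (simp add: lncosh_def cosh_real_ge_1)
  show "lncosh v \<le> \<bar>v\<bar>" using abs_lncosh_diff[of v 0] by simp
qed

text \<open>The third derivative - 2 tanh sech2 is bounded by 2, and 2 / 3! = 1 / 3.\<close>

lemma lncosh_taylor: "\<bar>lncosh (v + a) - lncosh v - a * tanh v - a\<^sup>2 / 2 * sech2 v\<bar> \<le> \<bar>a\<bar> ^ 3 / 3"
proof -
  define D where "D k t = (if k = 0 then lncosh (v + t) else if k = 1 then tanh (v + t)
      else if k = 2 then sech2 (v + t) else - 2 * tanh (v + t) * sech2 (v + t))" for k :: nat and t
  have sh: "(\<lambda>t. f (v + t)) = (\<lambda>t. f (t + v))" for f :: "real \<Rightarrow> real" by (simp add: add.commute)
  have "\<forall>m t. m < 3 \<and> \<bar>t\<bar> \<le> \<bar>a\<bar> \<longrightarrow> DERIV (D m) t :> D (Suc m) t"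
  proof (intro allI impI)
    fix m :: nat and t assume "m < 3 \<and> \<bar>t\<bar> \<le> \<bar>a\<bar>"
    then consider "m = 0" | "m = 1" | "m = 2" by linarith
    then show "DERIV (D m) t :> D (Suc m) t"
      by cases (simp_all add: D_def[abs_def] sh add.commute[of v] DERIV_shift[symmetric] DERIV_lncosh DERIV_tanh DERIV_sech2[simplified])
  qed
  from Maclaurin_bi_le[of D "\<lambda>t. lncosh (v + t)" 3 a, OF _ this]
  obtain t where t: "lncosh (v + a) = (\<Sum>m<3. D m 0 / fact m * a ^ m) + D 3 t / fact 3 * a ^ 3"
    by (auto simp: D_def fun_eq_iff)
  have "\<bar>tanh (v + t)\<bar> * sech2 (v + t) \<le> 1 * 1"
    by (intro mult_mono abs_tanh_le_1 sech2_bounds) auto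
  then have "\<bar>D 3 t\<bar> \<le> 2"
    using sech2_bounds(1)[of "v + t"] by (simp add: D_def abs_mult)
  have "\<bar>lncosh (v + a) - lncosh v - a * tanh v - a\<^sup>2 / 2 * sech2 v\<bar> = \<bar>D 3 t\<bar> / 6 * \<bar>a\<bar> ^ 3"
    unfolding t by (simp add: D_def eval_nat_numeral abs_mult power_abs)
  also have "\<dots> \<le> 2 / 6 * \<bar>a\<bar> ^ 3"
    using \<open>\<bar>D 3 t\<bar> \<le> 2\<close> by (intro mult_right_mono) auto
  finally show ?thesis by simp
qed

text \<open>As sech2 is at most 1, ln cosh lies below its tangent parabola of unit curvature; this
  one-sided bound dominates the likelihood-ratio integrand.\<close>

lemma lncosh_le_quadratic: "lncosh (v + a) \<le> lncosh v + a * tanh v + a\<^sup>2 / 2"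
proof -
  define D where "D k t = (if k = 0 then lncosh (v + t) else if k = 1 then tanh (v + t) else sech2 (v + t))" for k :: nat and t
  have sh: "(\<lambda>t. f (v + t)) = (\<lambda>t. f (t + v))" for f :: "real \<Rightarrow> real" by (simp add: add.commute)
  have "\<forall>m t. m < 2 \<and> \<bar>t\<bar> \<le> \<bar>a\<bar> \<longrightarrow> DERIV (D m) t :> D (Suc m) t"
  proof (intro allI impI)
    fix m :: nat and t assume "m < 2 \<and> \<bar>t\<bar> \<le> \<bar>a\<bar>"
    then consider "m = 0" | "m = 1" by linarith
    then show "DERIV (D m) t :> D (Suc m) t"
      by cases (simp_all add: D_def[abs_def] sh add.commute[of v] DERIV_shift[symmetric] DERIV_lncosh DERIV_tanh)
  qed
  from Maclaurin_bi_le[of D "\<lambda>t. lncosh (v + t)" 2 a, OF _ this]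
  obtain t where "lncosh (v + a) = (\<Sum>m<2. D m 0 / fact m * a ^ m) + D 2 t / fact 2 * a ^ 2"
    by (auto simp: D_def fun_eq_iff)
  then have "lncosh (v + a) = lncosh v + a * tanh v + sech2 (v + t) * (a\<^sup>2 / 2)"
    by (simp add: D_def eval_nat_numeral)
  moreover have "sech2 (v + t) * (a\<^sup>2 / 2) \<le> 1 * (a\<^sup>2 / 2)"
    by (intro mult_right_mono sech2_bounds) auto
  ultimately show ?thesis by linarith
qed

section \<open>The Curie--Weiss fixed point and its free energy\<close>

text \<open>Negative Curie-Weiss free energy per label in its Hubbard-Stratonovich form, up to ln 2;
  its critical points solve u = tanh (\<beta> u).\<close>

definition cw_kappa :: "real \<Rightarrow> real \<Rightarrow> real" where
  "cw_kappa \<beta> u = lncosh (\<beta> * u) - \<beta> * u\<^sup>2 / 2"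

lemma cw_kappa_abs: "cw_kappa \<beta> \<bar>u\<bar> = cw_kappa \<beta> u"
proof -
  have "lncosh (\<beta> * \<bar>u\<bar>) = lncosh (\<beta> * u)"
    by (metis abs_mult abs_abs lncosh_abs)
  then show ?thesis by (simp add: cw_kappa_def)
qed

locale cw_temp =
  fixes \<beta> :: real
  assumes \<beta>_gt_1: "\<beta> > 1"
begin

abbreviation m where "m \<equiv> cw_m \<beta>"

lemma \<beta>_pos: "\<beta> > 0" using \<beta>_gt_1 by simp

lemma DERIV_gap: "((\<lambda>u. tanh (\<beta> * u) - u) has_real_derivative (\<beta> * sech2 (\<beta> * u) - 1)) (at u)"
  by (auto intro!: derivative_eq_intros simp: sech2_eq)

lemma sech2_strict_antimono: "0 \<le> u \<Longrightarrow> u < v \<Longrightarrow> sech2 (\<beta> * v) < sech2 (\<beta> * u)"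
  unfolding sech2_eq using \<beta>_pos by (simp add: power_strict_mono)

text \<open>The gap tanh (\<beta> u) - u has slope \<beta> - 1 > 0 at 0 and is negative at
  1.\<close>

lemma fixed_point_exists: "\<exists>u>0. u = tanh (\<beta> * u)"
proof -
  let ?r = "\<lambda>u. tanh (\<beta> * u) - u"
  have "DERIV ?r 0 :> \<beta> * sech2 (\<beta> * 0) - 1" by (rule DERIV_gap)
  from DERIV_pos_inc_right[OF this] obtain d where d: "d > 0" "\<And>h. 0 < h \<Longrightarrow> h < d \<Longrightarrow> ?r 0 < ?r (0 + h)"
    using \<beta>_gt_1 by (auto simp: sech2_def)
  define a where "a = min (d / 2) (1 / 2)"
  have a: "0 < a" "a < d" "a \<le> 1" using d(1) by (auto simp: a_def)
  have "?r a > 0" using d(2)[OF a(1,2)] by simp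
  moreover have "?r 1 < 0" using tanh_real_lt_1[of \<beta>] by simp
  moreover have "continuous_on {a..1} ?r"
    by (rule DERIV_continuous_on[OF DERIV_gap[THEN has_field_derivative_at_within]])
  ultimately obtain u where "a \<le> u" "u \<le> 1" "?r u = 0"
    using IVT2'[of ?r 1 0 a] a(3) by auto
  then show ?thesis using a(1) by (intro exI[of _ u]) auto
qed

text \<open>On the positive axis the slope of the gap is strictly decreasing. By Rolle it vanishes
  at some z below u, so the gap rises from 0 up to z and falls afterwards; this gives its sign on
  both sides of u, hence uniqueness of the positive zero.\<close>

lemma fixed_point_shape:
  assumes "u > 0" "u = tanh (\<beta> * u)"
  obtains p where "0 < p" "p < u" "\<beta> * sech2 (\<beta> * p) < 1"
    "\<And>v. 0 < v \<Longrightarrow> v < u \<Longrightarrow> v < tanh (\<beta> * v)" "\<And>v. u < v \<Longrightarrow> tanh (\<beta> * v) < v"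
proof -
  let ?r = "\<lambda>u. tanh (\<beta> * u) - u"
  obtain z where z: "0 < z" "z < u" "\<beta> * sech2 (\<beta> * z) - 1 = 0"
    using Rolle_deriv[of 0 u ?r "\<lambda>x h. (\<beta> * sech2 (\<beta> * x) - 1) * h"] assms
      DERIV_continuous_on[OF DERIV_gap[THEN has_field_derivative_at_within], of "{0..u}"]
      DERIV_gap[unfolded has_field_derivative_def]
    by (auto simp: fun_eq_iff)
  have neg: "\<beta> * sech2 (\<beta> * v) < 1" if "v > z" for v
    using sech2_strict_antimono[of z v] z that mult_strict_left_mono[of "sech2 (\<beta> * v)" "sech2 (\<beta> * z)" \<beta>] \<beta>_pos by linarith
  have pos: "\<beta> * sech2 (\<beta> * v) > 1" if "0 \<le> v" "v < z" for v
    using sech2_strict_antimono[of v z] z that mult_strict_left_mono[of "sech2 (\<beta> * z)" "sech2 (\<beta> * v)" \<beta>] \<beta>_pos by linarith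
  have dec: "?r b < ?r a" if "z \<le> a" "a < b" for a b
  proof (rule DERIV_neg_imp_decreasing_open[OF that(2)])
    show "\<exists>y. DERIV ?r x :> y \<and> y < 0" if "a < x" "x < b" for x
      using DERIV_gap[of x] neg[of x] that \<open>z \<le> a\<close> by (intro exI conjI) auto
    show "continuous_on {a..b} ?r" by (rule DERIV_continuous_on[OF DERIV_gap[THEN has_field_derivative_at_within]])
  qed
  have inc: "?r a < ?r b" if "0 \<le> a" "a < b" "b \<le> z" for a b
  proof (rule DERIV_pos_imp_increasing_open[OF that(2)])
    show "\<exists>y. DERIV ?r x :> y \<and> y > 0" if "a < x" "x < b" for x
      using DERIV_gap[of x] pos[of x] that \<open>0 \<le> a\<close> \<open>b \<le> z\<close> by (intro exI conjI) auto
    show "continuous_on {a..b} ?r" by (rule DERIV_continuous_on[OF DERIV_gap[THEN has_field_derivative_at_within]])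
  qed
  show thesis
  \<comment> \<open>A point strictly beyond z: at z the product \<beta> sech2 equals 1, past it the
    inequality is strict.\<close>
  proof (rule that[of "(z + u) / 2"])
    show "v < tanh (\<beta> * v)" if "0 < v" "v < u" for v
    proof (cases "v \<le> z")
      case True then show ?thesis using inc[of 0 v] that by simp
    next
      case False then show ?thesis using dec[of v u] that assms by simp
    qed
    show "tanh (\<beta> * v) < v" if "u < v" for v
      using dec[of u v] that assms z by simp
    show "\<beta> * sech2 (\<beta> * ((z + u) / 2)) < 1" using neg[of "(z + u) / 2"] z by simp
  qed (use z in auto)
qed

lemma m_pos: "m > 0" and m_fixed: "tanh (\<beta> * m) = m"
proof -
  obtain u where u: "u > 0" "u = tanh (\<beta> * u)" using fixed_point_exists by blast
  have "cw_m \<beta> = u" unfolding cw_m_def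
  proof (rule the_equality)
    fix v assume v: "v > 0 \<and> v = tanh (\<beta> * v)"
    from fixed_point_shape[OF u] v show "v = u" by (metis linorder_neqE_linordered_idom less_irrefl)
  qed (use u in auto)
  then show "m > 0" "tanh (\<beta> * m) = m" using u by auto
qed

lemma m_lt_1: "m < 1"
  using tanh_real_lt_1[of "\<beta> * m"] m_fixed by simp

lemma DERIV_kappa: "(cw_kappa \<beta> has_real_derivative \<beta> * (tanh (\<beta> * u) - u)) (at u)"
  unfolding cw_kappa_def[abs_def] by (auto intro!: derivative_eq_intros simp: field_simps)

text \<open>Past \<open>p\<close> the gap falls at rate at least a, so the derivative of kappa
  dominates a linear restoring force towards m and kappa loses a quadratic amount. Below
  \<open>p\<close> kappa is increasing, so its value at \<open>p\<close> suffices. The last claim, a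
  slope below 1 at m, is the source of \<open>gamma11_pos\<close>.\<close>

lemma kappa_gap:
  obtains c where "c > 0" "\<And>u. u \<ge> 0 \<Longrightarrow> cw_kappa \<beta> m - cw_kappa \<beta> u \<ge> c * (u - m)\<^sup>2"
    and "\<beta> * (1 - m\<^sup>2) < 1"
proof -
  obtain p where p: "0 < p" "p < m" "\<beta> * sech2 (\<beta> * p) < 1"
    and above: "\<And>v. 0 < v \<Longrightarrow> v < m \<Longrightarrow> v < tanh (\<beta> * v)"
    using fixed_point_shape[OF m_pos] m_fixed by metis
  define a where "a = 1 - \<beta> * sech2 (\<beta> * p)"
  have a: "a > 0" using p(3) by (simp add: a_def)
  define c where "c = \<beta> * a / 2"
  have c: "c > 0" using a \<beta>_pos by (simp add: c_def)
  have slope: "\<beta> * sech2 (\<beta> * v) - 1 \<le> - a" if "v \<ge> p" for v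
  proof (cases "v = p")
    case False
    then show ?thesis using sech2_strict_antimono[of p v] p that \<beta>_pos unfolding a_def by simp
  qed (simp add: a_def)
  \<comment> \<open>Adding a y compensates a slope of at most - a; comparison with the zero at m
    then yields the linear force on both sides of m.\<close>
  have lin: "tanh (\<beta> * y) - y + a * y \<le> tanh (\<beta> * x) - x + a * x" if "p \<le> x" "x \<le> y" for x y
  proof (rule DERIV_nonpos_imp_nonincreasing[OF that(2)])
    show "\<exists>z. DERIV (\<lambda>u. tanh (\<beta> * u) - u + a * u) v :> z \<and> z \<le> 0" if "x \<le> v" "v \<le> y" for v
      using slope[of v] that \<open>p \<le> x\<close>
      by (intro exI[of _ "\<beta> * sech2 (\<beta> * v) - 1 + a"] conjI DERIV_add DERIV_gap)
         (auto intro!: derivative_eq_intros)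
  qed
  let ?D = "\<lambda>u. cw_kappa \<beta> u + c * (u - m)\<^sup>2"
  have D: "DERIV ?D u :> \<beta> * (tanh (\<beta> * u) - u + a * (u - m))" for u
    unfolding c_def by (auto intro!: derivative_eq_intros DERIV_kappa simp: field_simps)
  have near: "cw_kappa \<beta> m - cw_kappa \<beta> u \<ge> c * (u - m)\<^sup>2" if "u \<ge> p" for u
  proof (cases "u \<le> m")
    case True
    have "?D u \<le> ?D m"
    proof (rule DERIV_nonneg_imp_nondecreasing[where f="?D", OF True])
      show "\<exists>y. DERIV ?D v :> y \<and> y \<ge> 0" if "u \<le> v" "v \<le> m" for v
      proof -
        have "0 \<le> tanh (\<beta> * v) - v + a * (v - m)"
          using lin[of v m] that \<open>u \<ge> p\<close> m_fixed by (simp add: algebra_simps)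
        then have "0 \<le> \<beta> * (tanh (\<beta> * v) - v + a * (v - m))" using \<beta>_pos by simp
        with D[of v] show ?thesis by blast
      qed
    qed
    then show ?thesis by simp
  next
    case False
    then have "m \<le> u" by simp
    then have "?D u \<le> ?D m"
    proof (rule DERIV_nonpos_imp_nonincreasing[where f="?D"])
      show "\<exists>y. DERIV ?D v :> y \<and> y \<le> 0" if "m \<le> v" "v \<le> u" for v
      proof -
        have "tanh (\<beta> * v) - v + a * (v - m) \<le> 0"
          using lin[of m v] that p m_fixed by (simp add: algebra_simps)
        then have "\<beta> * (tanh (\<beta> * v) - v + a * (v - m)) \<le> 0" using \<beta>_pos by (simp add: mult_le_0_iff)
        with D[of v] show ?thesis by blast
      qed
    qed
    then show ?thesis by simp
  qed
  \<comment> \<open>For u in [0, p) the squared distance to m is at most m^2, while the bound at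
    \<open>p\<close> is c (m - p)^2; \<open>q\<close> is the quotient of the two squares.\<close>
  define q where "q = ((m - p) / m)\<^sup>2"
  have q: "0 < q" "q \<le> 1" using p m_pos by (auto simp: q_def power_le_one)
  have "cw_kappa \<beta> m - cw_kappa \<beta> u \<ge> c * q * (u - m)\<^sup>2" if "u \<ge> 0" for u
  proof (cases "u \<ge> p")
    case True
    have "c * q * (u - m)\<^sup>2 \<le> c * 1 * (u - m)\<^sup>2"
      using c q by (intro mult_right_mono mult_left_mono) auto
    then show ?thesis using near[OF True] by simp
  next
    case False
    have "cw_kappa \<beta> u \<le> cw_kappa \<beta> p"
    proof (rule DERIV_nonneg_imp_nondecreasing[where f="cw_kappa \<beta>"])
      show "\<exists>y. DERIV (cw_kappa \<beta>) v :> y \<and> y \<ge> 0" if "u \<le> v" "v \<le> p" for v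
      proof (cases "v = 0")
        case True then show ?thesis using DERIV_kappa[of v] by (intro exI[of _ 0]) simp
      next
        case False
        then have "v < tanh (\<beta> * v)" using that \<open>u \<ge> 0\<close> p by (intro above) auto
        then show ?thesis using DERIV_kappa[of v] \<beta>_pos by (intro exI conjI) auto
      qed
    qed (use False in simp)
    moreover have "c * q * (u - m)\<^sup>2 \<le> c * q * m\<^sup>2"
      using c q that False p by (intro mult_left_mono) (auto simp flip: abs_le_square_iff)
    moreover have "c * q * m\<^sup>2 = c * (p - m)\<^sup>2"
      using m_pos by (simp add: q_def power_divide power2_commute)
    ultimately show ?thesis using near[of p] by simp
  qed
  moreover have "\<beta> * (1 - m\<^sup>2) < 1"
    using slope[of m] p a m_fixed by (simp add: sech2_eq)
  ultimately show thesis using that[of "c * q"] c q by simp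
qed

end

section \<open>The label space and concentration of the Curie-Weiss prior\<close>

lemma labels_abs_1: "z \<in> labels n \<Longrightarrow> i < n \<Longrightarrow> z i = 1 \<or> z i = -1"
  by (auto simp: labels_def PiE_def Pi_def)

lemma finite_labels [simp]: "finite (labels n)"
  by (simp add: labels_def finite_PiE)

lemma labels_nonempty: "labels n \<noteq> {}"
  by (simp add: labels_def PiE_eq_empty_iff)

text \<open>Distributivity over the n coordinates; the reason why linearising the square of the
  label mean makes posterior sums computable.\<close>

lemma sum_labels_prod:
  fixes f :: "nat \<Rightarrow> real \<Rightarrow> 'a::comm_semiring_1"
  shows "(\<Sum>z\<in>labels n. \<Prod>i<n. f i (z i)) = (\<Prod>i<n. f i 1 + f i (-1))"
  unfolding labels_def by (subst prod_sum_PiE[symmetric]) (auto simp: add.commute)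

lemma sum_labels_exp: "(\<Sum>z\<in>labels n. exp (a * (\<Sum>i<n. z i))) = (2 * cosh a) ^ n" for a :: real
  using sum_labels_prod[of "\<lambda>_ w. exp (a * w)" n]
  by (simp add: exp_sum[symmetric] sum_distrib_left cosh_field_def add_divide_distrib)

lemma zbar_bounds:
  assumes "z \<in> labels n" shows "\<bar>zbar n z\<bar> \<le> 1"
proof -
  have "\<bar>\<Sum>i<n. z i\<bar> \<le> (\<Sum>i<n. 1)"
    by (rule order_trans[OF sum_abs sum_mono]) (use labels_abs_1[OF assms] in fastforce)
  then show ?thesis by (cases "n = 0") (simp_all add: zbar_def)
qed

text \<open>Label sums are 2 k - n with k the number of positive labels. With only linearly many
  levels, a union over levels cannot defeat an exponential bound.\<close>

lemma card_zbar_image: "card (zbar n ` labels n) \<le> n + 1"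
proof -
  have "zbar n ` labels n \<subseteq> (\<lambda>k. (2 * real k - real n) / real n) ` {..n}"
  proof safe
    fix z assume z: "z \<in> labels n"
    let ?P = "{i. i < n \<and> z i = 1}"
    have "(\<Sum>i<n. z i) = (\<Sum>i<n. 2 * (if z i = 1 then 1 else 0) - 1)"
      by (rule sum.cong) (use labels_abs_1[OF z] in auto)
    also have "\<dots> = 2 * real (card ?P) - real n"
      by (simp add: sum_subtractf sum_distrib_left[symmetric] sum.If_cases Int_def)
    finally have "zbar n z = (2 * real (card ?P) - real n) / real n" by (simp add: zbar_def)
    moreover have "card ?P \<le> n" using card_mono[of "{..<n}" ?P] by auto
    ultimately show "zbar n z \<in> (\<lambda>k. (2 * real k - real n) / real n) ` {..n}" by blast
  qed
  then have "card (zbar n ` labels n) \<le> card ((\<lambda>k. (2 * real k - real n) / real n) ` {..n})"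
    by (rule card_mono[rotated]) simp
  also have "\<dots> \<le> n + 1" using card_image_le[of "{..n}"] by simp
  finally show ?thesis .
qed

lemma cw_weight_sum_pos: "(\<Sum>w\<in>labels n. cw_weight n \<beta>' w) > 0"
  by (rule sum_pos) (auto simp: labels_nonempty cw_weight_def)

lemma cw_prior_nonneg: "cw_prior n \<beta>' z \<ge> 0"
  unfolding cw_prior_def using cw_weight_sum_pos by (intro divide_nonneg_pos) (auto simp: cw_weight_def)

lemma cw_prior_sum: "(\<Sum>z\<in>labels n. cw_prior n \<beta>' z) = 1"
  unfolding cw_prior_def sum_divide_distrib[symmetric] using cw_weight_sum_pos[of n \<beta>'] by simp

context cw_temp
begin

text \<open>The normaliser is bounded below by tilting with slope \<open>m\<close>, the weight of a level set of the
  mean above by tilting with the slope of that level; no integral transform is needed.\<close>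
lemma cw_prior_level_le:
  assumes n: "n > 0"
  shows "(\<Sum>z\<in>{z\<in>labels n. zbar n z = a}. cw_prior n \<beta> z) \<le> exp (- real n * (cw_kappa \<beta> m - cw_kappa \<beta> a))"
proof -
  have tilt: "(\<Sum>z\<in>labels n. exp (real n * \<beta> * (b * zbar n z - b\<^sup>2 / 2))) = 2 ^ n * exp (real n * cw_kappa \<beta> b)" for b
  proof -
    have "(\<Sum>z\<in>labels n. exp (real n * \<beta> * (b * zbar n z - b\<^sup>2 / 2)))
        = exp (- real n * \<beta> * b\<^sup>2 / 2) * (\<Sum>z\<in>labels n. exp (\<beta> * b * (\<Sum>i<n. z i)))"
      unfolding sum_distrib_left
      by (rule sum.cong) (use n in \<open>simp_all add: mult_exp_exp zbar_def field_simps sum_distrib_left\<close>)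
    also have "\<dots> = exp (- real n * \<beta> * b\<^sup>2 / 2) * (2 ^ n * exp (real n * lncosh (\<beta> * b)))"
      by (simp add: sum_labels_exp power_mult_distrib exp_of_nat_mult)
    also have "\<dots> = 2 ^ n * exp (real n * cw_kappa \<beta> b)"
      by (simp add: mult.left_commute mult_exp_exp cw_kappa_def algebra_simps)
    finally show ?thesis .
  qed
  \<comment> \<open>On the level the tilted exponent with slope a equals a^2 / 2 exactly, and
    extending the sum to all labels only increases it.\<close>
  have num: "(\<Sum>z\<in>{z\<in>labels n. zbar n z = a}. cw_weight n \<beta> z) \<le> 2 ^ n * exp (real n * cw_kappa \<beta> a)"
  proof -
    have "(\<Sum>z\<in>{z\<in>labels n. zbar n z = a}. cw_weight n \<beta> z)
      = (\<Sum>z\<in>{z\<in>labels n. zbar n z = a}. exp (real n * \<beta> * (a * zbar n z - a\<^sup>2 / 2)))"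
      by (rule sum.cong) (auto simp: cw_weight_def power2_eq_square)
    also have "\<dots> \<le> (\<Sum>z\<in>labels n. exp (real n * \<beta> * (a * zbar n z - a\<^sup>2 / 2)))"
      by (rule sum_mono2) auto
    finally show ?thesis unfolding tilt .
  qed
  have den: "2 ^ n * exp (real n * cw_kappa \<beta> m) \<le> (\<Sum>z\<in>labels n. cw_weight n \<beta> z)"
    unfolding tilt[symmetric]
  proof (rule sum_mono)
    fix z
    have "m * zbar n z - m\<^sup>2 / 2 \<le> (zbar n z)\<^sup>2 / 2"
      using zero_le_power2[of "zbar n z - m"] unfolding power2_diff by (simp add: algebra_simps)
    then have "real n * \<beta> * (m * zbar n z - m\<^sup>2 / 2) \<le> real n * \<beta> * ((zbar n z)\<^sup>2 / 2)"
      using \<beta>_pos by (intro mult_left_mono) auto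
    then show "exp (real n * \<beta> * (m * zbar n z - m\<^sup>2 / 2)) \<le> cw_weight n \<beta> z"
      by (simp add: cw_weight_def)
  qed
  have "(\<Sum>z\<in>{z\<in>labels n. zbar n z = a}. cw_prior n \<beta> z) \<le> 2 ^ n * exp (real n * cw_kappa \<beta> a) / (2 ^ n * exp (real n * cw_kappa \<beta> m))"
    unfolding cw_prior_def sum_divide_distrib[symmetric] by (intro frac_le num den) auto
  also have "\<dots> = exp (- real n * (cw_kappa \<beta> m - cw_kappa \<beta> a))"
    by (simp add: exp_diff[symmetric] algebra_simps)
  finally show ?thesis .
qed

text \<open>Levels with squared distance at most \<delta> contribute at most \<delta>; each of the
  at most n + 1 others has weight at most exp (- c \<delta> n) by \<open>kappa_gap\<close>. The
  absolute value appears because the prior cannot tell m from - m.\<close>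

lemma cw_prior_concentrates: "(\<lambda>n. \<Sum>z\<in>labels n. cw_prior n \<beta> z * (\<bar>zbar n z\<bar> - m)\<^sup>2) \<longlonglongrightarrow> 0"
proof (rule LIMSEQ_approxI)
  fix \<delta> :: real assume \<delta>: "\<delta> > 0"
  obtain c where c: "c > 0" "\<And>u. u \<ge> 0 \<Longrightarrow> cw_kappa \<beta> m - cw_kappa \<beta> u \<ge> c * (u - m)\<^sup>2"
    using kappa_gap by metis
  define y where "y = exp (- c * \<delta>)"
  have y: "0 < y" "y < 1" using c \<delta> by (auto simp: y_def)
  \<comment> \<open>The sum lies between 0 and \<delta> plus the tail (n + 1) y^n. Measured from the
    tail, it is within \<delta> as soon as the tail is at most \<delta>.\<close>
  have bound: "norm ((\<Sum>z\<in>labels n. cw_prior n \<beta> z * (\<bar>zbar n z\<bar> - m)\<^sup>2) - (real n * y ^ n + y ^ n)) \<le> \<delta>" if n: "n > 0" and small: "real n * y ^ n + y ^ n \<le> \<delta>" for n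
  proof -
    let ?A = "zbar n ` labels n"
    have A1: "(\<bar>a\<bar> - m)\<^sup>2 \<le> 1" if "a \<in> ?A" for a
    proof -
      have "\<bar>a\<bar> \<le> 1" using that zbar_bounds by auto
      then have "\<bar>\<bar>a\<bar> - m\<bar> \<le> 1" using m_pos m_lt_1 by linarith
      then show ?thesis by (simp add: abs_square_le_1)
    qed
    let ?p = "\<lambda>a. \<Sum>z\<in>{z\<in>labels n. zbar n z = a}. cw_prior n \<beta> z"
    have p0: "?p a \<ge> 0" for a by (intro sum_nonneg cw_prior_nonneg)
    have "(\<Sum>z\<in>labels n. cw_prior n \<beta> z * (\<bar>zbar n z\<bar> - m)\<^sup>2) = (\<Sum>a\<in>?A. \<Sum>z\<in>{z\<in>labels n. zbar n z = a}. cw_prior n \<beta> z * (\<bar>zbar n z\<bar> - m)\<^sup>2)"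
      by (rule sum.image_gen) simp
    also have "\<dots> = (\<Sum>a\<in>?A. ?p a * (\<bar>a\<bar> - m)\<^sup>2)"
      unfolding sum_distrib_right by (intro sum.cong) auto
    also have "\<dots> \<le> (\<Sum>a\<in>?A. \<delta> * ?p a + y ^ n)"
    proof (rule sum_mono)
      fix a assume a: "a \<in> ?A"
      show "?p a * (\<bar>a\<bar> - m)\<^sup>2 \<le> \<delta> * ?p a + y ^ n"
      proof (cases "(\<bar>a\<bar> - m)\<^sup>2 \<le> \<delta>")
        case True
        then have "?p a * (\<bar>a\<bar> - m)\<^sup>2 \<le> ?p a * \<delta>" by (intro mult_left_mono p0)
        then show ?thesis using y by (simp add: mult.commute add_increasing2)
      next
        case False
        have "?p a \<le> exp (- real n * (cw_kappa \<beta> m - cw_kappa \<beta> a))" by (rule cw_prior_level_le[OF n])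
        also have "\<dots> \<le> exp (- real n * (c * \<delta>))"
        proof -
          have "c * \<delta> \<le> c * (\<bar>a\<bar> - m)\<^sup>2" using c(1) False by (intro mult_left_mono) auto
          also have "\<dots> \<le> cw_kappa \<beta> m - cw_kappa \<beta> a" using c(2)[of "\<bar>a\<bar>"] by (simp add: cw_kappa_abs)
          finally show ?thesis by (simp add: mult_left_mono)
        qed
        also have "\<dots> = y ^ n" by (simp add: y_def exp_of_nat_mult[symmetric] mult_ac)
        finally have "?p a * (\<bar>a\<bar> - m)\<^sup>2 \<le> y ^ n * 1" using p0 A1[OF a] y by (intro mult_mono) auto
        then show ?thesis using p0[of a] \<delta> by (simp add: add_increasing)
      qed
    qed
    also have "\<dots> = \<delta> * (\<Sum>a\<in>?A. ?p a) + real (card ?A) * y ^ n"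
      by (simp add: sum.distrib sum_distrib_left)
    also have "(\<Sum>a\<in>?A. ?p a) = 1"
      using sum.image_gen[of "labels n" "cw_prior n \<beta>" "zbar n"] cw_prior_sum[of n \<beta>] by simp
    also have "real (card ?A) * y ^ n \<le> (real n + 1) * y ^ n"
      using card_zbar_image[of n] y by (intro mult_right_mono) auto
    finally have "(\<Sum>z\<in>labels n. cw_prior n \<beta> z * (\<bar>zbar n z\<bar> - m)\<^sup>2) \<le> \<delta> + (real n * y ^ n + y ^ n)"
      by (simp add: algebra_simps)
    moreover have "(\<Sum>z\<in>labels n. cw_prior n \<beta> z * (\<bar>zbar n z\<bar> - m)\<^sup>2) \<ge> 0"
      by (intro sum_nonneg mult_nonneg_nonneg cw_prior_nonneg) auto
    ultimately show ?thesis using small by simp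
  qed
  have lim: "(\<lambda>n. real n * y ^ n + y ^ n) \<longlonglongrightarrow> 0"
    using tendsto_add[OF powser_times_n_limit_0[of y] LIMSEQ_power_zero[of y]] y by simp
  from order_tendstoD(2)[OF lim \<delta>] eventually_gt_at_top[of 0]
  have "\<forall>\<^sub>F n in sequentially. norm ((\<Sum>z\<in>labels n. cw_prior n \<beta> z * (\<bar>zbar n z\<bar> - m)\<^sup>2) - (real n * y ^ n + y ^ n)) \<le> \<delta>"
    by eventually_elim (rule bound, simp_all)
  then show "\<exists>a b. a \<longlonglongrightarrow> b \<and> (\<forall>\<^sub>F n in sequentially. norm ((\<Sum>z\<in>labels n. cw_prior n \<beta> z * (\<bar>zbar n z\<bar> - m)\<^sup>2) - a n) \<le> \<delta>) \<and> norm (0 - b) \<le> \<delta>"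
    using lim \<delta> by (intro exI conjI) auto
qed

end

section \<open>Laws of the data\<close>

text \<open>Growth up to a multiple of exp (norm x) covers powers of the norm and ln cosh of affine
  functions, while functions of this class and their squares are integrable under every shifted
  normal law; so one Chebyshev argument serves all tests.\<close>

definition exp_bounded :: "(real^'d \<Rightarrow> 'b::real_normed_vector) \<Rightarrow> bool" where
  "exp_bounded F \<longleftrightarrow> F \<in> borel_measurable borel \<and> (\<exists>C. \<forall>x. norm (F x) \<le> C * exp (norm x))"

lemma exp_boundedI: "F \<in> borel_measurable borel \<Longrightarrow> (\<And>x. norm (F x) \<le> C * exp (norm x)) \<Longrightarrow> exp_bounded F"
  by (auto simp: exp_bounded_def)

lemma exp_bounded_measurable: "exp_bounded F \<Longrightarrow> F \<in> borel_measurable borel"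
  by (simp add: exp_bounded_def)

lemma integrable_gauss_at_exp_bounded:
  fixes F :: "real^'d \<Rightarrow> 'b::{banach, second_countable_topology}"
  assumes "exp_bounded F" shows "integrable (gauss_at \<theta>) F"
proof -
  obtain C where C: "\<And>x. norm (F x) \<le> C * exp (norm x)" using assms by (auto simp: exp_bounded_def)
  have [measurable]: "F \<in> borel_measurable borel" using assms by (rule exp_bounded_measurable)
  show ?thesis
  proof (rule Bochner_Integration.integrable_bound)
    show "integrable (gauss_at \<theta>) (\<lambda>x. C * exp (1 * norm x))"
      by (intro integrable_mult_right integrable_gauss_at_exp_norm)
    show "AE x in gauss_at \<theta>. norm (F x) \<le> norm (C * exp (1 * norm x))"
      using C by (intro AE_I2) (auto intro: order_trans[OF _ abs_ge_self])
  qed measurable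
qed

lemma integrable_gauss_at_exp_bounded_square:
  fixes F :: "real^'d \<Rightarrow> real"
  assumes "exp_bounded F" shows "integrable (gauss_at \<theta>) (\<lambda>x. (F x)\<^sup>2)"
proof -
  obtain C where C: "\<And>x. norm (F x) \<le> C * exp (norm x)" using assms by (auto simp: exp_bounded_def)
  have [measurable]: "F \<in> borel_measurable borel" using assms by (simp add: exp_bounded_def)
  show ?thesis
  proof (rule Bochner_Integration.integrable_bound)
    show "integrable (gauss_at \<theta>) (\<lambda>x. C\<^sup>2 * exp (2 * norm x))"
      by (intro integrable_mult_right integrable_gauss_at_exp_norm)
    have "\<bar>F x\<bar>\<^sup>2 \<le> (C * exp (norm x))\<^sup>2" for x using C[of x] by (intro power_mono) auto
    then show "AE x in gauss_at \<theta>. norm ((F x)\<^sup>2) \<le> norm (C\<^sup>2 * exp (2 * norm x))"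
      by (intro AE_I2) (simp add: power_mult_distrib exp_double)
  qed measurable
qed

text \<open>Checked on rectangles, where Tonelli factors the integral. It identifies each summand of
  \<open>cw_dens\<close> as a density of independent shifted normals.\<close>

lemma PiM_gauss_at:
  "PiM {..<n} (\<lambda>i. gauss_at (a i)) = density (PiM {..<n} (\<lambda>_. lborel)) (\<lambda>x. ennreal (\<Prod>i<n. gauss_dens (x i - a i)))"
  for a :: "nat \<Rightarrow> real^'d"
proof -
  interpret G: product_prob_space "\<lambda>i. gauss_at (a i)"
    by (simp add: product_prob_space_def product_prob_space_axioms_def prob_space_gauss_at product_sigma_finite_def
        prob_space_imp_sigma_finite)
  interpret L: product_sigma_finite "\<lambda>_::nat. lborel :: (real^'d) measure" ..
  have "density (PiM {..<n} (\<lambda>_. lborel)) (\<lambda>x. ennreal (\<Prod>i<n. gauss_dens (x i - a i))) = PiM {..<n} (\<lambda>i. gauss_at (a i))"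
  proof (rule G.PiM_eqI)
    show "sets (density (PiM {..<n} (\<lambda>_. lborel)) (\<lambda>x. ennreal (\<Prod>i<n. gauss_dens (x i - a i)))) = sets (PiM {..<n} (\<lambda>i. gauss_at (a i)))"
      by (simp cong: sets_PiM_cong)
    fix A :: "nat \<Rightarrow> (real^'d) set" assume A: "\<And>i. i \<in> {..<n} \<Longrightarrow> A i \<in> sets (gauss_at (a i))"
    then have [measurable]: "i < n \<Longrightarrow> A i \<in> sets borel" for i by simp
    have "emeasure (density (PiM {..<n} (\<lambda>_. lborel)) (\<lambda>x. ennreal (\<Prod>i<n. gauss_dens (x i - a i)))) (Pi\<^sub>E {..<n} A)
      = (\<integral>\<^sup>+x. ennreal (\<Prod>i<n. gauss_dens (x i - a i)) * indicator (Pi\<^sub>E {..<n} A) x \<partial>PiM {..<n} (\<lambda>_. lborel))"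
      by (rule emeasure_density) (auto intro!: sets_PiM_I_finite)
    also have "\<dots> = (\<integral>\<^sup>+x. (\<Prod>i<n. ennreal (gauss_dens (x i - a i)) * indicator (A i) (x i)) \<partial>PiM {..<n} (\<lambda>_. lborel))"
    proof (rule nn_integral_cong)
      fix x :: "nat \<Rightarrow> real^'d" assume x: "x \<in> space (PiM {..<n} (\<lambda>_. lborel))"
      show "ennreal (\<Prod>i<n. gauss_dens (x i - a i)) * indicator (Pi\<^sub>E {..<n} A) x = (\<Prod>i<n. ennreal (gauss_dens (x i - a i)) * indicator (A i) (x i))"
      proof (cases "x \<in> Pi\<^sub>E {..<n} A")
        case True
        then show ?thesis by (auto simp: prod_ennreal[symmetric] PiE_iff intro!: prod.cong)
      next
        case False
        then obtain i where "i < n" "x i \<notin> A i" using x by (auto simp: space_PiM PiE_iff)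
        then have "(\<Prod>i<n. ennreal (gauss_dens (x i - a i)) * indicator (A i) (x i)) = 0"
          by (intro prod_zero) (auto intro!: bexI[of _ i])
        then show ?thesis using False by simp
      qed
    qed
    also have "\<dots> = (\<Prod>i<n. \<integral>\<^sup>+x. ennreal (gauss_dens (x - a i)) * indicator (A i) x \<partial>lborel)"
      by (rule L.product_nn_integral_prod) auto
    also have "\<dots> = (\<Prod>i<n. emeasure (gauss_at (a i)) (A i))"
      unfolding gauss_at_def by (intro prod.cong refl emeasure_density[symmetric]) auto
    finally show "emeasure (density (PiM {..<n} (\<lambda>_. lborel)) (\<lambda>x. ennreal (\<Prod>i<n. gauss_dens (x i - a i)))) (Pi\<^sub>E {..<n} A) = (\<Prod>i<n. emeasure (gauss_at (a i)) (A i))" .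
  qed simp
  then show ?thesis ..
qed

definition data_law :: "nat \<Rightarrow> (nat \<Rightarrow> real^'d) \<Rightarrow> (nat \<Rightarrow> real^'d) measure" where
  "data_law n a = PiM {..<n} (\<lambda>i. gauss_at (a i))"

lemma product_prob_space_gauss_at: "product_prob_space (\<lambda>i. gauss_at (a i))" for a :: "'i \<Rightarrow> real^'d"
  by (simp add: product_prob_space_def product_prob_space_axioms_def prob_space_gauss_at product_sigma_finite_def
        prob_space_imp_sigma_finite)

lemma prob_space_data_law: "prob_space (data_law n a)"
  unfolding data_law_def by (intro prob_space_PiM prob_space_gauss_at)

lemma sets_data_law [simp, measurable_cong]: "sets (data_law n a) = sets (PiM {..<n} (\<lambda>_. borel))"
  unfolding data_law_def by (intro sets_PiM_cong) auto

lemma sets_sample_space [simp, measurable_cong]: "sets (sample_space n) = sets (PiM {..<n} (\<lambda>_. borel))"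
  unfolding sample_space_def by (intro sets_PiM_cong) auto

lemma sets_cw_law [simp, measurable_cong]: "sets (cw_law n \<theta> \<beta>) = sets (PiM {..<n} (\<lambda>_. borel))"
  by (simp add: cw_law_def)

lemma data_law_density: "data_law n a = density (sample_space n) (\<lambda>x. ennreal (\<Prod>i<n. gauss_dens (x i - a i)))"
  unfolding data_law_def sample_space_def by (rule PiM_gauss_at)

text \<open>The density is a finite mixture over label vectors, and expectations inherit the
  mixture; this reduces dependent data to independent data with fixed labels.\<close>

lemma integral_cw_law:
  fixes \<phi> :: "(nat \<Rightarrow> real^'d) \<Rightarrow> 'b::{banach, second_countable_topology}"
  assumes [measurable]: "\<phi> \<in> borel_measurable (PiM {..<n} (\<lambda>_. borel))"
    and "\<And>z. z \<in> labels n \<Longrightarrow> integrable (data_law n (\<lambda>i. z i *\<^sub>R \<theta>)) \<phi>"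
  shows "integrable (cw_law n \<theta> \<beta>) \<phi>"
    and "(\<integral>x. \<phi> x \<partial>cw_law n \<theta> \<beta>) = (\<Sum>z\<in>labels n. cw_prior n \<beta> z *\<^sub>R (\<integral>x. \<phi> x \<partial>data_law n (\<lambda>i. z i *\<^sub>R \<theta>)))"
proof -
  have dens_nn: "cw_dens n \<theta> \<beta> x \<ge> 0" for x
    unfolding cw_dens_def by (intro sum_nonneg mult_nonneg_nonneg cw_prior_nonneg prod_nonneg) auto
  have [measurable]: "cw_dens n \<theta> \<beta> \<in> borel_measurable (PiM {..<n} (\<lambda>_. borel))"
    unfolding cw_dens_def by measurable
  have i: "integrable (sample_space n) (\<lambda>x. (\<Prod>i<n. gauss_dens (x i - z i *\<^sub>R \<theta>)) *\<^sub>R \<phi> x)"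
    and e: "(\<integral>x. \<phi> x \<partial>data_law n (\<lambda>i. z i *\<^sub>R \<theta>)) = (\<integral>x. (\<Prod>i<n. gauss_dens (x i - z i *\<^sub>R \<theta>)) *\<^sub>R \<phi> x \<partial>sample_space n)"
    if "z \<in> labels n" for z
  proof -
    show "integrable (sample_space n) (\<lambda>x. (\<Prod>i<n. gauss_dens (x i - z i *\<^sub>R \<theta>)) *\<^sub>R \<phi> x)"
      using assms(2)[OF that] unfolding data_law_density
      by (subst (asm) integrable_density) (auto intro!: prod_nonneg)
    show "(\<integral>x. \<phi> x \<partial>data_law n (\<lambda>i. z i *\<^sub>R \<theta>)) = (\<integral>x. (\<Prod>i<n. gauss_dens (x i - z i *\<^sub>R \<theta>)) *\<^sub>R \<phi> x \<partial>sample_space n)"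
      unfolding data_law_density by (subst integral_density) (auto intro!: prod_nonneg)
  qed
  have d: "cw_dens n \<theta> \<beta> x *\<^sub>R \<phi> x = (\<Sum>z\<in>labels n. cw_prior n \<beta> z *\<^sub>R ((\<Prod>i<n. gauss_dens (x i - z i *\<^sub>R \<theta>)) *\<^sub>R \<phi> x))" for x
    unfolding cw_dens_def by (simp add: scaleR_sum_left)
  show "integrable (cw_law n \<theta> \<beta>) \<phi>"
    unfolding cw_law_def using i
    by (subst integrable_density) (auto simp: dens_nn d simp del: scaleR_scaleR intro!: Bochner_Integration.integrable_sum integrable_scaleR_right)
  have "(\<integral>x. \<phi> x \<partial>cw_law n \<theta> \<beta>) = (\<integral>x. cw_dens n \<theta> \<beta> x *\<^sub>R \<phi> x \<partial>sample_space n)"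
    unfolding cw_law_def by (rule integral_density) (auto simp: dens_nn)
  also have "\<dots> = (\<Sum>z\<in>labels n. \<integral>x. cw_prior n \<beta> z *\<^sub>R ((\<Prod>i<n. gauss_dens (x i - z i *\<^sub>R \<theta>)) *\<^sub>R \<phi> x) \<partial>sample_space n)"
    unfolding d using i by (intro Bochner_Integration.integral_sum integrable_scaleR_right)
  also have "\<dots> = (\<Sum>z\<in>labels n. cw_prior n \<beta> z *\<^sub>R (\<integral>x. \<phi> x \<partial>data_law n (\<lambda>i. z i *\<^sub>R \<theta>)))"
    by (intro sum.cong refl) (simp add: e del: scaleR_scaleR)
  finally show "(\<integral>x. \<phi> x \<partial>cw_law n \<theta> \<beta>) = (\<Sum>z\<in>labels n. cw_prior n \<beta> z *\<^sub>R (\<integral>x. \<phi> x \<partial>data_law n (\<lambda>i. z i *\<^sub>R \<theta>)))" .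
qed

lemma prob_space_cw_law: "prob_space (cw_law n \<theta> \<beta>)" for \<theta> :: "real^'d"
proof -
  interpret D: prob_space "data_law n a" for a :: "nat \<Rightarrow> real^'d" by (rule prob_space_data_law)
  have i: "integrable (cw_law n \<theta> \<beta>) (\<lambda>_. 1::real)"
    by (rule integral_cw_law(1)) simp_all
  have "(\<integral>x. 1 \<partial>cw_law n \<theta> \<beta>) = (\<Sum>z\<in>labels n. cw_prior n \<beta> z *\<^sub>R (\<integral>x. (1::real) \<partial>data_law n (\<lambda>i. z i *\<^sub>R \<theta>)))"
    by (rule integral_cw_law(2)) simp_all
  also have "\<dots> = 1" using D.prob_space cw_prior_sum[of n \<beta>] by simp
  finally have v: "(\<integral>x. 1 \<partial>cw_law n \<theta> \<beta>) = (1::real)" .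
  have "(\<integral>\<^sup>+x. ennreal 1 \<partial>cw_law n \<theta> \<beta>) = ennreal (\<integral>x. 1 \<partial>cw_law n \<theta> \<beta>)"
    by (rule nn_integral_eq_integral[OF i]) simp
  then have "emeasure (cw_law n \<theta> \<beta>) (space (cw_law n \<theta> \<beta>)) = 1"
    unfolding v by simp
  then show ?thesis by (intro prob_spaceI) simp
qed

lemma measure_cw_law:
  fixes \<theta> :: "real^'d"
  assumes [measurable]: "B \<in> sets (PiM {..<n} (\<lambda>_. borel))"
  shows "measure (cw_law n \<theta> \<beta>) B = (\<Sum>z\<in>labels n. cw_prior n \<beta> z * measure (data_law n (\<lambda>i. z i *\<^sub>R \<theta>)) B)"
proof -
  interpret D: prob_space "data_law n a" for a :: "nat \<Rightarrow> real^'d" by (rule prob_space_data_law)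
  interpret P: prob_space "cw_law n \<theta> \<beta>" by (rule prob_space_cw_law)
  have "measure (cw_law n \<theta> \<beta>) B = (\<integral>x. indicator B x \<partial>cw_law n \<theta> \<beta>)" by simp
  also have "\<dots> = (\<Sum>z\<in>labels n. cw_prior n \<beta> z *\<^sub>R (\<integral>x. indicator B x \<partial>data_law n (\<lambda>i. z i *\<^sub>R \<theta>)))"
    by (rule integral_cw_law) (auto intro!: integrable_real_indicator simp: D.emeasure_eq_measure)
  finally show ?thesis by simp
qed

subsection \<open>Second moments of empirical means\<close>

definition emp_mean :: "nat \<Rightarrow> (real^'d \<Rightarrow> 'b::real_vector) \<Rightarrow> (nat \<Rightarrow> real^'d) \<Rightarrow> 'b" where
  "emp_mean n F x = (1 / real n) *\<^sub>R (\<Sum>i<n. F (x i))"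

text \<open>Cross terms vanish by independence and centring, so only the n variances remain, each at
  most the raw second moment.\<close>

lemma data_law_second_moment:
  fixes F :: "real^'d \<Rightarrow> real"
  assumes F: "exp_bounded F" and K: "\<And>i. i < n \<Longrightarrow> (\<integral>x. (F x)\<^sup>2 \<partial>gauss_at (a i)) \<le> K"
  shows "integrable (data_law n a) (\<lambda>x. (\<Sum>i<n. F (x i) - (\<integral>y. F y \<partial>gauss_at (a i)))\<^sup>2)"
    and "(\<integral>x. (\<Sum>i<n. F (x i) - (\<integral>y. F y \<partial>gauss_at (a i)))\<^sup>2 \<partial>data_law n a) \<le> real n * K"
proof -
  interpret G: prob_space "gauss_at (a i)" for i by (rule prob_space_gauss_at)
  interpret P: product_prob_space "\<lambda>i. gauss_at (a i)" by (rule product_prob_space_gauss_at)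
  define Y where "Y i y = F y - (\<integral>y. F y \<partial>gauss_at (a i))" for i y
  have iF: "integrable (gauss_at (a i)) F" "integrable (gauss_at (a i)) (\<lambda>x. (F x)\<^sup>2)" for i
    using integrable_gauss_at_exp_bounded[OF F] integrable_gauss_at_exp_bounded_square[OF F] by auto
  have iY: "integrable (gauss_at (a i)) (Y i)" "integrable (gauss_at (a i)) (\<lambda>y. Y i y * Y i y)" for i
  proof -
    let ?\<mu> = "\<integral>y. F y \<partial>gauss_at (a i)"
    show "integrable (gauss_at (a i)) (Y i)" unfolding Y_def[abs_def] using iF[of i] by simp
    have "(\<lambda>y. Y i y * Y i y) = (\<lambda>y. (F y)\<^sup>2 - 2 * ?\<mu> * F y + ?\<mu>\<^sup>2)"
      by (simp add: fun_eq_iff Y_def power2_eq_square algebra_simps)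
    then show "integrable (gauss_at (a i)) (\<lambda>y. Y i y * Y i y)" using iF[of i] by simp
  qed
  have EY: "(\<integral>y. Y i y \<partial>gauss_at (a i)) = 0" for i
    using iF G.prob_space[of i] by (simp add: Y_def)
  have EYY: "(\<integral>y. Y i y * Y i y \<partial>gauss_at (a i)) \<le> K" if "i < n" for i
  proof -
    let ?\<mu> = "\<integral>y. F y \<partial>gauss_at (a i)"
    have "(\<integral>y. Y i y * Y i y \<partial>gauss_at (a i)) = (\<integral>y. (F y)\<^sup>2 - 2 * ?\<mu> * F y + ?\<mu>\<^sup>2 \<partial>gauss_at (a i))"
      by (rule Bochner_Integration.integral_cong) (auto simp: Y_def power2_eq_square algebra_simps)
    also have "\<dots> = (\<integral>y. (F y)\<^sup>2 \<partial>gauss_at (a i)) - ?\<mu>\<^sup>2"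
      using iF[of i] G.prob_space[of i] by (simp add: power2_eq_square)
    finally show ?thesis using K[OF that] zero_le_power2[of ?\<mu>] by linarith
  qed
  \<comment> \<open>A factor for every coordinate, equal to 1 away from i and j, so that the product
    formula applies; for i = j the two conditionals together supply the square.\<close>
  define h where "h i j l y = (if l = i then Y i y else 1) * (if l = j then Y j y else 1)" for i j l :: nat and y
  have ih: "integrable (gauss_at (a l)) (h i j l)" for i j l
    using iY[of i] iY[of j] by (cases "l = i"; cases "l = j") (auto simp: h_def[abs_def])
  have hp: "Y i (x i) * Y j (x j) = (\<Prod>l<n. h i j l (x l))" if "i < n" "j < n" for i j x
    using that unfolding h_def by (simp add: prod.distrib)
  have int: "integrable (data_law n a) (\<lambda>x. Y i (x i) * Y j (x j))" if "i < n" "j < n" for i j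
    unfolding hp[OF that] data_law_def by (rule P.product_integrable_prod) (use ih in auto)
  have val: "(\<integral>x. Y i (x i) * Y j (x j) \<partial>data_law n a) \<le> (if i = j then K else 0)" if "i < n" "j < n" for i j
  proof -
    have eq: "(\<integral>x. Y i (x i) * Y j (x j) \<partial>data_law n a) = (\<Prod>l<n. \<integral>y. h i j l y \<partial>gauss_at (a l))"
      unfolding hp[OF that] data_law_def by (rule P.product_integral_prod) (use ih in auto)
    show ?thesis
    proof (cases "i = j")
      case True
      have "(\<Prod>l<n. \<integral>y. h i j l y \<partial>gauss_at (a l)) = (\<Prod>l<n. if l = i then \<integral>y. Y i y * Y i y \<partial>gauss_at (a i) else 1)"
        using True G.prob_space by (intro prod.cong) (auto simp: h_def)
      then show ?thesis using eq EYY that True by simp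
    next
      case False
      have "(\<Prod>l<n. \<integral>y. h i j l y \<partial>gauss_at (a l)) = 0"
        using False that EY[of i] by (intro prod_zero) (auto intro!: bexI[of _ i] simp: h_def)
      then show ?thesis unfolding eq using False by (simp only: if_False order_refl)
    qed
  qed
  have sq: "(\<Sum>i<n. F (x i) - (\<integral>y. F y \<partial>gauss_at (a i)))\<^sup>2 = (\<Sum>i<n. \<Sum>j<n. Y i (x i) * Y j (x j))" for x
    by (simp add: Y_def[symmetric] power2_eq_square sum_product)
  show "integrable (data_law n a) (\<lambda>x. (\<Sum>i<n. F (x i) - (\<integral>y. F y \<partial>gauss_at (a i)))\<^sup>2)"
    unfolding sq using int by (intro Bochner_Integration.integrable_sum) auto
  have "(\<integral>x. (\<Sum>i<n. F (x i) - (\<integral>y. F y \<partial>gauss_at (a i)))\<^sup>2 \<partial>data_law n a) = (\<Sum>i<n. \<Sum>j<n. \<integral>x. Y i (x i) * Y j (x j) \<partial>data_law n a)"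
    unfolding sq using int by (subst Bochner_Integration.integral_sum) (auto intro!: Bochner_Integration.integral_sum Bochner_Integration.integrable_sum sum.cong)
  also have "\<dots> \<le> (\<Sum>i<n. \<Sum>j<n. if i = j then K else 0)"
    by (intro sum_mono val) auto
  also have "\<dots> = real n * K" by simp
  finally show "(\<integral>x. (\<Sum>i<n. F (x i) - (\<integral>y. F y \<partial>gauss_at (a i)))\<^sup>2 \<partial>data_law n a) \<le> real n * K" .
qed

text \<open>Fluctuation plus bias, with (s + b)^2 at most 2 s^2 + 2 b^2. The centre \<open>c\<close>
  is arbitrary because the mixture mean differs from the mean under fixed labels.\<close>

lemma data_law_chebyshev:
  fixes F :: "real^'d \<Rightarrow> real"
  assumes F: "exp_bounded F" and K: "\<And>i. i < n \<Longrightarrow> (\<integral>x. (F x)\<^sup>2 \<partial>gauss_at (a i)) \<le> K"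
    and "\<delta> > 0" "n > 0"
  shows "measure (data_law n a) {x \<in> space (data_law n a). \<bar>emp_mean n F x - c\<bar> > \<delta>}
    \<le> (2 * K / real n + 2 * ((1 / real n) * (\<Sum>i<n. \<integral>y. F y \<partial>gauss_at (a i)) - c)\<^sup>2) / \<delta>\<^sup>2"
proof -
  interpret D: prob_space "data_law n a" by (rule prob_space_data_law)
  have [measurable]: "F \<in> borel_measurable borel" using F by (simp add: exp_bounded_def)
  define b where "b = (1 / real n) * (\<Sum>i<n. \<integral>y. F y \<partial>gauss_at (a i)) - c"
  define S where "S x = (\<Sum>i<n. F (x i) - (\<integral>y. F y \<partial>gauss_at (a i)))" for x
  have iS: "integrable (data_law n a) (\<lambda>x. (S x)\<^sup>2)" and ES: "(\<integral>x. (S x)\<^sup>2 \<partial>data_law n a) \<le> real n * K"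
    unfolding S_def using data_law_second_moment[OF F K] by auto
  have dec: "emp_mean n F x - c = S x / real n + b" for x
    using \<open>n > 0\<close> by (simp add: emp_mean_def S_def b_def sum_subtractf field_simps)
  have le: "(emp_mean n F x - c)\<^sup>2 \<le> 2 * (S x)\<^sup>2 / (real n)\<^sup>2 + 2 * b\<^sup>2" for x
    unfolding dec using zero_le_power2[of "S x / real n - b"] by (simp add: power2_sum power2_diff power_divide)
  have [measurable]: "emp_mean n F \<in> borel_measurable (data_law n a)"
    unfolding emp_mean_def[abs_def] by measurable
  have i2: "integrable (data_law n a) (\<lambda>x. 2 * (S x)\<^sup>2 / (real n)\<^sup>2 + 2 * b\<^sup>2)" using iS by simp
  have i: "integrable (data_law n a) (\<lambda>x. (emp_mean n F x - c)\<^sup>2)"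
    by (rule Bochner_Integration.integrable_bound[OF i2]) (use le in \<open>auto intro: order_trans[OF _ abs_ge_self]\<close>)
  have "measure (data_law n a) {x \<in> space (data_law n a). \<bar>emp_mean n F x - c\<bar> > \<delta>}
      \<le> measure (data_law n a) {x \<in> space (data_law n a). \<bar>emp_mean n F x - c\<bar> \<ge> \<delta>}"
    by (rule D.finite_measure_mono, force, measurable)
  also have "\<dots> \<le> (\<integral>x. (emp_mean n F x - c)\<^sup>2 \<partial>data_law n a) / \<delta>\<^sup>2"
    by (rule D.second_moment_method) (use i \<open>\<delta> > 0\<close> in auto)
  also have "\<dots> \<le> (\<integral>x. 2 * (S x)\<^sup>2 / (real n)\<^sup>2 + 2 * b\<^sup>2 \<partial>data_law n a) / \<delta>\<^sup>2"
    by (intro divide_right_mono integral_mono i i2 le) auto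
  also have "(\<integral>x. 2 * (S x)\<^sup>2 / (real n)\<^sup>2 + 2 * b\<^sup>2 \<partial>data_law n a) = 2 * (\<integral>x. (S x)\<^sup>2 \<partial>data_law n a) / (real n)\<^sup>2 + 2 * b\<^sup>2"
    using iS D.prob_space by simp
  also have "2 * (\<integral>x. (S x)\<^sup>2 \<partial>data_law n a) / (real n)\<^sup>2 + 2 * b\<^sup>2 \<le> 2 * (real n * K) / (real n)\<^sup>2 + 2 * b\<^sup>2"
    using ES by (intro add_right_mono divide_right_mono) auto
  also have "2 * (real n * K) / (real n)\<^sup>2 = 2 * K / real n"
    using \<open>n > 0\<close> by (simp add: power2_eq_square)
  finally show ?thesis using \<open>\<delta> > 0\<close> by (simp add: b_def divide_right_mono)
qed

lemma outer_prob_le: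
  assumes "B \<in> sets M" "A \<inter> space M \<subseteq> B" shows "outer_prob M A \<le> measure M B"
  unfolding outer_prob_def using assms by (intro cInf_lower bdd_belowI[of _ 0]) auto

lemma outer_prob_nonneg: "outer_prob M A \<ge> 0"
  unfolding outer_prob_def by (rule cInf_greatest) (auto intro!: exI[of _ "space M"])

section \<open>The limiting mixture and the population objective\<close>

lemma cosh_measurable [measurable]: "(cosh :: real \<Rightarrow> real) \<in> borel_measurable borel"
  by (intro borel_measurable_continuous_onI continuous_intros)

locale cw = cw_temp +
  fixes \<theta>0 :: "real^'d"
  assumes \<theta>0_nz: "\<theta>0 \<noteq> 0"
begin

abbreviation MX where "MX \<equiv> mix_meas \<theta>0 \<beta>"

text \<open>The fixed-point equation gives sinh (\<beta> m) = m cosh (\<beta> m), so the mixture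
  weights are the Gibbs weights of a sign in the field \<beta> m. This is what turns the mixture
  density into a single cosh.\<close>

lemma mix_weights: "(1 + m) / 2 = exp (\<beta> * m) / (2 * cosh (\<beta> * m))" "(1 - m) / 2 = exp (- (\<beta> * m)) / (2 * cosh (\<beta> * m))"
proof -
  have "sinh (\<beta> * m) = m * cosh (\<beta> * m)"
    using m_fixed unfolding tanh_def by (simp add: field_simps)
  then show "(1 + m) / 2 = exp (\<beta> * m) / (2 * cosh (\<beta> * m))" "(1 - m) / 2 = exp (- (\<beta> * m)) / (2 * cosh (\<beta> * m))"
    unfolding cosh_plus_sinh[symmetric] cosh_minus_sinh[symmetric] by (simp_all add: field_simps)
qed

text \<open>Density of the limiting mixture with respect to the standard normal law, by
  \<open>mix_dens_eq_tilt\<close>.\<close>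

definition tilt :: "real^'d \<Rightarrow> real" where
  "tilt x = exp (- (norm \<theta>0)\<^sup>2 / 2) * cosh (\<beta> * m + \<theta>0 \<bullet> x) / cosh (\<beta> * m)"

lemma tilt_measurable [measurable]: "tilt \<in> borel_measurable borel"
  unfolding tilt_def[abs_def] by measurable

lemma mix_dens_eq_tilt:
  "(1 + m) / 2 * gauss_dens (x - \<theta>0) + (1 - m) / 2 * gauss_dens (x + \<theta>0) = gauss_dens x * tilt x"
proof -
  have p: "gauss_dens (x + \<theta>0) = gauss_dens x * exp (- (\<theta>0 \<bullet> x) - (norm \<theta>0)\<^sup>2 / 2)"
    using gauss_dens_shift[of x "- \<theta>0"] by simp
  have e: "exp (a - (norm \<theta>0)\<^sup>2 / 2) = exp a * exp (- (norm \<theta>0)\<^sup>2 / 2)" for a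
    by (simp add: mult_exp_exp)
  have c: "cosh (\<beta> * m + \<theta>0 \<bullet> x) = (exp (\<beta> * m) * exp (\<theta>0 \<bullet> x) + exp (- (\<beta> * m)) * exp (- (\<theta>0 \<bullet> x))) / 2"
    unfolding cosh_field_def mult_exp_exp by simp
  show ?thesis
    unfolding p gauss_dens_shift[of x \<theta>0] mix_weights tilt_def c e
    by (simp add: field_simps)
qed

text \<open>The two-component form serves averages over labels; the tilted form brings in a cosh
  that cancels the denominators of tanh and of likelihood ratios.\<close>

lemma integral_mix:
  fixes F :: "real^'d \<Rightarrow> 'b::{banach, second_countable_topology}"
  assumes "exp_bounded F"
  shows "integrable MX F"
    and "(\<integral>x. F x \<partial>MX) = ((1 + m) / 2) *\<^sub>R (\<integral>x. F x \<partial>gauss_at \<theta>0) + ((1 - m) / 2) *\<^sub>R (\<integral>x. F x \<partial>gauss_at (- \<theta>0))"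
    and "(\<integral>x. F x \<partial>MX) = (\<integral>x. tilt x *\<^sub>R F x \<partial>gauss_at 0)"
proof -
  have [measurable]: "F \<in> borel_measurable borel" using assms by (rule exp_bounded_measurable)
  let ?p = "\<lambda>x. (1 + m) / 2 * gauss_dens (x - \<theta>0) + (1 - m) / 2 * gauss_dens (x + \<theta>0)"
  have p0: "?p x \<ge> 0" for x using m_pos m_lt_1 by (intro add_nonneg_nonneg mult_nonneg_nonneg) auto
  have i: "integrable lborel (\<lambda>x. gauss_dens (x - \<theta>) *\<^sub>R F x)" for \<theta>
    using integrable_gauss_at_exp_bounded[OF assms, of \<theta>] by (simp add: integrable_gauss_at)
  have d: "?p x *\<^sub>R F x = ((1 + m) / 2) *\<^sub>R (gauss_dens (x - \<theta>0) *\<^sub>R F x) + ((1 - m) / 2) *\<^sub>R (gauss_dens (x - (- \<theta>0)) *\<^sub>R F x)" for x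
    by (simp only: scaleR_add_left scaleR_scaleR diff_minus_eq_add)
  have Fm: "F \<in> borel_measurable lborel" and pm: "?p \<in> borel_measurable lborel" and AEp: "AE x in lborel. 0 \<le> ?p x"
    using p0 by (simp, measurable, simp)
  show "integrable MX F"
    unfolding mix_meas_def integrable_density[OF Fm pm AEp] d
    by (intro Bochner_Integration.integrable_add integrable_scaleR_right i)
  have eq: "(\<integral>x. F x \<partial>MX) = (\<integral>x. ?p x *\<^sub>R F x \<partial>lborel)"
    unfolding mix_meas_def by (rule integral_density[OF Fm pm AEp])
  show "(\<integral>x. F x \<partial>MX) = ((1 + m) / 2) *\<^sub>R (\<integral>x. F x \<partial>gauss_at \<theta>0) + ((1 - m) / 2) *\<^sub>R (\<integral>x. F x \<partial>gauss_at (- \<theta>0))"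
    unfolding eq d using i[of \<theta>0] i[of "- \<theta>0"]
    by (subst Bochner_Integration.integral_add) (simp_all only: integral_gauss_at integral_scaleR_right integrable_scaleR_right \<open>F \<in> borel_measurable borel\<close>)
  show "(\<integral>x. F x \<partial>MX) = (\<integral>x. tilt x *\<^sub>R F x \<partial>gauss_at 0)"
    unfolding eq mix_dens_eq_tilt by (subst integral_gauss_at) simp_all
qed

lemma exp_bounded_const: "exp_bounded (\<lambda>x. c)"
  by (rule exp_boundedI[where C="norm c"]) (auto intro!: mult_right_le_imp_le[of _ _ 1] simp: mult_le_cancel_left1)

lemma prob_space_mix: "prob_space MX"
proof -
  interpret G: prob_space "gauss_at \<theta>" for \<theta> :: "real^'d" by (rule prob_space_gauss_at)
  note c = integral_mix[OF exp_bounded_const[of "1::real"]]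
  have v: "(\<integral>x. 1 \<partial>MX) = (1::real)" using c(2) G.prob_space by (simp add: field_simps)
  have "(\<integral>\<^sup>+x. ennreal 1 \<partial>MX) = ennreal (\<integral>x. 1 \<partial>MX)"
    by (rule nn_integral_eq_integral[OF c(1)]) simp
  then show ?thesis unfolding v by (intro prob_spaceI) simp
qed

lemma sets_mix [simp, measurable_cong]: "sets MX = sets borel"
  by (simp add: mix_meas_def)

lemma exp_bounded_bounded:
  fixes F :: "real^'d \<Rightarrow> 'b::real_normed_vector"
  assumes "F \<in> borel_measurable borel" "\<And>x. norm (F x) \<le> B" shows "exp_bounded F"
proof (rule exp_boundedI[where C=B])
  fix x :: "real^'d"
  have "0 \<le> B" using order_trans[OF norm_ge_zero assms(2)] .
  then have "B * 1 \<le> B * exp (norm x)" by (intro mult_left_mono) auto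
  then show "norm (F x) \<le> B * exp (norm x)" using assms(2)[of x] by simp
qed (rule assms)

lemma exp_bounded_linear_growth:
  fixes F :: "real^'d \<Rightarrow> 'b::real_normed_vector"
  assumes "F \<in> borel_measurable borel" "\<And>x. norm (F x) \<le> A + B * norm x" "A \<ge> 0" "B \<ge> 0" shows "exp_bounded F"
proof (rule exp_boundedI[where C="A + B"])
  fix x :: "real^'d"
  have "A * 1 + B * norm x \<le> A * exp (norm x) + B * exp (norm x)"
    using assms exp_ge_add_one_self[of "norm x"] by (intro add_mono mult_left_mono) (auto intro: order_trans[OF _ exp_ge_add_one_self])
  then show "norm (F x) \<le> (A + B) * exp (norm x)" using assms(2)[of x] by (simp add: algebra_simps)
qed (rule assms)

lemma exp_bounded_power_growth:
  fixes F :: "real^'d \<Rightarrow> 'b::real_normed_vector"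
  assumes "F \<in> borel_measurable borel" "\<And>x. norm (F x) \<le> A * norm x ^ k" "A \<ge> 0" shows "exp_bounded F"
proof (rule exp_boundedI[where C="A * fact k"])
  fix x :: "real^'d"
  have "norm x ^ k / fact k \<le> exp (norm x)"
    using sum_le_suminf[OF summable_exp[of "norm x"], of "{k}"]
    by (simp add: exp_def scaleR_conv_of_real divide_inverse mult.commute)
  then have "A * (norm x ^ k) \<le> A * (fact k * exp (norm x))"
    using assms(3) by (intro mult_left_mono) (auto simp: field_simps)
  then show "norm (F x) \<le> A * fact k * exp (norm x)" using assms(2)[of x] by (simp add: mult.assoc)
qed (rule assms)

lemma integral_gauss_cosh: "(\<integral>x. cosh (b + \<theta>0 \<bullet> x) \<partial>gauss_at 0) = cosh b * exp ((norm \<theta>0)\<^sup>2 / 2)"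
  and integral_gauss_sinh: "(\<integral>x. sinh (b + \<theta>0 \<bullet> x) \<partial>gauss_at 0) = sinh b * exp ((norm \<theta>0)\<^sup>2 / 2)"
proof -
  have p: "integrable (gauss_at 0) (\<lambda>x. exp (\<theta>0 \<bullet> x))" "(\<integral>x. exp (\<theta>0 \<bullet> x) \<partial>gauss_at 0) = exp ((norm \<theta>0)\<^sup>2 / 2)"
    and q: "integrable (gauss_at 0) (\<lambda>x. exp (- (\<theta>0 \<bullet> x)))" "(\<integral>x. exp (- (\<theta>0 \<bullet> x)) \<partial>gauss_at 0) = exp ((norm \<theta>0)\<^sup>2 / 2)"
    using has_bochner_integral_gauss_at_exp[of 0 \<theta>0] has_bochner_integral_gauss_at_exp[of 0 "- \<theta>0"]
    by (simp_all add: has_bochner_integral_iff)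
  have e: "exp (b + \<theta>0 \<bullet> x) = exp b * exp (\<theta>0 \<bullet> x)" "exp (- (b + \<theta>0 \<bullet> x)) = exp (- b) * exp (- (\<theta>0 \<bullet> x))" for x
    unfolding mult_exp_exp by simp_all
  show "(\<integral>x. cosh (b + \<theta>0 \<bullet> x) \<partial>gauss_at 0) = cosh b * exp ((norm \<theta>0)\<^sup>2 / 2)"
    unfolding cosh_field_def e using p q by (simp add: field_simps)
  show "(\<integral>x. sinh (b + \<theta>0 \<bullet> x) \<partial>gauss_at 0) = sinh b * exp ((norm \<theta>0)\<^sup>2 / 2)"
    unfolding sinh_field_def e using p q by (simp add: field_simps)
qed

text \<open>Exponentiated 1-Lipschitz bound of \<open>lncosh\<close>; it makes the likelihood ratio
  in the population objective bounded.\<close>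

lemma cosh_ratio_le: "cosh (a + v) / cosh (b + v) \<le> exp \<bar>a - b\<bar>" for a b v :: real
proof -
  have "cosh (a + v) = exp (lncosh (a + v))" by simp
  also have "\<dots> \<le> exp (lncosh (b + v) + \<bar>a - b\<bar>)"
    using abs_lncosh_diff[of "a + v" "b + v"] by (subst exp_le_cancel_iff) simp
  also have "\<dots> = cosh (b + v) * exp \<bar>a - b\<bar>" unfolding exp_add by simp
  finally show ?thesis by (simp add: field_simps)
qed

text \<open>The cosh in \<open>tilt\<close> cancels the denominator of tanh and leaves a Gaussian
  integral of sinh. In other words, m is a critical point of the population objective.\<close>

lemma mix_tanh: "(\<integral>x. tanh (\<beta> * m + \<theta>0 \<bullet> x) \<partial>MX) = m"
proof -
  have "exp_bounded (\<lambda>x::real^'d. tanh (\<beta> * m + \<theta>0 \<bullet> x))"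
    by (rule exp_bounded_bounded[where B=1]) (simp_all add: abs_tanh_le_1)
  from integral_mix(3)[OF this]
  have "(\<integral>x. tanh (\<beta> * m + \<theta>0 \<bullet> x) \<partial>MX) = (\<integral>x. exp (- (norm \<theta>0)\<^sup>2 / 2) / cosh (\<beta> * m) * sinh (\<beta> * m + \<theta>0 \<bullet> x) \<partial>gauss_at 0)"
    by (simp add: tilt_def tanh_def)
  also have "\<dots> = exp (- (norm \<theta>0)\<^sup>2 / 2) / cosh (\<beta> * m) * (sinh (\<beta> * m) * exp ((norm \<theta>0)\<^sup>2 / 2))"
    by (simp only: integral_mult_right_zero integral_gauss_sinh)
  also have "\<dots> = tanh (\<beta> * m) * (exp (- (norm \<theta>0)\<^sup>2 / 2) * exp ((norm \<theta>0)\<^sup>2 / 2))"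
    by (simp add: tanh_def)
  also have "\<dots> = m" by (simp add: mult_exp_exp m_fixed)
  finally show ?thesis .
qed

text \<open>The mean square deviation of tanh from its mean m is nonnegative, so sech2 has mean at
  most 1 - m^2, and \<beta> (1 - m^2) < 1. Positivity makes the limiting Laplace integral
  Gaussian.\<close>

lemma gamma11_pos: "gamma11 \<theta>0 \<beta> > 0"
proof -
  interpret MX: prob_space MX by (rule prob_space_mix)
  let ?t = "\<lambda>x. tanh (\<beta> * m + \<theta>0 \<bullet> x)"
  have i: "integrable MX (\<lambda>x. ?t x)" "integrable MX (\<lambda>x. (?t x)\<^sup>2)"
    by (rule MX.integrable_const_bound[where B=1], auto simp: abs_tanh_le_1 abs_square_le_1)+
  have "0 \<le> (\<integral>x. (?t x - m)\<^sup>2 \<partial>MX)" by simp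
  also have "\<dots> = (\<integral>x. (?t x)\<^sup>2 - 2 * m * ?t x + m\<^sup>2 \<partial>MX)"
    by (simp add: power2_diff algebra_simps)
  also have "\<dots> = (\<integral>x. (?t x)\<^sup>2 \<partial>MX) - m\<^sup>2"
    using i MX.prob_space mix_tanh by (simp add: power2_eq_square)
  finally have "(\<integral>x. sech2 (\<beta> * m + \<theta>0 \<bullet> x) \<partial>MX) \<le> 1 - m\<^sup>2"
    unfolding sech2_eq using i MX.prob_space by simp
  then have "\<beta>\<^sup>2 * (\<integral>x. sech2 (\<beta> * m + \<theta>0 \<bullet> x) \<partial>MX) \<le> \<beta>\<^sup>2 * (1 - m\<^sup>2)" by (intro mult_left_mono) auto
  also have "\<dots> = \<beta> * (\<beta> * (1 - m\<^sup>2))" by (simp add: power2_eq_square)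
  also have "\<dots> < \<beta> * 1" using kappa_gap \<beta>_pos by (intro mult_strict_left_mono) metis+
  finally show ?thesis by (simp add: gamma11_def)
qed

definition pop :: "real \<Rightarrow> real" where
  "pop u = \<beta> * u\<^sup>2 / 2 - (\<integral>x. lncosh (\<beta> * u + \<theta>0 \<bullet> x) \<partial>MX)"

lemma exp_bounded_lncosh: "exp_bounded (\<lambda>x. lncosh (b + \<theta>0 \<bullet> x))"
proof (rule exp_bounded_linear_growth[where A="\<bar>b\<bar>" and B="norm \<theta>0"])
  fix x
  have "\<bar>b + \<theta>0 \<bullet> x\<bar> \<le> \<bar>b\<bar> + norm \<theta>0 * norm x"
    using Cauchy_Schwarz_ineq2[of \<theta>0 x] by linarith
  then show "norm (lncosh (b + \<theta>0 \<bullet> x)) \<le> \<bar>b\<bar> + norm \<theta>0 * norm x"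
    using lncosh_bounds[of "b + \<theta>0 \<bullet> x"] by simp
qed auto

text \<open>The population objective splits as the Curie--Weiss free energy plus a Kullback--Leibler
  divergence, here written as the expectation of \<open>y - 1 - ln y\<close> for the likelihood ratio \<open>y\<close>.\<close>
lemma pop_decomp:
  defines "y u x \<equiv> cosh (\<beta> * u + \<theta>0 \<bullet> x) * cosh (\<beta> * m) / (cosh (\<beta> * m + \<theta>0 \<bullet> x) * cosh (\<beta> * u))"
  shows "integrable MX (\<lambda>x. y u x - 1 - ln (y u x))"
    and "pop u - pop m = (cw_kappa \<beta> m - cw_kappa \<beta> u) + (\<integral>x. y u x - 1 - ln (y u x) \<partial>MX)"
proof -
  interpret MX: prob_space MX by (rule prob_space_mix)
  have ypos: "y u x > 0" for x by (simp add: y_def)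
  have lny: "ln (y u x) = lncosh (\<beta> * u + \<theta>0 \<bullet> x) + lncosh (\<beta> * m) - lncosh (\<beta> * m + \<theta>0 \<bullet> x) - lncosh (\<beta> * u)" for x
    unfolding y_def lncosh_def by (simp add: ln_div ln_mult)
  have yb: "exp_bounded (y u)"
  proof (rule exp_bounded_bounded[where B="exp \<bar>\<beta> * u - \<beta> * m\<bar> * (cosh (\<beta> * m) / cosh (\<beta> * u))"])
    fix x
    have "y u x = cosh (\<beta> * u + \<theta>0 \<bullet> x) / cosh (\<beta> * m + \<theta>0 \<bullet> x) * (cosh (\<beta> * m) / cosh (\<beta> * u))"
      by (simp add: y_def)
    also have "\<dots> \<le> exp \<bar>\<beta> * u - \<beta> * m\<bar> * (cosh (\<beta> * m) / cosh (\<beta> * u))"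
      by (intro mult_right_mono cosh_ratio_le) auto
    finally show "norm (y u x) \<le> exp \<bar>\<beta> * u - \<beta> * m\<bar> * (cosh (\<beta> * m) / cosh (\<beta> * u))"
      using ypos[of x] by simp
  next
    show "y u \<in> borel_measurable borel" unfolding y_def[abs_def] by measurable
  qed
  have iy: "integrable MX (y u)" by (rule integral_mix(1)[OF yb])
  \<comment> \<open>The cosh in \<open>tilt\<close> cancels, leaving the normalised mixture density
    with u in the place of m.\<close>
  have Ey: "(\<integral>x. y u x \<partial>MX) = 1"
  proof -
    have "(\<integral>x. y u x \<partial>MX) = (\<integral>x. exp (- (norm \<theta>0)\<^sup>2 / 2) / cosh (\<beta> * u) * cosh (\<beta> * u + \<theta>0 \<bullet> x) \<partial>gauss_at 0)"
      unfolding integral_mix(3)[OF yb]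
    proof (rule Bochner_Integration.integral_cong[OF refl])
      fix x
      have "cosh (\<beta> * m + \<theta>0 \<bullet> x) \<noteq> 0" "cosh (\<beta> * m) \<noteq> 0" by simp_all
      then show "tilt x *\<^sub>R y u x = exp (- (norm \<theta>0)\<^sup>2 / 2) / cosh (\<beta> * u) * cosh (\<beta> * u + \<theta>0 \<bullet> x)"
        unfolding tilt_def y_def real_scaleR_def by (simp add: divide_simps)
    qed
    also have "\<dots> = exp (- (norm \<theta>0)\<^sup>2 / 2) / cosh (\<beta> * u) * (cosh (\<beta> * u) * exp ((norm \<theta>0)\<^sup>2 / 2))"
      by (simp only: integral_mult_right_zero integral_gauss_cosh)
    also have "\<dots> = exp (- (norm \<theta>0)\<^sup>2 / 2) * exp ((norm \<theta>0)\<^sup>2 / 2)" by simp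
    also have "\<dots> = 1" by (simp add: mult_exp_exp)
    finally show ?thesis .
  qed
  note il = integral_mix(1)[OF exp_bounded_lncosh]
  show "integrable MX (\<lambda>x. y u x - 1 - ln (y u x))"
    unfolding lny using iy il by (intro Bochner_Integration.integrable_diff Bochner_Integration.integrable_add) auto
  have "(\<integral>x. y u x - 1 - ln (y u x) \<partial>MX)
     = 1 - 1 - ((\<integral>x. lncosh (\<beta> * u + \<theta>0 \<bullet> x) \<partial>MX) + lncosh (\<beta> * m) - (\<integral>x. lncosh (\<beta> * m + \<theta>0 \<bullet> x) \<partial>MX) - lncosh (\<beta> * u))"
    unfolding lny using iy il Ey MX.prob_space by simp
  then show "pop u - pop m = (cw_kappa \<beta> m - cw_kappa \<beta> u) + (\<integral>x. y u x - 1 - ln (y u x) \<partial>MX)"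
    by (simp add: pop_def cw_kappa_def)
qed

lemma pop_ge_kappa: "pop u - pop m \<ge> cw_kappa \<beta> m - cw_kappa \<beta> u"
proof -
  let ?y = "\<lambda>u x. cosh (\<beta> * u + \<theta>0 \<bullet> x) * cosh (\<beta> * m) / (cosh (\<beta> * m + \<theta>0 \<bullet> x) * cosh (\<beta> * u))"
  have "ln (?y u x) \<le> ?y u x - 1" for x by (rule ln_le_minus_one) simp
  then have "0 \<le> (\<integral>x. ?y u x - 1 - ln (?y u x) \<partial>MX)" by (intro integral_nonneg_AE AE_I2) simp
  then show ?thesis using pop_decomp(2)[of u] by simp
qed

text \<open>Here the free energies tie, so strictness must come from the divergence. If it vanished,
  the likelihood ratio would be 1 almost everywhere and the two cosh factors would agree, forcing
  \<theta>0 . x = 0 against \<theta>0 \<noteq> 0.\<close>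

lemma pop_uminus_m: "pop (- m) > pop m"
proof -
  let ?y = "\<lambda>u x. cosh (\<beta> * u + \<theta>0 \<bullet> x) * cosh (\<beta> * m) / (cosh (\<beta> * m + \<theta>0 \<bullet> x) * cosh (\<beta> * u))"
  let ?I = "\<integral>x. ?y (- m) x - 1 - ln (?y (- m) x) \<partial>MX"
  have le: "ln (?y u x) \<le> ?y u x - 1" for u x by (rule ln_le_minus_one) simp
  have "0 \<le> ?I" by (intro integral_nonneg_AE AE_I2) (simp only: diff_ge_0_iff_ge le)
  moreover have "?I \<noteq> 0"
  proof
    assume "?I = 0"
    then have "AE x in MX. ?y (- m) x - 1 - ln (?y (- m) x) = 0"
      by (subst (asm) integral_nonneg_eq_0_iff_AE[OF pop_decomp(1)]) (simp_all only: diff_ge_0_iff_ge le AE_I2)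
    then have "AE x in MX. \<theta>0 \<bullet> x = 0"
    proof eventually_elim
      case (elim x)
      have "?y (- m) x = 1" using elim by (intro ln_eq_minus_one) auto
      then have "cosh (- (\<beta> * m) + \<theta>0 \<bullet> x) = cosh (\<beta> * m + \<theta>0 \<bullet> x)" by simp
      then show "\<theta>0 \<bullet> x = 0" using \<beta>_pos m_pos by (auto simp: abs_if split: if_splits)
    qed
    then have "AE x in (lborel :: (real^'d) measure). \<theta>0 \<bullet> x = 0"
      unfolding mix_meas_def mix_dens_eq_tilt
      by (subst (asm) AE_density) (auto simp: gauss_dens_pos tilt_def[abs_def])
    then have "AE x in gauss_at (0 :: real^'d). \<theta>0 \<bullet> x = 0"
      unfolding gauss_at_def by (subst AE_density) auto
    \<comment> \<open>The vanishing inner product would make the Gaussian mean of exp (\<theta>0 .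
      x) equal to 1, while it is exp (|\<theta>0|^2 / 2).\<close>
    then have "(\<integral>x. exp (\<theta>0 \<bullet> x) \<partial>gauss_at (0 :: real^'d)) = (\<integral>x. 1 \<partial>gauss_at (0 :: real^'d))"
      by (intro integral_cong_AE) auto
    moreover have "(\<integral>x. 1 \<partial>gauss_at (0 :: real^'d)) = (1 :: real)"
      using prob_space.prob_space[OF prob_space_gauss_at[of "0 :: real^'d"]] by simp
    ultimately show False
      using has_bochner_integral_gauss_at_exp[of 0 \<theta>0] \<theta>0_nz by (simp add: has_bochner_integral_iff)
  qed
  moreover have "cw_kappa \<beta> (- m) = cw_kappa \<beta> m" by (simp add: cw_kappa_def)
  ultimately show ?thesis using pop_decomp(2)[of "- m"] by simp
qed

lemma pop_lipschitz: "\<bar>pop u - pop v\<bar> \<le> 2 * \<beta> * \<bar>u - v\<bar>" if "u \<in> {-1..1}" "v \<in> {-1..1}"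
proof -
  interpret MX: prob_space MX by (rule prob_space_mix)
  note il = integral_mix(1)[OF exp_bounded_lncosh]
  have "\<bar>\<integral>x. lncosh (\<beta> * u + \<theta>0 \<bullet> x) - lncosh (\<beta> * v + \<theta>0 \<bullet> x) \<partial>MX\<bar> \<le> (\<integral>x. \<beta> * \<bar>u - v\<bar> \<partial>MX)"
  proof (rule integral_abs_bound_integral)
    show "\<bar>lncosh (\<beta> * u + \<theta>0 \<bullet> x) - lncosh (\<beta> * v + \<theta>0 \<bullet> x)\<bar> \<le> \<beta> * \<bar>u - v\<bar>" for x
      using abs_lncosh_diff[of "\<beta> * u + \<theta>0 \<bullet> x" "\<beta> * v + \<theta>0 \<bullet> x"] \<beta>_pos
      by (simp add: abs_mult right_diff_distrib[symmetric])
  qed (use il in auto)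
  then have 1: "\<bar>(\<integral>x. lncosh (\<beta> * u + \<theta>0 \<bullet> x) \<partial>MX) - (\<integral>x. lncosh (\<beta> * v + \<theta>0 \<bullet> x) \<partial>MX)\<bar> \<le> \<beta> * \<bar>u - v\<bar>"
    using il MX.prob_space by simp
  have "\<bar>u + v\<bar> \<le> 2" using that by auto
  then have "\<bar>u + v\<bar> * \<bar>u - v\<bar> \<le> 2 * \<bar>u - v\<bar>" by (intro mult_right_mono) auto
  then have "\<beta> / 2 * (\<bar>u + v\<bar> * \<bar>u - v\<bar>) \<le> \<beta> / 2 * (2 * \<bar>u - v\<bar>)" using \<beta>_pos by (intro mult_left_mono) auto
  moreover have "\<beta> * u\<^sup>2 / 2 - \<beta> * v\<^sup>2 / 2 = \<beta> / 2 * ((u + v) * (u - v))" by (simp add: power2_eq_square algebra_simps)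
  moreover have "\<bar>\<beta> / 2 * ((u + v) * (u - v))\<bar> = \<beta> / 2 * (\<bar>u + v\<bar> * \<bar>u - v\<bar>)"
    unfolding abs_mult using \<beta>_pos by simp
  ultimately have 2: "\<bar>\<beta> * u\<^sup>2 / 2 - \<beta> * v\<^sup>2 / 2\<bar> \<le> \<beta> * \<bar>u - v\<bar>" by simp
  show ?thesis unfolding pop_def using 1 2 by linarith
qed

text \<open>On [0,1] the free-energy gap is already quadratic. On [-1,0] the minimum over a compact
  set lies strictly above \<open>pop m\<close>: by the free energy away from - m, by
  \<open>pop_uminus_m\<close> at it.\<close>

lemma pop_gap: obtains c where "c > 0" "\<And>u. u \<in> {-1..1} \<Longrightarrow> pop u - pop m \<ge> c * (u - m)\<^sup>2"
proof -
  obtain c where c: "c > 0" "\<And>u. u \<ge> 0 \<Longrightarrow> cw_kappa \<beta> m - cw_kappa \<beta> u \<ge> c * (u - m)\<^sup>2"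
    using kappa_gap by metis
  have cont: "continuous_on {-1..0} pop"
  proof (rule continuous_onI)
    fix x e :: real assume x: "x \<in> {-1..0}" and e: "e > 0"
    show "\<exists>d>0. \<forall>x'\<in>{-1..0}. dist x' x < d \<longrightarrow> dist (pop x') (pop x) \<le> e"
    proof (intro exI[of _ "e / (2 * \<beta>)"] conjI ballI impI)
      fix x' assume x': "x' \<in> {-1..0}" "dist x' x < e / (2 * \<beta>)"
      have "dist (pop x') (pop x) \<le> 2 * \<beta> * dist x' x"
        unfolding dist_real_def using x x' by (intro pop_lipschitz) auto
      also have "\<dots> \<le> e" using x'(2) \<beta>_pos by (simp add: field_simps)
      finally show "dist (pop x') (pop x) \<le> e" .
    qed (use e \<beta>_pos in auto)
  qed
  obtain u0 where u0: "u0 \<in> {-1..0}" "\<And>u. u \<in> {-1..0} \<Longrightarrow> pop u0 \<le> pop u"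
    using continuous_attains_inf[OF compact_Icc _ cont] by auto
  have gap0: "pop u0 > pop m"
  proof (cases "u0 = - m")
    case False
    have "c * (\<bar>u0\<bar> - m)\<^sup>2 > 0" using False u0(1) c(1) by auto
    also have "c * (\<bar>u0\<bar> - m)\<^sup>2 \<le> cw_kappa \<beta> m - cw_kappa \<beta> u0" using c(2)[of "\<bar>u0\<bar>"] by (simp add: cw_kappa_abs)
    finally show ?thesis using pop_ge_kappa[of u0] by linarith
  qed (use pop_uminus_m in simp)
  \<comment> \<open>Distances to m within [-1,1] are at most 2, so a constant gap dominates a
    quarter of itself times the squared distance.\<close>
  define c' where "c' = min c ((pop u0 - pop m) / 4)"
  have c': "c' > 0" "c' \<le> c" "4 * c' \<le> pop u0 - pop m"
    using c(1) gap0 min.cobounded2[of c "(pop u0 - pop m) / 4"] by (auto simp: c'_def)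
  show thesis
  proof (rule that[OF c'(1)])
    fix u :: real assume u: "u \<in> {-1..1}"
    show "pop u - pop m \<ge> c' * (u - m)\<^sup>2"
    proof (cases "u \<ge> 0")
      case True
      have "c' * (u - m)\<^sup>2 \<le> c * (u - m)\<^sup>2" using c'(2) by (intro mult_right_mono) auto
      then show ?thesis using c(2)[OF True] pop_ge_kappa[of u] by linarith
    next
      case False
      have "\<bar>u - m\<bar>\<^sup>2 \<le> 2\<^sup>2" using u m_pos m_lt_1 by (intro power_mono) auto
      then have "c' * (u - m)\<^sup>2 \<le> c' * 4" using c'(1) by (intro mult_left_mono) auto
      also have "\<dots> \<le> pop u - pop m" using u0(2)[of u] u False c'(3) by simp
      finally show ?thesis .
    qed
  qed
qed

section \<open>From sequences of good data to convergence in probability\<close>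

definition is_min :: "nat \<Rightarrow> (nat \<Rightarrow> real^'d) \<Rightarrow> real \<Rightarrow> bool" where
  "is_min n x u \<longleftrightarrow> u \<in> {-1..1} \<and> (\<forall>v\<in>{-1..1}. cw_objective n \<theta>0 \<beta> x u \<le> cw_objective n \<theta>0 \<beta> x v)"

lemma cw_objective_eq: "cw_objective n \<theta>0 \<beta> x u = \<beta> * u\<^sup>2 / 2 - emp_mean n (\<lambda>y. lncosh (\<beta> * u + \<theta>0 \<bullet> y)) x"
  by (simp add: cw_objective_def emp_mean_def lncosh_def)

lemma cw_objective_uminus: "cw_objective n \<theta>0 \<beta> (\<lambda>i. - x i) u = cw_objective n \<theta>0 \<beta> x (- u)"
proof -
  have "lncosh (\<beta> * u + \<theta>0 \<bullet> - y) = lncosh (\<beta> * - u + \<theta>0 \<bullet> y)" for y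
    using lncosh_minus[of "\<beta> * - u + \<theta>0 \<bullet> y"] by simp
  then show ?thesis unfolding cw_objective_eq emp_mean_def by simp
qed

lemma is_min_uminus: "is_min n x u \<Longrightarrow> is_min n (\<lambda>i. - x i) (- u)"
  unfolding is_min_def cw_objective_uminus by force

text \<open>Level \<open>k\<close> tightens the tolerance and enlarges the list of tests together.
  Data chosen good at level k for every k therefore satisfy all countably many limits, while each
  single level is a finite condition whose failure for both signs has vanishing probability.\<close>

definition good :: "(nat \<Rightarrow> real^'d \<Rightarrow> real) \<Rightarrow> nat \<Rightarrow> nat \<Rightarrow> (nat \<Rightarrow> real^'d) \<Rightarrow> bool" where
  "good Fs n k x \<longleftrightarrow> (\<forall>j\<le>k. \<bar>emp_mean n (Fs j) x - (\<integral>y. Fs j y \<partial>MX)\<bar> \<le> 1 / (real k + 1))"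

definition bad_set :: "(nat \<Rightarrow> real^'d \<Rightarrow> real) \<Rightarrow> nat \<Rightarrow> nat \<Rightarrow> (nat \<Rightarrow> real^'d) set" where
  "bad_set Fs n k = {x \<in> space (PiM {..<n} (\<lambda>_. borel)). \<not> good Fs n k x \<and> \<not> good Fs n k (\<lambda>i. - x i)}"

lemma space_data_law: "space (data_law n a) = space (PiM {..<n} (\<lambda>_. borel))"
  by (rule sets_eq_imp_space_eq) simp

text \<open>Every function on {-1, 1} is affine, so its label average depends on the labels through
  their mean only.\<close>

lemma label_average:
  fixes g :: "real \<Rightarrow> real"
  assumes z: "z \<in> labels n" and n: "n > 0" and s: "s = 1 \<or> s = -1"
  shows "(1 / real n) * (\<Sum>i<n. g (s * z i)) - ((1 + m) / 2 * g 1 + (1 - m) / 2 * g (-1)) = (s * zbar n z - m) / 2 * (g 1 - g (-1))"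
proof -
  have "(\<Sum>i<n. g (s * z i)) = (\<Sum>i<n. (g 1 + g (-1)) / 2 + s * z i * ((g 1 - g (-1)) / 2))"
  proof (rule sum.cong[OF refl])
    fix i assume "i \<in> {..<n}"
    then have "z i = 1 \<or> z i = -1" using labels_abs_1[OF z] by simp
    then show "g (s * z i) = (g 1 + g (-1)) / 2 + s * z i * ((g 1 - g (-1)) / 2)" using s by (auto simp: field_simps)
  qed
  also have "\<dots> = real n * ((g 1 + g (-1)) / 2) + s * (\<Sum>i<n. z i) * ((g 1 - g (-1)) / 2)"
    unfolding sum.distrib by (simp only: sum_constant card_lessThan sum_distrib_left sum_distrib_right)
  also have "(\<Sum>i<n. z i) = real n * zbar n z" using n by (simp add: zbar_def)
  finally show ?thesis using n by (simp add: field_simps)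
qed

lemma integral_gauss_at_uminus:
  fixes F :: "real^'d \<Rightarrow> real"
  assumes [measurable]: "F \<in> borel_measurable borel"
  shows "(\<integral>x. F (- x) \<partial>gauss_at \<theta>) = (\<integral>x. F x \<partial>gauss_at (- \<theta>))"
  unfolding gauss_at_uminus_eq_distr[of \<theta>] by (rule integral_distr[symmetric]) auto

text \<open>The variance is of order 1 / n and the bias proportional to s zbar - m by
  \<open>label_average\<close>. The constant is uniform in n, labels and sign, so that the bound can
  be averaged over the prior.\<close>

lemma data_law_deviation:
  fixes F :: "real^'d \<Rightarrow> real"
  assumes F: "exp_bounded F" and "\<delta> > 0"
  obtains C where "\<And>n z s. n > 0 \<Longrightarrow> z \<in> labels n \<Longrightarrow> s = 1 \<or> s = -1 \<Longrightarrow>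
    measure (data_law n (\<lambda>i. z i *\<^sub>R \<theta>0)) {x \<in> space (PiM {..<n} (\<lambda>_. borel)). \<bar>emp_mean n F (\<lambda>i. s *\<^sub>R x i) - (\<integral>y. F y \<partial>MX)\<bar> > \<delta>}
      \<le> C * (1 / real n + (s * zbar n z - m)\<^sup>2)"
proof -
  have Fm [measurable]: "F \<in> borel_measurable borel" using F by (rule exp_bounded_measurable)
  define g where "g t = (\<integral>y. F y \<partial>gauss_at (t *\<^sub>R \<theta>0))" for t :: real
  define K where "K = (\<integral>y. (F y)\<^sup>2 \<partial>gauss_at \<theta>0) + (\<integral>y. (F y)\<^sup>2 \<partial>gauss_at (- \<theta>0))"
  define C where "C = (2 * K + (g 1 - g (-1))\<^sup>2) / \<delta>\<^sup>2"
  have nn: "(\<integral>y. (F y)\<^sup>2 \<partial>gauss_at \<theta>) \<ge> 0" for \<theta> by simp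
  have K0: "K \<ge> 0" unfolding K_def using nn by (intro add_nonneg_nonneg)
  have EF: "(\<integral>y. F y \<partial>MX) = (1 + m) / 2 * g 1 + (1 - m) / 2 * g (-1)"
    using integral_mix(2)[OF F] by (simp add: g_def)
  show thesis
  proof (rule that[of C])
    fix n z s assume n: "n > 0" and z: "z \<in> labels n" and s: "s = 1 \<or> s = (-1 :: real)"
    \<comment> \<open>The sign moves from the data into the test function; reflecting the normal law
      then turns it into a sign on the label.\<close>
    define F' where "F' x = F (s *\<^sub>R x)" for x
    have F': "exp_bounded F'"
    proof -
      obtain D where "\<And>x. norm (F x) \<le> D * exp (norm x)" using F by (auto simp: exp_bounded_def)
      from this[of "s *\<^sub>R x" for x] show ?thesis
        using s unfolding F'_def by (intro exp_boundedI[where C=D]) auto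
    qed
    have swap: "(\<integral>y. H (s *\<^sub>R y) \<partial>gauss_at (t *\<^sub>R \<theta>0)) = (\<integral>y. H y \<partial>gauss_at ((s * t) *\<^sub>R \<theta>0))"
      if [measurable]: "H \<in> borel_measurable borel" for H :: "real^'d \<Rightarrow> real" and t
      using s integral_gauss_at_uminus[OF that, of "t *\<^sub>R \<theta>0"] by auto
    have K: "(\<integral>y. (F' y)\<^sup>2 \<partial>gauss_at (z i *\<^sub>R \<theta>0)) \<le> K" if "i < n" for i
    proof -
      have "(\<integral>y. (F' y)\<^sup>2 \<partial>gauss_at (z i *\<^sub>R \<theta>0)) = (\<integral>y. (F y)\<^sup>2 \<partial>gauss_at ((s * z i) *\<^sub>R \<theta>0))"
        unfolding F'_def by (rule swap) measurable
      also have "\<dots> \<le> K" using s labels_abs_1[OF z that] nn unfolding K_def by auto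
      finally show ?thesis .
    qed
    have avg: "(\<Sum>i<n. \<integral>y. F' y \<partial>gauss_at (z i *\<^sub>R \<theta>0)) = (\<Sum>i<n. g (s * z i))"
      unfolding F'_def g_def by (intro sum.cong refl swap Fm)
    have em: "emp_mean n F (\<lambda>i. s *\<^sub>R x i) = emp_mean n F' x" for x by (simp add: emp_mean_def F'_def)
    have "measure (data_law n (\<lambda>i. z i *\<^sub>R \<theta>0)) {x \<in> space (PiM {..<n} (\<lambda>_. borel)). \<bar>emp_mean n F (\<lambda>i. s *\<^sub>R x i) - (\<integral>y. F y \<partial>MX)\<bar> > \<delta>}
      \<le> (2 * K / real n + 2 * ((1 / real n) * (\<Sum>i<n. g (s * z i)) - (\<integral>y. F y \<partial>MX))\<^sup>2) / \<delta>\<^sup>2"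
      using data_law_chebyshev[where c="\<integral>y. F y \<partial>MX" and a="\<lambda>i. z i *\<^sub>R \<theta>0", OF F' K \<open>\<delta> > 0\<close> n] unfolding space_data_law em avg .
    also have "\<dots> = (2 * K / real n + (s * zbar n z - m)\<^sup>2 * ((g 1 - g (-1))\<^sup>2 / 2)) / \<delta>\<^sup>2"
      unfolding EF label_average[OF z n s] by (simp add: power_mult_distrib power_divide)
    also have "\<dots> \<le> ((2 * K + (g 1 - g (-1))\<^sup>2) * (1 / real n + (s * zbar n z - m)\<^sup>2)) / \<delta>\<^sup>2"
    proof (rule divide_right_mono)
      have "0 \<le> (g 1 - g (-1))\<^sup>2 * (1 / real n)" "0 \<le> 2 * K * (s * zbar n z - m)\<^sup>2" "0 \<le> (g 1 - g (-1))\<^sup>2 * (s * zbar n z - m)\<^sup>2"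
        using K0 by simp_all
      then show "2 * K / real n + (s * zbar n z - m)\<^sup>2 * ((g 1 - g (-1))\<^sup>2 / 2) \<le> (2 * K + (g 1 - g (-1))\<^sup>2) * (1 / real n + (s * zbar n z - m)\<^sup>2)"
        by (simp add: ring_distribs mult.commute)
    qed simp
    also have "\<dots> = C * (1 / real n + (s * zbar n z - m)\<^sup>2)" by (simp add: C_def)
    finally show "measure (data_law n (\<lambda>i. z i *\<^sub>R \<theta>0)) {x \<in> space (PiM {..<n} (\<lambda>_. borel)). \<bar>emp_mean n F (\<lambda>i. s *\<^sub>R x i) - (\<integral>y. F y \<partial>MX)\<bar> > \<delta>}
      \<le> C * (1 / real n + (s * zbar n z - m)\<^sup>2)" .
  qed
qed

lemma emp_mean_measurable:
  fixes F :: "real^'d \<Rightarrow> real"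
  assumes "F \<in> borel_measurable borel"
  shows "(\<lambda>x. emp_mean n F (\<lambda>i. (s::real) *\<^sub>R x i)) \<in> borel_measurable (PiM {..<n} (\<lambda>_. borel))"
  using assms unfolding emp_mean_def by measurable

text \<open>Failure for both signs is contained in failure for the sign that matches the label mean,
  where the bias is of size |zbar| - m; its prior mean square vanishes by
  \<open>cw_prior_concentrates\<close>.\<close>

lemma bad_set_vanishes:
  fixes Fs :: "nat \<Rightarrow> real^'d \<Rightarrow> real"
  assumes F: "\<And>j. exp_bounded (Fs j)"
  shows "bad_set Fs n k \<in> sets (PiM {..<n} (\<lambda>_. borel))"
    and "(\<lambda>n. measure (cw_law n \<theta>0 \<beta>) (bad_set Fs n k)) \<longlonglongrightarrow> 0"
proof -
  define \<delta> where "\<delta> = 1 / (real k + 1)"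
  have \<delta>: "\<delta> > 0" by (simp add: \<delta>_def)
  define E where "E n s j = {x \<in> space (PiM {..<n} (\<lambda>_. borel :: (real^'d) measure)). \<bar>emp_mean n (Fs j) (\<lambda>i. s *\<^sub>R x i) - (\<integral>y. Fs j y \<partial>MX)\<bar> > \<delta>}"
    for n :: nat and s :: real and j
  have Em: "E n s j \<in> sets (PiM {..<n} (\<lambda>_. borel))" for n s j
  proof -
    note [measurable] = emp_mean_measurable[OF exp_bounded_measurable[OF F[of j]], of n s]
    show ?thesis unfolding E_def by measurable
  qed
  have bad: "bad_set Fs n k = (\<Union>j\<le>k. E n 1 j) \<inter> (\<Union>j\<le>k. E n (-1) j)" for n
    unfolding bad_set_def good_def E_def \<delta>_def[symmetric] by (auto simp: not_le)
  show bm: "bad_set Fs n k \<in> sets (PiM {..<n} (\<lambda>_. borel))" for n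
    unfolding bad using Em by (intro sets.Int sets.finite_UN) auto
  have "\<forall>j. \<exists>C. \<forall>n z s. n > 0 \<longrightarrow> z \<in> labels n \<longrightarrow> s = 1 \<or> s = -1 \<longrightarrow>
      measure (data_law n (\<lambda>i. z i *\<^sub>R \<theta>0)) (E n s j) \<le> C * (1 / real n + (s * zbar n z - m)\<^sup>2)"
  proof
    fix j
    obtain C where "\<And>n z s. n > 0 \<Longrightarrow> z \<in> labels n \<Longrightarrow> s = 1 \<or> s = -1 \<Longrightarrow>
      measure (data_law n (\<lambda>i. z i *\<^sub>R \<theta>0)) (E n s j) \<le> C * (1 / real n + (s * zbar n z - m)\<^sup>2)"
      unfolding E_def by (rule data_law_deviation[OF F[of j] \<delta>]) blast
    then show "\<exists>C. \<forall>n z s. n > 0 \<longrightarrow> z \<in> labels n \<longrightarrow> s = 1 \<or> s = -1 \<longrightarrow>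
      measure (data_law n (\<lambda>i. z i *\<^sub>R \<theta>0)) (E n s j) \<le> C * (1 / real n + (s * zbar n z - m)\<^sup>2)"
      by blast
  qed
  from choice[OF this] obtain C where C: "\<And>j n z s. n > 0 \<Longrightarrow> z \<in> labels n \<Longrightarrow> s = 1 \<or> s = -1 \<Longrightarrow>
      measure (data_law n (\<lambda>i. z i *\<^sub>R \<theta>0)) (E n s j) \<le> C j * (1 / real n + (s * zbar n z - m)\<^sup>2)"
    by blast
  let ?C = "\<Sum>j\<le>k. C j"
  have bz: "measure (data_law n (\<lambda>i. z i *\<^sub>R \<theta>0)) (bad_set Fs n k) \<le> ?C * (1 / real n + (\<bar>zbar n z\<bar> - m)\<^sup>2)"
    if n: "n > 0" and z: "z \<in> labels n" for n z
  proof -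
    interpret D: prob_space "data_law n (\<lambda>i. z i *\<^sub>R \<theta>0)" by (rule prob_space_data_law)
    obtain s :: real where s: "s = 1 \<or> s = -1" "s * zbar n z = \<bar>zbar n z\<bar>"
      by (metis abs_if mult_1 mult_minus1)
    have "measure (data_law n (\<lambda>i. z i *\<^sub>R \<theta>0)) (bad_set Fs n k) \<le> measure (data_law n (\<lambda>i. z i *\<^sub>R \<theta>0)) (\<Union>j\<le>k. E n s j)"
      unfolding bad using s(1) Em by (intro D.finite_measure_mono) (auto intro!: sets.finite_UN)
    also have "\<dots> \<le> (\<Sum>j\<le>k. measure (data_law n (\<lambda>i. z i *\<^sub>R \<theta>0)) (E n s j))"
      using Em by (intro D.finite_measure_subadditive_finite) auto
    also have "\<dots> \<le> (\<Sum>j\<le>k. C j * (1 / real n + (\<bar>zbar n z\<bar> - m)\<^sup>2))"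
      using C[OF n z s(1)] unfolding s(2) by (intro sum_mono)
    finally show ?thesis by (simp add: sum_distrib_right)
  qed
  have le: "measure (cw_law n \<theta>0 \<beta>) (bad_set Fs n k) \<le> ?C * (1 / real n) + ?C * (\<Sum>z\<in>labels n. cw_prior n \<beta> z * (\<bar>zbar n z\<bar> - m)\<^sup>2)"
    if n: "n > 0" for n
  proof -
    have "measure (cw_law n \<theta>0 \<beta>) (bad_set Fs n k) \<le> (\<Sum>z\<in>labels n. cw_prior n \<beta> z * (?C * (1 / real n + (\<bar>zbar n z\<bar> - m)\<^sup>2)))"
      unfolding measure_cw_law[OF bm] by (intro sum_mono mult_left_mono bz n cw_prior_nonneg)
    also have "\<dots> = (\<Sum>z\<in>labels n. ?C * (1 / real n) * cw_prior n \<beta> z + ?C * (cw_prior n \<beta> z * (\<bar>zbar n z\<bar> - m)\<^sup>2))"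
      by (rule sum.cong) (auto simp: algebra_simps)
    also have "\<dots> = ?C * (1 / real n) * (\<Sum>z\<in>labels n. cw_prior n \<beta> z) + ?C * (\<Sum>z\<in>labels n. cw_prior n \<beta> z * (\<bar>zbar n z\<bar> - m)\<^sup>2)"
      unfolding sum.distrib sum_distrib_left ..
    finally show ?thesis by (simp add: cw_prior_sum)
  qed
  have lim: "(\<lambda>n. ?C * (1 / real n) + ?C * (\<Sum>z\<in>labels n. cw_prior n \<beta> z * (\<bar>zbar n z\<bar> - m)\<^sup>2)) \<longlonglongrightarrow> ?C * 0 + ?C * 0"
    by (intro tendsto_intros cw_prior_concentrates lim_1_over_n)
  show "(\<lambda>n. measure (cw_law n \<theta>0 \<beta>) (bad_set Fs n k)) \<longlonglongrightarrow> 0"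
  proof (rule tendsto_sandwich[OF _ _ tendsto_const])
    show "\<forall>\<^sub>F n in sequentially. measure (cw_law n \<theta>0 \<beta>) (bad_set Fs n k)
       \<le> ?C * (1 / real n) + ?C * (\<Sum>z\<in>labels n. cw_prior n \<beta> z * (\<bar>zbar n z\<bar> - m)\<^sup>2)"
      using eventually_gt_at_top[of 0] by eventually_elim (rule le)
  qed (use lim in simp_all)
qed

text \<open>If \<open>Q\<close> failed with non-vanishing probability, a diagonal choice of bad data inside
  ever better good sets would be a good sequence along which \<open>Q\<close> fails throughout.\<close>
lemma eventually_outer_prob_transfer:
  fixes Fs :: "nat \<Rightarrow> real^'d \<Rightarrow> real"
  assumes F: "\<And>j. exp_bounded (Fs j)"
    and U: "\<And>n x. is_min n x (U n x)"
    and Q_uminus: "\<And>n x u. Q n (\<lambda>i. - x i) (- u) \<Longrightarrow> Q n x u"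
    and Q: "\<And>\<nu> X u. (\<And>k. \<nu> k > k) \<Longrightarrow> (\<And>j. (\<lambda>k. emp_mean (\<nu> k) (Fs j) (X k)) \<longlonglongrightarrow> (\<integral>y. Fs j y \<partial>MX))
      \<Longrightarrow> (\<And>k. is_min (\<nu> k) (X k) (u k)) \<Longrightarrow> \<forall>\<^sub>F k in sequentially. Q (\<nu> k) (X k) (u k)"
  shows "(\<lambda>n. outer_prob (cw_law n \<theta>0 \<beta>) {x \<in> space (cw_law n \<theta>0 \<beta>). \<not> Q n x (U n x)}) \<longlonglongrightarrow> 0"
proof -
  \<comment> \<open>One level at which goodness and minimality force \<open>Q\<close> is enough: the
    bad set of that fixed level then contains the exceptional event.\<close>
  have "\<exists>k. \<forall>n>k. \<forall>x u. good Fs n k x \<longrightarrow> is_min n x u \<longrightarrow> Q n x u"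
  proof (rule ccontr)
    assume "\<not> ?thesis"
    then have "\<forall>k. \<exists>n x u. n > k \<and> good Fs n k x \<and> is_min n x u \<and> \<not> Q n x u" by meson
    then obtain \<nu> X u where *: "\<And>k. \<nu> k > k" "\<And>k. good Fs (\<nu> k) k (X k)" "\<And>k. is_min (\<nu> k) (X k) (u k)" "\<And>k. \<not> Q (\<nu> k) (X k) (u k)"
      by metis
    have "(\<lambda>k. emp_mean (\<nu> k) (Fs j) (X k)) \<longlonglongrightarrow> (\<integral>y. Fs j y \<partial>MX)" for j
    proof (rule LIM_zero_cancel, rule tendsto_rabs_zero_cancel, rule tendsto_sandwich[OF _ _ tendsto_const])
      show "\<forall>\<^sub>F k in sequentially. \<bar>emp_mean (\<nu> k) (Fs j) (X k) - (\<integral>y. Fs j y \<partial>MX)\<bar> \<le> 1 / (real k + 1)"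
        using eventually_ge_at_top[of j] by eventually_elim (use *(2) in \<open>auto simp: good_def\<close>)
      show "(\<lambda>k. 1 / (real k + 1)) \<longlonglongrightarrow> 0"
        using LIMSEQ_inverse_real_of_nat by (simp add: inverse_eq_divide add.commute)
    qed simp
    from Q[OF *(1) this *(3)] *(4) show False by simp
  qed
  then obtain k where k: "\<And>n x u. n > k \<Longrightarrow> good Fs n k x \<Longrightarrow> is_min n x u \<Longrightarrow> Q n x u" by blast
  show ?thesis
  proof (rule tendsto_sandwich[OF _ _ tendsto_const bad_set_vanishes(2)[of Fs k, OF F]])
    show "\<forall>\<^sub>F n in sequentially. outer_prob (cw_law n \<theta>0 \<beta>) {x \<in> space (cw_law n \<theta>0 \<beta>). \<not> Q n x (U n x)} \<le> measure (cw_law n \<theta>0 \<beta>) (bad_set Fs n k)"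
      using eventually_gt_at_top[of k]
    proof eventually_elim
      case (elim n)
      show ?case
      proof (rule outer_prob_le)
        show "bad_set Fs n k \<in> sets (cw_law n \<theta>0 \<beta>)" using bad_set_vanishes(1)[OF F] by simp
        have sp: "space (cw_law n \<theta>0 \<beta>) = space (PiM {..<n} (\<lambda>_. borel))" by (rule sets_eq_imp_space_eq) simp
        \<comment> \<open>If only the reflected data are good, \<open>Q\<close> holds for them with
          minimiser - U n x and is carried back by \<open>Q_uminus\<close>.\<close>
        show "{x \<in> space (cw_law n \<theta>0 \<beta>). \<not> Q n x (U n x)} \<inter> space (cw_law n \<theta>0 \<beta>) \<subseteq> bad_set Fs n k"
          unfolding bad_set_def sp using k[OF elim _ U] k[OF elim _ is_min_uminus[OF U]] Q_uminus by blast
      qed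
    qed
  qed (simp add: outer_prob_nonneg)
qed

end

section \<open>Integral representation of the posterior\<close>

text \<open>Completing the square identifies the integrand as a multiple of the normal density with
  mean y and variance 1 / \<kappa>.\<close>

lemma gauss_quadratic:
  assumes "\<kappa> > 0"
  shows "exp (- \<kappa> * v\<^sup>2 / 2 + \<kappa> * v * y) = sqrt (2 * pi / \<kappa>) * exp (\<kappa> * y\<^sup>2 / 2) * normal_density y (1 / sqrt \<kappa>) v"
proof -
  have "sqrt (2 * pi / \<kappa>) * normal_density y (1 / sqrt \<kappa>) v = exp (- \<kappa> * (v - y)\<^sup>2 / 2)"
    using assms by (simp add: normal_density_def power_divide field_simps)
  then have "sqrt (2 * pi / \<kappa>) * exp (\<kappa> * y\<^sup>2 / 2) * normal_density y (1 / sqrt \<kappa>) v = exp (\<kappa> * y\<^sup>2 / 2) * exp (- \<kappa> * (v - y)\<^sup>2 / 2)"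
    by (simp add: mult_ac)
  also have "\<dots> = exp (- \<kappa> * v\<^sup>2 / 2 + \<kappa> * v * y)"
    unfolding mult_exp_exp by (simp add: power2_eq_square field_simps)
  finally show ?thesis by simp
qed

lemma has_integral_gauss_quadratic:
  assumes "\<kappa> > 0"
  shows "has_bochner_integral lborel (\<lambda>v. exp (- \<kappa> * v\<^sup>2 / 2 + \<kappa> * v * y)) (sqrt (2 * pi / \<kappa>) * exp (\<kappa> * y\<^sup>2 / 2))"
    and "has_bochner_integral lborel (\<lambda>v. v * exp (- \<kappa> * v\<^sup>2 / 2 + \<kappa> * v * y)) (y * (sqrt (2 * pi / \<kappa>) * exp (\<kappa> * y\<^sup>2 / 2)))"
proof -
  have \<sigma>: "1 / sqrt \<kappa> > 0" using assms by simp
  have 0: "has_bochner_integral lborel (normal_density y (1 / sqrt \<kappa>)) 1"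
    using \<sigma> by (simp add: has_bochner_integral_iff)
  have 1: "has_bochner_integral lborel (\<lambda>v. normal_density y (1 / sqrt \<kappa>) v * v) y"
    using normal_moment_nz_1[OF \<sigma>] .
  show "has_bochner_integral lborel (\<lambda>v. exp (- \<kappa> * v\<^sup>2 / 2 + \<kappa> * v * y)) (sqrt (2 * pi / \<kappa>) * exp (\<kappa> * y\<^sup>2 / 2))"
    unfolding gauss_quadratic[OF assms] using has_bochner_integral_mult_right[of "sqrt (2 * pi / \<kappa>) * exp (\<kappa> * y\<^sup>2 / 2)", OF 0] by simp
  show "has_bochner_integral lborel (\<lambda>v. v * exp (- \<kappa> * v\<^sup>2 / 2 + \<kappa> * v * y)) (y * (sqrt (2 * pi / \<kappa>) * exp (\<kappa> * y\<^sup>2 / 2)))"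
    unfolding gauss_quadratic[OF assms] using has_bochner_integral_mult_right[of "sqrt (2 * pi / \<kappa>) * exp (\<kappa> * y\<^sup>2 / 2)", OF 1]
    by (simp add: mult_ac)
qed

lemma integral_gauss_iexp:
  assumes "\<gamma> > 0"
  shows "(\<integral>s. exp (- \<gamma> * s\<^sup>2 / 2) *\<^sub>R iexp (\<eta> * s) \<partial>lborel) = complex_of_real (sqrt (2 * pi / \<gamma>) * exp (- \<eta>\<^sup>2 / (2 * \<gamma>)))"
proof -
  have c: "(\<integral>x. std_normal_density x *\<^sub>R iexp (t * x) \<partial>lborel) = exp (- t\<^sup>2 / 2)" for t
  proof -
    have "char std_normal_distribution t = exp (- t\<^sup>2 / 2)" by (simp add: char_std_normal_distribution)
    then show ?thesis unfolding char_def by (subst (asm) integral_density) auto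
  qed
  have "(\<integral>s. exp (- \<gamma> * s\<^sup>2 / 2) *\<^sub>R iexp (\<eta> * s) \<partial>lborel)
      = (1 / sqrt \<gamma>) *\<^sub>R (\<integral>x. exp (- \<gamma> * ((1 / sqrt \<gamma>) * x)\<^sup>2 / 2) *\<^sub>R iexp (\<eta> * ((1 / sqrt \<gamma>) * x)) \<partial>lborel)"
    using assms by (subst lborel_integral_real_affine[of "1 / sqrt \<gamma>" _ 0]) auto
  also have "(\<lambda>x. exp (- \<gamma> * ((1 / sqrt \<gamma>) * x)\<^sup>2 / 2) *\<^sub>R iexp (\<eta> * ((1 / sqrt \<gamma>) * x)))
      = (\<lambda>x. sqrt (2 * pi) *\<^sub>R (std_normal_density x *\<^sub>R iexp (\<eta> / sqrt \<gamma> * x)))"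
    using assms by (simp add: fun_eq_iff std_normal_density_def power_mult_distrib power_divide)
  also have "(1 / sqrt \<gamma>) *\<^sub>R (\<integral>x. sqrt (2 * pi) *\<^sub>R (std_normal_density x *\<^sub>R iexp (\<eta> / sqrt \<gamma> * x)) \<partial>lborel)
      = (1 / sqrt \<gamma> * sqrt (2 * pi)) *\<^sub>R complex_of_real (exp (- (\<eta> / sqrt \<gamma>)\<^sup>2 / 2))"
    unfolding integral_scaleR_right c by simp
  also have "\<dots> = complex_of_real (sqrt (2 * pi / \<gamma>) * exp (- \<eta>\<^sup>2 / (2 * \<gamma>)))"
    using assms by (simp add: scaleR_conv_of_real real_sqrt_divide power_divide mult.commute)
  finally show ?thesis .
qed

lemma iexp_cis: "iexp x = cis x"
  by (simp add: cis_conv_exp)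

lemma prod_scaleR_distrib:
  fixes g :: "'i \<Rightarrow> 'a::real_normed_field"
  shows "(\<Prod>i\<in>A. f i *\<^sub>R g i) = (\<Prod>i\<in>A. f i) *\<^sub>R (\<Prod>i\<in>A. g i)"
  by (simp add: scaleR_conv_of_real prod.distrib)

lemma n_zbar: "n > 0 \<Longrightarrow> real n * zbar n w = (\<Sum>i<n. w i)"
  by (simp add: zbar_def)

text \<open>The Hubbard--Stratonovich linearisation, with a multiplier \<open>p\<close> in the auxiliary variable
  whose Gaussian mean is \<open>q\<close>; only \<open>p = 1\<close> and \<open>p v = v\<close> occur.\<close>
lemma hubbard_stratonovich:
  fixes c :: "nat \<Rightarrow> real \<Rightarrow> 'a::{real_normed_field, banach, second_countable_topology}"
  assumes n: "n > 0" and \<beta>: "\<beta> > 0"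
    and pq: "\<And>y. has_bochner_integral lborel (\<lambda>v. p v * exp (- (real n * \<beta>) * v\<^sup>2 / 2 + (real n * \<beta>) * v * y))
      (q y * (sqrt (2 * pi / (real n * \<beta>)) * exp (real n * \<beta> * y\<^sup>2 / 2)))"
  shows "has_bochner_integral lborel
    (\<lambda>v. (p v * exp (- (real n * \<beta>) * v\<^sup>2 / 2)) *\<^sub>R (\<Prod>i<n. exp (\<beta> * v) *\<^sub>R c i 1 + exp (- (\<beta> * v)) *\<^sub>R c i (-1)))
    (sqrt (2 * pi / (real n * \<beta>)) *\<^sub>R (\<Sum>w\<in>labels n. (q (zbar n w) * exp (real n * \<beta> * (zbar n w)\<^sup>2 / 2)) *\<^sub>R (\<Prod>i<n. c i (w i))))"
proof -
  let ?K = "real n * \<beta>"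
  have pr: "(\<Prod>i<n. exp (\<beta> * v) *\<^sub>R c i 1 + exp (- (\<beta> * v)) *\<^sub>R c i (-1)) = (\<Sum>w\<in>labels n. exp (?K * v * zbar n w) *\<^sub>R (\<Prod>i<n. c i (w i)))" for v
  proof -
    have "(\<Prod>i<n. exp (\<beta> * v) *\<^sub>R c i 1 + exp (- (\<beta> * v)) *\<^sub>R c i (-1)) = (\<Sum>w\<in>labels n. \<Prod>i<n. exp (\<beta> * v * w i) *\<^sub>R c i (w i))"
      using sum_labels_prod[of "\<lambda>i y. exp (\<beta> * v * y) *\<^sub>R c i y" n] by simp
    also have "\<dots> = (\<Sum>w\<in>labels n. exp (?K * v * zbar n w) *\<^sub>R (\<Prod>i<n. c i (w i)))"
    proof (rule sum.cong[OF refl])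
      fix w
      have "?K * v * zbar n w = (\<Sum>i<n. \<beta> * v * w i)"
        unfolding sum_distrib_left[symmetric] n_zbar[OF n, symmetric] by (simp add: mult_ac)
      then have "exp (?K * v * zbar n w) = (\<Prod>i<n. exp (\<beta> * v * w i))" by (simp add: exp_sum)
      then show "(\<Prod>i<n. exp (\<beta> * v * w i) *\<^sub>R c i (w i)) = exp (?K * v * zbar n w) *\<^sub>R (\<Prod>i<n. c i (w i))"
        by (simp add: scaleR_conv_of_real prod.distrib)
    qed
    finally show ?thesis .
  qed
  have "(p v * exp (- ?K * v\<^sup>2 / 2)) *\<^sub>R (\<Prod>i<n. exp (\<beta> * v) *\<^sub>R c i 1 + exp (- (\<beta> * v)) *\<^sub>R c i (-1))
     = (\<Sum>w\<in>labels n. (p v * exp (- ?K * v\<^sup>2 / 2 + ?K * v * zbar n w)) *\<^sub>R (\<Prod>i<n. c i (w i)))" for v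
    unfolding pr scaleR_sum_right exp_add by (simp only: scaleR_scaleR mult.assoc)
  moreover have "sqrt (2 * pi / ?K) *\<^sub>R (\<Sum>w\<in>labels n. (q (zbar n w) * exp (?K * (zbar n w)\<^sup>2 / 2)) *\<^sub>R (\<Prod>i<n. c i (w i)))
     = (\<Sum>w\<in>labels n. (q (zbar n w) * (sqrt (2 * pi / ?K) * exp (?K * (zbar n w)\<^sup>2 / 2))) *\<^sub>R (\<Prod>i<n. c i (w i)))"
    unfolding scaleR_sum_right by (simp only: scaleR_scaleR mult_ac)
  moreover have "has_bochner_integral lborel (\<lambda>v. \<Sum>w\<in>labels n. (p v * exp (- ?K * v\<^sup>2 / 2 + ?K * v * zbar n w)) *\<^sub>R (\<Prod>i<n. c i (w i)))
     (\<Sum>w\<in>labels n. (q (zbar n w) * (sqrt (2 * pi / ?K) * exp (?K * (zbar n w)\<^sup>2 / 2))) *\<^sub>R (\<Prod>i<n. c i (w i)))"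
    by (intro has_bochner_integral_sum has_bochner_integral_scaleR_left pq)
  ultimately show ?thesis by simp
qed

lemma cw_objective_eq_lncosh: "cw_objective n \<theta> \<beta> x v = \<beta> * v\<^sup>2 / 2 - (1 / real n) * (\<Sum>i<n. lncosh (\<beta> * v + \<theta> \<bullet> x i))"
  by (simp add: cw_objective_def lncosh_def)

lemma exp_cw_objective:
  assumes "n > 0"
  shows "exp (- (real n * \<beta>) * v\<^sup>2 / 2) * (\<Prod>i<n. 2 * cosh (\<beta> * v + \<theta> \<bullet> x i)) = 2 ^ n * exp (- real n * cw_objective n \<theta> \<beta> x v)"
proof -
  have "- real n * cw_objective n \<theta> \<beta> x v = - (real n * \<beta>) * v\<^sup>2 / 2 + (\<Sum>i<n. lncosh (\<beta> * v + \<theta> \<bullet> x i))"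
    using assms by (simp add: cw_objective_eq_lncosh field_simps)
  then show ?thesis by (simp only: exp_add exp_sum finite_lessThan exp_lncosh prod.distrib prod_constant card_lessThan mult_ac)
qed

lemma post_weight_prod:
  assumes "n > 0"
  shows "post_weight n \<theta> \<beta> x w = exp (real n * \<beta> * (zbar n w)\<^sup>2 / 2) * (\<Prod>i<n. exp (w i * (\<theta> \<bullet> x i)))"
  unfolding post_weight_def by (simp add: exp_add exp_sum inner_sum_right)

text \<open>Depends on n and \<beta> only, hence cancels in posterior means and also in the ratio of
  partition functions at two different \<theta>.\<close>

definition post_const :: "nat \<Rightarrow> real \<Rightarrow> real" where
  "post_const n \<beta> = 2 ^ n / sqrt (2 * pi / (real n * \<beta>))"

lemma post_const_pos: "n > 0 \<Longrightarrow> \<beta> > 0 \<Longrightarrow> post_const n \<beta> > 0"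
  by (simp add: post_const_def)

text \<open>The factor at coordinate \<open>i\<close> is \<open>2 cosh (\<beta> v + \<theta> \<bullet> x i)\<close> times \<open>r i v\<close>.\<close>
lemma post_sum_integral:
  fixes c :: "nat \<Rightarrow> real \<Rightarrow> 'a::{real_normed_field, banach, second_countable_topology}" and x :: "nat \<Rightarrow> real^'d"
  assumes n: "n > 0" and \<beta>: "\<beta> > 0"
    and pq: "\<And>y. has_bochner_integral lborel (\<lambda>v. p v * exp (- (real n * \<beta>) * v\<^sup>2 / 2 + (real n * \<beta>) * v * y))
      (q y * (sqrt (2 * pi / (real n * \<beta>)) * exp (real n * \<beta> * y\<^sup>2 / 2)))"
    and r: "\<And>i v. i < n \<Longrightarrow> exp (\<beta> * v + \<theta> \<bullet> x i) *\<^sub>R c i 1 + exp (- (\<beta> * v + \<theta> \<bullet> x i)) *\<^sub>R c i (-1) = (2 * cosh (\<beta> * v + \<theta> \<bullet> x i)) *\<^sub>R r i v"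
  shows "has_bochner_integral lborel (\<lambda>v. (p v * exp (- real n * cw_objective n \<theta> \<beta> x v)) *\<^sub>R (\<Prod>i<n. r i v))
     ((1 / post_const n \<beta>) *\<^sub>R (\<Sum>w\<in>labels n. (q (zbar n w) * post_weight n \<theta> \<beta> x w) *\<^sub>R (\<Prod>i<n. c i (w i))))"
proof -
  let ?c = "\<lambda>i y. exp (y * (\<theta> \<bullet> x i)) *\<^sub>R c i y"
  have f: "exp (\<beta> * v) *\<^sub>R ?c i 1 + exp (- (\<beta> * v)) *\<^sub>R ?c i (-1) = (2 * cosh (\<beta> * v + \<theta> \<bullet> x i)) *\<^sub>R r i v" if "i < n" for i v
    unfolding r[OF that, symmetric] by (simp add: mult_exp_exp add.commute)
  have L: "(p v * exp (- (real n * \<beta>) * v\<^sup>2 / 2)) *\<^sub>R (\<Prod>i<n. exp (\<beta> * v) *\<^sub>R ?c i 1 + exp (- (\<beta> * v)) *\<^sub>R ?c i (-1))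
     = 2 ^ n *\<^sub>R ((p v * exp (- real n * cw_objective n \<theta> \<beta> x v)) *\<^sub>R (\<Prod>i<n. r i v))" for v
  proof -
    have "(\<Prod>i<n. exp (\<beta> * v) *\<^sub>R ?c i 1 + exp (- (\<beta> * v)) *\<^sub>R ?c i (-1)) = (\<Prod>i<n. (2 * cosh (\<beta> * v + \<theta> \<bullet> x i)) *\<^sub>R r i v)"
      by (rule prod.cong) (use f in auto)
    also have "\<dots> = (\<Prod>i<n. 2 * cosh (\<beta> * v + \<theta> \<bullet> x i)) *\<^sub>R (\<Prod>i<n. r i v)"
      by (rule prod_scaleR_distrib)
    finally have "(p v * exp (- (real n * \<beta>) * v\<^sup>2 / 2)) *\<^sub>R (\<Prod>i<n. exp (\<beta> * v) *\<^sub>R ?c i 1 + exp (- (\<beta> * v)) *\<^sub>R ?c i (-1))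
      = (p v * (exp (- (real n * \<beta>) * v\<^sup>2 / 2) * (\<Prod>i<n. 2 * cosh (\<beta> * v + \<theta> \<bullet> x i)))) *\<^sub>R (\<Prod>i<n. r i v)"
      by (simp only: scaleR_scaleR mult.assoc)
    then show ?thesis unfolding exp_cw_objective[OF n] by (simp only: scaleR_scaleR mult_ac)
  qed
  have R: "(q (zbar n w) * exp (real n * \<beta> * (zbar n w)\<^sup>2 / 2)) *\<^sub>R (\<Prod>i<n. ?c i (w i)) = (q (zbar n w) * post_weight n \<theta> \<beta> x w) *\<^sub>R (\<Prod>i<n. c i (w i))" for w
    unfolding post_weight_prod[OF n] by (simp add: scaleR_conv_of_real prod.distrib)
  have "has_bochner_integral lborel (\<lambda>v. 2 ^ n *\<^sub>R ((p v * exp (- real n * cw_objective n \<theta> \<beta> x v)) *\<^sub>R (\<Prod>i<n. r i v)))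
    (sqrt (2 * pi / (real n * \<beta>)) *\<^sub>R (\<Sum>w\<in>labels n. (q (zbar n w) * post_weight n \<theta> \<beta> x w) *\<^sub>R (\<Prod>i<n. c i (w i))))"
    using hubbard_stratonovich[OF n \<beta> pq, of ?c] unfolding L R .
  from has_bochner_integral_scaleR_right[OF this, of "1 / 2 ^ n"]
  show ?thesis by (simp add: post_const_def)
qed

definition post_int :: "nat \<Rightarrow> real^'d \<Rightarrow> real \<Rightarrow> (nat \<Rightarrow> real^'d) \<Rightarrow> (real \<Rightarrow> 'b) \<Rightarrow> 'b::{banach, second_countable_topology}" where
  "post_int n \<theta> \<beta> x g = (\<integral>v. exp (- real n * cw_objective n \<theta> \<beta> x v) *\<^sub>R g v \<partial>lborel)"

context
  fixes n :: nat and \<beta> :: real and \<theta> :: "real^'d" and x :: "nat \<Rightarrow> real^'d"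
  assumes n: "n > 0" and \<beta>: "\<beta> > 0"
begin

lemma pq_one: "has_bochner_integral lborel (\<lambda>v. 1 * exp (- (real n * \<beta>) * v\<^sup>2 / 2 + (real n * \<beta>) * v * y))
      (1 * (sqrt (2 * pi / (real n * \<beta>)) * exp (real n * \<beta> * y\<^sup>2 / 2)))"
  using has_integral_gauss_quadratic(1)[of "real n * \<beta>" y] n \<beta> by simp

lemma pq_id: "has_bochner_integral lborel (\<lambda>v. v * exp (- (real n * \<beta>) * v\<^sup>2 / 2 + (real n * \<beta>) * v * y))
      (y * (sqrt (2 * pi / (real n * \<beta>)) * exp (real n * \<beta> * y\<^sup>2 / 2)))"
  using has_integral_gauss_quadratic(2)[of "real n * \<beta>" y] n \<beta> by simp

lemma post_sum_one:
  shows "integrable lborel (\<lambda>v. exp (- real n * cw_objective n \<theta> \<beta> x v))"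
    and "(\<Sum>w\<in>labels n. post_weight n \<theta> \<beta> x w) = post_const n \<beta> * post_int n \<theta> \<beta> x (\<lambda>_. 1)"
proof -
  have "has_bochner_integral lborel (\<lambda>v. (1 * exp (- real n * cw_objective n \<theta> \<beta> x v)) *\<^sub>R (\<Prod>i<n. 1::real))
     ((1 / post_const n \<beta>) *\<^sub>R (\<Sum>w\<in>labels n. (1 * post_weight n \<theta> \<beta> x w) *\<^sub>R (\<Prod>i<n. 1::real)))"
    by (rule post_sum_integral[OF n \<beta> pq_one]) (simp add: cosh_field_def)
  then show "integrable lborel (\<lambda>v. exp (- real n * cw_objective n \<theta> \<beta> x v))"
    "(\<Sum>w\<in>labels n. post_weight n \<theta> \<beta> x w) = post_const n \<beta> * post_int n \<theta> \<beta> x (\<lambda>_. 1)"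
    using post_const_pos[OF n \<beta>] by (simp_all add: has_bochner_integral_iff post_int_def)
qed

text \<open>Given the labels, the Gaussian auxiliary variable has mean zbar, so its posterior mean
  equals that of the label mean. This identity later pins the offset of the auxiliary variable from
  the minimiser.\<close>

lemma post_sum_mean:
  shows "integrable lborel (\<lambda>v. exp (- real n * cw_objective n \<theta> \<beta> x v) * v)"
    and "(\<Sum>w\<in>labels n. zbar n w * post_weight n \<theta> \<beta> x w) = post_const n \<beta> * post_int n \<theta> \<beta> x (\<lambda>v. v)"
proof -
  have "has_bochner_integral lborel (\<lambda>v. (v * exp (- real n * cw_objective n \<theta> \<beta> x v)) *\<^sub>R (\<Prod>i<n. 1::real))
     ((1 / post_const n \<beta>) *\<^sub>R (\<Sum>w\<in>labels n. (zbar n w * post_weight n \<theta> \<beta> x w) *\<^sub>R (\<Prod>i<n. 1::real)))"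
    by (rule post_sum_integral[OF n \<beta> pq_id]) (simp add: cosh_field_def)
  then show "integrable lborel (\<lambda>v. exp (- real n * cw_objective n \<theta> \<beta> x v) * v)"
    "(\<Sum>w\<in>labels n. zbar n w * post_weight n \<theta> \<beta> x w) = post_const n \<beta> * post_int n \<theta> \<beta> x (\<lambda>v. v)"
    using post_const_pos[OF n \<beta>] by (simp_all add: has_bochner_integral_iff post_int_def mult.commute)
qed

text \<open>Given the auxiliary variable, the labels are independent signs with means tanh (\<beta>
  v + \<theta> . x_j).\<close>

lemma post_sum_coord:
  assumes "j < n"
  shows "(\<Sum>w\<in>labels n. w j * post_weight n \<theta> \<beta> x w) = post_const n \<beta> * post_int n \<theta> \<beta> x (\<lambda>v. tanh (\<beta> * v + \<theta> \<bullet> x j))"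
proof -
  have "has_bochner_integral lborel (\<lambda>v. (1 * exp (- real n * cw_objective n \<theta> \<beta> x v)) *\<^sub>R (\<Prod>i<n. if i = j then tanh (\<beta> * v + \<theta> \<bullet> x i) else 1::real))
     ((1 / post_const n \<beta>) *\<^sub>R (\<Sum>w\<in>labels n. (1 * post_weight n \<theta> \<beta> x w) *\<^sub>R (\<Prod>i<n. if i = j then w i else 1::real)))"
  proof (rule post_sum_integral[OF n \<beta> pq_one])
    fix i v
    let ?b = "\<beta> * v + \<theta> \<bullet> x i"
    have "2 * cosh ?b * tanh ?b = 2 * sinh ?b" by (simp add: tanh_def)
    also have "\<dots> = exp ?b - exp (- ?b)" by (simp add: sinh_field_def)
    finally have "2 * cosh ?b * tanh ?b = exp ?b - exp (- ?b)" .
    moreover have "2 * cosh ?b = exp ?b + exp (- ?b)" by (simp add: cosh_field_def)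
    ultimately show "exp ?b *\<^sub>R (if i = j then 1 else 1) + exp (- ?b) *\<^sub>R (if i = j then - 1 else 1)
      = (2 * cosh ?b) *\<^sub>R (if i = j then tanh ?b else 1)"
      by (cases "i = j") simp_all
  qed
  then show ?thesis
    using post_const_pos[OF n \<beta>] assms by (simp add: has_bochner_integral_iff post_int_def mult.commute)
qed

text \<open>By the same conditional independence, each factor is the characteristic function at a_i
  of a sign with mean tanh (\<beta> v + \<theta> . x_i).\<close>

lemma post_sum_char:
  fixes a :: "nat \<Rightarrow> real"
  shows "(\<Sum>w\<in>labels n. post_weight n \<theta> \<beta> x w *\<^sub>R iexp (\<Sum>i<n. a i * w i))
    = post_const n \<beta> *\<^sub>R post_int n \<theta> \<beta> x (\<lambda>v. \<Prod>i<n. complex_of_real (cos (a i)) + \<i> * (sin (a i) * tanh (\<beta> * v + \<theta> \<bullet> x i)))"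
proof -
  have "has_bochner_integral lborel (\<lambda>v. (1 * exp (- real n * cw_objective n \<theta> \<beta> x v)) *\<^sub>R (\<Prod>i<n. complex_of_real (cos (a i)) + \<i> * (sin (a i) * tanh (\<beta> * v + \<theta> \<bullet> x i))))
     ((1 / post_const n \<beta>) *\<^sub>R (\<Sum>w\<in>labels n. (1 * post_weight n \<theta> \<beta> x w) *\<^sub>R (\<Prod>i<n. iexp (a i * w i))))"
  proof (rule post_sum_integral[OF n \<beta> pq_one])
    fix i v
    let ?b = "\<beta> * v + \<theta> \<bullet> x i"
    have "sinh ?b = cosh ?b * tanh ?b" by (simp add: tanh_def)
    then have e: "exp ?b = cosh ?b * (1 + tanh ?b)" "exp (- ?b) = cosh ?b * (1 - tanh ?b)"
      using cosh_plus_sinh[of ?b] cosh_minus_sinh[of ?b] by (simp_all only: ring_distribs mult_1_right)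
    show "exp ?b *\<^sub>R iexp (a i * 1) + exp (- ?b) *\<^sub>R iexp (a i * (-1)) = (2 * cosh ?b) *\<^sub>R (complex_of_real (cos (a i)) + \<i> * (sin (a i) * tanh ?b))"
      unfolding e iexp_cis by (simp add: complex_eq_iff algebra_simps)
  qed
  then show ?thesis
    using post_const_pos[OF n \<beta>]
    by (simp add: has_bochner_integral_iff post_int_def exp_sum[symmetric] sum_distrib_left)
qed

end

section \<open>Laplace's method and Taylor bounds for its factors\<close>

lemma exp_mult_le: "K * \<bar>s\<bar> \<le> c * s\<^sup>2 / 2 + K\<^sup>2 / (2 * c)" if "c > 0" for c K s :: real
proof -
  have "0 \<le> (c * \<bar>s\<bar> - K)\<^sup>2 / (2 * c)" using that by simp
  also have "\<dots> = c * s\<^sup>2 / 2 + K\<^sup>2 / (2 * c) - K * \<bar>s\<bar>" using that by (simp add: power2_diff power_mult_distrib field_simps power2_eq_square)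
  finally show ?thesis by simp
qed

text \<open>Dominated convergence: the lower bound c s^2, half of it spent on absorbing the growth
  of \<open>G\<close>, yields one Gaussian majorant on the whole line, so local and tail
  contributions are handled together.\<close>

lemma laplace_tendsto:
  fixes G :: "nat \<Rightarrow> real \<Rightarrow> 'b::{banach, second_countable_topology}"
  assumes c: "c > 0" and "\<And>k. \<phi> k \<in> borel_measurable borel" "\<And>k. G k \<in> borel_measurable borel"
    and "g \<in> borel_measurable borel"
    and lower: "\<forall>\<^sub>F k in sequentially. \<forall>s. \<phi> k s \<ge> c * s\<^sup>2"
    and growth: "\<forall>\<^sub>F k in sequentially. \<forall>s. norm (G k s) \<le> C * exp (K * \<bar>s\<bar>)"
    and lim: "\<And>s. (\<lambda>k. \<phi> k s) \<longlonglongrightarrow> \<gamma> * s\<^sup>2 / 2" "\<And>s. (\<lambda>k. G k s) \<longlonglongrightarrow> g s"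
  shows "(\<lambda>k. \<integral>s. exp (- \<phi> k s) *\<^sub>R G k s \<partial>lborel) \<longlonglongrightarrow> (\<integral>s. exp (- \<gamma> * s\<^sup>2 / 2) *\<^sub>R g s \<partial>lborel)"
proof -
  note [measurable] = assms(2-4)
  obtain k0 where k0: "\<And>k s. k \<ge> k0 \<Longrightarrow> \<phi> k s \<ge> c * s\<^sup>2" "\<And>k s. k \<ge> k0 \<Longrightarrow> norm (G k s) \<le> C * exp (K * \<bar>s\<bar>)"
    using eventually_conj[OF lower growth] by (auto simp: eventually_sequentially)
  have C0: "0 \<le> C" using k0(2)[of k0 0] order_trans[OF norm_ge_zero] by fastforce
  \<comment> \<open>The bounds hold only eventually, so the sequence is shifted by \<open>k0\<close>
    to have them at every index.\<close>
  have "(\<lambda>k. \<integral>s. exp (- \<phi> (k + k0) s) *\<^sub>R G (k + k0) s \<partial>lborel) \<longlonglongrightarrow> (\<integral>s. exp (- \<gamma> * s\<^sup>2 / 2) *\<^sub>R g s \<partial>lborel)"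
  proof (rule integral_dominated_convergence[where w="\<lambda>s. C * exp (K\<^sup>2 / (2 * c)) * exp (- c * s\<^sup>2 / 2 + c * s * 0)"])
    show "integrable lborel (\<lambda>s. C * exp (K\<^sup>2 / (2 * c)) * exp (- c * s\<^sup>2 / 2 + c * s * 0))"
      using has_integral_gauss_quadratic(1)[OF c, of 0] by (intro integrable_mult_right) (simp add: has_bochner_integral_iff)
    show "AE s in lborel. norm (exp (- \<phi> (k + k0) s) *\<^sub>R G (k + k0) s) \<le> C * exp (K\<^sup>2 / (2 * c)) * exp (- c * s\<^sup>2 / 2 + c * s * 0)" for k
    proof (rule AE_I2)
      fix s
      have "norm (exp (- \<phi> (k + k0) s) *\<^sub>R G (k + k0) s) = exp (- \<phi> (k + k0) s) * norm (G (k + k0) s)" by simp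
      also have "\<dots> \<le> exp (- (c * s\<^sup>2)) * (C * exp (K * \<bar>s\<bar>))"
        using k0[of "k + k0" s] by (intro mult_mono) auto
      also have "\<dots> = C * exp (K * \<bar>s\<bar> - c * s\<^sup>2)"
        by (simp add: mult.left_commute mult_exp_exp)
      also have "\<dots> \<le> C * exp (K\<^sup>2 / (2 * c) + (- c * s\<^sup>2 / 2 + c * s * 0))"
        using exp_mult_le[OF c, of K s] C0 by (intro mult_left_mono) auto
      also have "\<dots> = C * exp (K\<^sup>2 / (2 * c)) * exp (- c * s\<^sup>2 / 2 + c * s * 0)"
        unfolding exp_add by simp
      finally show "norm (exp (- \<phi> (k + k0) s) *\<^sub>R G (k + k0) s) \<le> C * exp (K\<^sup>2 / (2 * c)) * exp (- c * s\<^sup>2 / 2 + c * s * 0)" .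
    qed
    show "AE s in lborel. (\<lambda>k. exp (- \<phi> (k + k0) s) *\<^sub>R G (k + k0) s) \<longlonglongrightarrow> exp (- \<gamma> * s\<^sup>2 / 2) *\<^sub>R g s"
    proof (rule AE_I2)
      fix s
      have "(\<lambda>k. exp (- \<phi> k s) *\<^sub>R G k s) \<longlonglongrightarrow> exp (- (\<gamma> * s\<^sup>2 / 2)) *\<^sub>R g s"
        by (intro tendsto_intros lim)
      from LIMSEQ_ignore_initial_segment[OF this, of k0]
      show "(\<lambda>k. exp (- \<phi> (k + k0) s) *\<^sub>R G (k + k0) s) \<longlonglongrightarrow> exp (- \<gamma> * s\<^sup>2 / 2) *\<^sub>R g s" by simp
    qed
  qed measurable
  then show ?thesis by (rule LIMSEQ_offset)
qed

lemma tanh_taylor: "\<bar>tanh (b + a) - tanh b - a * sech2 b\<bar> \<le> a\<^sup>2" for a b :: real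
proof -
  define D where "D k t = (if k = 0 then tanh (b + t) else if k = 1 then sech2 (b + t) else - 2 * tanh (b + t) * sech2 (b + t))" for k :: nat and t
  have sh: "(\<lambda>t. f (b + t)) = (\<lambda>t. f (t + b))" for f :: "real \<Rightarrow> real" by (simp add: add.commute)
  have "\<forall>m t. m < 2 \<and> \<bar>t\<bar> \<le> \<bar>a\<bar> \<longrightarrow> DERIV (D m) t :> D (Suc m) t"
  proof (intro allI impI)
    fix m :: nat and t assume "m < 2 \<and> \<bar>t\<bar> \<le> \<bar>a\<bar>"
    then consider "m = 0" | "m = 1" by linarith
    then show "DERIV (D m) t :> D (Suc m) t"
      by cases (simp_all add: D_def[abs_def] sh add.commute[of b] DERIV_shift[symmetric] DERIV_tanh DERIV_sech2[simplified])
  qed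
  from Maclaurin_bi_le[of D "\<lambda>t. tanh (b + t)" 2 a, OF _ this]
  obtain t where t: "tanh (b + a) = (\<Sum>m<2. D m 0 / fact m * a ^ m) + D 2 t / fact 2 * a ^ 2"
    by (auto simp: D_def fun_eq_iff)
  have "\<bar>tanh (b + t)\<bar> * sech2 (b + t) \<le> 1 * 1"
    by (intro mult_mono abs_tanh_le_1 sech2_bounds) auto
  then have "\<bar>D 2 t\<bar> \<le> 2" using sech2_bounds(1)[of "b + t"] by (simp add: D_def abs_mult)
  have "\<bar>tanh (b + a) - tanh b - a * sech2 b\<bar> = \<bar>D 2 t\<bar> / 2 * a\<^sup>2"
    unfolding t by (simp add: D_def eval_nat_numeral abs_mult)
  also have "\<dots> \<le> 2 / 2 * a\<^sup>2" using \<open>\<bar>D 2 t\<bar> \<le> 2\<close> by (intro mult_right_mono) auto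
  finally show ?thesis by simp
qed

text \<open>Both sides have modulus at most one, being characteristic functions of a centred sign
  and of a Gaussian with the same first two moments.\<close>
lemma sign_char_factor:
  fixes a \<tau> :: real
  assumes \<tau>: "\<bar>\<tau>\<bar> \<le> 1"
  defines "L \<equiv> complex_of_real (cos a) + \<i> * (sin a * \<tau>)"
    and "R \<equiv> exp (\<i> * (a * \<tau>) - a\<^sup>2 / 2 * (1 - \<tau>\<^sup>2))"
  shows "norm L \<le> 1" "norm R \<le> 1" "norm (L - R) \<le> 4 * \<bar>a\<bar> ^ 3"
proof -
  have \<tau>2: "\<tau>\<^sup>2 \<le> 1" using \<tau> by (simp add: abs_square_le_1)
  have Lc: "L = ((1 + \<tau>) / 2) *\<^sub>R iexp a + ((1 - \<tau>) / 2) *\<^sub>R iexp (- a)"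
    unfolding L_def iexp_cis by (simp add: complex_eq_iff field_simps)
  have "norm L \<le> norm (((1 + \<tau>) / 2) *\<^sub>R iexp a) + norm (((1 - \<tau>) / 2) *\<^sub>R iexp (- a))"
    unfolding Lc by (rule norm_triangle_ineq)
  then have "norm L \<le> (1 + \<tau>) / 2 + (1 - \<tau>) / 2" using \<tau> by (simp add: abs_le_iff)
  also have "(1 + \<tau>) / 2 + (1 - \<tau>) / 2 = 1" by (simp add: field_simps)
  finally show L1: "norm L \<le> 1" .
  show R1: "norm R \<le> 1" using \<tau>2 by (simp add: R_def)
  show "norm (L - R) \<le> 4 * \<bar>a\<bar> ^ 3"
  \<comment> \<open>For |a| at least 1 the trivial bound 2 on the difference suffices; below 1 the
    fourth-order term from the real exponential is absorbed into the cube.\<close>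
  proof (cases "\<bar>a\<bar> \<ge> 1")
    case True
    then have "1 \<le> \<bar>a\<bar> ^ 3" by simp
    then show ?thesis using norm_triangle_ineq4[of L R] L1 R1 by linarith
  next
    case False
    define e where "e x = iexp x - (1 + \<i> * x - x\<^sup>2 / 2)" for x :: real
    have e: "norm (e x) \<le> \<bar>x\<bar> ^ 3 / 6" for x
      using iexp_approx1[of x 2] by (simp add: e_def eval_nat_numeral power2_eq_square algebra_simps numeral_eq_Suc)
    define y where "y = a\<^sup>2 / 2 * (1 - \<tau>\<^sup>2)"
    have y: "0 \<le> y" "y \<le> a\<^sup>2 / 2"
      using \<tau>2 by (auto simp: y_def intro!: mult_left_le)
    have ey: "\<bar>exp (- y) - (1 - y)\<bar> \<le> y\<^sup>2"
    proof -
      have "1 - y \<le> exp (- y)" using exp_ge_add_one_self[of "- y"] by simp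
      moreover have "exp (- y) \<le> 1 - y + y\<^sup>2"
      proof -
        have "1 + y \<le> exp y" using exp_ge_add_one_self[of y] by simp
        then have "exp (- y) \<le> 1 / (1 + y)" using y(1) unfolding exp_minus inverse_eq_divide by (intro divide_left_mono) auto
        also have "\<dots> \<le> 1 - y + y\<^sup>2"
          using y(1) by (simp add: field_simps power2_eq_square)
        finally show ?thesis .
      qed
      ultimately show ?thesis by simp
    qed
    \<comment> \<open>Multiplication by a unimodular phase centres the sign: its values become a (1
      - \<tau>) and - a (1 + \<tau>), the linear terms cancel, and the second moment produces 1 -
      y.\<close>
    have Le: "L * iexp (- (a * \<tau>)) = ((1 + \<tau>) / 2) *\<^sub>R iexp (a * (1 - \<tau>)) + ((1 - \<tau>) / 2) *\<^sub>R iexp (- (a * (1 + \<tau>)))"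
      unfolding Lc by (simp add: distrib_right mult_exp_exp algebra_simps)
    have Re: "R * iexp (- (a * \<tau>)) = complex_of_real (exp (- y))"
      by (simp add: R_def y_def mult_exp_exp exp_of_real[symmetric])
    have main: "L * iexp (- (a * \<tau>)) - complex_of_real (1 - y)
       = ((1 + \<tau>) / 2) *\<^sub>R e (a * (1 - \<tau>)) + ((1 - \<tau>) / 2) *\<^sub>R e (- (a * (1 + \<tau>)))"
      unfolding Le e_def y_def scaleR_conv_of_real by (simp add: field_simps power2_eq_square)
    have b: "norm (e (a * (1 - \<tau>))) \<le> 4 / 3 * \<bar>a\<bar> ^ 3" "norm (e (- (a * (1 + \<tau>)))) \<le> 4 / 3 * \<bar>a\<bar> ^ 3"
    proof -
      have "\<bar>1 - \<tau>\<bar> ^ 3 \<le> 2 ^ 3" "\<bar>1 + \<tau>\<bar> ^ 3 \<le> 2 ^ 3" using \<tau> by (intro power_mono; simp add: abs_le_iff)+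
      then have "\<bar>a\<bar> ^ 3 * \<bar>1 - \<tau>\<bar> ^ 3 \<le> \<bar>a\<bar> ^ 3 * 8" "\<bar>a\<bar> ^ 3 * \<bar>1 + \<tau>\<bar> ^ 3 \<le> \<bar>a\<bar> ^ 3 * 8"
        by (intro mult_left_mono; simp)+
      then show "norm (e (a * (1 - \<tau>))) \<le> 4 / 3 * \<bar>a\<bar> ^ 3" "norm (e (- (a * (1 + \<tau>)))) \<le> 4 / 3 * \<bar>a\<bar> ^ 3"
        using e[of "a * (1 - \<tau>)"] e[of "- (a * (1 + \<tau>))"] by (simp_all add: abs_mult power_mult_distrib)
    qed
    have "norm (L * iexp (- (a * \<tau>)) - complex_of_real (1 - y)) \<le> (1 + \<tau>) / 2 * (4 / 3 * \<bar>a\<bar> ^ 3) + (1 - \<tau>) / 2 * (4 / 3 * \<bar>a\<bar> ^ 3)"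
    proof -
      have w: "0 \<le> (1 + \<tau>) / 2" "0 \<le> (1 - \<tau>) / 2" using \<tau> by (simp_all add: abs_le_iff)
      show ?thesis
        unfolding main
        by (rule order_trans[OF norm_triangle_ineq], unfold norm_scaleR abs_of_nonneg[OF w(1)] abs_of_nonneg[OF w(2)])
           (intro add_mono mult_left_mono b w)
    qed
    also have "\<dots> = 4 / 3 * \<bar>a\<bar> ^ 3" by (simp add: field_simps)
    finally have 1: "norm (L * iexp (- (a * \<tau>)) - complex_of_real (1 - y)) \<le> 4 / 3 * \<bar>a\<bar> ^ 3" .
    have "y\<^sup>2 \<le> (a\<^sup>2 / 2)\<^sup>2" using y by (intro power_mono) auto
    also have "\<dots> = \<bar>a\<bar> * \<bar>a\<bar> ^ 3 / 4" by (simp add: power_divide eval_nat_numeral)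
    also have "\<dots> \<le> 1 * \<bar>a\<bar> ^ 3 / 4" using False by (intro divide_right_mono mult_right_mono) auto
    finally have y2: "y\<^sup>2 \<le> \<bar>a\<bar> ^ 3 / 4" by simp
    have 2: "norm (complex_of_real (1 - y) - R * iexp (- (a * \<tau>))) \<le> \<bar>a\<bar> ^ 3 / 4"
    proof -
      have "norm (complex_of_real (1 - y) - R * iexp (- (a * \<tau>))) = norm (complex_of_real (1 - y - exp (- y)))"
        unfolding Re of_real_diff ..
      also have "\<dots> = \<bar>exp (- y) - (1 - y)\<bar>" by (simp only: norm_of_real abs_minus_commute)
      finally show ?thesis using ey y2 by linarith
    qed
    have "norm (L - R) = norm ((L - R) * iexp (- (a * \<tau>)))" by (simp add: norm_mult)
    also have "\<dots> = norm ((L * iexp (- (a * \<tau>)) - complex_of_real (1 - y)) + (complex_of_real (1 - y) - R * iexp (- (a * \<tau>))))"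
      by (simp add: algebra_simps)
    also have "\<dots> \<le> 4 / 3 * \<bar>a\<bar> ^ 3 + \<bar>a\<bar> ^ 3 / 4" by (rule order_trans[OF norm_triangle_ineq add_mono[OF 1 2]])
    also have "\<dots> \<le> 4 * \<bar>a\<bar> ^ 3" by simp
    finally show ?thesis .
  qed
qed

section \<open>Empirical means\<close>

lemma emp_mean_add: "emp_mean n (\<lambda>y. F y + G y) x = emp_mean n F x + emp_mean n G x"
  by (simp add: emp_mean_def sum.distrib scaleR_add_right)

lemma emp_mean_diff: "emp_mean n (\<lambda>y. F y - G y) x = emp_mean n F x - emp_mean n G x"
  by (simp add: emp_mean_def sum_subtractf scaleR_diff_right)

lemma emp_mean_cmult: "emp_mean n (\<lambda>y. (c::real) * F y) x = c * emp_mean n F x"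
  by (simp add: emp_mean_def sum_distrib_left mult.left_commute)

lemma emp_mean_const: "n > 0 \<Longrightarrow> emp_mean n (\<lambda>y. c::real) x = c"
  by (simp add: emp_mean_def)

lemma emp_mean_mono: "(\<And>y. F y \<le> (G y::real)) \<Longrightarrow> emp_mean n F x \<le> emp_mean n G x"
  by (simp add: emp_mean_def divide_right_mono sum_mono)

lemma emp_mean_nonneg: "(\<And>y. (0::real) \<le> F y) \<Longrightarrow> 0 \<le> emp_mean n F x"
  by (simp add: emp_mean_def sum_nonneg)

lemma emp_mean_abs: "\<bar>emp_mean n F x\<bar> \<le> emp_mean n (\<lambda>y. \<bar>F y :: real\<bar>) x"
  by (simp add: emp_mean_def abs_mult divide_right_mono sum_abs)

lemma emp_mean_abs_diff:
  assumes "\<And>y. \<bar>F y - G y\<bar> \<le> (K y :: real)"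
  shows "\<bar>emp_mean n F x - emp_mean n G x\<bar> \<le> emp_mean n K x"
  using order_trans[OF emp_mean_abs[of n _ x] emp_mean_mono[OF assms]] by (simp only: emp_mean_diff)

lemma sum_eq_emp_mean: "n > 0 \<Longrightarrow> (\<Sum>i<n. F (x i)) = real n * emp_mean n F x" for F :: "real^'d \<Rightarrow> real"
  by (simp add: emp_mean_def)

lemma power2_add_le: "(a + b)\<^sup>2 \<le> 2 * a\<^sup>2 + 2 * b\<^sup>2" for a b :: real
  using zero_le_power2[of "a - b"] by (simp add: power2_sum power2_diff)

lemma tendsto_of_abs_le:
  fixes f :: "nat \<Rightarrow> real"
  assumes "\<forall>\<^sub>F k in sequentially. \<bar>f k - a k\<bar> \<le> g k" "g \<longlonglongrightarrow> 0" "a \<longlonglongrightarrow> L"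
  shows "f \<longlonglongrightarrow> L"
proof -
  have "(\<lambda>k. f k - a k) \<longlonglongrightarrow> 0"
    by (rule Lim_null_comparison[OF _ assms(2)]) (use assms(1) in simp)
  from tendsto_add[OF this assms(3)] show ?thesis by simp
qed

text \<open>The majorant of \<open>laplace_tendsto\<close> at a fixed index, so that integrals can
  be split before passing to the limit.\<close>

lemma integrable_exp_quadratic:
  fixes G :: "real \<Rightarrow> 'b::{banach, second_countable_topology}"
  assumes c: "c > 0" and [measurable]: "\<phi> \<in> borel_measurable borel" "G \<in> borel_measurable borel"
    and lower: "\<And>s. \<phi> s \<ge> c * s\<^sup>2" and growth: "\<And>s. norm (G s) \<le> C * exp (K * \<bar>s\<bar>)"
  shows "integrable lborel (\<lambda>s. exp (- \<phi> s) *\<^sub>R G s)"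
proof (rule Bochner_Integration.integrable_bound)
  have C0: "0 \<le> C" using growth[of 0] order_trans[OF norm_ge_zero] by fastforce
  show "integrable lborel (\<lambda>s. C * exp (K\<^sup>2 / (2 * c)) * exp (- c * s\<^sup>2 / 2 + c * s * 0))"
    using has_integral_gauss_quadratic(1)[OF c, of 0] by (intro integrable_mult_right) (simp add: has_bochner_integral_iff)
  show "AE s in lborel. norm (exp (- \<phi> s) *\<^sub>R G s) \<le> norm (C * exp (K\<^sup>2 / (2 * c)) * exp (- c * s\<^sup>2 / 2 + c * s * 0))"
  proof (rule AE_I2)
    fix s
    have "norm (exp (- \<phi> s) *\<^sub>R G s) = exp (- \<phi> s) * norm (G s)" by simp
    also have "\<dots> \<le> exp (- (c * s\<^sup>2)) * (C * exp (K * \<bar>s\<bar>))"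
      using lower[of s] growth[of s] by (intro mult_mono) auto
    also have "\<dots> = C * exp (K * \<bar>s\<bar> - c * s\<^sup>2)"
      by (simp add: mult.left_commute mult_exp_exp)
    also have "\<dots> \<le> C * exp (K\<^sup>2 / (2 * c) + (- c * s\<^sup>2 / 2 + c * s * 0))"
      using exp_mult_le[OF c, of K s] C0 by (intro mult_left_mono) auto
    also have "\<dots> = C * exp (K\<^sup>2 / (2 * c)) * exp (- c * s\<^sup>2 / 2 + c * s * 0)"
      unfolding exp_add by simp
    also have "\<dots> \<le> norm \<dots>" by simp
    finally show "norm (exp (- \<phi> s) *\<^sub>R G s) \<le> norm (C * exp (K\<^sup>2 / (2 * c)) * exp (- c * s\<^sup>2 / 2 + c * s * 0))" .
  qed
qed measurable

section \<open>Good data sequences\<close>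

context cw
begin

text \<open>Index 0 controls all moments up to the third, 1 to 3 the weights behind
  \<open>gamma11\<close>, \<open>lim1\<close> and \<open>lim2\<close>, and the rest the objective at
  every rational argument. Countability is what the levels of \<open>good\<close> can handle; real
  arguments follow by Lipschitz continuity.\<close>

definition tests :: "real^'d \<Rightarrow> nat \<Rightarrow> real^'d \<Rightarrow> real" where
  "tests h j = (if j = 0 then (\<lambda>y. norm y ^ 3)
     else if j = 1 then (\<lambda>y. sech2 (\<beta> * m + \<theta>0 \<bullet> y))
     else if j = 2 then (\<lambda>y. sech2 (\<beta> * m + \<theta>0 \<bullet> y) * (h \<bullet> y))
     else if j = 3 then (\<lambda>y. sech2 (\<beta> * m + \<theta>0 \<bullet> y) * (h \<bullet> y)\<^sup>2)
     else (\<lambda>y. lncosh (\<beta> * of_rat (nat_to_rat_surj (j - 4)) + \<theta>0 \<bullet> y)))"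

lemma sech2_mult_le: "\<bar>sech2 v * a\<bar> \<le> \<bar>a\<bar>"
  using sech2_bounds[of v] by (simp add: abs_mult mult_left_le_one_le)

lemma exp_bounded_sech2_1: "exp_bounded (\<lambda>y. sech2 (b + \<theta>0 \<bullet> y) * (h \<bullet> y))"
proof (rule exp_bounded_power_growth[where A="norm h" and k=1])
  show "norm (sech2 (b + \<theta>0 \<bullet> y) * (h \<bullet> y)) \<le> norm h * norm y ^ 1" for y
    using order_trans[OF sech2_mult_le Cauchy_Schwarz_ineq2[of h y]] by simp
qed auto

lemma inner_power2_le: "(h \<bullet> y)\<^sup>2 \<le> (norm h)\<^sup>2 * (norm y)\<^sup>2" for h y :: "real^'d"
proof -
  have "\<bar>h \<bullet> y\<bar>\<^sup>2 \<le> (norm h * norm y)\<^sup>2" by (intro power_mono Cauchy_Schwarz_ineq2) auto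
  then show ?thesis by (simp add: power_mult_distrib)
qed

lemma exp_bounded_sech2_2: "exp_bounded (\<lambda>y. sech2 (b + \<theta>0 \<bullet> y) * (h \<bullet> y)\<^sup>2)"
proof (rule exp_bounded_power_growth[where A="(norm h)\<^sup>2" and k=2])
  show "norm (sech2 (b + \<theta>0 \<bullet> y) * (h \<bullet> y)\<^sup>2) \<le> (norm h)\<^sup>2 * norm y ^ 2" for y
    using order_trans[OF sech2_mult_le[of _ "(h \<bullet> y)\<^sup>2"]] inner_power2_le[of h y] by simp
qed auto

lemma exp_bounded_sech2: "exp_bounded (\<lambda>y. sech2 (b + \<theta>0 \<bullet> y))"
  by (rule exp_bounded_bounded[where B=1]) (use sech2_bounds in \<open>auto simp: abs_le_iff intro: order_trans\<close>)

lemma exp_bounded_tests: "exp_bounded (tests h j)"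
proof -
  have "exp_bounded (\<lambda>y :: real^'d. norm y ^ 3)"
    by (rule exp_bounded_power_growth[where A=1 and k=3]) auto
  then show ?thesis
    using exp_bounded_sech2 exp_bounded_sech2_1 exp_bounded_sech2_2 exp_bounded_lncosh by (simp add: tests_def)
qed

definition lim1 :: "real^'d \<Rightarrow> real" where "lim1 h = (\<integral>y. sech2 (\<beta> * m + \<theta>0 \<bullet> y) * (h \<bullet> y) \<partial>MX)"

definition lim2 :: "real^'d \<Rightarrow> real" where "lim2 h = (\<integral>y. sech2 (\<beta> * m + \<theta>0 \<bullet> y) * (h \<bullet> y)\<^sup>2 \<partial>MX)"

text \<open>One unit absorbs the eventual fluctuation of the third moment, the other the comparison
  of t and t^2 with 1 + t^3.\<close>

definition mom_bound :: real where "mom_bound = (\<integral>y. norm y ^ 3 \<partial>MX) + 2"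

abbreviation \<gamma> where "\<gamma> \<equiv> gamma11 \<theta>0 \<beta>"

end

text \<open>Deterministic setting: sample sizes, data and minimisers along a sequence as it comes
  out of the contradiction argument; \<open>\<nu> k > k\<close> forces the sample sizes to
  infinity.\<close>

locale good_seq = cw \<beta> \<theta>0 for \<beta> :: real and \<theta>0 :: "real^'d" +
  fixes h :: "real^'d" and \<nu> :: "nat \<Rightarrow> nat" and X :: "nat \<Rightarrow> nat \<Rightarrow> real^'d" and u :: "nat \<Rightarrow> real"
  assumes \<nu>_gt: "\<nu> k > k"
    and tests_tendsto: "(\<lambda>k. emp_mean (\<nu> k) (tests h j) (X k)) \<longlonglongrightarrow> (\<integral>y. tests h j y \<partial>MX)"
    and u_min: "is_min (\<nu> k) (X k) (u k)"
begin

abbreviation E where "E k F \<equiv> emp_mean (\<nu> k) F (X k)"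
abbreviation N where "N k \<equiv> real (\<nu> k)"
abbreviation f where "f k v \<equiv> cw_objective (\<nu> k) \<theta>0 \<beta> (X k) v"

lemma \<nu>_pos: "\<nu> k > 0" using \<nu>_gt[of k] by simp

lemma N_pos: "N k > 0" using \<nu>_pos by simp

lemma sqrt_N_pos: "sqrt (N k) > 0" using N_pos by simp

lemma N_at_top: "filterlim N at_top sequentially"
  by (rule filterlim_at_top_mono[OF filterlim_real_sequentially]) (use \<nu>_gt in \<open>auto intro!: always_eventually less_imp_le\<close>)

lemma inv_sqrt_N: "(\<lambda>k. C / sqrt (N k)) \<longlonglongrightarrow> 0"
  by (intro tendsto_divide_0[OF tendsto_const] filterlim_at_top_imp_at_infinity filterlim_compose[OF sqrt_at_top N_at_top])

lemma moments_le_mom_bound: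
  shows "mom_bound > 0" and "\<forall>\<^sub>F k in sequentially. E k norm \<le> mom_bound"
    and "\<forall>\<^sub>F k in sequentially. E k (\<lambda>y. (norm y)\<^sup>2) \<le> mom_bound"
    and "\<forall>\<^sub>F k in sequentially. E k (\<lambda>y. norm y ^ 3) \<le> mom_bound"
proof -
  define \<mu> where "\<mu> = (\<integral>y. norm y ^ 3 \<partial>MX)"
  have \<mu>: "\<mu> \<ge> 0" unfolding \<mu>_def by (rule integral_nonneg_AE) simp
  have "(\<lambda>k. E k (\<lambda>y. norm y ^ 3)) \<longlonglongrightarrow> \<mu>" using tests_tendsto[of 0] by (simp add: tests_def \<mu>_def)
  from order_tendstoD(2)[OF this, of "\<mu> + 1"]
  have ev: "\<forall>\<^sub>F k in sequentially. E k (\<lambda>y. norm y ^ 3) < \<mu> + 1" by simp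
  have p: "t \<le> 1 + t ^ 3" "t\<^sup>2 \<le> 1 + t ^ 3" if "t \<ge> 0" for t :: real
  proof -
    show "t \<le> 1 + t ^ 3"
    proof (cases "t \<le> 1")
      case False then have "t ^ 1 \<le> t ^ 3" by (intro power_increasing) auto
      then show ?thesis by simp
    qed (use that in \<open>simp add: add_increasing2\<close>)
    show "t\<^sup>2 \<le> 1 + t ^ 3"
    proof (cases "t \<le> 1")
      case True then have "t\<^sup>2 \<le> 1" using that by (simp add: power_le_one)
      then show ?thesis using that by (simp add: add_increasing2)
    next
      case False then have "t ^ 2 \<le> t ^ 3" by (intro power_increasing) auto
      then show ?thesis by simp
    qed
  qed
  have 13: "E k norm \<le> 1 + E k (\<lambda>y. norm y ^ 3)" "E k (\<lambda>y. (norm y)\<^sup>2) \<le> 1 + E k (\<lambda>y. norm y ^ 3)" for k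
    using emp_mean_mono[of norm "\<lambda>y. 1 + norm y ^ 3" "\<nu> k" "X k"] emp_mean_mono[of "\<lambda>y. (norm y)\<^sup>2" "\<lambda>y. 1 + norm y ^ 3" "\<nu> k" "X k"]
      p \<nu>_pos[of k] by (simp_all add: emp_mean_add emp_mean_const)
  have mb: "mom_bound = \<mu> + 2" by (simp add: mom_bound_def \<mu>_def)
  show "mom_bound > 0" using mb \<mu> by simp
  show "\<forall>\<^sub>F k in sequentially. E k norm \<le> mom_bound"
    using ev unfolding mb by eventually_elim (use 13 in \<open>fastforce intro: order_trans\<close>)
  show "\<forall>\<^sub>F k in sequentially. E k (\<lambda>y. (norm y)\<^sup>2) \<le> mom_bound"
    using ev unfolding mb by eventually_elim (use 13 in \<open>fastforce intro: order_trans\<close>)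
  show "\<forall>\<^sub>F k in sequentially. E k (\<lambda>y. norm y ^ 3) \<le> mom_bound"
    using ev unfolding mb by eventually_elim simp
qed

lemma objective_eq: "f k v = \<beta> * v\<^sup>2 / 2 - E k (\<lambda>y. lncosh (\<beta> * v + \<theta>0 \<bullet> y))"
  by (rule cw_objective_eq)

lemma objective_lipschitz: "\<bar>f k a - f k b\<bar> \<le> 2 * \<beta> * \<bar>a - b\<bar>" if "a \<in> {-1..1}" "b \<in> {-1..1}"
proof -
  have "\<bar>E k (\<lambda>y. lncosh (\<beta> * a + \<theta>0 \<bullet> y)) - E k (\<lambda>y. lncosh (\<beta> * b + \<theta>0 \<bullet> y))\<bar> \<le> E k (\<lambda>_. \<beta> * \<bar>a - b\<bar>)"
  proof (rule emp_mean_abs_diff)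
    show "\<bar>lncosh (\<beta> * a + \<theta>0 \<bullet> y) - lncosh (\<beta> * b + \<theta>0 \<bullet> y)\<bar> \<le> \<beta> * \<bar>a - b\<bar>" for y
      using abs_lncosh_diff[of "\<beta> * a + \<theta>0 \<bullet> y" "\<beta> * b + \<theta>0 \<bullet> y"] \<beta>_pos
      by (simp add: abs_mult right_diff_distrib[symmetric])
  qed
  then have 1: "\<bar>E k (\<lambda>y. lncosh (\<beta> * a + \<theta>0 \<bullet> y)) - E k (\<lambda>y. lncosh (\<beta> * b + \<theta>0 \<bullet> y))\<bar> \<le> \<beta> * \<bar>a - b\<bar>"
    using \<nu>_pos by (simp add: emp_mean_const)
  have "\<bar>a + b\<bar> \<le> 2" using that by auto
  then have "\<bar>a + b\<bar> * \<bar>a - b\<bar> \<le> 2 * \<bar>a - b\<bar>" by (intro mult_right_mono) auto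
  then have "\<beta> / 2 * (\<bar>a + b\<bar> * \<bar>a - b\<bar>) \<le> \<beta> / 2 * (2 * \<bar>a - b\<bar>)" using \<beta>_pos by (intro mult_left_mono) auto
  moreover have "\<beta> * a\<^sup>2 / 2 - \<beta> * b\<^sup>2 / 2 = \<beta> / 2 * ((a + b) * (a - b))" by (simp add: power2_eq_square algebra_simps)
  moreover have "\<bar>\<beta> / 2 * ((a + b) * (a - b))\<bar> = \<beta> / 2 * (\<bar>a + b\<bar> * \<bar>a - b\<bar>)"
    unfolding abs_mult using \<beta>_pos by simp
  ultimately have 2: "\<bar>\<beta> * a\<^sup>2 / 2 - \<beta> * b\<^sup>2 / 2\<bar> \<le> \<beta> * \<bar>a - b\<bar>" by simp
  show ?thesis unfolding objective_eq using 1 2 by linarith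
qed

lemma objective_tendsto_rat: "(\<lambda>k. f k (of_rat q)) \<longlonglongrightarrow> pop (of_rat q)"
proof -
  obtain j where "q = nat_to_rat_surj j" using surj_nat_to_rat_surj by (metis surjD)
  then have "(\<lambda>k. E k (\<lambda>y. lncosh (\<beta> * of_rat q + \<theta>0 \<bullet> y))) \<longlonglongrightarrow> (\<integral>y. lncosh (\<beta> * of_rat q + \<theta>0 \<bullet> y) \<partial>MX)"
    using tests_tendsto[of "j + 4"] by (simp add: tests_def)
  then show ?thesis unfolding objective_eq pop_def by (intro tendsto_intros)
qed

text \<open>Limits on a finite rational grid extend to [-1,1] because empirical and population
  objectives share the Lipschitz constant 2 \<beta>.\<close>

lemma objective_uniform:
  assumes \<epsilon>: "\<epsilon> > 0"
  shows "\<forall>\<^sub>F k in sequentially. \<forall>v\<in>{-1..1}. \<bar>f k v - pop v\<bar> \<le> \<epsilon>"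
proof -
  \<comment> \<open>The grid spacing 1 / K is below \<epsilon> / (8 \<beta>), so moving to the grid
    costs \<epsilon> / 4 for each objective, next to \<epsilon> / 2 at the grid point.\<close>
  obtain K :: nat where K: "K > 0" "8 * \<beta> / \<epsilon> < real K"
    using reals_Archimedean2[of "max 1 (8 * \<beta> / \<epsilon>)"] by (metis max_less_iff_conj of_nat_0_less_iff less_trans zero_less_one)
  define R where "R = (\<lambda>i :: int. of_int i / of_nat K :: rat) ` {- int K..int K}"
  have "\<forall>\<^sub>F k in sequentially. \<forall>q\<in>R. \<bar>f k (of_rat q) - pop (of_rat q)\<bar> < \<epsilon> / 2"
  proof (rule eventually_ball_finite)
    show "\<forall>q\<in>R. \<forall>\<^sub>F k in sequentially. \<bar>f k (of_rat q) - pop (of_rat q)\<bar> < \<epsilon> / 2"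
      using tendstoD[OF objective_tendsto_rat, of "\<epsilon> / 2"] \<epsilon> by (simp add: dist_real_def)
  qed (simp add: R_def)
  then show ?thesis
  proof eventually_elim
    case (elim k)
    show ?case
    proof
      fix v :: real assume v: "v \<in> {-1..1}"
      define i where "i = \<lfloor>v * K\<rfloor>"
      have i: "of_int i \<le> v * K" "v * K < of_int i + 1" by (auto simp: i_def)
      have "-1 * real K \<le> v * K" "v * K \<le> 1 * real K" using v by (intro mult_right_mono; simp)+
      then have iK: "i \<in> {- int K..int K}" unfolding i_def by (auto simp: le_floor_iff floor_le_iff)
      define q where "q = (of_int i / of_nat K :: rat)"
      have q: "q \<in> R" using iK by (auto simp: R_def q_def)
      have rq: "(of_rat q :: real) = of_int i / real K" by (simp add: q_def of_rat_divide)
      have q1: "(of_rat q :: real) \<in> {-1..1}"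
      proof -
        have "- real K \<le> of_int i" "of_int i \<le> real K" using iK by (simp_all add: of_int_le_iff[of _ "int K", where 'a=real, simplified] of_int_le_iff[of "- int K", where 'a=real, simplified])
        then show ?thesis unfolding rq using K(1) by (simp add: field_simps)
      qed
      have "v - of_rat q = (v * K - of_int i) / real K" unfolding rq using K(1) by (simp add: field_simps)
      then have "\<bar>v - of_rat q\<bar> = (v * K - of_int i) / real K" using i K(1) by simp
      also have "\<dots> \<le> 1 / real K" using i by (intro divide_right_mono) auto
      finally have "\<bar>v - of_rat q\<bar> \<le> 1 / real K" .
      also have "\<dots> \<le> \<epsilon> / (8 * \<beta>)" using K \<epsilon> \<beta>_pos by (simp add: field_simps)
      finally have d: "2 * \<beta> * \<bar>v - of_rat q\<bar> \<le> \<epsilon> / 4" using \<beta>_pos by (simp add: field_simps)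
      have "\<bar>f k (of_rat q) - pop (of_rat q)\<bar> < \<epsilon> / 2" using elim q by blast
      then show "\<bar>f k v - pop v\<bar> \<le> \<epsilon>"
        using objective_lipschitz[OF v q1, of k] pop_lipschitz[OF v q1] d by linarith
    qed
  qed
qed

lemma u_range: "u k \<in> {-1..1}" and u_le: "v \<in> {-1..1} \<Longrightarrow> f k (u k) \<le> f k v"
  using u_min[of k] by (auto simp: is_min_def)

lemma m_range: "m \<in> {-1..1}" using m_pos m_lt_1 by simp

text \<open>Consistency of the minimiser: uniform closeness within c e^2 / 4 leaves
  \<open>pop (u k)\<close> at most c e^2 / 2 above \<open>pop m\<close>, and \<open>pop_gap\<close>
  turns this into distance.\<close>

lemma u_tendsto: "u \<longlonglongrightarrow> m"
proof (rule LIMSEQ_I)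
  fix e :: real assume e: "e > 0"
  obtain c where c: "c > 0" "\<And>v. v \<in> {-1..1} \<Longrightarrow> pop v - pop m \<ge> c * (v - m)\<^sup>2" using pop_gap by metis
  have "c * e\<^sup>2 / 4 > 0" using c e by simp
  from objective_uniform[OF this]
  have "\<forall>\<^sub>F k in sequentially. norm (u k - m) < e"
  proof eventually_elim
    case (elim k)
    have "c * (u k - m)\<^sup>2 \<le> pop (u k) - pop m" by (rule c(2)[OF u_range])
    also have "\<dots> \<le> c * e\<^sup>2 / 2" 
    proof -
      have "\<bar>f k (u k) - pop (u k)\<bar> \<le> c * e\<^sup>2 / 4" "\<bar>f k m - pop m\<bar> \<le> c * e\<^sup>2 / 4" using elim u_range[of k] m_range by blast+
      then show ?thesis using u_le[OF m_range, of k] by linarith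
    qed
    also have "\<dots> < c * e\<^sup>2" using c e by simp
    finally have "(u k - m)\<^sup>2 < e\<^sup>2" using c by simp
    then have "\<bar>u k - m\<bar>\<^sup>2 < e\<^sup>2" by simp
    then show ?case unfolding real_norm_def by (rule power2_less_imp_less) (use e in simp)
  qed
  then show "\<exists>no. \<forall>n\<ge>no. norm (u n - m) < e" by (simp add: eventually_sequentially)
qed

text \<open>The limit is known for the test at the fixed argument m; Lipschitz continuity in the
  argument transfers it to arguments moving towards m.\<close>

lemma tendsto_E_near:
  assumes v: "v \<longlonglongrightarrow> m" and T: "(\<lambda>k. E k T) \<longlonglongrightarrow> L"
    and d: "\<forall>\<^sub>F k in sequentially. \<bar>E k (F k) - E k T\<bar> \<le> C * \<bar>v k - m\<bar>"
  shows "(\<lambda>k. E k (F k)) \<longlonglongrightarrow> L"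
proof (rule tendsto_of_abs_le[OF d _ T])
  have "(\<lambda>k. C * \<bar>v k - m\<bar>) \<longlonglongrightarrow> C * \<bar>m - m\<bar>" by (intro tendsto_intros v)
  then show "(\<lambda>k. C * \<bar>v k - m\<bar>) \<longlonglongrightarrow> 0" by simp
qed

lemma sech2_near: "\<bar>sech2 (\<beta> * v + t) * w - sech2 (\<beta> * m + t) * w\<bar> \<le> 2 * \<beta> * \<bar>v - m\<bar> * \<bar>w\<bar>"
proof -
  have "\<bar>sech2 (\<beta> * v + t) - sech2 (\<beta> * m + t)\<bar> \<le> 2 * \<beta> * \<bar>v - m\<bar>"
    using abs_sech2_diff[of "\<beta> * v + t" "\<beta> * m + t"] \<beta>_pos by (simp add: abs_mult right_diff_distrib[symmetric])
  then have "\<bar>sech2 (\<beta> * v + t) - sech2 (\<beta> * m + t)\<bar> * \<bar>w\<bar> \<le> 2 * \<beta> * \<bar>v - m\<bar> * \<bar>w\<bar>" by (intro mult_right_mono) auto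
  then show ?thesis by (simp add: abs_mult[symmetric] left_diff_distrib)
qed

lemma sech2_tendsto:
  assumes v: "v \<longlonglongrightarrow> m"
  shows "(\<lambda>k. E k (\<lambda>y. sech2 (\<beta> * v k + \<theta>0 \<bullet> y))) \<longlonglongrightarrow> (\<integral>y. sech2 (\<beta> * m + \<theta>0 \<bullet> y) \<partial>MX)"
proof (rule tendsto_E_near[OF v, where C="2 * \<beta>" and T="\<lambda>y. sech2 (\<beta> * m + \<theta>0 \<bullet> y)"])
  show "(\<lambda>k. E k (\<lambda>y. sech2 (\<beta> * m + \<theta>0 \<bullet> y))) \<longlonglongrightarrow> (\<integral>y. sech2 (\<beta> * m + \<theta>0 \<bullet> y) \<partial>MX)"
    using tests_tendsto[of 1] by (simp add: tests_def)
  have "\<bar>E k (\<lambda>y. sech2 (\<beta> * v k + \<theta>0 \<bullet> y)) - E k (\<lambda>y. sech2 (\<beta> * m + \<theta>0 \<bullet> y))\<bar> \<le> E k (\<lambda>_. 2 * \<beta> * \<bar>v k - m\<bar>)" for k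
    using sech2_near[of "v k" _ 1] by (intro emp_mean_abs_diff) simp
  then show "\<forall>\<^sub>F k in sequentially. \<bar>E k (\<lambda>y. sech2 (\<beta> * v k + \<theta>0 \<bullet> y)) - E k (\<lambda>y. sech2 (\<beta> * m + \<theta>0 \<bullet> y))\<bar> \<le> 2 * \<beta> * \<bar>v k - m\<bar>"
    using \<nu>_pos by (simp add: emp_mean_const)
qed

lemma sech2_1_tendsto:
  assumes v: "v \<longlonglongrightarrow> m"
  shows "(\<lambda>k. E k (\<lambda>y. sech2 (\<beta> * v k + \<theta>0 \<bullet> y) * (h \<bullet> y))) \<longlonglongrightarrow> lim1 h"
proof -
  obtain M where M: "M > 0" "\<forall>\<^sub>F k in sequentially. E k norm \<le> M" using moments_le_mom_bound by metis
  show ?thesis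
  proof (rule tendsto_E_near[OF v, where C="2 * \<beta> * (norm h * M)" and T="\<lambda>y. sech2 (\<beta> * m + \<theta>0 \<bullet> y) * (h \<bullet> y)"])
    show "(\<lambda>k. E k (\<lambda>y. sech2 (\<beta> * m + \<theta>0 \<bullet> y) * (h \<bullet> y))) \<longlonglongrightarrow> lim1 h"
      using tests_tendsto[of 2] by (simp add: tests_def lim1_def)
    show "\<forall>\<^sub>F k in sequentially. \<bar>E k (\<lambda>y. sech2 (\<beta> * v k + \<theta>0 \<bullet> y) * (h \<bullet> y)) - E k (\<lambda>y. sech2 (\<beta> * m + \<theta>0 \<bullet> y) * (h \<bullet> y))\<bar>
        \<le> 2 * \<beta> * (norm h * M) * \<bar>v k - m\<bar>"
      using M(2)
    proof eventually_elim
      case (elim k)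
      have "\<bar>E k (\<lambda>y. sech2 (\<beta> * v k + \<theta>0 \<bullet> y) * (h \<bullet> y)) - E k (\<lambda>y. sech2 (\<beta> * m + \<theta>0 \<bullet> y) * (h \<bullet> y))\<bar>
        \<le> E k (\<lambda>y. (2 * \<beta> * \<bar>v k - m\<bar> * norm h) * norm y)"
      proof (rule emp_mean_abs_diff)
        fix y
        have "2 * \<beta> * \<bar>v k - m\<bar> * \<bar>h \<bullet> y\<bar> \<le> 2 * \<beta> * \<bar>v k - m\<bar> * (norm h * norm y)"
          using \<beta>_pos by (intro mult_left_mono Cauchy_Schwarz_ineq2) auto
        then show "\<bar>sech2 (\<beta> * v k + \<theta>0 \<bullet> y) * (h \<bullet> y) - sech2 (\<beta> * m + \<theta>0 \<bullet> y) * (h \<bullet> y)\<bar> \<le> 2 * \<beta> * \<bar>v k - m\<bar> * norm h * norm y"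
          using sech2_near[of "v k" "\<theta>0 \<bullet> y" "h \<bullet> y"] by (simp add: mult.assoc)
      qed
      also have "\<dots> \<le> (2 * \<beta> * \<bar>v k - m\<bar> * norm h) * M"
        unfolding emp_mean_cmult using elim \<beta>_pos by (intro mult_left_mono) auto
      finally show ?case by (simp add: mult_ac)
    qed
  qed
qed

lemma sech2_2_tendsto:
  assumes v: "v \<longlonglongrightarrow> m"
  shows "(\<lambda>k. E k (\<lambda>y. sech2 (\<beta> * v k + \<theta>0 \<bullet> y) * (h \<bullet> y)\<^sup>2)) \<longlonglongrightarrow> lim2 h"
proof -
  obtain M where M: "M > 0" "\<forall>\<^sub>F k in sequentially. E k (\<lambda>y. (norm y)\<^sup>2) \<le> M" using moments_le_mom_bound by metis
  show ?thesis
  proof (rule tendsto_E_near[OF v, where C="2 * \<beta> * ((norm h)\<^sup>2 * M)" and T="\<lambda>y. sech2 (\<beta> * m + \<theta>0 \<bullet> y) * (h \<bullet> y)\<^sup>2"])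
    show "(\<lambda>k. E k (\<lambda>y. sech2 (\<beta> * m + \<theta>0 \<bullet> y) * (h \<bullet> y)\<^sup>2)) \<longlonglongrightarrow> lim2 h"
      using tests_tendsto[of 3] by (simp add: tests_def lim2_def)
    show "\<forall>\<^sub>F k in sequentially. \<bar>E k (\<lambda>y. sech2 (\<beta> * v k + \<theta>0 \<bullet> y) * (h \<bullet> y)\<^sup>2) - E k (\<lambda>y. sech2 (\<beta> * m + \<theta>0 \<bullet> y) * (h \<bullet> y)\<^sup>2)\<bar>
        \<le> 2 * \<beta> * ((norm h)\<^sup>2 * M) * \<bar>v k - m\<bar>"
      using M(2)
    proof eventually_elim
      case (elim k)
      have "\<bar>E k (\<lambda>y. sech2 (\<beta> * v k + \<theta>0 \<bullet> y) * (h \<bullet> y)\<^sup>2) - E k (\<lambda>y. sech2 (\<beta> * m + \<theta>0 \<bullet> y) * (h \<bullet> y)\<^sup>2)\<bar>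
        \<le> E k (\<lambda>y. (2 * \<beta> * \<bar>v k - m\<bar> * (norm h)\<^sup>2) * (norm y)\<^sup>2)"
      proof (rule emp_mean_abs_diff)
        fix y
        have "2 * \<beta> * \<bar>v k - m\<bar> * \<bar>(h \<bullet> y)\<^sup>2\<bar> \<le> 2 * \<beta> * \<bar>v k - m\<bar> * ((norm h)\<^sup>2 * (norm y)\<^sup>2)"
          using \<beta>_pos inner_power2_le[of h y] by (intro mult_left_mono) auto
        then show "\<bar>sech2 (\<beta> * v k + \<theta>0 \<bullet> y) * (h \<bullet> y)\<^sup>2 - sech2 (\<beta> * m + \<theta>0 \<bullet> y) * (h \<bullet> y)\<^sup>2\<bar> \<le> 2 * \<beta> * \<bar>v k - m\<bar> * (norm h)\<^sup>2 * (norm y)\<^sup>2"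
          using sech2_near[of "v k" "\<theta>0 \<bullet> y" "(h \<bullet> y)\<^sup>2"] by (simp add: mult.assoc)
      qed
      also have "\<dots> \<le> (2 * \<beta> * \<bar>v k - m\<bar> * (norm h)\<^sup>2) * M"
        unfolding emp_mean_cmult using elim \<beta>_pos by (intro mult_left_mono) auto
      finally show ?case by (simp add: mult_ac)
    qed
  qed
qed

text \<open>Second derivative of the empirical objective at its minimiser.\<close>

definition D where "D k = \<beta> - \<beta>\<^sup>2 * E k (\<lambda>y. sech2 (\<beta> * u k + \<theta>0 \<bullet> y))"

lemma D_tendsto: "D \<longlonglongrightarrow> \<gamma>"
  unfolding D_def[abs_def] gamma11_def by (intro tendsto_intros sech2_tendsto u_tendsto)

section \<open>Second-order behaviour of the empirical objective\<close>

lemma DERIV_objective: "((\<lambda>v. f k v) has_real_derivative \<beta> * (v - E k (\<lambda>y. tanh (\<beta> * v + \<theta>0 \<bullet> y)))) (at v)"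
proof -
  have "((\<lambda>v. \<beta> * v\<^sup>2 / 2 - (1 / N k) * (\<Sum>i<\<nu> k. lncosh (\<beta> * v + \<theta>0 \<bullet> X k i))) has_real_derivative
     \<beta> * v - (1 / N k) * (\<Sum>i<\<nu> k. tanh (\<beta> * v + \<theta>0 \<bullet> X k i) * \<beta>)) (at v)"
    using N_pos[of k] by (auto intro!: derivative_eq_intros)
  then show ?thesis
    unfolding cw_objective_eq_lncosh by (simp add: emp_mean_def right_diff_distrib sum_distrib_left mult.commute)
qed

text \<open>The limit m is interior to [-1,1], so eventually the minimiser is too and the derivative
  vanishes there.\<close>

lemma u_stationary: "\<forall>\<^sub>F k in sequentially. E k (\<lambda>y. tanh (\<beta> * u k + \<theta>0 \<bullet> y)) = u k"
  using order_tendstoD[OF u_tendsto, of 0] order_tendstoD[OF u_tendsto, of 1] m_pos m_lt_1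
proof -
  have "\<forall>\<^sub>F k in sequentially. u k > 0" "\<forall>\<^sub>F k in sequentially. u k < 1"
    using order_tendstoD[OF u_tendsto] m_pos m_lt_1 by auto
  then show ?thesis
  proof eventually_elim
    case (elim k)
    have "\<beta> * (u k - E k (\<lambda>y. tanh (\<beta> * u k + \<theta>0 \<bullet> y))) = 0"
    proof (rule DERIV_local_min[OF DERIV_objective, of "min (u k) (1 - u k)"])
      show "0 < min (u k) (1 - u k)" using elim by simp
      show "\<forall>y. \<bar>u k - y\<bar> < min (u k) (1 - u k) \<longrightarrow> f k (u k) \<le> f k y"
        using elim by (auto intro!: u_le simp: abs_less_iff)
    qed
    then show ?case using \<beta>_pos by simp
  qed
qed

lemma objective_taylor:
  assumes "E k (\<lambda>y. tanh (\<beta> * u k + \<theta>0 \<bullet> y)) = u k"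
  shows "\<bar>f k (u k + d) - f k (u k) - D k * d\<^sup>2 / 2\<bar> \<le> \<beta> ^ 3 * \<bar>d\<bar> ^ 3 / 3"
proof -
  let ?b = "\<lambda>y. \<beta> * u k + \<theta>0 \<bullet> y"
  have "\<bar>E k (\<lambda>y. lncosh (?b y + \<beta> * d) - lncosh (?b y)) - E k (\<lambda>y. \<beta> * d * tanh (?b y) + (\<beta> * d)\<^sup>2 / 2 * sech2 (?b y))\<bar> \<le> E k (\<lambda>_. \<bar>\<beta> * d\<bar> ^ 3 / 3)"
    using lncosh_taylor[of "?b y" "\<beta> * d" for y] by (intro emp_mean_abs_diff) (simp only: diff_diff_eq add.assoc)
  also have "E k (\<lambda>_. \<bar>\<beta> * d\<bar> ^ 3 / 3) = \<beta> ^ 3 * \<bar>d\<bar> ^ 3 / 3"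
    using \<nu>_pos \<beta>_pos by (simp add: emp_mean_const abs_mult power_mult_distrib)
  finally have *: "\<bar>E k (\<lambda>y. lncosh (?b y + \<beta> * d)) - E k (\<lambda>y. lncosh (?b y)) - (\<beta> * d * u k + (\<beta> * d)\<^sup>2 / 2 * E k (\<lambda>y. sech2 (?b y)))\<bar> \<le> \<beta> ^ 3 * \<bar>d\<bar> ^ 3 / 3"
    unfolding emp_mean_diff emp_mean_add emp_mean_cmult assms .
  have "(\<lambda>y. lncosh (\<beta> * (u k + d) + \<theta>0 \<bullet> y)) = (\<lambda>y. lncosh (?b y + \<beta> * d))" by (simp add: algebra_simps)
  then have "f k (u k + d) - f k (u k) - D k * d\<^sup>2 / 2
     = - (E k (\<lambda>y. lncosh (?b y + \<beta> * d)) - E k (\<lambda>y. lncosh (?b y)) - (\<beta> * d * u k + (\<beta> * d)\<^sup>2 / 2 * E k (\<lambda>y. sech2 (?b y))))"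
    unfolding objective_eq D_def by (simp add: power2_eq_square field_simps)
  then show ?thesis using * by (simp only: abs_minus)
qed

text \<open>Beyond [-1,1] the growth of \<beta> v^2 / 2 beats the Lipschitz constant \<beta> of the
  ln cosh average. The minimiser ranges over [-1,1], but the Hubbard-Stratonovich integral over the
  whole line.\<close>

lemma objective_outside: "f k v \<ge> f k (sgn v) + \<beta> / 2 * (\<bar>v\<bar> - 1)\<^sup>2" if "\<bar>v\<bar> > 1"
proof -
  define \<sigma> where "\<sigma> = sgn v"
  have v: "v = \<sigma> * \<bar>v\<bar>" "\<bar>\<sigma>\<bar> = 1" "\<sigma>\<^sup>2 = 1" using that by (auto simp: \<sigma>_def sgn_mult_abs sgn_if power2_eq_square)
  have "E k (\<lambda>y. lncosh (\<beta> * v + \<theta>0 \<bullet> y)) \<le> E k (\<lambda>y. lncosh (\<beta> * \<sigma> + \<theta>0 \<bullet> y) + \<beta> * (\<bar>v\<bar> - 1))"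
  proof (rule emp_mean_mono)
    fix y
    have "\<bar>\<beta> * v - \<beta> * \<sigma>\<bar> = \<beta> * (\<bar>v\<bar> - 1)"
    proof -
      have "\<beta> * v - \<beta> * \<sigma> = \<beta> * \<sigma> * (\<bar>v\<bar> - 1)" using v(1) by (simp add: algebra_simps)
      then show ?thesis using v(2) \<beta>_pos that by (simp add: abs_mult)
    qed
    then show "lncosh (\<beta> * v + \<theta>0 \<bullet> y) \<le> lncosh (\<beta> * \<sigma> + \<theta>0 \<bullet> y) + \<beta> * (\<bar>v\<bar> - 1)"
      using abs_lncosh_diff[of "\<beta> * v + \<theta>0 \<bullet> y" "\<beta> * \<sigma> + \<theta>0 \<bullet> y"] by simp
  qed
  also have "\<dots> = E k (\<lambda>y. lncosh (\<beta> * \<sigma> + \<theta>0 \<bullet> y)) + \<beta> * (\<bar>v\<bar> - 1)"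
    using \<nu>_pos by (simp add: emp_mean_add emp_mean_const)
  finally have "f k v \<ge> \<beta> * \<bar>v\<bar>\<^sup>2 / 2 - E k (\<lambda>y. lncosh (\<beta> * \<sigma> + \<theta>0 \<bullet> y)) - \<beta> * (\<bar>v\<bar> - 1)"
    unfolding objective_eq by simp
  moreover have "f k \<sigma> = \<beta> / 2 - E k (\<lambda>y. lncosh (\<beta> * \<sigma> + \<theta>0 \<bullet> y))" unfolding objective_eq using v(3) by simp
  moreover have "\<beta> / 2 * (\<bar>v\<bar> - 1)\<^sup>2 = \<beta> * \<bar>v\<bar>\<^sup>2 / 2 - \<beta> / 2 - \<beta> * (\<bar>v\<bar> - 1)" by (simp add: power2_diff field_simps)
  ultimately show ?thesis unfolding \<sigma>_def[symmetric] by linarith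
qed

text \<open>Three regimes: Taylor expansion within distance r of the minimiser, uniform convergence
  with \<open>pop_gap\<close> on the rest of [-1,1], and \<open>objective_outside\<close>
  beyond.\<close>

lemma objective_quadratic:
  obtains c where "c > 0" "\<forall>\<^sub>F k in sequentially. \<forall>v. f k v - f k (u k) \<ge> c * (v - u k)\<^sup>2"
proof -
  obtain c0 where c0: "c0 > 0" "\<And>v. v \<in> {-1..1} \<Longrightarrow> pop v - pop m \<ge> c0 * (v - m)\<^sup>2" using pop_gap by metis
  have \<gamma>: "\<gamma> > 0" by (rule gamma11_pos)
  \<comment> \<open>With this radius the cubic remainder is at most \<gamma> / 8 times the square,
    against \<gamma> / 4 from the quadratic term.\<close>
  define r where "r = 3 * \<gamma> / (8 * \<beta> ^ 3)"
  have r: "r > 0" using \<gamma> \<beta>_pos by (simp add: r_def)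
  \<comment> \<open>At distance r / 2 from m the population gap is c0 r^2 / 4; two errors \<epsilon>
    leave half of it.\<close>
  define \<epsilon> where "\<epsilon> = c0 * r\<^sup>2 / 16"
  have \<epsilon>: "\<epsilon> > 0" using c0 r by (simp add: \<epsilon>_def)
  \<comment> \<open>Distances within [-1,1] are at most 2, hence the factor 4 between the remaining
    gap c0 r^2 / 8 and c0 r^2 / 32.\<close>
  define c1 where "c1 = min (\<gamma> / 8) (c0 * r\<^sup>2 / 32)"
  have c1: "c1 > 0" "c1 \<le> \<gamma> / 8" "c1 \<le> c0 * r\<^sup>2 / 32" using \<gamma> c0 r by (auto simp: c1_def)
  \<comment> \<open>The halving pays for (x + y)^2 at most 2 x^2 + 2 y^2 when v lies outside [-1,1]
    and is compared through the endpoint \<open>sgn v\<close>.\<close>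
  define c where "c = min c1 (\<beta> / 2) / 2"
  have c: "c > 0" "c \<le> c1" "2 * c \<le> c1" "2 * c \<le> \<beta> / 2" using c1 \<beta>_pos by (auto simp: c_def)
  have evD: "\<forall>\<^sub>F k in sequentially. D k > \<gamma> / 2" using order_tendstoD(1)[OF D_tendsto, of "\<gamma> / 2"] \<gamma> by simp
  have evu: "\<forall>\<^sub>F k in sequentially. \<bar>u k - m\<bar> < r / 2" using tendstoD[OF u_tendsto, of "r / 2"] r by (simp add: dist_real_def)
  have "\<forall>\<^sub>F k in sequentially. \<forall>v. f k v - f k (u k) \<ge> c * (v - u k)\<^sup>2"
    using evD evu objective_uniform[OF \<epsilon>] u_stationary
  proof eventually_elim
    case (elim k)
    have inside: "f k v - f k (u k) \<ge> c1 * (v - u k)\<^sup>2" if v: "v \<in> {-1..1}" for v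
    proof (cases "\<bar>v - u k\<bar> \<le> r")
      case True
      let ?d = "v - u k"
      have "\<beta> ^ 3 * \<bar>?d\<bar> ^ 3 / 3 = \<beta> ^ 3 / 3 * \<bar>?d\<bar> * ?d\<^sup>2" by (simp add: eval_nat_numeral)
      also have "\<dots> \<le> \<beta> ^ 3 / 3 * r * ?d\<^sup>2" using True \<beta>_pos by (intro mult_right_mono mult_left_mono) auto
      also have "\<dots> = \<gamma> / 8 * ?d\<^sup>2" using \<beta>_pos by (simp add: r_def)
      finally have 1: "\<beta> ^ 3 * \<bar>?d\<bar> ^ 3 / 3 \<le> \<gamma> / 8 * ?d\<^sup>2" .
      have "\<gamma> / 4 * ?d\<^sup>2 \<le> D k / 2 * ?d\<^sup>2" using elim(1) by (intro mult_right_mono) auto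
      then have 2: "\<gamma> / 4 * ?d\<^sup>2 \<le> D k * ?d\<^sup>2 / 2" by simp
      have 3: "c1 * ?d\<^sup>2 \<le> \<gamma> / 8 * ?d\<^sup>2" using c1 by (intro mult_right_mono) auto
      have 4: "f k v - f k (u k) - D k * ?d\<^sup>2 / 2 \<ge> - (\<beta> ^ 3 * \<bar>?d\<bar> ^ 3 / 3)"
      proof -
        have "u k + ?d = v" by simp
        then show ?thesis using objective_taylor[OF elim(4), of ?d] by (metis abs_le_D2 minus_le_iff)
      qed
      show ?thesis using 1 2 3 4 by (simp add: field_simps)
    next
      case False
      then have "r / 2 \<le> \<bar>v - m\<bar>" using elim(2) by linarith
      then have "(r / 2)\<^sup>2 \<le> \<bar>v - m\<bar>\<^sup>2" using r by (intro power_mono) auto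
      then have "c0 * (r\<^sup>2 / 4) \<le> c0 * (v - m)\<^sup>2" using c0 by (intro mult_left_mono) (auto simp: power_divide)
      then have "pop v - pop m \<ge> c0 * r\<^sup>2 / 4" using c0(2)[OF v] by simp
      moreover have "\<bar>f k v - pop v\<bar> \<le> \<epsilon>" "\<bar>f k m - pop m\<bar> \<le> \<epsilon>" using elim(3) v m_range by auto
      moreover have "f k (u k) \<le> f k m" by (rule u_le[OF m_range])
      ultimately have 1: "f k v - f k (u k) \<ge> c0 * r\<^sup>2 / 8" unfolding \<epsilon>_def by linarith
      have "\<bar>v - u k\<bar>\<^sup>2 \<le> 2\<^sup>2" using v u_range[of k] by (intro power_mono) auto
      then have "c1 * (v - u k)\<^sup>2 \<le> c0 * r\<^sup>2 / 32 * 4" using c1 by (intro mult_mono) auto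
      then show ?thesis using 1 by simp
    qed
    show ?case
    proof
      fix v
      show "f k v - f k (u k) \<ge> c * (v - u k)\<^sup>2"
      proof (cases "\<bar>v\<bar> \<le> 1")
        case True
        have "c * (v - u k)\<^sup>2 \<le> c1 * (v - u k)\<^sup>2" using c by (intro mult_right_mono) auto
        then show ?thesis using inside[of v] True by (auto simp: abs_le_iff)
      next
        case False
        then have v1: "\<bar>v\<bar> > 1" by simp
        have s: "sgn v \<in> {-1..1}" "\<bar>v - sgn v\<bar> = \<bar>v\<bar> - 1" using v1 by (auto simp: sgn_if)
        have "(v - u k)\<^sup>2 = ((v - sgn v) + (sgn v - u k))\<^sup>2" by simp
        also have "\<dots> \<le> 2 * (v - sgn v)\<^sup>2 + 2 * (sgn v - u k)\<^sup>2"
          by (rule power2_add_le)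
        also have "(v - sgn v)\<^sup>2 = (\<bar>v\<bar> - 1)\<^sup>2" by (metis s(2) power2_abs)
        finally have "c * (v - u k)\<^sup>2 \<le> c * (2 * (\<bar>v\<bar> - 1)\<^sup>2 + 2 * (sgn v - u k)\<^sup>2)" using c by (intro mult_left_mono) auto
        also have "\<dots> = 2 * c * (\<bar>v\<bar> - 1)\<^sup>2 + 2 * c * (sgn v - u k)\<^sup>2" by (simp add: algebra_simps)
        also have "\<dots> \<le> \<beta> / 2 * (\<bar>v\<bar> - 1)\<^sup>2 + c1 * (sgn v - u k)\<^sup>2" using c by (intro add_mono mult_right_mono) auto
        also have "\<dots> \<le> f k v - f k (u k)" using objective_outside[OF v1, of k] inside[OF s(1)] by linarith
        finally show ?thesis .
      qed
    qed
  qed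
  then show thesis using that c by blast
qed

end

section \<open>Laplace expansion along good data\<close>

definition dens_const :: "nat \<Rightarrow> real^'d \<Rightarrow> real \<Rightarrow> (nat \<Rightarrow> real^'d) \<Rightarrow> real" where
  "dens_const n \<theta> \<beta> x = (\<Prod>i<n. gauss_dens (x i)) * exp (- real n * (norm \<theta>)\<^sup>2 / 2) / (\<Sum>w\<in>labels n. cw_weight n \<beta> w)"

text \<open>Labels square to 1, so the quadratic terms of the shifted Gaussians are the same for
  every label vector and only the linear one, which is the posterior exponent, remains.\<close>

lemma cw_dens_term:
  assumes z: "z \<in> labels n"
  shows "cw_prior n \<beta> z * (\<Prod>i<n. gauss_dens (x i - z i *\<^sub>R \<theta>)) = dens_const n \<theta> \<beta> x * post_weight n \<theta> \<beta> x z"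
proof -
  have "(\<Prod>i<n. gauss_dens (x i - z i *\<^sub>R \<theta>)) = (\<Prod>i<n. gauss_dens (x i) * exp (\<theta> \<bullet> (z i *\<^sub>R x i) - (norm \<theta>)\<^sup>2 / 2))"
  proof (rule prod.cong[OF refl])
    fix i assume "i \<in> {..<n}"
    then have "(z i)\<^sup>2 = 1" using labels_abs_1[OF z, of i] by auto
    then show "gauss_dens (x i - z i *\<^sub>R \<theta>) = gauss_dens (x i) * exp (\<theta> \<bullet> (z i *\<^sub>R x i) - (norm \<theta>)\<^sup>2 / 2)"
      unfolding gauss_dens_shift by (simp add: power_mult_distrib)
  qed
  also have "\<dots> = (\<Prod>i<n. gauss_dens (x i)) * exp (\<Sum>i<n. \<theta> \<bullet> (z i *\<^sub>R x i) - (norm \<theta>)\<^sup>2 / 2)"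
    by (simp only: prod.distrib exp_sum finite_lessThan)
  also have "(\<Sum>i<n. \<theta> \<bullet> (z i *\<^sub>R x i) - (norm \<theta>)\<^sup>2 / 2) = - real n * (norm \<theta>)\<^sup>2 / 2 + \<theta> \<bullet> (\<Sum>i<n. z i *\<^sub>R x i)"
    by (simp add: sum_subtractf inner_sum_right)
  finally have "(\<Prod>i<n. gauss_dens (x i - z i *\<^sub>R \<theta>))
     = (\<Prod>i<n. gauss_dens (x i)) * (exp (- real n * (norm \<theta>)\<^sup>2 / 2) * exp (\<theta> \<bullet> (\<Sum>i<n. z i *\<^sub>R x i)))"
    by (simp only: exp_add)
  moreover have "post_weight n \<theta> \<beta> x z = cw_weight n \<beta> z * exp (\<theta> \<bullet> (\<Sum>i<n. z i *\<^sub>R x i))"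
    unfolding post_weight_def cw_weight_def by (rule exp_add)
  ultimately show ?thesis unfolding dens_const_def cw_prior_def by simp
qed

lemma cw_dens_eq: "cw_dens n \<theta> \<beta> x = dens_const n \<theta> \<beta> x * (\<Sum>w\<in>labels n. post_weight n \<theta> \<beta> x w)"
  unfolding cw_dens_def sum_distrib_left by (rule sum.cong[OF refl cw_dens_term])

lemma post_weight_sum_pos: "(\<Sum>w\<in>labels n. post_weight n \<theta> \<beta> x w) > 0"
  by (rule sum_pos) (auto simp: labels_nonempty post_weight_def)

lemma ln_exp_mult: "r > 0 \<Longrightarrow> ln (exp t * r) = t + ln r" for r t :: real
  by (simp add: ln_mult)

text \<open>Both laws share the Gaussian base density and the prior normaliser; what survives is the
  norm term of \<open>dens_const\<close> and a ratio of posterior partition functions, which the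
  Laplace expansion can reach.\<close>

lemma log_lr_eq:
  "log_lr n \<theta>1 \<theta> \<beta> x = - real n * ((norm \<theta>1)\<^sup>2 - (norm \<theta>)\<^sup>2) / 2
     + ln ((\<Sum>w\<in>labels n. post_weight n \<theta>1 \<beta> x w) / (\<Sum>w\<in>labels n. post_weight n \<theta> \<beta> x w))"
proof -
  have p: "(\<Prod>i<n. gauss_dens (x i)) > 0" by (intro prod_pos) (simp add: gauss_dens_pos)
  have "cw_dens n \<theta>1 \<beta> x / cw_dens n \<theta> \<beta> x = exp (- real n * (norm \<theta>1)\<^sup>2 / 2) / exp (- real n * (norm \<theta>)\<^sup>2 / 2)
     * ((\<Sum>w\<in>labels n. post_weight n \<theta>1 \<beta> x w) / (\<Sum>w\<in>labels n. post_weight n \<theta> \<beta> x w))"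
  proof -
    have "(P * A / W * S) / (P * B / W * T) = A / B * (S / T)" if "P > 0" "W > 0" for P A W S B T :: real
      using that by simp
    from this[OF p cw_weight_sum_pos[of n \<beta>]] show ?thesis unfolding cw_dens_eq dens_const_def .
  qed
  also have "exp (- real n * (norm \<theta>1)\<^sup>2 / 2) / exp (- real n * (norm \<theta>)\<^sup>2 / 2) = exp (- real n * ((norm \<theta>1)\<^sup>2 - (norm \<theta>)\<^sup>2) / 2)"
    unfolding exp_diff[symmetric] by (simp add: field_simps)
  finally show ?thesis
    unfolding log_lr_def using ln_exp_mult[OF divide_pos_pos[OF post_weight_sum_pos[of n \<theta>1 \<beta> x] post_weight_sum_pos[of n \<theta> \<beta> x]]]
    by (simp only:)
qed

definition char_post :: "nat \<Rightarrow> real^'d \<Rightarrow> real \<Rightarrow> real^'d \<Rightarrow> (nat \<Rightarrow> real^'d) \<Rightarrow> complex" where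
  "char_post n \<theta> \<beta> h x = (\<Sum>w\<in>labels n. post_weight n \<theta> \<beta> x w *\<^sub>R iexp (\<Sum>i<n. (h \<bullet> x i) / sqrt (real n) * w i))
     / complex_of_real (\<Sum>w\<in>labels n. post_weight n \<theta> \<beta> x w)"

context cw
begin

text \<open>Second moment of the limiting Gaussian of the rescaled auxiliary variable. It is fixed
  by \<beta> and \<theta>0, so the transfer to probability gets one constant for all good
  sequences.\<close>

definition var_bound :: real where
  "var_bound = (\<integral>s. exp (- \<gamma> * s\<^sup>2 / 2) *\<^sub>R s\<^sup>2 \<partial>lborel) / sqrt (2 * pi / \<gamma>)"

text \<open>Each posterior mean deviates from its tanh by at most (2 \<beta>^4 / \<gamma> +
  \<beta>^2) V / n with V eventually below \<open>var_bound + 1\<close>, and the norms of the data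
  average to at most \<open>mom_bound\<close>.\<close>

definition mean_bound :: real where
  "mean_bound = (2 * \<beta> ^ 4 / \<gamma> + \<beta>\<^sup>2) * (var_bound + 1) * mom_bound"

end

section \<open>Rescaled Laplace integrals along a good sequence\<close>

context good_seq
begin

definition v where "v k s = u k + s / sqrt (N k)"

definition \<phi> where "\<phi> k s = N k * (f k (v k s) - f k (u k))"

lemma v_tendsto: "(\<lambda>k. v k s) \<longlonglongrightarrow> m"
  unfolding v_def using tendsto_add[OF u_tendsto inv_sqrt_N[of s]] by simp

lemma v_measurable [measurable]: "v k \<in> borel_measurable borel"
  unfolding v_def[abs_def] by measurable

lemma \<phi>_measurable [measurable]: "\<phi> k \<in> borel_measurable borel"
  unfolding \<phi>_def[abs_def] cw_objective_eq_lncosh by measurable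

lemma \<phi>_lower: obtains c where "c > 0" "\<forall>\<^sub>F k in sequentially. \<forall>s. \<phi> k s \<ge> c * s\<^sup>2"
proof -
  obtain c where c: "c > 0" "\<forall>\<^sub>F k in sequentially. \<forall>v. f k v - f k (u k) \<ge> c * (v - u k)\<^sup>2"
    using objective_quadratic by blast
  from c(2) have "\<forall>\<^sub>F k in sequentially. \<forall>s. \<phi> k s \<ge> c * s\<^sup>2"
  proof eventually_elim
    case (elim k)
    show ?case
    proof
      fix s
      have "c * s\<^sup>2 = N k * (c * (v k s - u k)\<^sup>2)" using N_pos[of k] by (simp add: v_def power_divide)
      also have "\<dots> \<le> \<phi> k s" unfolding \<phi>_def using elim by (intro mult_left_mono) auto
      finally show "\<phi> k s \<ge> c * s\<^sup>2" .
    qed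
  qed
  then show thesis using that c(1) by blast
qed

text \<open>The linear term vanishes by stationarity; the cubic remainder, n times (s / sqrt n)^3,
  is of order 1 / sqrt n.\<close>

lemma \<phi>_tendsto: "(\<lambda>k. \<phi> k s) \<longlonglongrightarrow> \<gamma> * s\<^sup>2 / 2"
proof (rule tendsto_of_abs_le)
  show "(\<lambda>k. D k * s\<^sup>2 / 2) \<longlonglongrightarrow> \<gamma> * s\<^sup>2 / 2" by (intro tendsto_intros D_tendsto) simp
  show "(\<lambda>k. (\<beta> ^ 3 * \<bar>s\<bar> ^ 3 / 3) / sqrt (N k)) \<longlonglongrightarrow> 0" by (rule inv_sqrt_N)
  show "\<forall>\<^sub>F k in sequentially. \<bar>\<phi> k s - D k * s\<^sup>2 / 2\<bar> \<le> (\<beta> ^ 3 * \<bar>s\<bar> ^ 3 / 3) / sqrt (N k)"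
    using u_stationary
  proof eventually_elim
    case (elim k)
    let ?d = "s / sqrt (N k)"
    have "\<phi> k s - D k * s\<^sup>2 / 2 = N k * (f k (u k + ?d) - f k (u k) - D k * ?d\<^sup>2 / 2)"
      using N_pos[of k] by (simp add: \<phi>_def v_def power_divide algebra_simps)
    then have "\<bar>\<phi> k s - D k * s\<^sup>2 / 2\<bar> = N k * \<bar>f k (u k + ?d) - f k (u k) - D k * ?d\<^sup>2 / 2\<bar>"
      using N_pos[of k] by (simp add: abs_mult)
    also have "\<dots> \<le> N k * (\<beta> ^ 3 * \<bar>?d\<bar> ^ 3 / 3)" by (intro mult_left_mono objective_taylor elim) simp
    also have "\<bar>?d\<bar> ^ 3 = \<bar>s\<bar> ^ 3 / (N k * sqrt (N k))"
      using N_pos[of k] by (simp add: abs_divide power_divide eval_nat_numeral)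
    finally show ?case using N_pos[of k] by simp
  qed
qed

lemma laplace_good:
  fixes G :: "nat \<Rightarrow> real \<Rightarrow> 'b::{banach, second_countable_topology}"
  assumes "\<And>k. G k \<in> borel_measurable borel" "g \<in> borel_measurable borel"
    and "\<forall>\<^sub>F k in sequentially. \<forall>s. norm (G k s) \<le> C * exp (K * \<bar>s\<bar>)"
    and "\<And>s. (\<lambda>k. G k s) \<longlonglongrightarrow> g s"
  shows "(\<lambda>k. \<integral>s. exp (- \<phi> k s) *\<^sub>R G k s \<partial>lborel) \<longlonglongrightarrow> (\<integral>s. exp (- \<gamma> * s\<^sup>2 / 2) *\<^sub>R g s \<partial>lborel)"
proof -
  obtain c where c: "c > 0" "\<forall>\<^sub>F k in sequentially. \<forall>s. \<phi> k s \<ge> c * s\<^sup>2" using \<phi>_lower by blast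
  show ?thesis by (rule laplace_tendsto[OF c(1) \<phi>_measurable assms(1,2) c(2) assms(3) \<phi>_tendsto assms(4)])
qed

definition Z where "Z k = (\<integral>s. exp (- \<phi> k s) \<partial>lborel)"

lemma Z_tendsto: "Z \<longlonglongrightarrow> sqrt (2 * pi / \<gamma>)"
proof -
  have "(\<lambda>k. \<integral>s. exp (- \<phi> k s) *\<^sub>R (1::real) \<partial>lborel) \<longlonglongrightarrow> (\<integral>s. exp (- \<gamma> * s\<^sup>2 / 2) *\<^sub>R (1::real) \<partial>lborel)"
    by (rule laplace_good[where C=1 and K=0]) auto
  moreover have "(\<integral>s. exp (- \<gamma> * s\<^sup>2 / 2) \<partial>lborel) = sqrt (2 * pi / \<gamma>)"
    using has_integral_gauss_quadratic(1)[OF gamma11_pos, of 0] by (simp add: has_bochner_integral_iff)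
  ultimately show ?thesis by (simp add: Z_def[abs_def])
qed

lemma limZ_pos: "sqrt (2 * pi / \<gamma>) > 0" using gamma11_pos by simp

lemma Z_pos: "\<forall>\<^sub>F k in sequentially. Z k > 0"
  using order_tendstoD(1)[OF Z_tendsto limZ_pos] .

text \<open>Substitution of u + s / sqrt n for the auxiliary variable. The prefactor is common to
  all posterior integrals at \<theta>0 and drops out of their ratios.\<close>

lemma post_int_eq:
  fixes g :: "real \<Rightarrow> 'b::{banach, second_countable_topology}"
  shows "post_int (\<nu> k) \<theta>0 \<beta> (X k) g = (exp (- N k * f k (u k)) / sqrt (N k)) *\<^sub>R (\<integral>s. exp (- \<phi> k s) *\<^sub>R g (v k s) \<partial>lborel)"
proof -
  have e: "exp (- N k * f k (v k s)) = exp (- N k * f k (u k)) * exp (- \<phi> k s)" for s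
    unfolding mult_exp_exp \<phi>_def by (simp add: algebra_simps)
  have "post_int (\<nu> k) \<theta>0 \<beta> (X k) g = \<bar>1 / sqrt (N k)\<bar> *\<^sub>R (\<integral>s. exp (- N k * f k (u k + 1 / sqrt (N k) * s)) *\<^sub>R g (u k + 1 / sqrt (N k) * s) \<partial>lborel)"
    unfolding post_int_def using sqrt_N_pos[of k] by (intro lborel_integral_real_affine) simp
  also have "(\<lambda>s. exp (- N k * f k (u k + 1 / sqrt (N k) * s)) *\<^sub>R g (u k + 1 / sqrt (N k) * s))
     = (\<lambda>s. exp (- N k * f k (u k)) *\<^sub>R (exp (- \<phi> k s) *\<^sub>R g (v k s)))"
    using e by (simp add: fun_eq_iff v_def)
  finally have "post_int (\<nu> k) \<theta>0 \<beta> (X k) g = \<bar>1 / sqrt (N k)\<bar> *\<^sub>R (exp (- N k * f k (u k)) *\<^sub>R (\<integral>s. exp (- \<phi> k s) *\<^sub>R g (v k s) \<partial>lborel))"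
    by (simp only: integral_scaleR_right)
  then show ?thesis by simp
qed

lemma post_int_one: "post_int (\<nu> k) \<theta>0 \<beta> (X k) (\<lambda>_. 1) = exp (- N k * f k (u k)) / sqrt (N k) * Z k"
  unfolding post_int_eq Z_def by simp

definition a where "a k i = (h \<bullet> X k i) / sqrt (N k)"

definition b where "b k t i = \<beta> * t + \<theta>0 \<bullet> X k i"

text \<open>The leading random term, evaluated at the minimiser: h . Delta up to the shift sqrt n (h
  . \<theta>0). It is split off before limits are taken.\<close>

definition lin where "lin k = (\<Sum>i<\<nu> k. a k i * tanh (b k (u k) i))"

definition drift where "drift k s = (\<Sum>i<\<nu> k. a k i * (tanh (b k (v k s) i) - tanh (b k (u k) i)))"

definition quad where "quad k s = (\<Sum>i<\<nu> k. (a k i)\<^sup>2 * sech2 (b k (v k s) i))"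

lemma E_inner_le: "E k (\<lambda>y. \<bar>h \<bullet> y\<bar>) \<le> norm h * E k norm"
  unfolding emp_mean_cmult[symmetric] by (intro emp_mean_mono Cauchy_Schwarz_ineq2)

lemma sum_abs_a: "(\<Sum>i<\<nu> k. \<bar>a k i\<bar>) = sqrt (N k) * E k (\<lambda>y. \<bar>h \<bullet> y\<bar>)"
proof -
  have "(\<Sum>i<\<nu> k. \<bar>a k i\<bar>) = (\<Sum>i<\<nu> k. \<bar>h \<bullet> X k i\<bar>) / sqrt (N k)"
    by (simp add: a_def sum_divide_distrib)
  also have "(\<Sum>i<\<nu> k. \<bar>h \<bullet> X k i\<bar>) = N k * E k (\<lambda>y. \<bar>h \<bullet> y\<bar>)" by (rule sum_eq_emp_mean[OF \<nu>_pos])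
  finally have "(\<Sum>i<\<nu> k. \<bar>a k i\<bar>) = (N k / sqrt (N k)) * E k (\<lambda>y. \<bar>h \<bullet> y\<bar>)" by simp
  then show ?thesis by (simp add: real_div_sqrt)
qed

lemma sum_a2: "(\<Sum>i<\<nu> k. (a k i)\<^sup>2 * F (X k i)) = E k (\<lambda>y. F y * (h \<bullet> y)\<^sup>2)"
proof -
  have "(\<Sum>i<\<nu> k. (a k i)\<^sup>2 * F (X k i)) = (\<Sum>i<\<nu> k. F (X k i) * (h \<bullet> X k i)\<^sup>2) / N k"
    using N_pos[of k] by (simp add: a_def sum_divide_distrib power_divide mult.commute)
  then show ?thesis by (simp add: emp_mean_def)
qed

text \<open>A Lyapunov-type sum: the bounded third moment leaves a factor 1 / sqrt n. It bounds the
  remainders of the real and the imaginary expansion.\<close>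

lemma sum_a3_tendsto: "(\<lambda>k. \<Sum>i<\<nu> k. \<bar>a k i\<bar> ^ 3) \<longlonglongrightarrow> 0"
proof (rule tendsto_of_abs_le[OF _ inv_sqrt_N tendsto_const])
  show "\<forall>\<^sub>F k in sequentially. \<bar>(\<Sum>i<\<nu> k. \<bar>a k i\<bar> ^ 3) - 0\<bar> \<le> (norm h ^ 3 * mom_bound) / sqrt (N k)"
    using moments_le_mom_bound(4)
  proof eventually_elim
    case (elim k)
    have "(\<Sum>i<\<nu> k. \<bar>a k i\<bar> ^ 3) = (\<Sum>i<\<nu> k. \<bar>h \<bullet> X k i\<bar> ^ 3) / (N k * sqrt (N k))"
      using N_pos[of k] by (simp add: a_def sum_divide_distrib power_divide abs_divide eval_nat_numeral mult.commute[of "sqrt (N k)"])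
    also have "(\<Sum>i<\<nu> k. \<bar>h \<bullet> X k i\<bar> ^ 3) = N k * E k (\<lambda>y. \<bar>h \<bullet> y\<bar> ^ 3)" by (rule sum_eq_emp_mean[OF \<nu>_pos])
    finally have e: "(\<Sum>i<\<nu> k. \<bar>a k i\<bar> ^ 3) = E k (\<lambda>y. \<bar>h \<bullet> y\<bar> ^ 3) / sqrt (N k)" using N_pos[of k] by simp
    have "E k (\<lambda>y. \<bar>h \<bullet> y\<bar> ^ 3) \<le> E k (\<lambda>y. norm h ^ 3 * norm y ^ 3)"
      unfolding power_mult_distrib[symmetric] by (intro emp_mean_mono power_mono Cauchy_Schwarz_ineq2) simp
    also have "\<dots> \<le> norm h ^ 3 * mom_bound" unfolding emp_mean_cmult using elim by (intro mult_left_mono) auto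
    finally have "E k (\<lambda>y. \<bar>h \<bullet> y\<bar> ^ 3) / sqrt (N k) \<le> norm h ^ 3 * mom_bound / sqrt (N k)" by (intro divide_right_mono) auto
    moreover have "0 \<le> E k (\<lambda>y. \<bar>h \<bullet> y\<bar> ^ 3) / sqrt (N k)" by (intro divide_nonneg_nonneg emp_mean_nonneg) auto
    ultimately show ?case unfolding e by simp
  qed
qed

lemma quad_tendsto: "(\<lambda>k. quad k s) \<longlonglongrightarrow> lim2 h"
proof -
  have "quad k s = E k (\<lambda>y. sech2 (\<beta> * v k s + \<theta>0 \<bullet> y) * (h \<bullet> y)\<^sup>2)" for k
    unfolding quad_def b_def by (rule sum_a2)
  then show ?thesis using sech2_2_tendsto[OF v_tendsto] by simp
qed

lemma b_v: "b k (v k s) i = b k (u k) i + \<beta> * (s / sqrt (N k))"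
  by (simp add: b_def v_def algebra_simps)

lemma drift_bound: "\<forall>\<^sub>F k in sequentially. \<forall>s. \<bar>drift k s\<bar> \<le> \<beta> * norm h * mom_bound * \<bar>s\<bar>"
  using moments_le_mom_bound(2)
proof eventually_elim
  case (elim k)
  show ?case
  proof
    fix s
    have "\<bar>drift k s\<bar> \<le> (\<Sum>i<\<nu> k. \<bar>a k i\<bar> * (\<beta> * \<bar>s\<bar> / sqrt (N k)))"
      unfolding drift_def
    proof (rule order_trans[OF sum_abs sum_mono])
      fix i
      have "\<bar>tanh (b k (v k s) i) - tanh (b k (u k) i)\<bar> \<le> \<beta> * \<bar>s\<bar> / sqrt (N k)"
        using abs_tanh_diff[of "b k (v k s) i" "b k (u k) i"] \<beta>_pos unfolding b_v by (simp add: abs_mult)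
      then show "\<bar>a k i * (tanh (b k (v k s) i) - tanh (b k (u k) i))\<bar> \<le> \<bar>a k i\<bar> * (\<beta> * \<bar>s\<bar> / sqrt (N k))"
        unfolding abs_mult by (intro mult_left_mono) auto
    qed
    also have "\<dots> = E k (\<lambda>y. \<bar>h \<bullet> y\<bar>) * (\<beta> * \<bar>s\<bar>)"
      unfolding sum_distrib_right[symmetric] sum_abs_a using sqrt_N_pos[of k] by simp
    also have "\<dots> \<le> (norm h * mom_bound) * (\<beta> * \<bar>s\<bar>)"
    proof (rule mult_right_mono)
      have "norm h * E k norm \<le> norm h * mom_bound" using elim by (intro mult_left_mono) auto
      then show "E k (\<lambda>y. \<bar>h \<bullet> y\<bar>) \<le> norm h * mom_bound" using E_inner_le[of k] by linarith
    qed (use \<beta>_pos in auto)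
    finally show "\<bar>drift k s\<bar> \<le> \<beta> * norm h * mom_bound * \<bar>s\<bar>" by (simp add: mult_ac)
  qed
qed

text \<open>First-order expansion of tanh; the remainder is at most the sum of |a_i| (\<beta> s)^2 /
  n, of order 1 / sqrt n.\<close>

lemma drift_tendsto: "(\<lambda>k. drift k s) \<longlonglongrightarrow> \<beta> * s * lim1 h"
proof (rule tendsto_of_abs_le)
  show "(\<lambda>k. \<beta> * s * E k (\<lambda>y. sech2 (\<beta> * u k + \<theta>0 \<bullet> y) * (h \<bullet> y))) \<longlonglongrightarrow> \<beta> * s * lim1 h"
    by (intro tendsto_intros sech2_1_tendsto u_tendsto)
  show "(\<lambda>k. (norm h * mom_bound * (\<beta> * s)\<^sup>2) / sqrt (N k)) \<longlonglongrightarrow> 0" by (rule inv_sqrt_N)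
  show "\<forall>\<^sub>F k in sequentially. \<bar>drift k s - \<beta> * s * E k (\<lambda>y. sech2 (\<beta> * u k + \<theta>0 \<bullet> y) * (h \<bullet> y))\<bar> \<le> (norm h * mom_bound * (\<beta> * s)\<^sup>2) / sqrt (N k)"
    using moments_le_mom_bound(2)
  proof eventually_elim
    case (elim k)
    let ?d = "\<beta> * (s / sqrt (N k))"
    have "\<beta> * s * E k (\<lambda>y. sech2 (\<beta> * u k + \<theta>0 \<bullet> y) * (h \<bullet> y)) = (\<Sum>i<\<nu> k. \<beta> * s * (sech2 (\<beta> * u k + \<theta>0 \<bullet> X k i) * (h \<bullet> X k i)) / N k)"
      by (simp add: emp_mean_def sum_distrib_left sum_divide_distrib)
    also have "\<dots> = (\<Sum>i<\<nu> k. a k i * (?d * sech2 (b k (u k) i)))"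
      using N_pos[of k] by (intro sum.cong) (auto simp: a_def b_def)
    finally have dr: "drift k s - \<beta> * s * E k (\<lambda>y. sech2 (\<beta> * u k + \<theta>0 \<bullet> y) * (h \<bullet> y))
       = (\<Sum>i<\<nu> k. a k i * (tanh (b k (u k) i + ?d) - tanh (b k (u k) i) - ?d * sech2 (b k (u k) i)))"
      unfolding drift_def b_v by (simp add: sum_subtractf right_diff_distrib)
    have "\<bar>drift k s - \<beta> * s * E k (\<lambda>y. sech2 (\<beta> * u k + \<theta>0 \<bullet> y) * (h \<bullet> y))\<bar> \<le> (\<Sum>i<\<nu> k. \<bar>a k i\<bar> * ?d\<^sup>2)"
      unfolding dr by (rule order_trans[OF sum_abs sum_mono]) (unfold abs_mult, intro mult_left_mono tanh_taylor, simp)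
    also have "\<dots> = E k (\<lambda>y. \<bar>h \<bullet> y\<bar>) * ((\<beta> * s)\<^sup>2 / sqrt (N k))"
    proof -
      have q: "sqrt (N k) / N k = 1 / sqrt (N k)" by (rule sqrt_divide_self_eq[unfolded inverse_eq_divide]) simp
      have "?d\<^sup>2 = (\<beta> * s)\<^sup>2 / N k"
        by (simp only: power_mult_distrib power_divide real_sqrt_pow2 of_nat_0_le_iff times_divide_eq_right)
      then have "(\<Sum>i<\<nu> k. \<bar>a k i\<bar> * ?d\<^sup>2) = E k (\<lambda>y. \<bar>h \<bullet> y\<bar>) * (\<beta> * s)\<^sup>2 * (sqrt (N k) / N k)"
        unfolding sum_distrib_right[symmetric] sum_abs_a by simp
      then show ?thesis unfolding q by simp
    qed
    also have "\<dots> \<le> (norm h * mom_bound) * ((\<beta> * s)\<^sup>2 / sqrt (N k))"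
    proof (rule mult_right_mono)
      have "norm h * E k norm \<le> norm h * mom_bound" using elim by (intro mult_left_mono) auto
      then show "E k (\<lambda>y. \<bar>h \<bullet> y\<bar>) \<le> norm h * mom_bound" using E_inner_le[of k] by linarith
    qed simp
    finally show ?case by simp
  qed
qed

text \<open>A total variance: \<open>lim2\<close> is the limiting conditional variance of the scaled
  label sum given the auxiliary variable, and the second term is the contribution of that variable,
  of limiting variance 1 / \<gamma>, through the drift \<beta> s \<open>lim1 h\<close>.\<close>

definition curv :: real where "curv = lim2 h + \<beta>\<^sup>2 * (lim1 h)\<^sup>2 / \<gamma>"

subsection \<open>The real expansion\<close>

definition excess where "excess k s = (\<Sum>i<\<nu> k. lncosh (b k (v k s) i + a k i) - lncosh (b k (v k s) i)) - lin k"

lemma excess_tendsto: "(\<lambda>k. excess k s) \<longlonglongrightarrow> \<beta> * s * lim1 h + lim2 h / 2"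
proof (rule tendsto_of_abs_le)
  show "(\<lambda>k. drift k s + quad k s / 2) \<longlonglongrightarrow> \<beta> * s * lim1 h + lim2 h / 2"
    by (intro tendsto_intros drift_tendsto quad_tendsto) simp
  show "(\<lambda>k. (\<Sum>i<\<nu> k. \<bar>a k i\<bar> ^ 3) / 3) \<longlonglongrightarrow> 0" using tendsto_divide[OF sum_a3_tendsto tendsto_const[of 3]] by simp
  have "excess k s - (drift k s + quad k s / 2) = (\<Sum>i<\<nu> k. lncosh (b k (v k s) i + a k i) - lncosh (b k (v k s) i) - a k i * tanh (b k (v k s) i) - (a k i)\<^sup>2 / 2 * sech2 (b k (v k s) i))" for k
    unfolding excess_def drift_def quad_def lin_def by (simp add: sum_subtractf sum_divide_distrib right_diff_distrib)
  moreover have "\<bar>\<Sum>i<\<nu> k. lncosh (b k (v k s) i + a k i) - lncosh (b k (v k s) i) - a k i * tanh (b k (v k s) i) - (a k i)\<^sup>2 / 2 * sech2 (b k (v k s) i)\<bar> \<le> (\<Sum>i<\<nu> k. \<bar>a k i\<bar> ^ 3 / 3)" for k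
    by (rule order_trans[OF sum_abs sum_mono]) (rule lncosh_taylor)
  ultimately show "\<forall>\<^sub>F k in sequentially. \<bar>excess k s - (drift k s + quad k s / 2)\<bar> \<le> (\<Sum>i<\<nu> k. \<bar>a k i\<bar> ^ 3) / 3"
    by (simp add: sum_divide_distrib)
qed

text \<open>Supplies the growth bound exp (K |s|) for Laplace's method; an upper bound is enough
  since \<open>excess\<close> is exponentiated.\<close>

lemma excess_le: "\<forall>\<^sub>F k in sequentially. \<forall>s. excess k s \<le> \<beta> * norm h * mom_bound * \<bar>s\<bar> + (norm h)\<^sup>2 * mom_bound / 2"
  using drift_bound moments_le_mom_bound(3)
proof eventually_elim
  case (elim k)
  show ?case
  proof
    fix s
    have "excess k s \<le> (\<Sum>i<\<nu> k. a k i * tanh (b k (v k s) i) + (a k i)\<^sup>2 / 2) - lin k"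
      unfolding excess_def
    proof (intro diff_right_mono sum_mono)
      show "lncosh (b k (v k s) i + a k i) - lncosh (b k (v k s) i) \<le> a k i * tanh (b k (v k s) i) + (a k i)\<^sup>2 / 2" for i
        using lncosh_le_quadratic[of "b k (v k s) i" "a k i"] by linarith
    qed
    also have "\<dots> = drift k s + (\<Sum>i<\<nu> k. (a k i)\<^sup>2) / 2"
      unfolding drift_def lin_def by (simp add: sum.distrib sum_subtractf right_diff_distrib sum_divide_distrib)
    finally have 1: "excess k s \<le> drift k s + (\<Sum>i<\<nu> k. (a k i)\<^sup>2) / 2" .
    have "(\<Sum>i<\<nu> k. (a k i)\<^sup>2) = E k (\<lambda>y. (h \<bullet> y)\<^sup>2)" using sum_a2[of k "\<lambda>_. 1"] by simp
    also have "\<dots> \<le> (norm h)\<^sup>2 * E k (\<lambda>y. (norm y)\<^sup>2)" unfolding emp_mean_cmult[symmetric] by (intro emp_mean_mono inner_power2_le)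
    also have "\<dots> \<le> (norm h)\<^sup>2 * mom_bound" using elim(2) by (intro mult_left_mono) auto
    finally have 2: "(\<Sum>i<\<nu> k. (a k i)\<^sup>2) \<le> (norm h)\<^sup>2 * mom_bound" .
    have "drift k s \<le> \<beta> * norm h * mom_bound * \<bar>s\<bar>" using elim(1) abs_le_D1 by blast
    then show "excess k s \<le> \<beta> * norm h * mom_bound * \<bar>s\<bar> + (norm h)\<^sup>2 * mom_bound / 2"
      using 1 2 by linarith
  qed
qed

lemma excess_measurable [measurable]: "excess k \<in> borel_measurable borel"
  unfolding excess_def[abs_def] b_def by measurable

text \<open>The limit is a Gaussian integral with linear term \<beta> s \<open>lim1 h\<close>;
  completing its square supplies the second part of \<open>curv\<close>.\<close>

lemma real_ratio_tendsto: "(\<lambda>k. (\<integral>s. exp (- \<phi> k s) * exp (excess k s) \<partial>lborel) / Z k) \<longlonglongrightarrow> exp (curv / 2)"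
proof -
  have "(\<lambda>k. \<integral>s. exp (- \<phi> k s) *\<^sub>R exp (excess k s) \<partial>lborel) \<longlonglongrightarrow> (\<integral>s. exp (- \<gamma> * s\<^sup>2 / 2) *\<^sub>R exp (\<beta> * s * lim1 h + lim2 h / 2) \<partial>lborel)"
  proof (rule laplace_good[where C="exp ((norm h)\<^sup>2 * mom_bound / 2)" and K="\<beta> * norm h * mom_bound"])
    show "\<forall>\<^sub>F k in sequentially. \<forall>s. norm (exp (excess k s)) \<le> exp ((norm h)\<^sup>2 * mom_bound / 2) * exp (\<beta> * norm h * mom_bound * \<bar>s\<bar>)"
      using excess_le unfolding mult_exp_exp by eventually_elim (simp add: add.commute)
    show "(\<lambda>k. exp (excess k s)) \<longlonglongrightarrow> exp (\<beta> * s * lim1 h + lim2 h / 2)" for s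
      by (intro tendsto_intros excess_tendsto)
  qed measurable
  moreover have "(\<integral>s. exp (- \<gamma> * s\<^sup>2 / 2) *\<^sub>R exp (\<beta> * s * lim1 h + lim2 h / 2) \<partial>lborel) = exp (curv / 2) * sqrt (2 * pi / \<gamma>)"
  proof -
    let ?y = "\<beta> * lim1 h / \<gamma>"
    have "exp (- \<gamma> * s\<^sup>2 / 2) *\<^sub>R exp (\<beta> * s * lim1 h + lim2 h / 2) = exp (lim2 h / 2) * exp (- \<gamma> * s\<^sup>2 / 2 + \<gamma> * s * ?y)" for s
      unfolding real_scaleR_def mult_exp_exp using gamma11_pos by (simp add: mult_ac)
    then have "(\<integral>s. exp (- \<gamma> * s\<^sup>2 / 2) *\<^sub>R exp (\<beta> * s * lim1 h + lim2 h / 2) \<partial>lborel) = exp (lim2 h / 2) * (sqrt (2 * pi / \<gamma>) * exp (\<gamma> * ?y\<^sup>2 / 2))"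
      using has_integral_gauss_quadratic(1)[OF gamma11_pos, of ?y] by (simp add: has_bochner_integral_iff)
    also have "\<dots> = exp (lim2 h / 2) * exp (\<gamma> * ?y\<^sup>2 / 2) * sqrt (2 * pi / \<gamma>)" by simp
    also have "exp (lim2 h / 2) * exp (\<gamma> * ?y\<^sup>2 / 2) = exp (curv / 2)"
      unfolding mult_exp_exp curv_def using gamma11_pos by (simp add: power2_eq_square field_simps)
    finally show ?thesis .
  qed
  ultimately have "(\<lambda>k. (\<integral>s. exp (- \<phi> k s) * exp (excess k s) \<partial>lborel) / Z k) \<longlonglongrightarrow> (exp (curv / 2) * sqrt (2 * pi / \<gamma>)) / sqrt (2 * pi / \<gamma>)"
    using limZ_pos by (intro tendsto_divide Z_tendsto) auto
  then show ?thesis unfolding nonzero_mult_div_cancel_right[OF less_imp_neq[OF limZ_pos, symmetric]] .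
qed

lemma log_lr_expansion:
  "(\<lambda>k. log_lr (\<nu> k) (\<theta>0 + (1 / sqrt (N k)) *\<^sub>R h) \<theta>0 \<beta> (X k) - (lin k - sqrt (N k) * (h \<bullet> \<theta>0) - ((norm h)\<^sup>2 - curv) / 2)) \<longlonglongrightarrow> 0"
proof -
  let ?R = "\<lambda>k. (\<integral>s. exp (- \<phi> k s) * exp (excess k s) \<partial>lborel) / Z k"
  let ?\<theta> = "\<lambda>k. \<theta>0 + (1 / sqrt (N k)) *\<^sub>R h"
  have eq: "log_lr (\<nu> k) (?\<theta> k) \<theta>0 \<beta> (X k) = lin k - sqrt (N k) * (h \<bullet> \<theta>0) - (norm h)\<^sup>2 / 2 + ln (?R k)"
    if Z: "Z k > 0" and Rp: "?R k > 0" for k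
  proof -
    have th: "?\<theta> k \<bullet> X k i = \<theta>0 \<bullet> X k i + a k i" for i by (simp add: inner_add_left a_def)
    \<comment> \<open>The change of \<theta> only shifts each ln cosh argument by a_i, so the
      integral at the new parameter is written over the base integrand and stays centred at the
      minimiser for \<theta>0.\<close>
    have ob: "exp (- N k * cw_objective (\<nu> k) (?\<theta> k) \<beta> (X k) t) = exp (- N k * f k t) * exp (\<Sum>i<\<nu> k. lncosh (b k t i + a k i) - lncosh (b k t i))" for t
      unfolding mult_exp_exp cw_objective_eq_lncosh th b_def using N_pos[of k] by (simp add: sum_subtractf field_simps)
    have "post_int (\<nu> k) (?\<theta> k) \<beta> (X k) (\<lambda>_. 1) = post_int (\<nu> k) \<theta>0 \<beta> (X k) (\<lambda>t. exp (\<Sum>i<\<nu> k. lncosh (b k t i + a k i) - lncosh (b k t i)))"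
      unfolding post_int_def ob by simp
    also have "\<dots> = exp (- N k * f k (u k)) / sqrt (N k) * (\<integral>s. exp (- \<phi> k s) * (exp (lin k) * exp (excess k s)) \<partial>lborel)"
    proof -
      have "exp (\<Sum>i<\<nu> k. lncosh (b k (v k s) i + a k i) - lncosh (b k (v k s) i)) = exp (lin k) * exp (excess k s)" for s
        unfolding mult_exp_exp by (simp add: excess_def)
      then show ?thesis unfolding post_int_eq by simp
    qed
    also have "(\<integral>s. exp (- \<phi> k s) * (exp (lin k) * exp (excess k s)) \<partial>lborel) = exp (lin k) * (\<integral>s. exp (- \<phi> k s) * exp (excess k s) \<partial>lborel)"
      by (simp add: mult.left_commute)
    finally have "post_int (\<nu> k) (?\<theta> k) \<beta> (X k) (\<lambda>_. 1) / post_int (\<nu> k) \<theta>0 \<beta> (X k) (\<lambda>_. 1) = exp (lin k) * ?R k"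
      unfolding post_int_one using sqrt_N_pos[of k] by simp
    then have "(\<Sum>w\<in>labels (\<nu> k). post_weight (\<nu> k) (?\<theta> k) \<beta> (X k) w) / (\<Sum>w\<in>labels (\<nu> k). post_weight (\<nu> k) \<theta>0 \<beta> (X k) w) = exp (lin k) * ?R k"
      unfolding post_sum_one(2)[OF \<nu>_pos \<beta>_pos] using post_const_pos[OF \<nu>_pos[of k] \<beta>_pos] by simp
    \<comment> \<open>Expanding the squared norm at step h / sqrt n produces the centring sqrt n (h
      . \<theta>0) of \<open>lin\<close>.\<close>
    moreover have "- N k * ((norm (?\<theta> k))\<^sup>2 - (norm \<theta>0)\<^sup>2) / 2 = - sqrt (N k) * (h \<bullet> \<theta>0) - (norm h)\<^sup>2 / 2"
    proof -
      have "(norm (?\<theta> k))\<^sup>2 = (norm \<theta>0)\<^sup>2 + 2 / sqrt (N k) * (h \<bullet> \<theta>0) + (norm h)\<^sup>2 / N k"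
        unfolding power2_norm_eq_inner using N_pos[of k] by (simp add: inner_add inner_commute)
      then have "N k * ((norm (?\<theta> k))\<^sup>2 - (norm \<theta>0)\<^sup>2) = N k * (2 / sqrt (N k) * (h \<bullet> \<theta>0)) + N k * ((norm h)\<^sup>2 / N k)"
        by (simp only: add_diff_cancel_left' add.assoc distrib_left)
      also have "\<dots> = (N k / sqrt (N k)) * 2 * (h \<bullet> \<theta>0) + (norm h)\<^sup>2" using N_pos[of k] by simp
      also have "N k / sqrt (N k) = sqrt (N k)" by (simp add: real_div_sqrt)
      finally show ?thesis by simp
    qed
    ultimately show ?thesis unfolding log_lr_eq using ln_exp_mult[OF Rp, of "lin k"] by simp
  qed
  have "(\<lambda>k. ln (?R k) - curv / 2) \<longlonglongrightarrow> ln (exp (curv / 2)) - curv / 2"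
    by (intro tendsto_intros real_ratio_tendsto) simp
  then have "(\<lambda>k. ln (?R k) - curv / 2) \<longlonglongrightarrow> 0" by simp
  moreover have "\<forall>\<^sub>F k in sequentially. ln (?R k) - curv / 2 = log_lr (\<nu> k) (?\<theta> k) \<theta>0 \<beta> (X k) - (lin k - sqrt (N k) * (h \<bullet> \<theta>0) - ((norm h)\<^sup>2 - curv) / 2)"
    using Z_pos order_tendstoD(1)[OF real_ratio_tendsto exp_gt_zero]
    by eventually_elim (simp add: eq diff_divide_distrib)
  ultimately show ?thesis by (rule Lim_transform_eventually)
qed

subsection \<open>The imaginary expansion\<close>

definition cprod where "cprod k s = (\<Prod>i<\<nu> k. complex_of_real (cos (a k i)) + \<i> * (sin (a k i) * tanh (b k (v k s) i)))"

lemma cprod_norm: "norm (cprod k s) \<le> 1"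
  unfolding cprod_def prod_norm[symmetric] by (intro prod_le_1) (use sign_char_factor(1)[OF abs_tanh_le_1] in auto)

text \<open>Each factor is replaced by a Gaussian characteristic factor with the same first two
  moments. As all factors have modulus at most 1, the errors add without amplification, to at most 4
  times the sum of |a_i|^3.\<close>

lemma cprod_tendsto: "(\<lambda>k. cprod k s * iexp (- lin k)) \<longlonglongrightarrow> exp (\<i> * (\<beta> * s * lim1 h) - lim2 h / 2)"
proof -
  define R where "R k = (\<Prod>i<\<nu> k. exp (\<i> * complex_of_real (a k i * tanh (b k (v k s) i)) - complex_of_real ((a k i)\<^sup>2 / 2 * (1 - (tanh (b k (v k s) i))\<^sup>2))))" for k
  have Rexp: "R k * iexp (- lin k) = exp (\<i> * drift k s - quad k s / 2)" for k
  proof -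
    have "R k = exp (\<Sum>i<\<nu> k. \<i> * complex_of_real (a k i * tanh (b k (v k s) i)) - complex_of_real ((a k i)\<^sup>2 / 2 * (1 - (tanh (b k (v k s) i))\<^sup>2)))"
      unfolding R_def by (simp add: exp_sum)
    also have "(\<Sum>i<\<nu> k. \<i> * complex_of_real (a k i * tanh (b k (v k s) i)) - complex_of_real ((a k i)\<^sup>2 / 2 * (1 - (tanh (b k (v k s) i))\<^sup>2)))
       = \<i> * complex_of_real (\<Sum>i<\<nu> k. a k i * tanh (b k (v k s) i)) - complex_of_real (quad k s / 2)"
      unfolding quad_def sech2_eq sum_subtractf of_real_sum sum_distrib_left sum_divide_distrib by simp
    also have "(\<Sum>i<\<nu> k. a k i * tanh (b k (v k s) i)) = drift k s + lin k"
      unfolding drift_def lin_def by (simp add: sum_subtractf right_diff_distrib)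
    finally show ?thesis by (simp add: mult_exp_exp algebra_simps)
  qed
  have cb: "norm (cprod k s - R k) \<le> 4 * (\<Sum>i<\<nu> k. \<bar>a k i\<bar> ^ 3)" for k
  proof -
    note S = sign_char_factor[OF abs_tanh_le_1]
    have "norm (cprod k s - R k) \<le> (\<Sum>i<\<nu> k. norm ((complex_of_real (cos (a k i)) + \<i> * (sin (a k i) * tanh (b k (v k s) i)))
        - exp (\<i> * complex_of_real (a k i * tanh (b k (v k s) i)) - complex_of_real ((a k i)\<^sup>2 / 2 * (1 - (tanh (b k (v k s) i))\<^sup>2)))))"
      unfolding cprod_def R_def using S(1,2) by (intro norm_prod_diff) (simp_all only: of_real_mult)
    also have "\<dots> \<le> (\<Sum>i<\<nu> k. 4 * \<bar>a k i\<bar> ^ 3)"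
      using S(3) by (intro sum_mono) (simp only: of_real_mult)
    finally show ?thesis by (simp only: sum_distrib_left)
  qed
  have "(\<lambda>k. cprod k s - R k) \<longlonglongrightarrow> 0"
    by (rule Lim_null_comparison[OF always_eventually[OF allI[OF cb]] tendsto_mult_right_zero[OF sum_a3_tendsto]])
  then have "(\<lambda>k. norm (cprod k s - R k)) \<longlonglongrightarrow> 0" by (rule tendsto_norm_zero)
  then have "(\<lambda>k. norm ((cprod k s - R k) * iexp (- lin k))) \<longlonglongrightarrow> 0" by (simp add: norm_mult)
  then have 1: "(\<lambda>k. (cprod k s - R k) * iexp (- lin k)) \<longlonglongrightarrow> 0" by (rule tendsto_norm_zero_cancel)
  have 2: "(\<lambda>k. R k * iexp (- lin k)) \<longlonglongrightarrow> exp (\<i> * (\<beta> * s * lim1 h) - lim2 h / 2)"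
  proof -
    have d: "(\<lambda>k. complex_of_real (drift k s)) \<longlonglongrightarrow> complex_of_real \<beta> * complex_of_real s * complex_of_real (lim1 h)"
      using tendsto_of_real[OF drift_tendsto[of s], where 'a=complex] by simp
    have q: "(\<lambda>k. complex_of_real (quad k s / 2)) \<longlonglongrightarrow> complex_of_real (lim2 h / 2)"
      by (intro tendsto_of_real tendsto_divide quad_tendsto tendsto_const) simp
    have "(\<lambda>k. exp (\<i> * complex_of_real (drift k s) - complex_of_real (quad k s / 2)))
        \<longlonglongrightarrow> exp (\<i> * (complex_of_real \<beta> * complex_of_real s * complex_of_real (lim1 h)) - complex_of_real (lim2 h / 2))"
      by (intro tendsto_exp tendsto_diff tendsto_mult[OF tendsto_const d] q)
    then show ?thesis unfolding Rexp by simp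
  qed
  show ?thesis using tendsto_add[OF 1 2] by (simp add: left_diff_distrib)
qed

lemma cprod_measurable [measurable]: "cprod k \<in> borel_measurable borel"
  unfolding cprod_def[abs_def] b_def by measurable

text \<open>With the phase exp (i \<open>lin\<close>) removed the integrands converge, and Laplace's
  method applies with constant bound 1. The sign of \<open>curv\<close> is opposite to the real
  expansion because h is replaced by i h.\<close>

lemma char_post_expansion: "(\<lambda>k. char_post (\<nu> k) \<theta>0 \<beta> h (X k) * iexp (- lin k)) \<longlonglongrightarrow> exp (- curv / 2)"
proof -
  have "(\<lambda>k. \<integral>s. exp (- \<phi> k s) *\<^sub>R (cprod k s * iexp (- lin k)) \<partial>lborel) \<longlonglongrightarrow> (\<integral>s. exp (- \<gamma> * s\<^sup>2 / 2) *\<^sub>R exp (\<i> * (\<beta> * s * lim1 h) - lim2 h / 2) \<partial>lborel)"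
  proof (rule laplace_good[where C=1 and K=0])
    show "\<forall>\<^sub>F k in sequentially. \<forall>s. norm (cprod k s * iexp (- lin k)) \<le> 1 * exp (0 * \<bar>s\<bar>)"
      using cprod_norm by (simp add: norm_mult)
    show "(\<lambda>k. cprod k s * iexp (- lin k)) \<longlonglongrightarrow> exp (\<i> * (\<beta> * s * lim1 h) - lim2 h / 2)" for s
      by (rule cprod_tendsto)
  qed measurable
  moreover have "(\<integral>s. exp (- \<gamma> * s\<^sup>2 / 2) *\<^sub>R exp (\<i> * (\<beta> * s * lim1 h) - lim2 h / 2) \<partial>lborel) = complex_of_real (exp (- curv / 2) * sqrt (2 * pi / \<gamma>))"
  proof -
    have "exp (- \<gamma> * s\<^sup>2 / 2) *\<^sub>R exp (\<i> * (\<beta> * s * lim1 h) - lim2 h / 2) = exp (- lim2 h / 2) *\<^sub>R (exp (- \<gamma> * s\<^sup>2 / 2) *\<^sub>R iexp (\<beta> * lim1 h * s))" for s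
    proof -
      have "exp (\<i> * complex_of_real (\<beta> * s * lim1 h) - complex_of_real (lim2 h / 2))
         = exp (\<i> * complex_of_real (\<beta> * s * lim1 h)) * complex_of_real (exp (- (lim2 h / 2)))"
        by (simp only: diff_conv_add_uminus exp_add of_real_minus[symmetric] exp_of_real)
      also have "\<beta> * s * lim1 h = \<beta> * lim1 h * s" by simp
      finally show ?thesis by (simp only: scaleR_conv_of_real mult_ac minus_divide_left)
    qed
    then have "(\<integral>s. exp (- \<gamma> * s\<^sup>2 / 2) *\<^sub>R exp (\<i> * (\<beta> * s * lim1 h) - lim2 h / 2) \<partial>lborel)
       = exp (- lim2 h / 2) *\<^sub>R complex_of_real (sqrt (2 * pi / \<gamma>) * exp (- (\<beta> * lim1 h)\<^sup>2 / (2 * \<gamma>)))"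
      by (simp only: integral_scaleR_right integral_gauss_iexp[OF gamma11_pos])
    also have "\<dots> = complex_of_real (exp (- lim2 h / 2) * exp (- (\<beta> * lim1 h)\<^sup>2 / (2 * \<gamma>)) * sqrt (2 * pi / \<gamma>))"
      by (simp add: scaleR_conv_of_real mult_ac)
    also have "exp (- lim2 h / 2) * exp (- (\<beta> * lim1 h)\<^sup>2 / (2 * \<gamma>)) = exp (- curv / 2)"
      unfolding mult_exp_exp curv_def by (simp add: power_mult_distrib field_simps)
    finally show ?thesis .
  qed
  ultimately have "(\<lambda>k. (\<integral>s. exp (- \<phi> k s) *\<^sub>R (cprod k s * iexp (- lin k)) \<partial>lborel) / complex_of_real (Z k))
     \<longlonglongrightarrow> complex_of_real (exp (- curv / 2) * sqrt (2 * pi / \<gamma>)) / complex_of_real (sqrt (2 * pi / \<gamma>))"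
    using limZ_pos by (intro tendsto_divide tendsto_of_real Z_tendsto) auto
  then have L: "(\<lambda>k. (\<integral>s. exp (- \<phi> k s) *\<^sub>R (cprod k s * iexp (- lin k)) \<partial>lborel) / complex_of_real (Z k)) \<longlonglongrightarrow> complex_of_real (exp (- curv / 2))"
    using limZ_pos by (simp only: of_real_mult nonzero_mult_div_cancel_right of_real_eq_0_iff less_imp_neq[symmetric] not_False_eq_True)
  have "char_post (\<nu> k) \<theta>0 \<beta> h (X k) * iexp (- lin k) = (\<integral>s. exp (- \<phi> k s) *\<^sub>R (cprod k s * iexp (- lin k)) \<partial>lborel) / complex_of_real (Z k)"
    for k
  proof -
    have "char_post (\<nu> k) \<theta>0 \<beta> h (X k) = (post_const (\<nu> k) \<beta> *\<^sub>R ((exp (- N k * f k (u k)) / sqrt (N k)) *\<^sub>R (\<integral>s. exp (- \<phi> k s) *\<^sub>R cprod k s \<partial>lborel)))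
       / complex_of_real (post_const (\<nu> k) \<beta> * (exp (- N k * f k (u k)) / sqrt (N k) * Z k))"
      unfolding char_post_def a_def[symmetric] post_sum_char[OF \<nu>_pos \<beta>_pos] post_sum_one(2)[OF \<nu>_pos \<beta>_pos] post_int_one post_int_eq cprod_def b_def ..
    also have "\<dots> = (\<integral>s. exp (- \<phi> k s) *\<^sub>R cprod k s \<partial>lborel) / complex_of_real (Z k)"
      using post_const_pos[OF \<nu>_pos[of k] \<beta>_pos] sqrt_N_pos[of k] by (simp add: scaleR_conv_of_real)
    finally show ?thesis
      by (simp add: mult_scaleR_left[symmetric] del: mult_scaleR_left)
  qed
  then show ?thesis using L by simp
qed

subsection \<open>The posterior mean\<close>

text \<open>A sum of n terms stays bounded only if the posterior offset \<open>e1\<close> of the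
  auxiliary variable from u is O(1 / n), while the Laplace limit alone gives o(1 / sqrt n). The
  better order comes from an identity: the posterior means of the labels average to the posterior
  mean of the auxiliary variable. With stationarity this is a linear equation for \<open>e1\<close>
  with coefficient D / \<beta>, bounded away from 0, and right side O(1 / n).\<close>

lemma post_mean_expansion:
  "\<forall>\<^sub>F k in sequentially. norm ((\<Sum>i<\<nu> k. post_mean (\<nu> k) \<theta>0 \<beta> (X k) i *\<^sub>R X k i) - (\<Sum>i<\<nu> k. tanh (\<beta> * u k + \<theta>0 \<bullet> X k i) *\<^sub>R X k i)) \<le> mean_bound"
proof -
  obtain c where c: "c > 0" "\<forall>\<^sub>F k in sequentially. \<forall>s. \<phi> k s \<ge> c * s\<^sup>2" using \<phi>_lower by blast
  define V where "V k = (\<integral>s. exp (- \<phi> k s) *\<^sub>R s\<^sup>2 \<partial>lborel) / Z k" for k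
  have sq: "s\<^sup>2 \<le> 2 * exp (1 * \<bar>s\<bar>)" and ab: "\<bar>s\<bar> \<le> 1 * exp (1 * \<bar>s\<bar>)" for s :: real
  proof -
    have "1 + \<bar>s\<bar> + \<bar>s\<bar>\<^sup>2 / 2 \<le> exp \<bar>s\<bar>" by (rule exp_lower_Taylor_quadratic) simp
    moreover have "0 \<le> \<bar>s\<bar>\<^sup>2" "\<bar>s\<bar>\<^sup>2 = s\<^sup>2" "0 \<le> \<bar>s\<bar>" by simp_all
    ultimately show "s\<^sup>2 \<le> 2 * exp (1 * \<bar>s\<bar>)" "\<bar>s\<bar> \<le> 1 * exp (1 * \<bar>s\<bar>)" unfolding mult_1 by linarith+
  qed
  have "V \<longlonglongrightarrow> (\<integral>s. exp (- \<gamma> * s\<^sup>2 / 2) *\<^sub>R s\<^sup>2 \<partial>lborel) / sqrt (2 * pi / \<gamma>)"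
    unfolding V_def[abs_def] using limZ_pos sq
    by (intro tendsto_divide Z_tendsto laplace_good[where C=2 and K=1]) (auto intro!: always_eventually)
  then have "V \<longlonglongrightarrow> var_bound" by (simp only: var_bound_def)
  from order_tendstoD(2)[OF this, of "var_bound + 1"]
  have evV: "\<forall>\<^sub>F k in sequentially. V k < var_bound + 1" by simp
  have evD: "\<forall>\<^sub>F k in sequentially. D k > \<gamma> / 2" using order_tendstoD(1)[OF D_tendsto, of "\<gamma> / 2"] gamma11_pos by simp
  show ?thesis
    using c(2) evV evD u_stationary Z_pos moments_le_mom_bound(2)
  proof eventually_elim
    case (elim k)
    let ?I = "\<lambda>g :: real \<Rightarrow> real. \<integral>s. exp (- \<phi> k s) *\<^sub>R g s \<partial>lborel"
    have int: "integrable lborel (\<lambda>s. exp (- \<phi> k s) *\<^sub>R g s)"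
      if "g \<in> borel_measurable borel" "\<And>s. norm (g s) \<le> C * exp (K * \<bar>s\<bar>)" for g :: "real \<Rightarrow> real" and C K
      using integrable_exp_quadratic[OF c(1) \<phi>_measurable that(1) _ that(2)] elim(1) by blast
    have i1: "integrable lborel (\<lambda>s. exp (- \<phi> k s))"
      using int[of "\<lambda>_. 1" 1 0] by simp
    have ia: "integrable lborel (\<lambda>s. exp (- \<phi> k s) * s)"
      using int[of "\<lambda>s. s" 1 1] ab by simp
    have ia2: "integrable lborel (\<lambda>s. exp (- \<phi> k s) * s\<^sup>2)"
      using int[of "\<lambda>s. s\<^sup>2" 2 1] sq by simp
    have it: "integrable lborel (\<lambda>s. exp (- \<phi> k s) * tanh (b k (v k s) i))" for i
      using int[of "\<lambda>s. tanh (b k (v k s) i)" 1 0] abs_tanh_le_1 unfolding b_def by simp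
    \<comment> \<open>\<open>e1\<close> and \<open>e2\<close> are the first and second posterior
      moments of the auxiliary variable minus u; the second is of order 1 / n by the bound on
      \<open>V\<close>.\<close>
    define e1 where "e1 = (\<integral>s. exp (- \<phi> k s) * s \<partial>lborel) / Z k / sqrt (N k)"
    define e2 where "e2 = V k / N k"
    have e2: "e2 \<ge> 0" unfolding e2_def V_def using elim(5) N_pos[of k] by (intro divide_nonneg_nonneg integral_nonneg_AE) auto
    define p where "p i = (\<integral>s. exp (- \<phi> k s) * tanh (b k (v k s) i) \<partial>lborel) / Z k" for i
    define T where "T i = p i - tanh (b k (u k) i)" for i
    have pm: "post_mean (\<nu> k) \<theta>0 \<beta> (X k) i = p i" if "i < \<nu> k" for i
      unfolding post_mean_def post_sum_coord[OF \<nu>_pos \<beta>_pos that] post_sum_one(2)[OF \<nu>_pos \<beta>_pos] post_int_one post_int_eq p_def b_def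
      using post_const_pos[OF \<nu>_pos[of k] \<beta>_pos] sqrt_N_pos[of k] by simp
    \<comment> \<open>Second-order expansion of tanh under the posterior: the linear part is the
      common offset \<open>e1\<close> times an explicit weight.\<close>
    have T: "\<bar>T i - \<beta> * e1 * sech2 (b k (u k) i)\<bar> \<le> \<beta>\<^sup>2 * e2" for i
    proof -
      let ?c0 = "tanh (b k (u k) i)" and ?c1 = "\<beta> / sqrt (N k) * sech2 (b k (u k) i)"
      have "\<bar>\<integral>s. exp (- \<phi> k s) * tanh (b k (v k s) i) - ?c0 * exp (- \<phi> k s) - ?c1 * (exp (- \<phi> k s) * s) \<partial>lborel\<bar>
         \<le> (\<integral>s. \<beta>\<^sup>2 / N k * (exp (- \<phi> k s) * s\<^sup>2) \<partial>lborel)"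
      proof (rule integral_abs_bound_integral)
        fix s
        let ?d = "\<beta> * (s / sqrt (N k))"
        have ig: "exp (- \<phi> k s) * tanh (b k (v k s) i) - ?c0 * exp (- \<phi> k s) - ?c1 * (exp (- \<phi> k s) * s)
           = exp (- \<phi> k s) * (tanh (b k (u k) i + ?d) - tanh (b k (u k) i) - ?d * sech2 (b k (u k) i))"
          unfolding b_v by (simp add: algebra_simps)
        have "\<bar>exp (- \<phi> k s) * tanh (b k (v k s) i) - ?c0 * exp (- \<phi> k s) - ?c1 * (exp (- \<phi> k s) * s)\<bar> \<le> exp (- \<phi> k s) * ?d\<^sup>2"
          unfolding ig abs_mult abs_exp_cancel by (intro mult_left_mono tanh_taylor) simp
        also have "\<dots> = \<beta>\<^sup>2 / N k * (exp (- \<phi> k s) * s\<^sup>2)" using N_pos[of k] by (simp add: power_mult_distrib power_divide)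
        finally show "\<bar>exp (- \<phi> k s) * tanh (b k (v k s) i) - ?c0 * exp (- \<phi> k s) - ?c1 * (exp (- \<phi> k s) * s)\<bar> \<le> \<beta>\<^sup>2 / N k * (exp (- \<phi> k s) * s\<^sup>2)" .
      qed (intro Bochner_Integration.integrable_diff integrable_mult_right it i1 ia ia2)+
      moreover have "(\<integral>s. exp (- \<phi> k s) * tanh (b k (v k s) i) - ?c0 * exp (- \<phi> k s) - ?c1 * (exp (- \<phi> k s) * s) \<partial>lborel)
         = Z k * (T i - \<beta> * e1 * sech2 (b k (u k) i))"
      proof -
        have "(\<integral>s. exp (- \<phi> k s) * tanh (b k (v k s) i) - ?c0 * exp (- \<phi> k s) - ?c1 * (exp (- \<phi> k s) * s) \<partial>lborel)
          = (\<integral>s. exp (- \<phi> k s) * tanh (b k (v k s) i) \<partial>lborel) - ?c0 * (\<integral>s. exp (- \<phi> k s) \<partial>lborel) - ?c1 * (\<integral>s. exp (- \<phi> k s) * s \<partial>lborel)"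
          using it[of i] i1 ia by (simp only: Bochner_Integration.integral_diff Bochner_Integration.integrable_diff integrable_mult_right integral_mult_right_zero)
        moreover have "(\<integral>s. exp (- \<phi> k s) * tanh (b k (v k s) i) \<partial>lborel) = Z k * p i"
          unfolding p_def using elim(5) by simp
        moreover have "(\<integral>s. exp (- \<phi> k s) * s \<partial>lborel) = Z k * e1 * sqrt (N k)"
          unfolding e1_def using elim(5) sqrt_N_pos[of k] by simp
        ultimately show ?thesis unfolding T_def Z_def[symmetric] using sqrt_N_pos[of k]
          by (simp add: right_diff_distrib)
      qed
      moreover have "(\<integral>s. \<beta>\<^sup>2 / N k * (exp (- \<phi> k s) * s\<^sup>2) \<partial>lborel) = Z k * (\<beta>\<^sup>2 * e2)"
        unfolding e2_def V_def using elim(5) by simp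
      ultimately have "\<bar>Z k * (T i - \<beta> * e1 * sech2 (b k (u k) i))\<bar> \<le> Z k * (\<beta>\<^sup>2 * e2)" by (simp only:)
      then show ?thesis using elim(5) by (simp add: abs_mult)
    qed
    \<comment> \<open>Both sides are the posterior mean of zbar minus u: on the left through
      \<open>post_sum_mean\<close>, on the right through \<open>post_sum_coord\<close> and
      stationarity.\<close>
    have e1_eq: "e1 = (1 / N k) * (\<Sum>i<\<nu> k. T i)"
    proof -
      have *: "(\<Sum>w\<in>labels (\<nu> k). zbar (\<nu> k) w * post_weight (\<nu> k) \<theta>0 \<beta> (X k) w)
         = (1 / N k) * (\<Sum>i<\<nu> k. \<Sum>w\<in>labels (\<nu> k). w i * post_weight (\<nu> k) \<theta>0 \<beta> (X k) w)"
        unfolding zbar_def sum_distrib_left sum_distrib_right sum_divide_distrib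
        by (subst sum.swap) (simp add: sum_distrib_right sum_divide_distrib)
      then have "post_const (\<nu> k) \<beta> * post_int (\<nu> k) \<theta>0 \<beta> (X k) (\<lambda>t. t)
         = (1 / N k) * (\<Sum>i<\<nu> k. post_const (\<nu> k) \<beta> * post_int (\<nu> k) \<theta>0 \<beta> (X k) (\<lambda>t. tanh (\<beta> * t + \<theta>0 \<bullet> X k i)))"
      proof -
        have "(\<Sum>i<\<nu> k. \<Sum>w\<in>labels (\<nu> k). w i * post_weight (\<nu> k) \<theta>0 \<beta> (X k) w)
           = (\<Sum>i<\<nu> k. post_const (\<nu> k) \<beta> * post_int (\<nu> k) \<theta>0 \<beta> (X k) (\<lambda>t. tanh (\<beta> * t + \<theta>0 \<bullet> X k i)))"
          by (rule sum.cong[OF refl], rule post_sum_coord[OF \<nu>_pos \<beta>_pos]) simp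
        then show ?thesis using * unfolding post_sum_mean(2)[OF \<nu>_pos \<beta>_pos] by (simp only:)
      qed
      then have "post_const (\<nu> k) \<beta> * post_int (\<nu> k) \<theta>0 \<beta> (X k) (\<lambda>t. t)
         = post_const (\<nu> k) \<beta> * ((1 / N k) * (\<Sum>i<\<nu> k. post_int (\<nu> k) \<theta>0 \<beta> (X k) (\<lambda>t. tanh (\<beta> * t + \<theta>0 \<bullet> X k i))))"
        by (simp add: sum_distrib_left mult_ac)
      then have "post_int (\<nu> k) \<theta>0 \<beta> (X k) (\<lambda>t. t) = (1 / N k) * (\<Sum>i<\<nu> k. post_int (\<nu> k) \<theta>0 \<beta> (X k) (\<lambda>t. tanh (\<beta> * t + \<theta>0 \<bullet> X k i)))"
        by (rule mult_left_cancel[OF less_imp_neq[OF post_const_pos[OF \<nu>_pos \<beta>_pos], symmetric], THEN iffD1])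
      moreover define C where "C = exp (- N k * f k (u k)) / sqrt (N k)"
      moreover have C0: "C \<noteq> 0" unfolding C_def using sqrt_N_pos[of k] by simp
      ultimately have "C * (\<integral>s. exp (- \<phi> k s) * v k s \<partial>lborel) = (1 / N k) * (\<Sum>i<\<nu> k. C * (p i * Z k))"
        unfolding post_int_eq p_def b_def using elim(5) by simp
      also have "\<dots> = C * ((1 / N k) * (\<Sum>i<\<nu> k. p i) * Z k)"
      proof -
        have "(\<Sum>i<\<nu> k. C * (p i * Z k)) = C * ((\<Sum>i<\<nu> k. p i) * Z k)"
          by (simp only: sum_distrib_left sum_distrib_right)
        then show ?thesis by simp
      qed
      finally have "(\<integral>s. exp (- \<phi> k s) * v k s \<partial>lborel) = (1 / N k) * (\<Sum>i<\<nu> k. p i) * Z k"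
        by (rule mult_left_cancel[OF C0, THEN iffD1])
      moreover have "(\<integral>s. exp (- \<phi> k s) * v k s \<partial>lborel) = (u k + e1) * Z k"
      proof -
        have "(\<integral>s. exp (- \<phi> k s) * v k s \<partial>lborel) = (\<integral>s. u k * exp (- \<phi> k s) + (1 / sqrt (N k)) * (exp (- \<phi> k s) * s) \<partial>lborel)"
          unfolding v_def by (simp add: algebra_simps)
        also have "\<dots> = u k * Z k + (1 / sqrt (N k)) * (\<integral>s. exp (- \<phi> k s) * s \<partial>lborel)"
          unfolding Z_def using i1 ia by (simp only: Bochner_Integration.integral_add integrable_mult_right integral_mult_right_zero)
        finally show ?thesis using elim(5) by (simp add: e1_def algebra_simps)
      qed
      ultimately have "(u k + e1) * Z k = (1 / N k) * (\<Sum>i<\<nu> k. p i) * Z k" by (simp only:)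
      then have "u k + e1 = (1 / N k) * (\<Sum>i<\<nu> k. p i)"
        by (rule mult_right_cancel[OF less_imp_neq[OF elim(5), symmetric], THEN iffD1])
      moreover have "(1 / N k) * (\<Sum>i<\<nu> k. tanh (b k (u k) i)) = u k" using elim(4) by (simp add: emp_mean_def b_def)
      ultimately show ?thesis unfolding T_def sum_subtractf right_diff_distrib by simp
    qed
    define S where "S = E k (\<lambda>y. sech2 (\<beta> * u k + \<theta>0 \<bullet> y))"
    \<comment> \<open>Averaging the expansion of \<open>T\<close> over i and inserting
      \<open>e1_eq\<close> closes the linear equation for \<open>e1\<close>.\<close>
    have "\<bar>e1 - \<beta> * e1 * S\<bar> \<le> \<beta>\<^sup>2 * e2"
    proof -
      have ee: "e1 - \<beta> * e1 * S = (1 / N k) * (\<Sum>i<\<nu> k. T i - \<beta> * e1 * sech2 (b k (u k) i))"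
        unfolding S_def emp_mean_def b_def sum_subtractf right_diff_distrib e1_eq[symmetric] by (simp add: sum_distrib_left)
      have "\<bar>e1 - \<beta> * e1 * S\<bar> \<le> (1 / N k) * (\<Sum>i<\<nu> k. \<beta>\<^sup>2 * e2)"
        unfolding ee abs_mult using N_pos[of k] T by (intro mult_mono order_trans[OF sum_abs sum_mono]) auto
      also have "\<dots> = \<beta>\<^sup>2 * e2" using N_pos[of k] by simp
      finally show ?thesis .
    qed
    then have "\<bar>e1\<bar> * \<bar>1 - \<beta> * S\<bar> \<le> \<beta>\<^sup>2 * e2" by (simp add: abs_mult[symmetric] right_diff_distrib mult_ac)
    moreover have "D k = \<beta> * (1 - \<beta> * S)" by (simp add: D_def S_def power2_eq_square algebra_simps)
    ultimately have "\<bar>e1\<bar> * \<bar>D k\<bar> \<le> \<beta> * (\<beta>\<^sup>2 * e2)" using \<beta>_pos by (simp add: abs_mult mult.left_commute)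
    moreover have "\<bar>e1\<bar> * (\<gamma> / 2) \<le> \<bar>e1\<bar> * \<bar>D k\<bar>" using elim(3) by (intro mult_left_mono) auto
    ultimately have e1: "\<bar>e1\<bar> \<le> 2 * \<beta> ^ 3 / \<gamma> * e2" using gamma11_pos by (simp add: field_simps eval_nat_numeral)
    have Tb: "\<bar>T i\<bar> \<le> (2 * \<beta> ^ 4 / \<gamma> + \<beta>\<^sup>2) * e2" for i
    proof -
      have "\<beta> * \<bar>e1\<bar> * sech2 (b k (u k) i) \<le> \<beta> * \<bar>e1\<bar> * 1" using \<beta>_pos sech2_bounds by (intro mult_left_mono) auto
      also have "\<dots> \<le> \<beta> * (2 * \<beta> ^ 3 / \<gamma> * e2)"
        unfolding mult_1_right by (intro mult_left_mono e1) (use \<beta>_pos in simp)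
      finally have "\<bar>\<beta> * e1 * sech2 (b k (u k) i)\<bar> \<le> 2 * \<beta> ^ 4 / \<gamma> * e2"
        using \<beta>_pos sech2_bounds(1)[of "b k (u k) i"] by (simp add: abs_mult eval_nat_numeral mult_ac)
      then show ?thesis using T[of i] by (simp add: distrib_right)
    qed
    have "(\<Sum>i<\<nu> k. post_mean (\<nu> k) \<theta>0 \<beta> (X k) i *\<^sub>R X k i) - (\<Sum>i<\<nu> k. tanh (\<beta> * u k + \<theta>0 \<bullet> X k i) *\<^sub>R X k i) = (\<Sum>i<\<nu> k. T i *\<^sub>R X k i)"
      unfolding sum_subtractf[symmetric] T_def b_def by (rule sum.cong) (auto simp: pm b_def scaleR_diff_left)
    also have "norm \<dots> \<le> (\<Sum>i<\<nu> k. (2 * \<beta> ^ 4 / \<gamma> + \<beta>\<^sup>2) * e2 * norm (X k i))"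
      by (rule order_trans[OF norm_sum sum_mono]) (use Tb in \<open>auto intro!: mult_right_mono\<close>)
    also have "\<dots> = (2 * \<beta> ^ 4 / \<gamma> + \<beta>\<^sup>2) * e2 * (N k * E k norm)"
      unfolding sum_distrib_left[symmetric] sum_eq_emp_mean[OF \<nu>_pos] ..
    also have "\<dots> = (2 * \<beta> ^ 4 / \<gamma> + \<beta>\<^sup>2) * V k * E k norm" using N_pos[of k] by (simp add: e2_def)
    also have "\<dots> \<le> (2 * \<beta> ^ 4 / \<gamma> + \<beta>\<^sup>2) * (var_bound + 1) * mom_bound"
    proof (intro mult_mono)
      have K: "0 \<le> 2 * \<beta> ^ 4 / \<gamma> + \<beta>\<^sup>2" using gamma11_pos by simp
      have V0: "0 \<le> V k" using e2 N_pos[of k] by (simp add: e2_def zero_le_divide_iff)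
      show "0 \<le> 2 * \<beta> ^ 4 / \<gamma> + \<beta>\<^sup>2" by (rule K)
      show "0 \<le> V k" by (rule V0)
      show "0 \<le> E k norm" by (rule emp_mean_nonneg) simp
      show "0 \<le> (2 * \<beta> ^ 4 / \<gamma> + \<beta>\<^sup>2) * (var_bound + 1)" using K V0 elim(2) by (intro mult_nonneg_nonneg) auto
    qed (use elim in auto)
    finally show ?case by (simp add: mean_bound_def)
  qed
qed

end

section \<open>The limiting quadratic form\<close>

lemma outer_mult_vec: "outer a b *v x = (b \<bullet> x) *\<^sub>R a" for a b x :: "real^'d"
  by (simp add: outer_def matrix_vector_mult_def vec_eq_iff inner_vec_def sum_distrib_left mult_ac)

lemma norm_outer_le: "norm (outer y y) \<le> real CARD('d) * (norm y)\<^sup>2" for y :: "real^'d"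
proof -
  have "norm (outer y y) \<le> (\<Sum>i\<in>UNIV. norm (outer y y $ i))"
    unfolding norm_vec_def[of "outer y y"] by (rule L2_set_le_sum) simp
  also have "\<dots> \<le> (\<Sum>i\<in>(UNIV :: 'd set). (norm y)\<^sup>2)"
  proof (rule sum_mono)
    fix i
    have "outer y y $ i = y $ i *\<^sub>R y" by (simp add: outer_def vec_eq_iff)
    then show "norm (outer y y $ i) \<le> (norm y)\<^sup>2"
      using component_le_norm_cart[of y i] by (simp add: power2_eq_square mult_right_mono)
  qed
  finally show ?thesis by simp
qed

lemma outer_measurable [measurable]: "(\<lambda>y :: real^'d. outer y y) \<in> borel_measurable borel"
  unfolding outer_def by (intro borel_measurable_continuous_onI continuous_on_vec_lambda continuous_intros)

context cw
begin

lemma gamma12_inner: "h \<bullet> gamma12 \<theta>0 \<beta> = - \<beta> * lim1 h"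
proof -
  have "exp_bounded (\<lambda>y. sech2 (\<beta> * m + \<theta>0 \<bullet> y) *\<^sub>R y)"
  proof (rule exp_bounded_power_growth[where A=1 and k=1])
    show "norm (sech2 (\<beta> * m + \<theta>0 \<bullet> y) *\<^sub>R y) \<le> 1 * norm y ^ 1" for y
      using sech2_mult_le[of "\<beta> * m + \<theta>0 \<bullet> y" "norm y"] by (simp add: abs_mult)
  qed auto
  then have "integrable MX (\<lambda>y. sech2 (\<beta> * m + \<theta>0 \<bullet> y) *\<^sub>R y)" by (rule integral_mix(1))
  then have "h \<bullet> (\<integral>y. sech2 (\<beta> * m + \<theta>0 \<bullet> y) *\<^sub>R y \<partial>MX) = (\<integral>y. h \<bullet> (sech2 (\<beta> * m + \<theta>0 \<bullet> y) *\<^sub>R y) \<partial>MX)"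
    by (simp only: integral_inner_right)
  then show ?thesis unfolding gamma12_def lim1_def by simp
qed

lemma integrable_sech2_outer: "integrable MX (\<lambda>y. sech2 (\<beta> * m + \<theta>0 \<bullet> y) *\<^sub>R outer y y)"
proof (rule integral_mix(1), rule exp_bounded_power_growth[where A="real CARD('d)" and k=2])
  show "norm (sech2 (\<beta> * m + \<theta>0 \<bullet> y) *\<^sub>R outer y y) \<le> real CARD('d) * norm y ^ 2" for y
    using order_trans[OF sech2_mult_le[of "\<beta> * m + \<theta>0 \<bullet> y" "norm (outer y y)"]] norm_outer_le[of y] by (simp add: abs_mult)
qed auto

text \<open>The quadratic form at \<open>h\<close> is a bounded linear functional of the matrix, so
  it passes under the matrix-valued integral.\<close>

lemma gamma22_quadratic: "h \<bullet> (gamma22 \<theta>0 \<beta> *v h) = (norm h)\<^sup>2 - lim2 h"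
proof -
  have bl: "bounded_linear (\<lambda>A :: real^'d^'d. h \<bullet> (A *v h))"
    by (intro linear_conv_bounded_linear[THEN iffD1] linearI)
       (simp_all add: matrix_vector_mult_add_rdistrib inner_add_right scaleR_matrix_vector_assoc[symmetric])
  have "h \<bullet> ((\<integral>y. sech2 (\<beta> * m + \<theta>0 \<bullet> y) *\<^sub>R outer y y \<partial>MX) *v h) = (\<integral>y. h \<bullet> ((sech2 (\<beta> * m + \<theta>0 \<bullet> y) *\<^sub>R outer y y) *v h) \<partial>MX)"
    using integral_bounded_linear[OF bl integrable_sech2_outer] by simp
  also have "\<dots> = lim2 h"
    unfolding lim2_def scaleR_matrix_vector_assoc[symmetric] outer_mult_vec
    by (simp add: inner_commute power2_eq_square mult.assoc)
  finally show ?thesis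
    by (simp add: gamma22_def matrix_vector_mult_diff_rdistrib inner_diff_right power2_norm_eq_inner)
qed

text \<open>Complete-data information |h|^2 minus the missing information, which is the posterior
  curvature found by both Laplace expansions.\<close>

lemma info_mat_quadratic: "h \<bullet> (info_mat \<theta>0 \<beta> *v h) = (norm h)\<^sup>2 - (lim2 h + \<beta>\<^sup>2 * (lim1 h)\<^sup>2 / \<gamma>)"
proof -
  have "h \<bullet> (info_mat \<theta>0 \<beta> *v h) = h \<bullet> (gamma22 \<theta>0 \<beta> *v h) - (1 / \<gamma>) * (h \<bullet> gamma12 \<theta>0 \<beta>)\<^sup>2"
    unfolding info_mat_def matrix_vector_mult_diff_rdistrib scaleR_matrix_vector_assoc[symmetric] outer_mult_vec
    by (simp add: inner_diff_right inner_commute power2_eq_square)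
  then show ?thesis unfolding gamma22_quadratic gamma12_inner by (simp add: power_mult_distrib)
qed

lemma info_mat_symmetric: "transpose (info_mat \<theta>0 \<beta>) = info_mat \<theta>0 \<beta>"
proof -
  have bl: "bounded_linear (transpose :: real^'d^'d \<Rightarrow> real^'d^'d)"
    by (intro linear_conv_bounded_linear[THEN iffD1] linearI) (simp_all add: transpose_def vec_eq_iff)
  have o: "transpose (outer y y) = outer y y" for y :: "real^'d"
    by (simp add: transpose_def outer_def vec_eq_iff mult.commute)
  have "transpose (\<integral>y. sech2 (\<beta> * m + \<theta>0 \<bullet> y) *\<^sub>R outer y y \<partial>MX) = (\<integral>y. transpose (sech2 (\<beta> * m + \<theta>0 \<bullet> y) *\<^sub>R outer y y) \<partial>MX)"
    using integral_bounded_linear[OF bl integrable_sech2_outer] by simp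
  also have "\<dots> = (\<integral>y. sech2 (\<beta> * m + \<theta>0 \<bullet> y) *\<^sub>R outer y y \<partial>MX)"
    unfolding linear_cmul[OF bounded_linear.linear[OF bl]] o ..
  finally have t: "transpose (\<integral>y. sech2 (\<beta> * m + \<theta>0 \<bullet> y) *\<^sub>R outer y y \<partial>MX) = (\<integral>y. sech2 (\<beta> * m + \<theta>0 \<bullet> y) *\<^sub>R outer y y \<partial>MX)" .
  show ?thesis
    unfolding info_mat_def gamma22_def
    by (simp only: linear_diff[OF bounded_linear.linear[OF bl]] linear_cmul[OF bounded_linear.linear[OF bl]] t o transpose_mat)
qed

end

section \<open>Sign symmetry\<close>

text \<open>Restricted to indices below n because label vectors are extensional functions; plain
  negation could leave the set \<open>labels n\<close>.\<close>

definition flip :: "nat \<Rightarrow> (nat \<Rightarrow> real) \<Rightarrow> nat \<Rightarrow> real" where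
  "flip n w = (\<lambda>i\<in>{..<n}. - w i)"

lemma sum_labels_flip: "(\<Sum>w\<in>labels n. G (flip n w)) = (\<Sum>w\<in>labels n. G w)"
proof (rule sum.reindex_bij_witness[where i="flip n" and j="flip n"])
  fix w assume w: "w \<in> labels n"
  then show "flip n (flip n w) = w" "flip n w \<in> labels n"
    by (auto simp: labels_def flip_def PiE_iff extensional_def)
  then show "flip n (flip n w) = w" "flip n w \<in> labels n" by auto
qed simp

lemma zbar_flip: "zbar n (flip n w) = - zbar n w"
  by (simp add: zbar_def flip_def sum_negf)

text \<open>The weight is even in the label mean and sees the data only through the products w_i
  x_i, so negating labels and data together changes nothing.\<close>

lemma post_weight_flip: "post_weight n \<theta> \<beta> (\<lambda>i. - x i) (flip n w) = post_weight n \<theta> \<beta> x w"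
proof -
  have "(\<Sum>i<n. flip n w i *\<^sub>R - x i) = (\<Sum>i<n. w i *\<^sub>R x i)" by (rule sum.cong) (auto simp: flip_def)
  then show ?thesis by (simp add: post_weight_def zbar_flip)
qed

lemma post_weight_sum_uminus: "(\<Sum>w\<in>labels n. post_weight n \<theta> \<beta> (\<lambda>i. - x i) w) = (\<Sum>w\<in>labels n. post_weight n \<theta> \<beta> x w)"
  by (subst sum_labels_flip[symmetric]) (simp only: post_weight_flip)

lemma post_mean_uminus: "i < n \<Longrightarrow> post_mean n \<theta> \<beta> (\<lambda>i. - x i) i = - post_mean n \<theta> \<beta> x i"
  unfolding post_mean_def post_weight_sum_uminus
  by (subst sum_labels_flip[symmetric]) (simp only: post_weight_flip, simp add: flip_def sum_negf)

lemma log_lr_uminus: "log_lr n \<theta>1 \<theta> \<beta> (\<lambda>i. - x i) = log_lr n \<theta>1 \<theta> \<beta> x"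
  unfolding log_lr_eq post_weight_sum_uminus ..

lemma char_post_uminus: "char_post n \<theta> \<beta> h (\<lambda>i. - x i) = char_post n \<theta> \<beta> h x"
proof -
  have "(\<Sum>i<n. (h \<bullet> - x i) / sqrt (real n) * flip n w i) = (\<Sum>i<n. (h \<bullet> x i) / sqrt (real n) * w i)" for w
    by (rule sum.cong) (auto simp: flip_def)
  then show ?thesis
    unfolding char_post_def post_weight_sum_uminus
    by (subst sum_labels_flip[symmetric]) (simp only: post_weight_flip)
qed

section \<open>The characteristic function of the posterior sum under the data law\<close>

lemma norm_char_post_le: "norm (char_post n \<theta> \<beta> h x) \<le> 1"
proof -
  have "norm (\<Sum>w\<in>labels n. post_weight n \<theta> \<beta> x w *\<^sub>R iexp (\<Sum>i<n. (h \<bullet> x i) / sqrt (real n) * w i)) \<le> (\<Sum>w\<in>labels n. post_weight n \<theta> \<beta> x w)"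
    by (rule order_trans[OF norm_sum sum_mono]) (simp add: post_weight_def)
  moreover have "norm (S / complex_of_real W) \<le> 1" if "norm S \<le> W" "W > 0" for S W
    using that by (simp add: norm_divide)
  ultimately show ?thesis
    unfolding char_post_def using post_weight_sum_pos by blast
qed

lemma char_post_measurable [measurable]: "char_post n \<theta> \<beta> h \<in> borel_measurable (PiM {..<n} (\<lambda>_. borel))"
  unfolding char_post_def[abs_def] post_weight_def by measurable

text \<open>The posterior characteristic function turns the mixture weights of the labels back into
  Gaussian integrals with complex shift, which can be evaluated exactly.\<close>
lemma integral_char_post:
  fixes \<theta> h :: "real^'d"
  assumes n: "n > 0"
  shows "(\<integral>x. char_post n \<theta> \<beta> h x \<partial>cw_law n \<theta> \<beta>) = iexp (sqrt (real n) * (h \<bullet> \<theta>)) * exp (- (norm h)\<^sup>2 / 2)"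
proof -
  interpret D: prob_space "data_law n a" for a :: "nat \<Rightarrow> real^'d" by (rule prob_space_data_law)
  have dens_nn: "cw_dens n \<theta> \<beta> x \<ge> 0" for x
    unfolding cw_dens_def by (intro sum_nonneg mult_nonneg_nonneg cw_prior_nonneg prod_nonneg) auto
  have [measurable]: "cw_dens n \<theta> \<beta> \<in> borel_measurable (PiM {..<n} (\<lambda>_. borel))"
    unfolding cw_dens_def by measurable
  define ch where "ch z x = iexp (\<Sum>i<n. (h \<bullet> x i) / sqrt (real n) * z i)" for z :: "nat \<Rightarrow> real" and x :: "nat \<Rightarrow> real^'d"
  have chm [measurable]: "ch z \<in> borel_measurable (PiM {..<n} (\<lambda>_. borel))" for z
    unfolding ch_def[abs_def] by measurable
  have i: "integrable (sample_space n) (\<lambda>x. (\<Prod>i<n. gauss_dens (x i - z i *\<^sub>R \<theta>)) *\<^sub>R ch z x)"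
    and e: "(\<integral>x. ch z x \<partial>data_law n (\<lambda>i. z i *\<^sub>R \<theta>)) = (\<integral>x. (\<Prod>i<n. gauss_dens (x i - z i *\<^sub>R \<theta>)) *\<^sub>R ch z x \<partial>sample_space n)" for z
  proof -
    have "integrable (data_law n (\<lambda>i. z i *\<^sub>R \<theta>)) (ch z)"
      by (rule D.integrable_const_bound[where B=1]) (simp_all add: ch_def)
    then show "integrable (sample_space n) (\<lambda>x. (\<Prod>i<n. gauss_dens (x i - z i *\<^sub>R \<theta>)) *\<^sub>R ch z x)"
      unfolding data_law_density by (subst (asm) integrable_density) (auto intro!: prod_nonneg)
    show "(\<integral>x. ch z x \<partial>data_law n (\<lambda>i. z i *\<^sub>R \<theta>)) = (\<integral>x. (\<Prod>i<n. gauss_dens (x i - z i *\<^sub>R \<theta>)) *\<^sub>R ch z x \<partial>sample_space n)"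
      unfolding data_law_density by (subst integral_density) (auto intro!: prod_nonneg)
  qed
  \<comment> \<open>Labels square to 1, so neither phase nor modulus of a coordinate factor depends
    on them, and the mixture over labels becomes trivial.\<close>
  have val: "(\<integral>x. ch z x \<partial>data_law n (\<lambda>i. z i *\<^sub>R \<theta>)) = iexp (sqrt (real n) * (h \<bullet> \<theta>)) * exp (- (norm h)\<^sup>2 / 2)" if z: "z \<in> labels n" for z
  proof -
    interpret P: product_prob_space "\<lambda>i. gauss_at (z i *\<^sub>R \<theta>)" by (rule product_prob_space_gauss_at)
    have "ch z x = (\<Prod>i<n. iexp (((z i / sqrt (real n)) *\<^sub>R h) \<bullet> x i))" for x
    proof -
      have "\<i> * complex_of_real (\<Sum>i<n. (h \<bullet> x i) / sqrt (real n) * z i) = (\<Sum>i<n. \<i> * complex_of_real (((z i / sqrt (real n)) *\<^sub>R h) \<bullet> x i))"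
        unfolding of_real_sum sum_distrib_left by (rule sum.cong) simp_all
      then show ?thesis unfolding ch_def by (simp only: exp_sum finite_lessThan)
    qed
    then have "(\<integral>x. ch z x \<partial>data_law n (\<lambda>i. z i *\<^sub>R \<theta>)) = (\<Prod>i<n. \<integral>y. iexp (((z i / sqrt (real n)) *\<^sub>R h) \<bullet> y) \<partial>gauss_at (z i *\<^sub>R \<theta>))"
      unfolding data_law_def
      by (simp only:) (rule P.product_integral_prod, simp, rule finite_measure.integrable_const_bound[OF prob_space.axioms(1)[OF prob_space_gauss_at], where B=1], simp_all)
    also have "\<dots> = (\<Prod>i<n. iexp ((h \<bullet> \<theta>) / sqrt (real n)) * exp (- (norm h)\<^sup>2 / (2 * real n)))"
    proof (rule prod.cong[OF refl])
      fix i assume "i \<in> {..<n}"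
      then have zz: "(z i)\<^sup>2 = 1" using labels_abs_1[OF z, of i] by auto
      have 1: "((z i / sqrt (real n)) *\<^sub>R h) \<bullet> (z i *\<^sub>R \<theta>) = (h \<bullet> \<theta>) / sqrt (real n)"
        using zz by (simp add: power2_eq_square)
      have 2: "(norm ((z i / sqrt (real n)) *\<^sub>R h))\<^sup>2 = (norm h)\<^sup>2 / real n"
        using zz by (simp add: power_mult_distrib power_divide)
      show "(\<integral>y. iexp (((z i / sqrt (real n)) *\<^sub>R h) \<bullet> y) \<partial>gauss_at (z i *\<^sub>R \<theta>)) = iexp ((h \<bullet> \<theta>) / sqrt (real n)) * exp (- (norm h)\<^sup>2 / (2 * real n))"
        unfolding integral_gauss_at_iexp 1 2 by (simp add: mult.commute)
    qed
    also have "\<dots> = iexp (real n * ((h \<bullet> \<theta>) / sqrt (real n))) * exp (real n * (- (norm h)\<^sup>2 / (2 * real n)))"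
    proof -
      have "(iexp t * complex_of_real (exp r)) ^ n = iexp (real n * t) * complex_of_real (exp (real n * r))" for t r
        unfolding power_mult_distrib of_real_power[symmetric] exp_of_nat_mult[symmetric] by (simp add: mult.left_commute)
      then show ?thesis by (simp only: prod_constant card_lessThan)
    qed
    also have "real n * ((h \<bullet> \<theta>) / sqrt (real n)) = sqrt (real n) * (h \<bullet> \<theta>)"
    proof -
      have "real n * ((h \<bullet> \<theta>) / sqrt (real n)) = (real n / sqrt (real n)) * (h \<bullet> \<theta>)" by simp
      then show ?thesis by (simp only: real_div_sqrt of_nat_0_le_iff)
    qed
    also have "real n * (- (norm h)\<^sup>2 / (2 * real n)) = - (norm h)\<^sup>2 / 2" using n by simp
    finally show ?thesis .
  qed
  have "(\<integral>x. char_post n \<theta> \<beta> h x \<partial>cw_law n \<theta> \<beta>) = (\<integral>x. cw_dens n \<theta> \<beta> x *\<^sub>R char_post n \<theta> \<beta> h x \<partial>sample_space n)"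
    unfolding cw_law_def by (rule integral_density) (auto simp: dens_nn)
  also have "\<dots> = (\<integral>x. (\<Sum>z\<in>labels n. cw_prior n \<beta> z *\<^sub>R ((\<Prod>i<n. gauss_dens (x i - z i *\<^sub>R \<theta>)) *\<^sub>R ch z x)) \<partial>sample_space n)"
  proof (rule Bochner_Integration.integral_cong[OF refl])
    fix x
    let ?W = "\<Sum>w\<in>labels n. post_weight n \<theta> \<beta> x w"
    \<comment> \<open>The posterior normaliser in \<open>char_post\<close> is the very sum in
      \<open>cw_dens_eq\<close> and cancels against it.\<close>
    have "(dens_const n \<theta> \<beta> x * ?W) *\<^sub>R (S / complex_of_real ?W) = dens_const n \<theta> \<beta> x *\<^sub>R S" for S
      using post_weight_sum_pos[of n \<theta> \<beta> x] by (simp add: scaleR_conv_of_real del: of_real_sum)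
    then have "cw_dens n \<theta> \<beta> x *\<^sub>R char_post n \<theta> \<beta> h x = dens_const n \<theta> \<beta> x *\<^sub>R (\<Sum>w\<in>labels n. post_weight n \<theta> \<beta> x w *\<^sub>R ch w x)"
      unfolding cw_dens_eq char_post_def ch_def .
    also have "\<dots> = (\<Sum>z\<in>labels n. cw_prior n \<beta> z *\<^sub>R ((\<Prod>i<n. gauss_dens (x i - z i *\<^sub>R \<theta>)) *\<^sub>R ch z x))"
      unfolding scaleR_sum_right scaleR_scaleR by (rule sum.cong[OF refl]) (simp only: cw_dens_term)
    finally show "cw_dens n \<theta> \<beta> x *\<^sub>R char_post n \<theta> \<beta> h x = (\<Sum>z\<in>labels n. cw_prior n \<beta> z *\<^sub>R ((\<Prod>i<n. gauss_dens (x i - z i *\<^sub>R \<theta>)) *\<^sub>R ch z x))" .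
  qed
  also have "\<dots> = (\<Sum>z\<in>labels n. \<integral>x. cw_prior n \<beta> z *\<^sub>R ((\<Prod>i<n. gauss_dens (x i - z i *\<^sub>R \<theta>)) *\<^sub>R ch z x) \<partial>sample_space n)"
    using i by (intro Bochner_Integration.integral_sum integrable_scaleR_right)
  also have "\<dots> = (\<Sum>z\<in>labels n. cw_prior n \<beta> z *\<^sub>R (iexp (sqrt (real n) * (h \<bullet> \<theta>)) * exp (- (norm h)\<^sup>2 / 2)))"
    by (rule sum.cong[OF refl]) (simp only: integral_scaleR_right e[symmetric] val)
  also have "\<dots> = iexp (sqrt (real n) * (h \<bullet> \<theta>)) * exp (- (norm h)\<^sup>2 / 2)"
    unfolding scaleR_sum_left[symmetric] cw_prior_sum by simp
  finally show ?thesis .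
qed

section \<open>Limit law of the central sequence\<close>

lemma measure_le_outer_prob:
  assumes "finite_measure M" "A \<in> sets M" shows "measure M A \<le> outer_prob M A"
proof -
  interpret finite_measure M by fact
  have "A \<inter> space M = A" using sets.sets_into_space[OF assms(2)] by blast
  then show ?thesis unfolding outer_prob_def
    using assms(2) by (intro cInf_greatest) (auto intro!: finite_measure_mono exI[of _ A])
qed

text \<open>Convergence in probability with a uniform bound gives convergence in mean: \<epsilon> /
  2 where the variable is small, B times the probability of the exceptional set elsewhere.\<close>

lemma integral_norm_tendsto_0:
  fixes Y :: "nat \<Rightarrow> 'a \<Rightarrow> complex"
  assumes P: "\<And>n. prob_space (M n)" and Ym: "\<And>n. Y n \<in> borel_measurable (M n)" and B: "\<And>n x. norm (Y n x) \<le> B"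
    and small: "\<And>\<epsilon>. \<epsilon> > 0 \<Longrightarrow> (\<lambda>n. outer_prob (M n) {x \<in> space (M n). \<not> norm (Y n x) \<le> \<epsilon>}) \<longlonglongrightarrow> 0"
  shows "(\<lambda>n. \<integral>x. norm (Y n x) \<partial>M n) \<longlonglongrightarrow> 0"
proof (rule LIMSEQ_approxI)
  fix \<epsilon> :: real assume \<epsilon>: "\<epsilon> > 0"
  let ?A = "\<lambda>n. {x \<in> space (M n). \<not> norm (Y n x) \<le> \<epsilon> / 2}"
  have B0: "0 \<le> B" using B[of 0] norm_ge_zero order_trans by blast
  have le: "(\<integral>x. norm (Y n x) \<partial>M n) \<le> \<epsilon> / 2 + B * outer_prob (M n) (?A n)" for n
  proof -
    interpret prob_space "M n" by (rule P)
    note [measurable] = Ym[of n]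
    define S where "S = ?A n"
    have A: "S \<in> sets (M n)" unfolding S_def by measurable
    have i2: "integrable (M n) (\<lambda>x. B * indicator S x)"
      using A by (intro integrable_mult_right integrable_real_indicator) (auto simp: less_top[symmetric])
    have "(\<integral>x. norm (Y n x) \<partial>M n) \<le> (\<integral>x. \<epsilon> / 2 + B * indicator S x \<partial>M n)"
    proof (rule integral_mono)
      show "integrable (M n) (\<lambda>x. norm (Y n x))" by (rule integrable_const_bound[where B=B]) (use B in auto)
      show "integrable (M n) (\<lambda>x. \<epsilon> / 2 + B * indicator S x)" using i2 by simp
      show "norm (Y n x) \<le> \<epsilon> / 2 + B * indicator S x" if "x \<in> space (M n)" for x
        using B[of n x] that \<epsilon> by (auto simp: indicator_def S_def)
    qed
    also have "\<dots> = \<epsilon> / 2 + B * measure (M n) S" using A i2 prob_space by simp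
    also have "\<dots> \<le> \<epsilon> / 2 + B * outer_prob (M n) S"
      using B0 measure_le_outer_prob[OF finite_measure_axioms A] by (intro add_left_mono mult_left_mono) auto
    also have "outer_prob (M n) S = outer_prob (M n) (?A n)" unfolding S_def ..
    finally show ?thesis .
  qed
  have "(\<lambda>n. B * outer_prob (M n) (?A n)) \<longlonglongrightarrow> 0"
    using small[of "\<epsilon> / 2"] \<epsilon> by (intro tendsto_mult_right_zero) auto
  from order_tendstoD(2)[OF this, of "\<epsilon> / 2"] \<epsilon>
  have "\<forall>\<^sub>F n in sequentially. B * outer_prob (M n) (?A n) < \<epsilon> / 2" by simp
  then have "\<forall>\<^sub>F n in sequentially. norm ((\<integral>x. norm (Y n x) \<partial>M n) - 0) \<le> \<epsilon>"
  proof eventually_elim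
    case (elim n)
    have "0 \<le> (\<integral>x. norm (Y n x) \<partial>M n)" by (rule integral_nonneg_AE) simp
    then show ?case using le[of n] elim by simp
  qed
  then show "\<exists>a b. a \<longlonglongrightarrow> b \<and> (\<forall>\<^sub>F n in sequentially. norm ((\<integral>x. norm (Y n x) \<partial>M n) - a n) \<le> \<epsilon>) \<and> norm (0 - b) \<le> \<epsilon>"
    using \<epsilon> by (intro exI[of _ "\<lambda>_. 0"] exI[of _ 0]) auto
qed

section \<open>The central sequence and the transfer to probability\<close>

context cw
begin

text \<open>\<open>Delta_tilde\<close> with the minimiser as an explicit argument, so that the
  simultaneous sign change of data and minimiser can be expressed.\<close>

definition delta_at :: "nat \<Rightarrow> (nat \<Rightarrow> real^'d) \<Rightarrow> real \<Rightarrow> real^'d" where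
  "delta_at n x u = sqrt (real n) *\<^sub>R ((1 / real n) *\<^sub>R (\<Sum>i<n. tanh (\<beta> * u + \<theta>0 \<bullet> x i) *\<^sub>R x i) - \<theta>0)"

lemma tanh_uminus_arg: "tanh (\<beta> * - u + \<theta>0 \<bullet> - y) = - tanh (\<beta> * u + \<theta>0 \<bullet> y)"
  using tanh_minus[of "\<beta> * u + \<theta>0 \<bullet> y"] by simp

lemma delta_at_uminus: "delta_at n (\<lambda>i. - x i) (- u) = delta_at n x u"
  unfolding delta_at_def tanh_uminus_arg by simp

end

lemma (in good_seq) inner_delta_at: "h \<bullet> delta_at (\<nu> k) (X k) (u k) = lin k - sqrt (N k) * (h \<bullet> \<theta>0)"
proof -
  have q: "sqrt (N k) / N k = 1 / sqrt (N k)" by (rule sqrt_divide_self_eq[unfolded inverse_eq_divide]) simp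
  have "h \<bullet> delta_at (\<nu> k) (X k) (u k) = sqrt (N k) / N k * (\<Sum>i<\<nu> k. tanh (\<beta> * u k + \<theta>0 \<bullet> X k i) * (h \<bullet> X k i)) - sqrt (N k) * (h \<bullet> \<theta>0)"
    by (simp add: delta_at_def inner_diff_right inner_sum_right right_diff_distrib)
  also have "sqrt (N k) / N k * (\<Sum>i<\<nu> k. tanh (\<beta> * u k + \<theta>0 \<bullet> X k i) * (h \<bullet> X k i)) = lin k"
    unfolding q lin_def a_def b_def sum_distrib_left by (rule sum.cong) simp_all
  finally show ?thesis .
qed

context cw
begin

definition curv_at :: "real^'d \<Rightarrow> real" where "curv_at h = lim2 h + \<beta>\<^sup>2 * (lim1 h)\<^sup>2 / \<gamma>"

text \<open>The phase is \<open>lin\<close> rewritten through \<open>inner_delta_at\<close>, and the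
  subtracted constant is the limit from \<open>char_post_expansion\<close>; so this vanishes along
  good data.\<close>

definition char_err :: "real^'d \<Rightarrow> nat \<Rightarrow> (nat \<Rightarrow> real^'d) \<Rightarrow> real \<Rightarrow> complex" where
  "char_err h n x u = char_post n \<theta>0 \<beta> h x * iexp (- (h \<bullet> delta_at n x u + sqrt (real n) * (h \<bullet> \<theta>0))) - complex_of_real (exp (- curv_at h / 2))"

context
  fixes U :: "nat \<Rightarrow> (nat \<Rightarrow> real^'d) \<Rightarrow> real"
  assumes U_min: "\<And>n x. is_min n x (U n x)"
begin

text \<open>The claim concerns the vector sum and singles out no direction, so the tests are taken
  at h = 0.\<close>

lemma post_mean_outer_prob:
  "(\<lambda>n. outer_prob (cw_law n \<theta>0 \<beta>) {x \<in> space (cw_law n \<theta>0 \<beta>).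
     \<not> norm ((\<Sum>i<n. post_mean n \<theta>0 \<beta> x i *\<^sub>R x i) - (\<Sum>i<n. tanh (\<beta> * U n x + \<theta>0 \<bullet> x i) *\<^sub>R x i)) \<le> mean_bound}) \<longlonglongrightarrow> 0"
proof (rule eventually_outer_prob_transfer[where Fs="tests 0" and
    Q="\<lambda>n x u. norm ((\<Sum>i<n. post_mean n \<theta>0 \<beta> x i *\<^sub>R x i) - (\<Sum>i<n. tanh (\<beta> * u + \<theta>0 \<bullet> x i) *\<^sub>R x i)) \<le> mean_bound",
    OF exp_bounded_tests U_min])
  fix n and x :: "nat \<Rightarrow> real^'d" and u
  assume *: "norm ((\<Sum>i<n. post_mean n \<theta>0 \<beta> (\<lambda>i. - x i) i *\<^sub>R - x i) - (\<Sum>i<n. tanh (\<beta> * - u + \<theta>0 \<bullet> - x i) *\<^sub>R - x i)) \<le> mean_bound"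
  have "(\<Sum>i<n. post_mean n \<theta>0 \<beta> (\<lambda>i. - x i) i *\<^sub>R - x i) = (\<Sum>i<n. post_mean n \<theta>0 \<beta> x i *\<^sub>R x i)"
    by (rule sum.cong) (auto simp: post_mean_uminus)
  then show "norm ((\<Sum>i<n. post_mean n \<theta>0 \<beta> x i *\<^sub>R x i) - (\<Sum>i<n. tanh (\<beta> * u + \<theta>0 \<bullet> x i) *\<^sub>R x i)) \<le> mean_bound"
    using * unfolding tanh_uminus_arg by simp
next
  fix \<nu> X u
  assume "\<And>k. k < \<nu> k" "\<And>j. (\<lambda>k. emp_mean (\<nu> k) (tests 0 j) (X k)) \<longlonglongrightarrow> (\<integral>y. tests 0 j y \<partial>MX)" "\<And>k. is_min (\<nu> k) (X k) (u k)"
  then interpret good_seq \<beta> \<theta>0 0 \<nu> X u by unfold_locales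
  show "\<forall>\<^sub>F k in sequentially. norm ((\<Sum>i<\<nu> k. post_mean (\<nu> k) \<theta>0 \<beta> (X k) i *\<^sub>R X k i) - (\<Sum>i<\<nu> k. tanh (\<beta> * u k + \<theta>0 \<bullet> X k i) *\<^sub>R X k i)) \<le> mean_bound"
    by (rule post_mean_expansion)
qed

lemma log_lr_outer_prob:
  assumes \<epsilon>: "\<epsilon> > 0"
  shows "(\<lambda>n. outer_prob (cw_law n \<theta>0 \<beta>) {x \<in> space (cw_law n \<theta>0 \<beta>).
     \<not> \<bar>log_lr n (\<theta>0 + (1 / sqrt (real n)) *\<^sub>R h) \<theta>0 \<beta> x - (h \<bullet> delta_at n x (U n x) - h \<bullet> (info_mat \<theta>0 \<beta> *v h) / 2)\<bar> \<le> \<epsilon>}) \<longlonglongrightarrow> 0"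
proof (rule eventually_outer_prob_transfer[where Fs="tests h" and
    Q="\<lambda>n x u. \<bar>log_lr n (\<theta>0 + (1 / sqrt (real n)) *\<^sub>R h) \<theta>0 \<beta> x - (h \<bullet> delta_at n x u - h \<bullet> (info_mat \<theta>0 \<beta> *v h) / 2)\<bar> \<le> \<epsilon>",
    OF exp_bounded_tests U_min])
  fix n x u
  assume "\<bar>log_lr n (\<theta>0 + (1 / sqrt (real n)) *\<^sub>R h) \<theta>0 \<beta> (\<lambda>i. - x i) - (h \<bullet> delta_at n (\<lambda>i. - x i) (- u) - h \<bullet> (info_mat \<theta>0 \<beta> *v h) / 2)\<bar> \<le> \<epsilon>"
  then show "\<bar>log_lr n (\<theta>0 + (1 / sqrt (real n)) *\<^sub>R h) \<theta>0 \<beta> x - (h \<bullet> delta_at n x u - h \<bullet> (info_mat \<theta>0 \<beta> *v h) / 2)\<bar> \<le> \<epsilon>"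
    unfolding log_lr_uminus delta_at_uminus .
next
  fix \<nu> X u
  assume "\<And>k. k < \<nu> k" "\<And>j. (\<lambda>k. emp_mean (\<nu> k) (tests h j) (X k)) \<longlonglongrightarrow> (\<integral>y. tests h j y \<partial>MX)" "\<And>k. is_min (\<nu> k) (X k) (u k)"
  then interpret good_seq \<beta> \<theta>0 h \<nu> X u by unfold_locales
  have "h \<bullet> delta_at (\<nu> k) (X k) (u k) = lin k - sqrt (N k) * (h \<bullet> \<theta>0)" for k
    by (rule inner_delta_at)
  then have "h \<bullet> delta_at (\<nu> k) (X k) (u k) - h \<bullet> (info_mat \<theta>0 \<beta> *v h) / 2 = lin k - sqrt (N k) * (h \<bullet> \<theta>0) - ((norm h)\<^sup>2 - curv) / 2" for k
    unfolding info_mat_quadratic curv_def by simp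
  then have "(\<lambda>k. log_lr (\<nu> k) (\<theta>0 + (1 / sqrt (N k)) *\<^sub>R h) \<theta>0 \<beta> (X k) - (h \<bullet> delta_at (\<nu> k) (X k) (u k) - h \<bullet> (info_mat \<theta>0 \<beta> *v h) / 2)) \<longlonglongrightarrow> 0"
    using log_lr_expansion by simp
  from tendstoD[OF this \<epsilon>]
  show "\<forall>\<^sub>F k in sequentially. \<bar>log_lr (\<nu> k) (\<theta>0 + (1 / sqrt (N k)) *\<^sub>R h) \<theta>0 \<beta> (X k) - (h \<bullet> delta_at (\<nu> k) (X k) (u k) - h \<bullet> (info_mat \<theta>0 \<beta> *v h) / 2)\<bar> \<le> \<epsilon>"
    by eventually_elim simp
qed

lemma char_err_outer_prob:
  assumes \<epsilon>: "\<epsilon> > 0"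
  shows "(\<lambda>n. outer_prob (cw_law n \<theta>0 \<beta>) {x \<in> space (cw_law n \<theta>0 \<beta>). \<not> norm (char_err h n x (U n x)) \<le> \<epsilon>}) \<longlonglongrightarrow> 0"
proof (rule eventually_outer_prob_transfer[where Fs="tests h" and Q="\<lambda>n x u. norm (char_err h n x u) \<le> \<epsilon>", OF exp_bounded_tests U_min])
  fix n x u
  assume "norm (char_err h n (\<lambda>i. - x i) (- u)) \<le> \<epsilon>"
  then show "norm (char_err h n x u) \<le> \<epsilon>" unfolding char_err_def char_post_uminus delta_at_uminus .
next
  fix \<nu> X u
  assume "\<And>k. k < \<nu> k" "\<And>j. (\<lambda>k. emp_mean (\<nu> k) (tests h j) (X k)) \<longlonglongrightarrow> (\<integral>y. tests h j y \<partial>MX)" "\<And>k. is_min (\<nu> k) (X k) (u k)"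
  then interpret good_seq \<beta> \<theta>0 h \<nu> X u by unfold_locales
  have "h \<bullet> delta_at (\<nu> k) (X k) (u k) + sqrt (N k) * (h \<bullet> \<theta>0) = lin k" for k
    unfolding inner_delta_at by simp
  then have "(\<lambda>k. char_err h (\<nu> k) (X k) (u k)) \<longlonglongrightarrow> 0"
    unfolding char_err_def curv_at_def curv_def[symmetric] using char_post_expansion by (simp add: LIM_zero)
  from tendstoD[OF this \<epsilon>]
  show "\<forall>\<^sub>F k in sequentially. norm (char_err h (\<nu> k) (X k) (u k)) \<le> \<epsilon>"
    by eventually_elim simp
qed

end

end

section \<open>Convergence in law of the central sequence\<close>

context cw
begin

context
  fixes U :: "nat \<Rightarrow> (nat \<Rightarrow> real^'d) \<Rightarrow> real"
  assumes U_min: "\<And>n x. is_min n x (U n x)"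
    and U_measurable [measurable]: "\<And>n. U n \<in> borel_measurable (PiM {..<n} (\<lambda>_. borel))"
begin

lemma delta_measurable [measurable]: "(\<lambda>x. delta_at n x (U n x)) \<in> borel_measurable (PiM {..<n} (\<lambda>_. borel))"
  unfolding delta_at_def by measurable

text \<open>The posterior characteristic function has a known expectation and is asymptotically a constant
  multiple of \<open>iexp (t \<bullet> \<Delta>)\<close>, so the limit of the characteristic function of \<open>\<Delta>\<close> comes for free.\<close>
lemma delta_char_tendsto:
  "(\<lambda>n. \<integral>x. iexp (t \<bullet> delta_at n x (U n x)) \<partial>cw_law n \<theta>0 \<beta>) \<longlonglongrightarrow> complex_of_real (exp (- (t \<bullet> (info_mat \<theta>0 \<beta> *v t)) / 2))"
proof -
  define c where "c = exp (- curv_at t / 2)"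
  define Y where "Y n x = char_err t n x (U n x)" for n x
  define J where "J n = (\<integral>x. iexp (t \<bullet> delta_at n x (U n x)) \<partial>cw_law n \<theta>0 \<beta>)" for n
  have c: "c > 0" unfolding c_def by simp
  interpret P: prob_space "cw_law n \<theta>0 \<beta>" for n by (rule prob_space_cw_law)
  have Ym [measurable]: "Y n \<in> borel_measurable (PiM {..<n} (\<lambda>_. borel))" for n
    unfolding Y_def[abs_def] char_err_def by measurable
  have YB: "norm (Y n x) \<le> 1 + c" for n x
  proof -
    have "norm (Y n x) \<le> norm (char_post n \<theta>0 \<beta> t x * iexp (- (t \<bullet> delta_at n x (U n x) + sqrt (real n) * (t \<bullet> \<theta>0)))) + norm (complex_of_real c)"
      unfolding Y_def char_err_def c_def by (rule norm_triangle_ineq4)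
    then show ?thesis using norm_char_post_le[of n \<theta>0 \<beta> t x] c by (simp add: norm_mult)
  qed
  have Y0: "(\<lambda>n. \<integral>x. norm (Y n x) \<partial>cw_law n \<theta>0 \<beta>) \<longlonglongrightarrow> 0"
  proof (rule integral_norm_tendsto_0[where B="1 + c"])
    show "prob_space (cw_law n \<theta>0 \<beta>)" for n by (rule prob_space_cw_law)
    show "Y n \<in> borel_measurable (cw_law n \<theta>0 \<beta>)" for n by simp
    show "norm (Y n x) \<le> 1 + c" for n x by (rule YB)
    show "(\<lambda>n. outer_prob (cw_law n \<theta>0 \<beta>) {x \<in> space (cw_law n \<theta>0 \<beta>). \<not> norm (Y n x) \<le> \<epsilon>}) \<longlonglongrightarrow> 0" if "\<epsilon> > 0" for \<epsilon>
      unfolding Y_def by (rule char_err_outer_prob[OF U_min that])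
  qed
  \<comment> \<open>In the product with exp (i t . Delta) the random phases cancel, leaving the
    posterior characteristic function with a deterministic phase; its mean is exact by
    \<open>integral_char_post\<close>.\<close>
  have eq: "(\<integral>x. Y n x * iexp (t \<bullet> delta_at n x (U n x)) \<partial>cw_law n \<theta>0 \<beta>) = complex_of_real (exp (- (norm t)\<^sup>2 / 2)) - c * J n" if n: "n > 0" for n
  proof -
    let ?s = "sqrt (real n) * (t \<bullet> \<theta>0)"
    have "iexp (- (p + s)) * iexp p = iexp (- s)" for p s :: real
      unfolding exp_add[symmetric] by (simp add: algebra_simps)
    then have pt: "Y n x * iexp (t \<bullet> delta_at n x (U n x)) = char_post n \<theta>0 \<beta> t x * iexp (- ?s) - c * iexp (t \<bullet> delta_at n x (U n x))" for x
      unfolding Y_def char_err_def c_def left_diff_distrib mult.assoc by (simp only:)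
    have i1: "integrable (cw_law n \<theta>0 \<beta>) (\<lambda>x. char_post n \<theta>0 \<beta> t x)"
      by (rule P.integrable_const_bound[where B=1]) (auto simp: norm_char_post_le)
    have i2: "integrable (cw_law n \<theta>0 \<beta>) (\<lambda>x. iexp (t \<bullet> delta_at n x (U n x)))"
      by (rule P.integrable_const_bound[where B=1]) auto
    have "(\<integral>x. Y n x * iexp (t \<bullet> delta_at n x (U n x)) \<partial>cw_law n \<theta>0 \<beta>)
        = (\<integral>x. char_post n \<theta>0 \<beta> t x \<partial>cw_law n \<theta>0 \<beta>) * iexp (- ?s) - c * J n"
      unfolding pt J_def
      by (subst Bochner_Integration.integral_diff) (simp_all add: i1 i2 integrable_mult_left integrable_mult_right)
    also have "\<dots> = complex_of_real (exp (- (norm t)\<^sup>2 / 2)) - c * J n"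
    proof -
      have "iexp ?s * E * iexp (- ?s) = E" for E
        using exp_add[of "\<i> * complex_of_real ?s" "\<i> * complex_of_real (- ?s)"] by simp
      then show ?thesis unfolding integral_char_post[OF n] by (simp only:)
    qed
    finally show ?thesis .
  qed
  have "(\<lambda>n. complex_of_real (exp (- (norm t)\<^sup>2 / 2)) - c * J n) \<longlonglongrightarrow> 0"
  proof (rule Lim_null_comparison[OF _ Y0])
    show "\<forall>\<^sub>F n in sequentially. norm (complex_of_real (exp (- (norm t)\<^sup>2 / 2)) - c * J n) \<le> (\<integral>x. norm (Y n x) \<partial>cw_law n \<theta>0 \<beta>)"
      using eventually_gt_at_top[of 0]
    proof eventually_elim
      case (elim n)
      have "norm (\<integral>x. Y n x * iexp (t \<bullet> delta_at n x (U n x)) \<partial>cw_law n \<theta>0 \<beta>) \<le> (\<integral>x. norm (Y n x * iexp (t \<bullet> delta_at n x (U n x))) \<partial>cw_law n \<theta>0 \<beta>)"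
        by (rule integral_norm_bound)
      then show ?case unfolding eq[OF elim] by (simp add: norm_mult)
    qed
  qed
  from tendsto_diff[OF tendsto_const[of "complex_of_real (exp (- (norm t)\<^sup>2 / 2))"] this]
  have "(\<lambda>n. c * J n) \<longlonglongrightarrow> complex_of_real (exp (- (norm t)\<^sup>2 / 2))" by simp
  from tendsto_mult[OF tendsto_const[of "complex_of_real (exp (curv_at t / 2))"] this]
  have "(\<lambda>n. complex_of_real (exp (curv_at t / 2)) * (c * J n)) \<longlonglongrightarrow> complex_of_real (exp (curv_at t / 2) * exp (- (norm t)\<^sup>2 / 2))" by simp
  moreover have "complex_of_real (exp (curv_at t / 2)) * (c * J n) = J n" for n
  proof -
    have "exp (curv_at t / 2) * c = 1" unfolding c_def by (simp add: exp_add[symmetric])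
    then show ?thesis unfolding mult.assoc[symmetric] of_real_mult[symmetric] by simp
  qed
  moreover have "exp (curv_at t / 2) * exp (- (norm t)\<^sup>2 / 2) = exp (- (t \<bullet> (info_mat \<theta>0 \<beta> *v t)) / 2)"
    unfolding info_mat_quadratic curv_at_def[symmetric] exp_add[symmetric] by (simp add: diff_divide_distrib)
  ultimately show ?thesis unfolding J_def by (simp only:)
qed

text \<open>Characteristic functions have modulus at most 1, and so has their limit exp (- q / 2),
  where q is the quadratic form.\<close>

lemma info_mat_nonneg: "0 \<le> t \<bullet> (info_mat \<theta>0 \<beta> *v t)"
proof -
  have "norm (complex_of_real (exp (- (t \<bullet> (info_mat \<theta>0 \<beta> *v t)) / 2))) \<le> 1"
  proof (rule tendsto_upperbound[OF tendsto_norm[OF delta_char_tendsto[of t]]])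
    show "\<forall>\<^sub>F n in sequentially. norm (\<integral>x. iexp (t \<bullet> delta_at n x (U n x)) \<partial>cw_law n \<theta>0 \<beta>) \<le> 1"
    proof (rule always_eventually, rule allI)
      fix n
      interpret prob_space "cw_law n \<theta>0 \<beta>" by (rule prob_space_cw_law)
      have "norm (\<integral>x. iexp (t \<bullet> delta_at n x (U n x)) \<partial>cw_law n \<theta>0 \<beta>) \<le> (\<integral>x. norm (iexp (t \<bullet> delta_at n x (U n x))) \<partial>cw_law n \<theta>0 \<beta>)"
        by (rule integral_norm_bound)
      then show "norm (\<integral>x. iexp (t \<bullet> delta_at n x (U n x)) \<partial>cw_law n \<theta>0 \<beta>) \<le> 1"
        by (simp add: prob_space)
    qed
  qed simp
  then show ?thesis by simp
qed

text \<open>Symmetry and semidefiniteness of \<open>info_mat\<close> make \<open>normal_meas\<close>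
  a genuine normal law with the limiting characteristic function, so
  \<open>weak_conv_of_char\<close> applies to the image laws.\<close>

lemma delta_conv_distr: "conv_distr (\<lambda>n. cw_law n \<theta>0 \<beta>) (\<lambda>n x. delta_at n x (U n x)) (normal_meas (info_mat \<theta>0 \<beta>))"
  unfolding conv_distr_def
proof (intro conjI allI impI)
  show dm: "(\<lambda>x. delta_at n x (U n x)) \<in> borel_measurable (cw_law n \<theta>0 \<beta>)" for n by simp
  fix g :: "real^'d \<Rightarrow> real" assume g: "continuous_on UNIV g \<and> bounded (range g)"
  then have gm [measurable]: "g \<in> borel_measurable borel" by (intro borel_measurable_continuous_onI) simp
  note normal = normal_meas_char[OF info_mat_symmetric info_mat_nonneg]
  define \<nu> where "\<nu> n = distr (cw_law n \<theta>0 \<beta>) borel (\<lambda>x. delta_at n x (U n x))" for n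
  have "(\<lambda>n. \<integral>y. g y \<partial>\<nu> n) \<longlonglongrightarrow> (\<integral>y. g y \<partial>normal_meas (info_mat \<theta>0 \<beta>))"
  proof (rule weak_conv_of_char)
    show "prob_space (\<nu> n)" for n
      unfolding \<nu>_def by (rule prob_space.prob_space_distr[OF prob_space_cw_law dm])
    show "sets (\<nu> n) = sets borel" for n unfolding \<nu>_def by simp
    show "prob_space (normal_meas (info_mat \<theta>0 \<beta>))" "sets (normal_meas (info_mat \<theta>0 \<beta>)) = sets borel"
      by (rule normal)+
    show "continuous_on UNIV g" "bounded (range g)" using g by auto
    fix t
    have "(\<integral>y. iexp (t \<bullet> y) \<partial>\<nu> n) = (\<integral>x. iexp (t \<bullet> delta_at n x (U n x)) \<partial>cw_law n \<theta>0 \<beta>)" for n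
      unfolding \<nu>_def by (rule integral_distr[OF dm]) simp
    then show "(\<lambda>n. \<integral>y. iexp (t \<bullet> y) \<partial>\<nu> n) \<longlonglongrightarrow> (\<integral>y. iexp (t \<bullet> y) \<partial>normal_meas (info_mat \<theta>0 \<beta>))"
      unfolding normal(1) using delta_char_tendsto[of t] by simp
  qed
  moreover have "(\<integral>y. g y \<partial>\<nu> n) = (\<integral>x. g (delta_at n x (U n x)) \<partial>cw_law n \<theta>0 \<beta>)" for n
    unfolding \<nu>_def by (rule integral_distr[OF dm gm])
  ultimately show "(\<lambda>n. \<integral>x. g (delta_at n x (U n x)) \<partial>cw_law n \<theta>0 \<beta>) \<longlonglongrightarrow> (\<integral>y. g y \<partial>normal_meas (info_mat \<theta>0 \<beta>))" by simp
qed

end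

end

theorem mainTheorem9:
  fixes \<beta> :: real and \<theta>0 :: "real^('d::{finite,linorder})"
    and U :: "nat \<Rightarrow> (nat \<Rightarrow> real^('d::{finite,linorder})) \<Rightarrow> real"
  assumes "\<beta> > 1"
    and "\<theta>0 \<in> Theta1"
    and "\<And>n x. U n x \<in> {-1..1} \<and>
            (\<forall>u\<in>{-1..1}. cw_objective n \<theta>0 \<beta> x (U n x) \<le> cw_objective n \<theta>0 \<beta> x u)"
    and "\<And>n. U n \<in> borel_measurable (sample_space n)"
  shows "bounded_in_prob (\<lambda>n. cw_law n \<theta>0 \<beta>)
           (\<lambda>n x. (\<Sum>i<n. post_mean n \<theta>0 \<beta> x i *\<^sub>R x i)
                  - (\<Sum>i<n. tanh (\<beta> * U n x + \<theta>0 \<bullet> x i) *\<^sub>R x i))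
       \<and> (\<forall>h :: real^('d::{finite,linorder}). vanish_in_prob (\<lambda>n. cw_law n \<theta>0 \<beta>)
           (\<lambda>n x. log_lr n (\<theta>0 + (1 / sqrt (real n)) *\<^sub>R h) \<theta>0 \<beta> x
                  - (h \<bullet> Delta_tilde n \<theta>0 \<beta> U x - h \<bullet> (info_mat \<theta>0 \<beta> *v h) / 2)))
       \<and> conv_distr (\<lambda>n. cw_law n \<theta>0 \<beta>) (\<lambda>n. Delta_tilde n \<theta>0 \<beta> U)
           (normal_meas (info_mat \<theta>0 \<beta>))
       \<and> cw_LAN \<beta> \<theta>0 (info_mat \<theta>0 \<beta>)"
proof -
  have "\<theta>0 \<noteq> 0" using assms(2) by (auto simp: Theta1_def)
  then interpret cw \<beta> \<theta>0 using assms(1) by unfold_locales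
  have U_min: "is_min n x (U n x)" for n x unfolding is_min_def by (rule assms(3))
  have U_meas: "U n \<in> borel_measurable (PiM {..<n} (\<lambda>_. borel))" for n
    using assms(4)[of n] by (simp add: measurable_cong_sets[OF sets_sample_space refl])
  have D: "Delta_tilde n \<theta>0 \<beta> U x = delta_at n x (U n x)" for n x
    unfolding Delta_tilde_def delta_at_def ..
  have bounded: "bounded_in_prob (\<lambda>n. cw_law n \<theta>0 \<beta>)
     (\<lambda>n x. (\<Sum>i<n. post_mean n \<theta>0 \<beta> x i *\<^sub>R x i) - (\<Sum>i<n. tanh (\<beta> * U n x + \<theta>0 \<bullet> x i) *\<^sub>R x i))"
    unfolding bounded_in_prob_def
  \<comment> \<open>One bound serves every \<epsilon>, as the probability of exceeding it tends to
    0.\<close>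
  proof (intro allI impI exI[of _ mean_bound])
    fix \<epsilon> :: real assume "\<epsilon> > 0"
    from order_tendstoD(2)[OF post_mean_outer_prob[OF U_min] this]
    show "\<exists>N. \<forall>n\<ge>N. outer_prob (cw_law n \<theta>0 \<beta>) {x \<in> space (cw_law n \<theta>0 \<beta>).
       norm ((\<Sum>i<n. post_mean n \<theta>0 \<beta> x i *\<^sub>R x i) - (\<Sum>i<n. tanh (\<beta> * U n x + \<theta>0 \<bullet> x i) *\<^sub>R x i)) > mean_bound} \<le> \<epsilon>"
      unfolding eventually_sequentially not_le by (meson less_imp_le)
  qed
  have vanish: "vanish_in_prob (\<lambda>n. cw_law n \<theta>0 \<beta>)
     (\<lambda>n x. log_lr n (\<theta>0 + (1 / sqrt (real n)) *\<^sub>R h) \<theta>0 \<beta> x - (h \<bullet> Delta_tilde n \<theta>0 \<beta> U x - h \<bullet> (info_mat \<theta>0 \<beta> *v h) / 2))" for h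
    unfolding vanish_in_prob_def D real_norm_def
    using log_lr_outer_prob[OF U_min] unfolding not_le by blast
  have conv: "conv_distr (\<lambda>n. cw_law n \<theta>0 \<beta>) (\<lambda>n. Delta_tilde n \<theta>0 \<beta> U) (normal_meas (info_mat \<theta>0 \<beta>))"
    using delta_conv_distr[OF U_min U_meas] unfolding D[symmetric] .
  \<comment> \<open>The existential in \<open>cw_LAN\<close> is witnessed by
    \<open>Delta_tilde\<close> itself.\<close>
  from bounded vanish conv show ?thesis
    unfolding cw_LAN_def by blast
qed

end
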